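(* Let $K \subset \mathbb{R}^d$ be a smooth convex body, and for each positive integer $n$ let $K_n$ be the convex hull of $n$ points chosen independently and uniformly at random in $K$. Then there is an integer $n_K$ such that for all $n \ge n_K$, $$E[f_i(K_{n+1})] > E[f_i(K_n)], \qquad i = d-2,\ d-1.$$
   Context: A convex body is a compact convex set with nonempty interior. It is called smooth if its boundary is of differentiability class $C^2$ and has everywhere positive Gaussian curvature. For a polytope $P$, $f_i(P)$ denotes the number of $i$-dimensional faces of $P$. *)

theory Defs
  imports "HOL-Probability.Probability"
begin

definition convex_body :: "(real^'n) set \<Rightarrow> bool" where
  "convex_body K \<longleftrightarrow> compact K \<and> convex K \<and> interior K \<noteq> {}"

definition grad_of :: "((real^'n) \<Rightarrow>\<^sub>L real) \<Rightarrow> real^'n" where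
  "grad_of D = (\<chi> i. blinfun_apply D (axis i 1))"

definition hess_of :: "((real^'n) \<Rightarrow>\<^sub>L ((real^'n) \<Rightarrow>\<^sub>L real)) \<Rightarrow> real^'n \<Rightarrow> real^'n" where
  "hess_of D2 v = (\<chi> i. blinfun_apply (blinfun_apply D2 v) (axis i 1))"

text \<open>Gaussian curvature of the hypersurface {F = 0} at a point where the gradient g
  is nonzero, oriented by the normal u = g/|g| (pointing into {F > 0}).
  The shape operator on the tangent space u-perp is  w |-> P(Hess w)/|g|  with P the
  orthogonal projection onto u-perp; extending it by the identity on the normal line
  gives a linear map of R^n whose determinant is the product of the principal
  curvatures, i.e. the Gaussian curvature.\<close>

definition gauss_curvature ::
  "((real^'n) \<Rightarrow>\<^sub>L real) \<Rightarrow> ((real^'n) \<Rightarrow>\<^sub>L ((real^'n) \<Rightarrow>\<^sub>L real)) \<Rightarrow> real" where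
  "gauss_curvature D D2 =
     (let g = grad_of D; u = (1 / norm g) *\<^sub>R g;
          P = (\<lambda>w. w - (w \<bullet> u) *\<^sub>R u);
          L = (\<lambda>v. (1 / norm g) *\<^sub>R P (hess_of D2 v) + (v \<bullet> u) *\<^sub>R u)
      in det (matrix L))"

definition smooth_convex_body :: "(real^'n) set \<Rightarrow> bool" where
  "smooth_convex_body K \<longleftrightarrow> convex_body K \<and>
     (\<forall>p \<in> frontier K. \<exists>U F F' F''.
        open U \<and> p \<in> U \<and>
        (\<forall>x\<in>U. (F has_derivative blinfun_apply (F' x)) (at x)) \<and>
        (\<forall>x\<in>U. (F' has_derivative blinfun_apply (F'' x)) (at x)) \<and>
        continuous_on U F'' \<and>
        (\<forall>x\<in>U. grad_of (F' x) \<noteq> 0) \<and>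
        K \<inter> U = {x \<in> U. F x \<le> 0} \<and>
        gauss_curvature (F' p) (F'' p) > 0)"

definition f_count :: "int \<Rightarrow> (real^'n) set \<Rightarrow> nat" where
  "f_count i P = card {F. F face_of P \<and> aff_dim F = i}"

definition expected_faces :: "(real^'n) set \<Rightarrow> nat \<Rightarrow> int \<Rightarrow> real" where
  "expected_faces K n i =
     integral\<^sup>L (PiM {..<n} (\<lambda>_. uniform_measure lborel K))
       (\<lambda>X. real (f_count i (convex hull (X ` {..<n}))))"

end

theory Submission
  imports Defs
begin

text \<open>Write \<open>d\<close> for the dimension and \<open>m = n - d\<close>. Almost surely the points are in general position, every facet is spanned by \<open>d\<close> of them,
  and every ridge lies in exactly two facets, so that \<open>2 f\<^bsub>d-2\<^esub> = d f\<^bsub>d-1\<^esub>\<close> and it suffices to treat facets. If \<open>p\<close> and \<open>1 - p\<close> are the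
  fractions of the volume on the two sides of the hyperplane through \<open>d\<close> random points, then
  \<open>E f\<^bsub>d-1\<^esub>(K\<^sub>n) = (n choose d) E (p ^ m + (1 - p) ^ m)\<close>, and the increment from \<open>n\<close> to \<open>n + 1\<close> is a positive multiple of
  \<open>E (g p + g (1 - p))\<close> with \<open>g v = (1 - v) ^ m * (d - (n + 1) * v)\<close>.

  An affine Blaschke--Petkantschin formula reduces this to a one-dimensional integral \<open>\<integral> A(t) g(V(t)) dt\<close> for each slope of the
  hyperplane: \<open>t\<close> is the depth of the section, \<open>V\<close> the cap volume, \<open>S = V'\<close> the section volume, and \<open>A\<close> the integral of the simplex
  volume over the section. Since \<open>v ^ (d-1) * g v\<close> is the derivative of \<open>Q v = v ^ d * (1 - v) ^ (m + 1)\<close>, whose maximum is at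
  \<open>v\<^sub>0 = d / (n + 1)\<close>, the integral is \<open>\<integral> \<psi> dQ(V)\<close> with \<open>\<psi> = A / (S V ^ (d-1))\<close>. For a smooth body the sections at small depth are,
  uniformly in the direction, ellipsoids of radius about \<open>sqrt t\<close> up to a factor close to 1, hence \<open>\<psi>\<close> is close to a
  multiple of \<open>t powr (- (d-1)/2)\<close>: it is almost decreasing and exceeds twice its value at \<open>V = v\<^sub>0\<close> for much smaller \<open>t\<close>. As \<open>Q\<close>
  increases up to \<open>v\<^sub>0\<close> and decreases afterwards, the integral is positive; deep sections contribute an exponentially small amount.\<close>

section \<open>One-dimensional analysis of cap profiles\<close>

text \<open>No asymptotic formula is required: only ratios of section quantities at two depths in
  the same direction are compared, so constants that depend on the curvature cancel. The obstacle is
  that a C^2 boundary yields the power laws only up to a factor \<eta> < 1, so \<psi> is monotone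
  only up to \<theta> = \<open>\<eta> ^ (2 * p\<^sup>2 + 3 * p)\<close> with
  \<open>p = d - 1\<close>. Q rises by Q(v0) before its peak and may fall by as much after it, so
  this distortion alone could cost (1/\<theta> - \<theta>) Q(v0). The loss is beaten by a gain that
  depends on \<open>d\<close> alone: \<psi> is at least twice its peak value at depths up to
  \<open>t0 / 16\<close>, and there Q has already reached a fixed fraction of Q(v0), by comparison
  with a cone. Hence \<eta> is fixed by \<open>d\<close>, the depth range by \<open>K\<close>
  through compactness of the boundary, and only then the threshold for \<open>n\<close>, which is
  therefore common to all directions. Hyperplanes are written as graphs over a coordinate
  hyperplane, which turns the integral formula into a linear change of variables; vertical
  hyperplanes are negligible.\<close>

lemma C1_lipschitz_01:
  fixes q q' :: "real \<Rightarrow> real"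
  assumes "\<And>v. (q has_real_derivative q' v) (at v)" "continuous_on {0..1} q'"
  obtains L where "L \<ge> 0" "\<And>u v. u \<in> {0..1} \<Longrightarrow> v \<in> {0..1} \<Longrightarrow> \<bar>q u - q v\<bar> \<le> L * \<bar>u - v\<bar>"
proof -
  have "compact (q' ` {0..1})" using assms(2) by (intro compact_continuous_image) auto
  then obtain L where L: "\<forall>x\<in>q' ` {0..1}. norm x \<le> L" using compact_imp_bounded bounded_iff by metis
  have "L \<ge> 0" using L[rule_format, of "q' 0"] by (auto intro: order_trans[OF abs_ge_zero])
  moreover have "\<bar>q u - q v\<bar> \<le> L * \<bar>u - v\<bar>" if "u \<in> {0..1}" "v \<in> {0..1}" for u v
    using field_differentiable_bound[of "{0..1}" q q' L v u] assms(1) L that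
    by (auto simp: has_field_derivative_at_within abs_minus_commute)
  ultimately show ?thesis by (rule that)
qed

text \<open>\<open>S\<close> is merely integrable, so \<open>V\<close> need not be differentiable
  everywhere and the chain rule does not apply directly. The difference \<Phi> of the two sides
  changes by at most a multiple of the square of the change of \<open>V\<close>, so as a function of
  the value of \<open>V\<close> it has derivative zero.\<close>

lemma cdf_integral_substitution:
  fixes S q Q :: "real \<Rightarrow> real"
  assumes S: "integrable lborel S" and S0: "\<And>x. S x \<ge> 0"
    and V: "\<And>t. V t = (\<integral>x. indicator {..t} x * S x \<partial>lborel)"
    and V1: "\<And>t. V t \<le> 1"
    and Q: "\<And>v. (Q has_real_derivative q v) (at v)"
    and q: "\<And>u v. u \<in> {0..1} \<Longrightarrow> v \<in> {0..1} \<Longrightarrow> \<bar>q u - q v\<bar> \<le> L * \<bar>u - v\<bar>"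
    and Vc: "continuous_on UNIV V"
    and ab: "a \<le> b"
  shows "(\<integral>x. indicator {a<..b} x * (S x * q (V x)) \<partial>lborel) = Q (V b) - Q (V a)" (is ?th1)
    and "integrable lborel (\<lambda>x. indicator {a<..b} x * (S x * q (V x)))" (is ?th2)
proof -
  have [measurable]: "S \<in> borel_measurable borel" using S by (auto dest: borel_measurable_integrable)
  have Vm[measurable]: "V \<in> borel_measurable borel" using Vc by (rule borel_measurable_continuous_onI)
  have qc: "continuous_on {0..1} q"
  proof -
    have "L-lipschitz_on {0..1} q \<or> L < 0"
      using q by (auto simp: lipschitz_on_def dist_real_def)
    moreover have "L \<ge> 0" using order_trans[OF abs_ge_zero q[of 0 1]] by simp
    ultimately show ?thesis by (auto intro: lipschitz_on_continuous_on)
  qed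
  \<comment> \<open>The Lipschitz hypothesis concerns the unit interval only. Clamping the argument
    gives a function that is continuous, hence measurable, on the whole line and agrees with
    \<open>q\<close> on the values of \<open>V\<close>.\<close>
  define qq where "qq v = q (max 0 (min 1 v))" for v
  have qqc: "continuous_on UNIV qq" unfolding qq_def
    by (rule continuous_on_compose2[OF qc]) (auto intro!: continuous_intros)
  have [measurable]: "qq \<in> borel_measurable borel" using qqc by (rule borel_measurable_continuous_onI)
  have Iint: "integrable lborel (\<lambda>x. indicator A x * S x)" if "A \<in> sets borel" for A
    using integrable_mult_indicator[OF _ S, of A] that by simp
  have V0: "V t \<ge> 0" for t unfolding V by (intro integral_nonneg_AE) (auto simp: S0)
  have qV: "q (V x) = qq (V x)" for x using V0[of x] V1[of x] by (simp add: qq_def)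
  have L0: "L \<ge> 0" using order_trans[OF abs_ge_zero q[of 0 1]] by simp
  have Vd: "(\<integral>x. indicator {s<..t} x * S x \<partial>lborel) = V t - V s" if "s \<le> t" for s t
  proof -
    have "(\<integral>x. indicator {s<..t} x * S x \<partial>lborel) = (\<integral>x. indicator {..t} x * S x - indicator {..s} x * S x \<partial>lborel)"
      using that by (intro Bochner_Integration.integral_cong) (auto simp: indicator_def)
    also have "\<dots> = V t - V s" unfolding V by (intro Bochner_Integration.integral_diff Iint) auto
    finally show ?thesis .
  qed
  have Vmono: "V s \<le> V t" if "s \<le> t" for s t
    using Vd[OF that] integral_nonneg_AE[of "\<lambda>x. indicator {s<..t} x * S x" lborel] by (auto simp: S0)
  have qb: "\<bar>qq v\<bar> \<le> \<bar>q 0\<bar> + L" for v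
  proof -
    have "\<bar>qq v - q 0\<bar> \<le> L * \<bar>max 0 (min 1 v)\<bar>" unfolding qq_def
      using q[of "max 0 (min 1 v)" 0] by auto
    also have "\<dots> \<le> L * 1" using L0 by (intro mult_left_mono) auto
    finally show ?thesis by linarith
  qed
  have Sq: "integrable lborel (\<lambda>x. S x * qq (V x))"
  proof (rule Bochner_Integration.integrable_bound)
    show "integrable lborel (\<lambda>x. (\<bar>q 0\<bar> + L) * S x)" using S by simp
    show "AE x in lborel. norm (S x * qq (V x)) \<le> norm ((\<bar>q 0\<bar> + L) * S x)"
      using qb S0 L0 by (auto simp: abs_mult intro!: AE_I2) (metis mult.commute mult_left_mono)
  qed measurable
  have Isq: "integrable lborel (\<lambda>x. indicator A x * (S x * qq (V x)))" if "A \<in> sets borel" for A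
    using integrable_mult_indicator[OF _ Sq, of A] that by simp
  show ?th2 unfolding qV by (rule Isq) auto
  define \<Phi> where "\<Phi> t = (\<integral>x. indicator {a<..t} x * (S x * qq (V x)) \<partial>lborel) - Q (V t)" for t
  have key: "\<bar>\<Phi> t - \<Phi> s\<bar> \<le> 2 * L * (V t - V s)\<^sup>2" if st: "a \<le> s" "s \<le> t" for s t
  proof -
    have "(\<integral>x. indicator {a<..t} x * (S x * qq (V x)) \<partial>lborel)
       - (\<integral>x. indicator {a<..s} x * (S x * qq (V x)) \<partial>lborel)
       = (\<integral>x. indicator {a<..t} x * (S x * qq (V x)) - indicator {a<..s} x * (S x * qq (V x)) \<partial>lborel)"
      by (intro Bochner_Integration.integral_diff[symmetric] Isq) auto
    also have "\<dots> = (\<integral>x. indicator {s<..t} x * (S x * qq (V x)) \<partial>lborel)"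
      using st by (intro Bochner_Integration.integral_cong) (auto simp: indicator_def)
    finally have 1: "\<Phi> t - \<Phi> s = (\<integral>x. indicator {s<..t} x * (S x * qq (V x)) \<partial>lborel) - (Q (V t) - Q (V s))"
      by (simp add: \<Phi>_def)
    have eq: "(\<integral>x. indicator {s<..t} x * (S x * qq (V x)) \<partial>lborel) - q (V s) * (V t - V s)
       = (\<integral>x. indicator {s<..t} x * (S x * qq (V x)) - q (V s) * (indicator {s<..t} x * S x) \<partial>lborel)"
      unfolding Vd[OF st(2), symmetric]
      by (subst Bochner_Integration.integral_diff) (auto intro: Isq Iint)
    have "\<bar>\<integral>x. indicator {s<..t} x * (S x * qq (V x)) - q (V s) * (indicator {s<..t} x * S x) \<partial>lborel\<bar> \<le> (\<integral>x. L * (V t - V s) * (indicator {s<..t} x * S x) \<partial>lborel)"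
    proof (rule integral_abs_bound[THEN order_trans], rule integral_mono)
      show "integrable lborel (\<lambda>x. \<bar>indicator {s<..t} x * (S x * qq (V x)) - q (V s) * (indicator {s<..t} x * S x)\<bar>)"
        by (intro integrable_abs Bochner_Integration.integrable_diff Isq integrable_mult_right Iint) auto
      show "integrable lborel (\<lambda>x. L * (V t - V s) * (indicator {s<..t} x * S x))"
        by (intro integrable_mult_right Iint) auto
      fix x
      show "\<bar>indicator {s<..t} x * (S x * qq (V x)) - q (V s) * (indicator {s<..t} x * S x)\<bar>
         \<le> L * (V t - V s) * (indicator {s<..t} x * S x)"
      proof (cases "x \<in> {s<..t}")
        case True
        have "\<bar>q (V x) - q (V s)\<bar> \<le> L * \<bar>V x - V s\<bar>" using V0 V1 by (intro q) auto
        also have "\<dots> \<le> L * (V t - V s)" using True Vmono[of s x] Vmono[of x t] L0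
          by (intro mult_left_mono) auto
        finally have "S x * \<bar>q (V x) - q (V s)\<bar> \<le> S x * (L * (V t - V s))" using S0 by (intro mult_left_mono)
        moreover have "\<bar>S x * qq (V x) - q (V s) * S x\<bar> = S x * \<bar>q (V x) - q (V s)\<bar>"
          unfolding qV[symmetric] using S0[of x] by (simp add: abs_mult[symmetric] abs_of_nonneg algebra_simps)
            (metis abs_mult abs_of_nonneg right_diff_distrib)
        ultimately show ?thesis using True by (simp add: mult_ac)
      qed auto
    qed
    also have "\<dots> = L * (V t - V s)\<^sup>2" using Vd[OF st(2)] by (simp add: power2_eq_square)
    finally have 2: "\<bar>(\<integral>x. indicator {s<..t} x * (S x * qq (V x)) \<partial>lborel) - q (V s) * (V t - V s)\<bar> \<le> L * (V t - V s)\<^sup>2" unfolding eq .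
    have 3: "\<bar>Q (V t) - Q (V s) - q (V s) * (V t - V s)\<bar> \<le> L * (V t - V s)\<^sup>2"
    proof (cases "V s < V t")
      case True
      obtain z where z: "V s < z" "z < V t" "Q (V t) - Q (V s) = (V t - V s) * q z"
        using MVT2[OF True, of Q q] Q by auto
      have "\<bar>q z - q (V s)\<bar> \<le> L * \<bar>z - V s\<bar>" using z V0[of s] V1[of t] V1[of s] by (intro q) auto
      also have "\<dots> \<le> L * (V t - V s)" using z L0 by (intro mult_left_mono) auto
      finally have "\<bar>q z - q (V s)\<bar> * (V t - V s) \<le> L * (V t - V s) * (V t - V s)"
        using True by (intro mult_right_mono) auto
      moreover have "Q (V t) - Q (V s) - q (V s) * (V t - V s) = (q z - q (V s)) * (V t - V s)"
        unfolding z by (simp add: algebra_simps)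
      ultimately show ?thesis using True by (simp add: abs_mult power2_eq_square)
    next
      case False
      then have "V s = V t" using Vmono[OF st(2)] by simp
      then show ?thesis by simp
    qed
    show ?thesis unfolding 1 using 2 3 by linarith
  qed
  \<comment> \<open>\<open>T\<close> selects a depth for each value of \<open>V\<close>. \<Phi> is
    constant wherever \<open>V\<close> is, so nothing is lost in studying
    \<open>\<Phi> (T v)\<close> as a function of \<open>v\<close>.\<close>
  define T where "T v = (SOME t. a \<le> t \<and> t \<le> b \<and> V t = v)" for v
  have T: "a \<le> T v \<and> T v \<le> b \<and> V (T v) = v" if "v \<in> {V a..V b}" for v
  proof -
    have "\<exists>t. a \<le> t \<and> t \<le> b \<and> V t = v"
      using that ab by (intro IVT') (auto intro: continuous_on_subset[OF Vc])
    then show ?thesis unfolding T_def by (rule someI_ex)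
  qed
  have sq: "\<bar>\<Phi> t - \<Phi> s\<bar> \<le> 2 * L * (V t - V s)\<^sup>2" if st: "a \<le> s" "a \<le> t" for s t
    using key[of s t] key[of t s] st by (cases "s \<le> t") (auto simp: abs_minus_commute power2_commute)
  have "\<exists>c. \<forall>v\<in>{V a..V b}. \<Phi> (T v) = c"
  proof (rule has_field_derivative_zero_constant)
    fix z assume z: "z \<in> {V a..V b}"
    have "((\<lambda>w. (\<Phi> (T w) - \<Phi> (T z)) / (w - z)) \<longlongrightarrow> 0) (at z within {V a..V b})"
    proof (rule Lim_null_comparison)
      show "\<forall>\<^sub>F w in at z within {V a..V b}. norm ((\<Phi> (T w) - \<Phi> (T z)) / (w - z)) \<le> 2 * L * \<bar>w - z\<bar>"
      proof (rule eventually_at_filter[THEN iffD2], rule always_eventually, safe)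
        fix w assume w: "w \<in> {V a..V b}" "w \<noteq> z"
        have "\<bar>\<Phi> (T w) - \<Phi> (T z)\<bar> \<le> 2 * L * \<bar>w - z\<bar> * \<bar>w - z\<bar>"
          using sq[of "T z" "T w"] T[OF w(1)] T[OF z] by (simp add: power2_eq_square)
        then show "norm ((\<Phi> (T w) - \<Phi> (T z)) / (w - z)) \<le> 2 * L * \<bar>w - z\<bar>"
          using w(2) by (simp add: abs_divide divide_le_eq)
      qed
      show "((\<lambda>w. 2 * L * \<bar>w - z\<bar>) \<longlongrightarrow> 0) (at z within {V a..V b})"
        by (auto intro!: tendsto_eq_intros)
    qed
    then show "((\<lambda>v. \<Phi> (T v)) has_field_derivative 0) (at z within {V a..V b})"
      by (simp add: has_field_derivative_iff)
  qed auto
  then obtain c where c: "\<And>v. v \<in> {V a..V b} \<Longrightarrow> \<Phi> (T v) = c" by auto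
  have "\<Phi> t = \<Phi> (T (V t))" if "a \<le> t" "t \<le> b" for t
    using sq[of t "T (V t)"] T[of "V t"] Vmono that by auto
  then have "\<Phi> b = \<Phi> a" using c ab Vmono[OF ab] by simp
  then show ?th1 unfolding qV by (simp add: \<Phi>_def)
qed

text \<open>Substitute \<open>c * x\<close> for \<open>x\<close> in the integral that defines
  \<open>V (c * s)\<close>: the factor \<open>c\<close> is the Jacobian and \<open>k\<close> comes
  from the pointwise comparison.\<close>

lemma cdf_scale:
  fixes S V :: "real \<Rightarrow> real"
  assumes S: "integrable lborel S" and S0: "\<And>x. S x \<ge> 0" and Sneg: "\<And>x. x \<le> 0 \<Longrightarrow> S x = 0"
    and V: "\<And>t. V t = (\<integral>x. indicator {..t} x * S x \<partial>lborel)"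
    and c: "c > 0" and k: "\<And>x. 0 < x \<Longrightarrow> x \<le> s \<Longrightarrow> S (c * x) \<ge> k * S x"
  shows "V (c * s) \<ge> c * k * V s"
proof -
  have Iint: "integrable lborel (\<lambda>x. indicator A x * S x)" if "A \<in> sets borel" for A
    using integrable_mult_indicator[OF _ S, of A] that by simp
  have "V (c * s) = c * (\<integral>x. indicator {..c * s} (c * x) * S (c * x) \<partial>lborel)"
    unfolding V using c
    by (subst lborel_integral_real_affine[where c = c and t = 0]) auto
  moreover have "k * V s \<le> (\<integral>x. indicator {..c * s} (c * x) * S (c * x) \<partial>lborel)"
    unfolding V Bochner_Integration.integral_mult_right_zero[symmetric]
  proof (rule integral_mono)
    show "integrable lborel (\<lambda>x. k * (indicator {..s} x * S x))"
      by (intro integrable_mult_right Iint) auto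
    show "integrable lborel (\<lambda>x. indicator {..c * s} (c * x) * S (c * x))"
      using lborel_integrable_real_affine[OF Iint[of "{..c * s}"], of c 0] c by simp
    show "k * (indicator {..s} x * S x) \<le> indicator {..c * s} (c * x) * S (c * x)" for x
      using k[of x] c Sneg[of x] S0[of "c * x"] by (cases "x \<le> 0") (auto simp: indicator_def)
  qed
  ultimately show ?thesis using c by (simp add: mult.assoc)
qed

lemma continuous_cdf:
  fixes S V :: "real \<Rightarrow> real"
  assumes S: "integrable lborel S"
    and V: "\<And>t. V t = (\<integral>x. indicator {..t} x * S x \<partial>lborel)"
  shows "continuous_on UNIV V"
proof (rule continuous_on_sequentiallyI)
  fix u :: "nat \<Rightarrow> real" and a assume u: "u \<longlonglongrightarrow> a"
  have [measurable]: "S \<in> borel_measurable borel" using S by (auto dest: borel_measurable_integrable)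
  show "(\<lambda>n. V (u n)) \<longlonglongrightarrow> V a"
    unfolding V
  proof (rule integral_dominated_convergence)
    show "integrable lborel (\<lambda>x. norm (S x))" using S by simp
    have "AE x in lborel. x \<noteq> a" by (rule AE_lborel_singleton)
    then show "AE x in lborel. (\<lambda>n. indicator {..u n} x * S x) \<longlonglongrightarrow> indicator {..a} x * S x"
    proof eventually_elim
      case (elim x)
      have "\<forall>\<^sub>F n in sequentially. indicator {..u n} x * S x = indicator {..a} x * S x"
      proof (cases "x < a")
        case True
        then have "\<forall>\<^sub>F n in sequentially. x < u n" using u by (intro order_tendstoD(1)[OF u])
        then show ?thesis by eventually_elim (use True in \<open>auto simp: indicator_def\<close>)
      next
        case False
        then have "\<forall>\<^sub>F n in sequentially. u n < x" using u elim by (intro order_tendstoD(2)[OF u]) auto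
        then show ?thesis by eventually_elim (use False elim in \<open>auto simp: indicator_def\<close>)
      qed
      then show ?case by (rule tendsto_eventually)
    qed
    show "AE x in lborel. norm (indicator {..u n} x * S x) \<le> norm (S x)" for n
      by (auto simp: indicator_def)
  qed measurable
qed

text \<open>Here \<open>q\<close> stands for the square root of the ratio of two depths. The
  exponents of \<open>q\<close> are p(p + 2) for A, p for S and p + 2 for the volume, so A / (S v^p)
  carries q^(-p), the factor moved to the left side. The powers of \<eta> that are lost add up to
  p(p + 2) + p + p^2 = 2p^2 + 3p.\<close>

lemma profile_ratio_before:
  fixes \<eta> q A0 A1 S0 S1 v0 v1 :: real and p :: nat
  assumes "0 < \<eta>" "0 < q" "S0 > 0" "v0 > 0" "S1 \<ge> 0" "v1 \<ge> 0" "A0 \<ge> 0"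
    and A: "A1 \<ge> (\<eta> * q) ^ (p * (p + 2)) * A0"
    and S: "S1 \<le> (q / \<eta>) ^ p * S0"
    and v: "v1 \<le> q\<^sup>2 * (q / \<eta>) ^ p * v0"
  shows "q ^ p * A1 \<ge> \<eta> ^ (2 * p\<^sup>2 + 3 * p) * (A0 / (S0 * v0 ^ p) * (S1 * v1 ^ p))"
proof -
  have "S1 * v1 ^ p \<le> ((q / \<eta>) ^ p * S0) * (q\<^sup>2 * (q / \<eta>) ^ p * v0) ^ p"
    using assms by (intro mult_mono S power_mono v) auto
  then have "A0 / (S0 * v0 ^ p) * (S1 * v1 ^ p) \<le> A0 / (S0 * v0 ^ p) * (((q / \<eta>) ^ p * S0) * (q\<^sup>2 * (q / \<eta>) ^ p * v0) ^ p)"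
    using assms by (intro mult_left_mono) auto
  also have "\<dots> = A0 * ((q / \<eta>) ^ p * (q\<^sup>2 * (q / \<eta>) ^ p) ^ p)"
    using assms by (simp add: power_mult_distrib field_simps)
  finally have "\<eta> ^ (2 * p\<^sup>2 + 3 * p) * (A0 / (S0 * v0 ^ p) * (S1 * v1 ^ p))
     \<le> \<eta> ^ (2 * p\<^sup>2 + 3 * p) * (A0 * ((q / \<eta>) ^ p * (q\<^sup>2 * (q / \<eta>) ^ p) ^ p))"
    using assms by (intro mult_left_mono) auto
  also have "\<dots> = q ^ p * ((\<eta> * q) ^ (p * (p + 2)) * A0)"
  proof -
    have "\<eta> ^ (2 * p\<^sup>2 + 3 * p) = \<eta> ^ (p * (p + 2)) * \<eta> ^ p * (\<eta> ^ p) ^ p"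
    proof -
      have "2 * p\<^sup>2 + 3 * p = p * (p + 2) + p + p * p" by (simp add: algebra_simps power2_eq_square)
      then show ?thesis by (simp only: power_add power_mult)
    qed
    moreover have "q ^ p * q ^ (p * (p + 2)) = q ^ p * (q\<^sup>2) ^ p * (q ^ p) ^ p"
    proof -
      have "p + p * (p + 2) = p + 2 * p + p * p" by (simp add: algebra_simps)
      then show ?thesis by (simp only: power_add[symmetric] power_mult[symmetric])
    qed
    ultimately show ?thesis using assms by (simp add: power_mult_distrib power_divide field_simps)
  qed
  also have "\<dots> \<le> q ^ p * A1" using assms by (intro mult_left_mono) auto
  finally show ?thesis .
qed

text \<open>The same count of exponents for the deeper of two depths, where \<open>q\<close> is at
  least 1 and the surplus factor \<open>q ^ p\<close> is simply discarded.\<close>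

lemma profile_ratio_after:
  fixes \<eta> q A0 A1 S0 S1 v0 v1 :: real and p :: nat
  assumes "0 < \<eta>" "1 \<le> q" "S0 > 0" "v0 > 0" "S1 \<ge> 0" "v1 \<ge> 0" "A0 \<ge> 0" "A1 \<ge> 0"
    and A: "A0 \<ge> (\<eta> / q) ^ (p * (p + 2)) * A1"
    and S: "S1 \<ge> (\<eta> * q) ^ p * S0"
    and v: "v1 \<ge> q\<^sup>2 * (\<eta> * q) ^ p * v0"
  shows "\<eta> ^ (2 * p\<^sup>2 + 3 * p) * A1 \<le> A0 / (S0 * v0 ^ p) * (S1 * v1 ^ p)"
proof -
  have "\<eta> ^ (2 * p\<^sup>2 + 3 * p) * A1 \<le> q ^ p * (\<eta> ^ (2 * p\<^sup>2 + 3 * p) * A1)"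
    using assms mult_right_mono[OF one_le_power[OF \<open>1 \<le> q\<close>, of p], of "\<eta> ^ (2 * p\<^sup>2 + 3 * p) * A1"] by simp
  also have "\<dots> = ((\<eta> / q) ^ (p * (p + 2)) * A1) * ((\<eta> * q) ^ p * (q\<^sup>2 * (\<eta> * q) ^ p) ^ p)"
  proof -
    have "\<eta> ^ (2 * p\<^sup>2 + 3 * p) = \<eta> ^ (p * (p + 2)) * \<eta> ^ p * (\<eta> ^ p) ^ p"
    proof -
      have "2 * p\<^sup>2 + 3 * p = p * (p + 2) + p + p * p" by (simp add: algebra_simps power2_eq_square)
      then show ?thesis by (simp only: power_add power_mult)
    qed
    moreover have "q ^ p * q ^ (p * (p + 2)) = q ^ p * (q\<^sup>2) ^ p * (q ^ p) ^ p"
    proof -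
      have "p + p * (p + 2) = p + 2 * p + p * p" by (simp add: algebra_simps)
      then show ?thesis by (simp only: power_add[symmetric] power_mult[symmetric])
    qed
    ultimately show ?thesis using assms by (simp add: power_mult_distrib power_divide field_simps)
  qed
  also have "\<dots> \<le> A0 * ((\<eta> * q) ^ p * (q\<^sup>2 * (\<eta> * q) ^ p) ^ p)"
    using assms by (intro mult_right_mono A) auto
  also have "\<dots> = A0 / (S0 * v0 ^ p) * (((\<eta> * q) ^ p * S0) * (q\<^sup>2 * (\<eta> * q) ^ p * v0) ^ p)"
    using assms by (simp add: power_mult_distrib field_simps)
  also have "\<dots> \<le> A0 / (S0 * v0 ^ p) * (S1 * v1 ^ p)"
    using assms by (intro mult_left_mono mult_mono power_mono) auto
  finally show ?thesis .
qed

text \<open>The right side decays only polynomially: with v0 = (p + 1) / (m + p + 2), the factor (1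
  - v0)^(m + 1) stays above exp(-(p + 1)). The left side decays geometrically.\<close>

lemma far_term_eventually_small:
  fixes x c C :: real and p :: nat
  assumes x: "0 \<le> x" "x < 1" and c: "c > 0"
  shows "\<forall>\<^sub>F m in sequentially. x ^ m * (real m + real p + 2) * C
     < c * (((real p + 1) / (real m + real p + 2)) ^ (p + 1) * (1 - (real p + 1) / (real m + real p + 2)) ^ (m + 1))"
proof -
  \<comment> \<open>After multiplication by N^(p + 1) the left side contains N^(p + 2). A root of
    that order distributes the geometric decay evenly over these factors, so it suffices that m y^m
    tends to 0.\<close>
  define k where "k = p + 2"
  define y where "y = root k x"
  have y: "0 \<le> y" "y < 1" "y ^ k = x" using x by (auto simp: y_def k_def simp del: power_Suc)
  have "(\<lambda>m. real m * y ^ m) \<longlonglongrightarrow> 0" using y by (intro powser_times_n_limit_0) auto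
  moreover have "(\<lambda>m. y ^ m) \<longlonglongrightarrow> 0" using y by (intro LIMSEQ_power_zero) auto
  ultimately have "(\<lambda>m. (real m * y ^ m + (real p + 2) * y ^ m) ^ k) \<longlonglongrightarrow> (0 + (real p + 2) * 0) ^ k"
    by (intro tendsto_power tendsto_add tendsto_mult_left)
  then have "(\<lambda>m. ((real m + real p + 2) * y ^ m) ^ k * \<bar>C\<bar>) \<longlonglongrightarrow> 0 * \<bar>C\<bar>"
    by (intro tendsto_mult_right) (simp add: algebra_simps k_def)
  then have "\<forall>\<^sub>F m in sequentially. ((real m + real p + 2) * y ^ m) ^ k * \<bar>C\<bar> < c * (real p + 1) ^ (p + 1) * exp (- (real p + 1))"
    using c by (intro order_tendstoD(2)[of _ "0 * \<bar>C\<bar>"]) auto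
  then show ?thesis
  proof eventually_elim
    case (elim m)
    define N where "N = real m + real p + 2"
    have N: "N > 0" by (simp add: N_def)
    \<comment> \<open>As m + 1 = N - (p + 1), the number 1 - (p + 1)/N is the reciprocal of 1 + (p +
      1)/(m + 1), whose power is bounded by an exponential.\<close>
    have "(1 + (real p + 1) / real (m + 1)) ^ (m + 1) \<le> exp (real p + 1)"
      by (rule exp_ge_one_plus_x_over_n_power_n) auto
    then have "exp (- (real p + 1)) \<le> inverse ((1 + (real p + 1) / real (m + 1)) ^ (m + 1))"
      unfolding exp_minus by (intro le_imp_inverse_le) (auto intro!: zero_less_power add_pos_nonneg simp del: power_Suc)
    also have "\<dots> = (1 - (real p + 1) / N) ^ (m + 1)"
    proof -
      have "inverse (1 + (real p + 1) / real (m + 1)) = 1 - (real p + 1) / N"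
        unfolding N_def by (simp add: field_simps)
      then show ?thesis by (metis power_inverse)
    qed
    finally have e: "exp (- (real p + 1)) \<le> (1 - (real p + 1) / N) ^ (m + 1)" .
    have "(x ^ m * N * C) * N ^ (p + 1) \<le> (x ^ m * N * \<bar>C\<bar>) * N ^ (p + 1)"
      using x N by (intro mult_right_mono mult_left_mono) auto
    also have "\<dots> = (N * y ^ m) ^ k * \<bar>C\<bar>"
      unfolding y(3)[symmetric] k_def by (simp add: power_mult_distrib flip: power_mult) (simp add: mult_ac)
    also have "\<dots> < c * (real p + 1) ^ (p + 1) * exp (- (real p + 1))" using elim by (simp add: N_def)
    also have "\<dots> \<le> c * (real p + 1) ^ (p + 1) * (1 - (real p + 1) / N) ^ (m + 1)"
      using e c by (intro mult_left_mono) auto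
    finally have "x ^ m * N * C < c * (real p + 1) ^ (p + 1) * (1 - (real p + 1) / N) ^ (m + 1) / N ^ (p + 1)"
      using N by (simp add: less_divide_eq)
    then show ?case by (simp add: N_def power_divide mult_ac)
  qed
qed

text \<open>The integrand is minorised. On each depth range it is at least a constant times
  \<open>S x * q (V x)\<close>, which integrates exactly to an increment of \<open>Q\<close>; the
  constants are 2\<kappa>, \<theta>\<kappa> and \<kappa>/\<theta>, with \<kappa> the value of A / (S
  V^p) at the depth \<open>t0\<close> where \<open>V\<close> equals \<open>v0\<close>. Beyond
  \<open>\<rho> * W\<close> a crude bound \<open>F\<close> is enough. In the application
  \<open>p\<close> is the dimension minus 1, \<open>Sc\<close> and \<open>Ac\<close> express
  convexity, and \<open>Sn\<close> and \<open>An\<close> express the curvature of the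
  boundary.\<close>

lemma profile_integral_pos_aux:
  fixes S A V :: "real \<Rightarrow> real" and p m :: nat and \<eta> \<rho> W \<theta> v0 :: real
  defines "\<theta> \<equiv> \<eta> ^ (2 * p\<^sup>2 + 3 * p)" and "v0 \<equiv> (real p + 1) / (real m + real p + 2)"
  assumes \<eta>: "0 < \<eta>" "\<eta> < 1" and \<theta>: "1 / 2 \<le> \<theta>" "1 / \<theta> - \<theta> \<le> (1 / 2) * ((1 / 16) ^ (p + 1)) ^ (p + 1)"
    and p: "p \<ge> 1" and \<rho>: "0 < \<rho>" "\<rho> < 1" and W: "W > 0"
    and small: "v0 < \<rho> ^ (p + 1)"
    and far: "(1 - \<rho> ^ (p + 1)) ^ m * (real m + real p + 2) * (2 ^ (p + 1) / (\<theta> * \<rho> * \<rho> ^ (p * (p + 2))))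
       < (1 / 2) * ((1 / 16) ^ (p + 1)) ^ (p + 1) * (v0 ^ (p + 1) * (1 - v0) ^ (m + 1))"
    and S: "integrable lborel S" "\<And>x. S x \<ge> 0" "\<And>x. x \<le> 0 \<Longrightarrow> S x = 0" "\<And>x. x \<ge> W \<Longrightarrow> S x = 0"
    and S1: "(\<integral>x. S x \<partial>lborel) = 1"
    and A: "integrable lborel A" "\<And>x. A x \<ge> 0" "\<And>x. x \<le> 0 \<Longrightarrow> A x = 0" "\<And>x. x \<ge> W \<Longrightarrow> A x = 0"
    and Apos: "(\<integral>x. A x \<partial>lborel) > 0"
    and V: "\<And>t. V t = (\<integral>x. indicator {..t} x * S x \<partial>lborel)"
    and Sc: "\<And>s t. 0 < s \<Longrightarrow> s \<le> t \<Longrightarrow> S s \<ge> (s / t) ^ p * S t"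
    and Ac: "\<And>s t. 0 < s \<Longrightarrow> s \<le> t \<Longrightarrow> A s \<ge> (s / t) ^ (p * (p + 2)) * A t"
    and Sn: "\<And>s t. 0 < s \<Longrightarrow> s \<le> \<rho> * W \<Longrightarrow> 0 < t \<Longrightarrow> t \<le> \<rho> * W \<Longrightarrow> S s \<ge> (\<eta> * sqrt (s / t)) ^ p * S t"
    and An: "\<And>s t. 0 < s \<Longrightarrow> s \<le> \<rho> * W \<Longrightarrow> 0 < t \<Longrightarrow> t \<le> \<rho> * W \<Longrightarrow>
       A s \<ge> (\<eta> * sqrt (s / t)) ^ (p * (p + 2)) * A t"
  shows "(\<integral>x. A x * ((1 - V x) ^ m * (real p + 1 - (real m + real p + 2) * V x)) \<partial>lborel) > 0"
proof -
  define r where "r = p * (p + 2)"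
  define N where "N = real m + real p + 2"
  define g where "g v = (1 - v) ^ m * (real p + 1 - N * v)" for v :: real
  define q where "q v = v ^ p * g v" for v :: real
  define Q where "Q v = v ^ (p + 1) * (1 - v) ^ (m + 1)" for v :: real
  define \<tau> where "\<tau> = \<rho> * W"
  have \<tau>: "0 < \<tau>" "\<tau> < W" using \<rho> W by (auto simp: \<tau>_def)
  have N: "N > 0" by (simp add: N_def)
  have v0N: "v0 = (real p + 1) / N" by (simp add: v0_def N_def)
  have v0: "0 < v0" "v0 < 1" by (auto simp: v0_def divide_less_eq)
  have [measurable]: "S \<in> borel_measurable borel" "A \<in> borel_measurable borel"
    using S(1) A(1) by (auto dest: borel_measurable_integrable)
  have Iint: "integrable lborel (\<lambda>x. indicator B x * S x)" if "B \<in> sets borel" for B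
    using integrable_mult_indicator[OF _ S(1), of B] that by simp
  have V0: "V t \<ge> 0" for t unfolding V by (intro integral_nonneg_AE) (auto simp: S)
  have V1: "V t \<le> 1" for t
    unfolding V S1[symmetric] by (intro integral_mono Iint S(1)) (auto simp: indicator_def S)
  have Vc: "continuous_on UNIV V" using continuous_cdf[OF S(1) V] .
  have [measurable]: "V \<in> borel_measurable borel" using Vc by (rule borel_measurable_continuous_onI)
  have Vd: "(\<integral>x. indicator {s<..t} x * S x \<partial>lborel) = V t - V s" if "s \<le> t" for s t
  proof -
    have "(\<integral>x. indicator {s<..t} x * S x \<partial>lborel) = (\<integral>x. indicator {..t} x * S x - indicator {..s} x * S x \<partial>lborel)"
      using that by (intro Bochner_Integration.integral_cong) (auto simp: indicator_def)
    also have "\<dots> = V t - V s" unfolding V by (intro Bochner_Integration.integral_diff Iint) auto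
    finally show ?thesis .
  qed
  have Vmono: "V s \<le> V t" if "s \<le> t" for s t
    using Vd[OF that] integral_nonneg_AE[of "\<lambda>x. indicator {s<..t} x * S x" lborel] by (auto simp: S)
  have Vinc: "V t - V x \<ge> (t - x) * ((x / t) ^ p * S t)" if "0 < x" "x \<le> t" for x t
  proof -
    have "(\<integral>y. indicator {x<..t} y * ((x / t) ^ p * S t) \<partial>lborel) \<le> (\<integral>y. indicator {x<..t} y * S y \<partial>lborel)"
    proof (rule integral_mono)
      show "integrable lborel (\<lambda>y. indicator {x<..t} y * ((x / t) ^ p * S t))"
        using that by (intro integrable_mult_left) (simp add: integrable_indicator_iff emeasure_lborel_Ioc)
      show "indicator {x<..t} y * ((x / t) ^ p * S t) \<le> indicator {x<..t} y * S y" for y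
      proof (cases "y \<in> {x<..t}")
        case True
        have "(x / t) ^ p * S t \<le> (y / t) ^ p * S t"
          using True that S(2)[of t] by (intro mult_right_mono power_mono divide_right_mono) auto
        also have "\<dots> \<le> S y" using True that by (intro Sc) auto
        finally show ?thesis using True by simp
      qed auto
    qed (intro Iint, auto)
    moreover have "(\<integral>y. indicator {x<..t} y * ((x / t) ^ p * S t) \<partial>lborel) = (t - x) * ((x / t) ^ p * S t)"
      using that by simp
    ultimately show ?thesis using Vd[of x t] that by linarith
  qed
  have Vbeyond: "V t = V x" if "\<And>y. y > x \<Longrightarrow> S y = 0" "x \<le> t" for x t
  proof -
    have "(\<integral>y. indicator {x<..t} y * S y \<partial>lborel) = (\<integral>y. 0 \<partial>(lborel::real measure))"
      by (intro Bochner_Integration.integral_cong) (auto simp: indicator_def that(1))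
    then show ?thesis using Vd[OF that(2)] by simp
  qed
  have VW: "V W = 1"
    unfolding V S1[symmetric] using S(4) by (intro Bochner_Integration.integral_cong) (auto simp: indicator_def)
  have Vz: "V t = 0" if "t \<le> 0" for t
  proof -
    have "V t = (\<integral>x. 0 \<partial>(lborel::real measure))"
      unfolding V using S(3) that by (intro Bochner_Integration.integral_cong) (auto simp: indicator_def)
    then show ?thesis by simp
  qed
  have Vcone: "V s \<ge> (s / t) ^ (p + 1) * V t" if "0 < s" "s \<le> t" for s t
  proof -
    have "V ((s / t) * t) \<ge> (s / t) * (s / t) ^ p * V t"
    proof (rule cdf_scale[OF S(1-3) V])
      fix x assume "0 < x" "x \<le> t"
      then show "(s / t) ^ p * S x \<le> S (s / t * x)"
        using Sc[of "s / t * x" x] that by (simp add: divide_le_eq mult_le_cancel_right1)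
    qed (use that in auto)
    then show ?thesis using that by simp
  qed
  have Vn: "V s \<ge> (s / t) * (\<eta> * sqrt (s / t)) ^ p * V t" if "0 < s" "s \<le> \<tau>" "0 < t" "t \<le> \<tau>" for s t
  proof -
    have "V ((s / t) * t) \<ge> (s / t) * (\<eta> * sqrt (s / t)) ^ p * V t"
    proof (rule cdf_scale[OF S(1-3) V])
      fix x assume x: "0 < x" "x \<le> t"
      have "s / t * x \<le> s" using x that by (simp add: field_simps)
      then have "s / t * x \<le> \<tau>" using that by linarith
      then show "(\<eta> * sqrt (s / t)) ^ p * S x \<le> S (s / t * x)"
        using Sn[of "s / t * x" x] that x by (simp add: \<tau>_def)
    qed (use that in auto)
    then show ?thesis using that by simp
  qed
  have V\<tau>: "\<rho> ^ (p + 1) \<le> V \<tau>"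
    using Vcone[of \<tau> W] \<tau> W by (simp add: VW) (simp add: \<tau>_def)
  \<comment> \<open>\<open>small\<close> and the cone comparison with the full width put the peak
    \<open>v0\<close> of \<open>Q\<close> below \<open>V \<tau>\<close>, so the peak is reached at a
    depth where the curvature comparison holds.\<close>
  have "\<exists>t. 0 \<le> t \<and> t \<le> \<tau> \<and> V t = v0"
    using v0 V\<tau> small Vz[of 0] \<tau> by (intro IVT') (auto intro: continuous_on_subset[OF Vc])
  then obtain t0 where t0: "0 \<le> t0" "t0 \<le> \<tau>" "V t0 = v0" by auto
  have t0pos: "0 < t0" using t0 v0 Vz[of t0] by (cases "t0 \<le> 0") auto
  have S0pos: "S t0 > 0"
  proof (rule ccontr)
    assume "\<not> S t0 > 0"
    then have "S t0 = 0" using S(2)[of t0] by linarith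
    then have "S y = 0" if "y > t0" for y
    proof -
      have "(t0 / y) ^ p * S y \<le> 0" using Sc[of t0 y] t0pos that \<open>S t0 = 0\<close> by simp
      moreover have "(t0 / y) ^ p > 0" using t0pos that by simp
      ultimately have "S y \<le> 0" by (auto simp: mult_le_0_iff)
      then show ?thesis using S(2)[of y] by linarith
    qed
    then have "V W = V t0" using Vbeyond[of t0 W] t0 \<tau> by auto
    then show False using VW t0 v0 by simp
  qed
  have gpos: "g v \<ge> 0" if "v \<le> v0" for v
  proof -
    have "N * v \<le> real p + 1" using that N by (simp add: v0N le_divide_eq mult.commute)
    then show ?thesis unfolding g_def using that v0 by (intro mult_nonneg_nonneg zero_le_power) auto
  qed
  have gneg: "g v \<le> 0" if "v0 \<le> v" "v \<le> 1" for v
  proof -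
    have "N * v \<ge> real p + 1" using that N by (simp add: v0N divide_le_eq mult.commute)
    then show ?thesis unfolding g_def using that v0 by (intro mult_nonneg_nonpos zero_le_power) auto
  qed
  have gbound: "\<bar>g v\<bar> \<le> N" if "0 \<le> v" "v \<le> 1" for v
  proof -
    have "\<bar>real p + 1 - N * v\<bar> \<le> N"
    proof -
      have "N * v \<le> N" "0 \<le> N * v" using that N by (auto simp: mult_left_le)
      moreover have "real p + 1 \<le> N" by (simp add: N_def)
      ultimately show ?thesis by linarith
    qed
    moreover have "\<bar>(1 - v) ^ m\<bar> \<le> 1" using that by (simp add: power_le_one)
    ultimately have "\<bar>(1 - v) ^ m\<bar> * \<bar>real p + 1 - N * v\<bar> \<le> 1 * N" by (intro mult_mono) auto
    then show ?thesis by (simp add: g_def abs_mult)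
  qed
  have gc: "continuous_on UNIV g" unfolding g_def by (intro continuous_intros)
  have [measurable]: "g \<in> borel_measurable borel" using gc by (rule borel_measurable_continuous_onI)
  have AgV: "integrable lborel (\<lambda>x. A x * g (V x))"
  proof (rule Bochner_Integration.integrable_bound)
    show "integrable lborel (\<lambda>x. N * A x)" using A(1) by simp
    show "AE x in lborel. norm (A x * g (V x)) \<le> norm (N * A x)"
    proof (rule AE_I2)
      fix x
      have "\<bar>g (V x)\<bar> * A x \<le> N * A x" using gbound[OF V0 V1] A(2) by (intro mult_right_mono)
      then show "norm (A x * g (V x)) \<le> norm (N * A x)" using A(2)[of x] N by (simp add: abs_mult mult.commute)
    qed
  qed measurable
  have "(\<integral>x. A x * g (V x) \<partial>lborel) > 0"
  proof (cases "A t0 = 0")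
    \<comment> \<open>Degenerate case: the cone comparison makes \<open>A\<close> vanish beyond
      \<open>t0\<close>, so only the range where \<open>g\<close> is nonnegative contributes.
      Strictness comes from \<open>V\<close> being strictly below \<open>v0\<close> before
      \<open>t0\<close>.\<close>
    case True
    have Az: "A y = 0" if "y \<ge> t0" for y
    proof -
      have "(t0 / y) ^ r * A y \<le> 0" using Ac[of t0 y] t0pos that True by (simp add: r_def)
      moreover have "(t0 / y) ^ r > 0" using t0pos that by simp
      ultimately have "A y \<le> 0" by (auto simp: mult_le_0_iff)
      then show ?thesis using A(2)[of y] by linarith
    qed
    have nn: "A x * g (V x) \<ge> 0" for x
      using A(2)[of x] gpos[of "V x"] Vmono[of x t0] t0(3) Az[of x] by (cases "x \<ge> t0") auto
    have "(\<integral>x. A x * g (V x) \<partial>lborel) \<noteq> 0"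
    proof
      assume "(\<integral>x. A x * g (V x) \<partial>lborel) = 0"
      then have "AE x in lborel. A x * g (V x) = 0"
        using integral_nonneg_eq_0_iff_AE[OF AgV] nn by auto
      then have "AE x in lborel. A x = 0"
      proof eventually_elim
        case (elim x)
        show ?case
        proof (cases "0 < x \<and> x < t0")
          case True
          then have "0 < (t0 - x) * ((x / t0) ^ p * S t0)" using S0pos by simp
          then have "V x < v0" using Vinc[of x t0] True t0(3) by linarith
          moreover from this have "N * V x < real p + 1" using N by (simp add: v0N less_divide_eq mult.commute)
          ultimately have "g (V x) > 0" unfolding g_def using v0 by (intro mult_pos_pos zero_less_power) auto
          then show ?thesis using elim by simp
        qed (use A(3)[of x] Az[of x] in linarith)
      qed
      then have "(\<integral>x. A x \<partial>lborel) = 0" by (rule integral_eq_zero_AE)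
      then show False using Apos by simp
    qed
    moreover have "(\<integral>x. A x * g (V x) \<partial>lborel) \<ge> 0" using nn by (intro integral_nonneg_AE) auto
    ultimately show ?thesis by linarith
  next
    case False
    then have A0: "A t0 > 0" using A(2)[of t0] by linarith
    define \<kappa> where "\<kappa> = A t0 / (S t0 * v0 ^ p)"
    have \<kappa>: "\<kappa> > 0" using A0 S0pos v0 by (simp add: \<kappa>_def)
    have \<theta>1: "0 < \<theta>" "\<theta> \<le> 1" using \<eta> by (auto simp: \<theta>_def power_le_one)
    have B1: "sqrt (s / t0) ^ p * A s \<ge> \<theta> * (\<kappa> * (S s * V s ^ p))" if s: "0 < s" "s \<le> t0" for s
      unfolding \<theta>_def \<kappa>_def
    proof (rule profile_ratio_before)
      have e: "sqrt (t0 / s) = 1 / sqrt (s / t0)" by (simp add: real_sqrt_divide)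
      have q0: "sqrt (s / t0) > 0" using s by simp
      show "(\<eta> * sqrt (s / t0)) ^ (p * (p + 2)) * A t0 \<le> A s"
        using An[of s t0] s t0 t0pos \<tau>_def by auto
      have "(\<eta> * (1 / sqrt (s / t0))) ^ p * S s \<le> S t0"
        using Sn[of t0 s] s t0 t0pos \<tau>_def unfolding e by auto
      then show "S s \<le> (sqrt (s / t0) / \<eta>) ^ p * S t0"
        using q0 \<eta> s t0pos by (simp add: power_divide power_mult_distrib divide_le_eq le_divide_eq mult_ac)
      have "(t0 / s) * (\<eta> * (1 / sqrt (s / t0))) ^ p * V s \<le> v0"
        using Vn[of t0 s] s t0 t0pos unfolding e by auto
      moreover have "t0 / s = 1 / (sqrt (s / t0))\<^sup>2" using s t0pos by simp
      ultimately have "1 / (sqrt (s / t0))\<^sup>2 * (\<eta> * (1 / sqrt (s / t0))) ^ p * V s \<le> v0" by metis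
      then show "V s \<le> (sqrt (s / t0))\<^sup>2 * (sqrt (s / t0) / \<eta>) ^ p * v0"
        using q0 \<eta> mult_pos_pos[OF zero_less_power[OF q0, of p] zero_less_power[OF q0, of 2]]
        by (simp add: power_divide power_mult_distrib divide_le_eq le_divide_eq mult_ac
            del: real_sqrt_pow2 real_sqrt_pow2_iff)
    qed (use \<eta> s t0pos S0pos v0 S A V0 in auto)
    have B1a: "A s \<ge> \<theta> * (\<kappa> * (S s * V s ^ p))" if s: "0 < s" "s \<le> t0" for s
    proof -
      have "sqrt (s / t0) ^ p * A s \<le> 1 * A s"
        using s A(2)[of s] by (intro mult_right_mono power_le_one) auto
      then show ?thesis using B1[OF s] by linarith
    qed
    \<comment> \<open>For \<open>s \<le> t0 / 16\<close> the factor \<open>sqrt (s / t0) ^ p\<close>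
      is at most 1/4 because \<open>p \<ge> 1\<close>. Dividing by it gains a factor 4, of which
      \<theta> \<ge> 1/2 leaves 2.\<close>
    have B1b: "A s \<ge> 2 * (\<kappa> * (S s * V s ^ p))" if s: "0 < s" "s \<le> t0 / 16" for s
    proof -
      have "sqrt (s / t0) \<le> sqrt ((1 / 4)\<^sup>2)"
        using s t0pos by (intro real_sqrt_le_mono) (auto simp: power2_eq_square field_simps)
      then have q4: "sqrt (s / t0) \<le> 1 / 4" by simp
      have "sqrt (s / t0) ^ p \<le> sqrt (s / t0) ^ 1"
        using p q4 s t0pos by (intro power_decreasing) auto
      then have "sqrt (s / t0) ^ p * A s \<le> (1 / 4) * A s"
        using q4 A(2)[of s] by (intro mult_right_mono) auto
      moreover have "(1/2) * (\<kappa> * (S s * V s ^ p)) \<le> \<theta> * (\<kappa> * (S s * V s ^ p))"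
        using \<theta>(1) \<kappa> S(2) V0 by (intro mult_right_mono) auto
      ultimately show ?thesis using B1[of s] s t0pos by linarith
    qed
    have B2: "\<theta> * A s \<le> \<kappa> * (S s * V s ^ p)" if s: "t0 < s" "s \<le> \<tau>" for s
      unfolding \<theta>_def \<kappa>_def
    proof (rule profile_ratio_after)
      have e: "sqrt (t0 / s) = 1 / sqrt (s / t0)" by (simp add: real_sqrt_divide)
      show "1 \<le> sqrt (s / t0)" using s t0pos by simp
      show "(\<eta> / sqrt (s / t0)) ^ (p * (p + 2)) * A s \<le> A t0"
        using An[of t0 s] s t0 t0pos \<tau>_def unfolding e by auto
      show "(\<eta> * sqrt (s / t0)) ^ p * S t0 \<le> S s"
        using Sn[of s t0] s t0 t0pos \<tau>_def by auto
      have "s / t0 * (\<eta> * sqrt (s / t0)) ^ p * v0 \<le> V s"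
        using Vn[of s t0] s t0 t0pos by auto
      moreover have "s / t0 = (sqrt (s / t0))\<^sup>2" using s t0pos by simp
      ultimately show "(sqrt (s / t0))\<^sup>2 * (\<eta> * sqrt (s / t0)) ^ p * v0 \<le> V s" by metis
    qed (use \<eta> s t0pos S0pos v0 S A V0 in auto)
    \<comment> \<open>The slab between \<open>\<tau> / 2\<close> and \<open>\<tau>\<close> has
      volume at most 1, and the cone comparison bounds \<open>S\<close> on it from below by
      \<open>S \<tau> / 2 ^ p\<close>.\<close>
    have S\<tau>: "S \<tau> * \<tau> \<le> 2 ^ (p + 1)"
    proof -
      have "(\<tau> - \<tau> / 2) * ((\<tau> / 2 / \<tau>) ^ p * S \<tau>) \<le> 1"
        using Vinc[of "\<tau> / 2" \<tau>] \<tau> V0[of "\<tau> / 2"] V1[of \<tau>] by auto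
      moreover have "(\<tau> - \<tau> / 2) * ((\<tau> / 2 / \<tau>) ^ p * S \<tau>) = (S \<tau> * \<tau>) / 2 ^ (p + 1)"
        using \<tau> by (simp add: power_divide field_simps)
      ultimately show ?thesis by (simp add: divide_le_eq)
    qed
    have A\<tau>: "\<theta> * A \<tau> \<le> \<kappa> * S \<tau>"
    proof -
      have "S \<tau> * V \<tau> ^ p \<le> S \<tau> * 1" using S(2) V0 V1 by (intro mult_left_mono power_le_one) auto
      then have "\<kappa> * (S \<tau> * V \<tau> ^ p) \<le> \<kappa> * S \<tau>" using \<kappa> by (intro mult_left_mono) auto
      moreover have "\<theta> * A \<tau> \<le> \<kappa> * (S \<tau> * V \<tau> ^ p)"
      proof (cases "t0 < \<tau>")
        case False
        then have "t0 = \<tau>" using t0 by simp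
        then have "\<kappa> * (S \<tau> * V \<tau> ^ p) = A \<tau>" using S0pos v0 t0(3) by (simp add: \<kappa>_def)
        then show ?thesis using \<theta>1 A(2)[of \<tau>] by (simp add: mult_left_le_one_le)
      qed (use B2[of \<tau>] in auto)
      ultimately show ?thesis by linarith
    qed
    \<comment> \<open>\<open>F\<close> bounds the negative part of the integrand past
      \<open>\<tau>\<close>: the cone comparison gives
      \<open>A s \<le> A \<tau> / \<rho> ^ r\<close>, the remaining volume is at most
      \<open>1 - \<rho> ^ (p + 1)\<close>, and the linear factor of \<open>g\<close> is at least
      \<open>- N\<close>.\<close>
    define F where "F = (1 - \<rho> ^ (p + 1)) ^ m * N * (A \<tau> / \<rho> ^ r)"
    have \<rho>d: "0 \<le> 1 - \<rho> ^ (p + 1)" using \<rho> by (simp add: power_le_one del: power_Suc)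
    have F0: "F \<ge> 0" unfolding F_def using \<rho>d N A \<rho> by (intro mult_nonneg_nonneg zero_le_power) auto
    have Bfar: "A s * g (V s) \<ge> - F" if s: "\<tau> < s" "s \<le> W" for s
    proof -
      have "\<rho> ^ r * A s \<le> (\<tau> / s) ^ r * A s"
      proof (intro mult_right_mono power_mono)
        have "\<rho> * s \<le> \<tau>" using s \<rho> unfolding \<tau>_def by (intro mult_left_mono) auto
        then show "\<rho> \<le> \<tau> / s" using s \<tau> by (simp add: le_divide_eq)
      qed (use \<rho> A(2)[of s] in auto)
      also have "\<dots> \<le> A \<tau>" using Ac[of \<tau> s] s \<tau> by (simp add: r_def)
      finally have 1: "A s \<le> A \<tau> / \<rho> ^ r" using \<rho> by (simp add: le_divide_eq mult.commute)
      have vs: "\<rho> ^ (p + 1) \<le> V s" using V\<tau> Vmono[of \<tau> s] s by linarith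
      have "(1 - V s) ^ m \<le> (1 - \<rho> ^ (p + 1)) ^ m" using vs V1[of s] by (intro power_mono) auto
      then have "(1 - V s) ^ m * N \<le> (1 - \<rho> ^ (p + 1)) ^ m * N" using N by (intro mult_right_mono) auto
      moreover have "- ((1 - V s) ^ m * N) \<le> g (V s)"
      proof -
        have "- N \<le> real p + 1 - N * V s" using mult_left_mono[OF V1[of s], of N] N by linarith
        then have "(1 - V s) ^ m * (- N) \<le> (1 - V s) ^ m * (real p + 1 - N * V s)"
          using V1[of s] by (intro mult_left_mono) auto
        then show ?thesis by (simp add: g_def)
      qed
      ultimately have "- g (V s) \<le> (1 - \<rho> ^ (p + 1)) ^ m * N" by linarith
      then have "A s * (- g (V s)) \<le> A s * ((1 - \<rho> ^ (p + 1)) ^ m * N)" using A(2) by (intro mult_left_mono) auto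
      also have "\<dots> \<le> (A \<tau> / \<rho> ^ r) * ((1 - \<rho> ^ (p + 1)) ^ m * N)"
        using 1 \<rho>d N by (intro mult_right_mono mult_nonneg_nonneg zero_le_power) auto
      also have "\<dots> = F" by (simp add: F_def)
      finally show ?thesis by simp
    qed
    define t1 where "t1 = t0 / 16"
    have t1: "0 < t1" "t1 < t0" using t0pos by (auto simp: t1_def)
    define sq where "sq x = S x * q (V x)" for x
    \<comment> \<open>The multiplier of \<open>sq x\<close> bounds \<psi> from below where
      \<open>g\<close> is nonnegative and from above between \<open>t0\<close> and
      \<open>\<tau>\<close>, where \<open>g\<close> is nonpositive; both choices make
      \<open>h\<close> a minorant.\<close>
    define h where "h x = 2 * \<kappa> * (indicator {0<..t1} x * sq x) + \<theta> * \<kappa> * (indicator {t1<..t0} x * sq x)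
       + \<kappa> / \<theta> * (indicator {t0<..\<tau>} x * sq x) - F * indicator {\<tau><..W} x" for x :: real
    have hA: "h x \<le> A x * g (V x)" for x
    proof -
      have pos: "a * (indicator B x * sq x) = (a * (S x * V x ^ p)) * g (V x) * indicator B x" for a B
        by (simp add: sq_def q_def)
      consider "x \<le> 0" | "0 < x" "x \<le> t1" | "t1 < x" "x \<le> t0" | "t0 < x" "x \<le> \<tau>" | "\<tau> < x" "x \<le> W" | "W < x"
        by linarith
      then show ?thesis
      proof cases
        case 1 then show ?thesis using t0 t1 \<tau> A(3)[of x] by (simp add: h_def indicator_def)
      next
        case 2
        have "h x = (2 * \<kappa> * (S x * V x ^ p)) * g (V x)"
          unfolding h_def pos using 2 t0 t1 \<tau> by (simp add: indicator_def)
        also have "\<dots> \<le> A x * g (V x)"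
          using B1b[of x] 2 gpos[of "V x"] Vmono[of x t0] t0(3) t1 by (intro mult_right_mono) (auto simp: t1_def)
        finally show ?thesis .
      next
        case 3
        have "h x = (\<theta> * \<kappa> * (S x * V x ^ p)) * g (V x)"
          unfolding h_def pos using 3 t0 t1 \<tau> by (simp add: indicator_def)
        also have "\<dots> \<le> A x * g (V x)"
          using B1a[of x] 3 gpos[of "V x"] Vmono[of x t0] t0(3) t1 by (intro mult_right_mono) (auto simp: mult.assoc)
        finally show ?thesis .
      next
        case 4
        have "h x = (\<kappa> / \<theta> * (S x * V x ^ p)) * g (V x)"
          unfolding h_def pos using 4 t0 t1 \<tau> by (simp add: indicator_def)
        also have "\<dots> \<le> A x * g (V x)"
        proof (rule mult_right_mono_neg)
          show "A x \<le> \<kappa> / \<theta> * (S x * V x ^ p)"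
            using B2[of x] 4 \<theta>1 by (simp add: le_divide_eq mult_ac)
          show "g (V x) \<le> 0" using gneg[of "V x"] Vmono[of t0 x] V1[of x] t0(3) 4 by auto
        qed
        finally show ?thesis .
      next
        case 5
        then have "h x = - F" unfolding h_def using t0 t1 \<tau> by (simp add: indicator_def)
        then show ?thesis using Bfar[of x] 5 by simp
      next
        case 6 then show ?thesis using t0 t1 \<tau> A(4)[of x] by (simp add: h_def indicator_def)
      qed
    qed
    have Qd: "(Q has_real_derivative q v) (at v)" for v
      unfolding Q_def q_def g_def N_def
      by (rule derivative_eq_intros refl | simp)+ (simp add: algebra_simps)
    have "\<exists>L. \<forall>u v. u \<in> {0..1} \<longrightarrow> v \<in> {0..1} \<longrightarrow> \<bar>q u - q v\<bar> \<le> L * \<bar>u - v\<bar>"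
    proof -
      define q' where "q' v = real p * v ^ (p - 1) * g v + v ^ p * (real m * (1 - v) ^ (m - 1) * (-1) * (real p + 1 - N * v) + (1 - v) ^ m * (- N))" for v
      have "(q has_real_derivative q' v) (at v)" for v
        unfolding q_def q'_def g_def
        by (rule derivative_eq_intros refl | simp)+
      moreover have "continuous_on {0..1} q'"
        unfolding q'_def by (intro continuous_intros continuous_on_subset[OF gc]) auto
      ultimately show ?thesis using C1_lipschitz_01[of q q'] by metis
    qed
    then obtain L where L: "\<And>u v. u \<in> {0..1} \<Longrightarrow> v \<in> {0..1} \<Longrightarrow> \<bar>q u - q v\<bar> \<le> L * \<bar>u - v\<bar>" by blast
    have hb: "has_bochner_integral lborel (\<lambda>x. indicator {a<..b} x * sq x) (Q (V b) - Q (V a))" if "a \<le> b" for a b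
      unfolding has_bochner_integral_iff sq_def
      by (intro conjI cdf_integral_substitution[where L = L and V = V and q = q and Q = Q] S(1,2) V V1 Qd Vc that) (use L in auto)
    have hF: "has_bochner_integral lborel (\<lambda>x. F * indicator {\<tau><..W} x) (F * (W - \<tau>))"
      using \<tau> by (simp add: has_bochner_integral_iff integrable_indicator_iff)
    have hI: "has_bochner_integral lborel h (2 * \<kappa> * (Q (V t1) - Q (V 0)) + \<theta> * \<kappa> * (Q (V t0) - Q (V t1))
        + \<kappa> / \<theta> * (Q (V \<tau>) - Q (V t0)) - F * (W - \<tau>))"
      unfolding h_def using t0 t1
      by (intro has_bochner_integral_diff has_bochner_integral_add has_bochner_integral_mult_right hb hF) auto
    have hint: "integrable lborel h" using hI by (simp add: has_bochner_integral_iff)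
    have "(\<integral>x. h x \<partial>lborel) = 2 * \<kappa> * (Q (V t1) - Q (V 0)) + \<theta> * \<kappa> * (Q (V t0) - Q (V t1))
        + \<kappa> / \<theta> * (Q (V \<tau>) - Q (V t0)) - F * (W - \<tau>)"
      using hI by (simp add: has_bochner_integral_iff)
    moreover have "Q (V 0) = 0" using Vz[of 0] by (simp add: Q_def)
    moreover have "Q (V \<tau>) \<ge> 0" using V0[of \<tau>] V1[of \<tau>] by (simp add: Q_def)
    then have "\<kappa> / \<theta> * Q (V \<tau>) \<ge> 0" using \<kappa> \<theta>1 by simp
    ultimately have I1: "(\<integral>x. h x \<partial>lborel) \<ge> 2 * \<kappa> * Q (V t1) + \<theta> * \<kappa> * (Q v0 - Q (V t1)) - \<kappa> / \<theta> * Q v0 - F * (W - \<tau>)"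
      using t0(3) by (simp add: right_diff_distrib)
    \<comment> \<open>One exponent \<open>p + 1\<close> comes from the cone comparison of volumes at
      the depth ratio 1/16, the other from the power of \<open>v\<close> in \<open>Q\<close>; the
      remaining factor of \<open>Q\<close> only helps at the smaller value. The fraction
      \<open>c\<close> does not depend on \<open>m\<close>, and the loss
      \<open>1 / \<theta> - \<theta>\<close> is at most \<open>c / 2\<close>.\<close>
    define c where "c = ((1 / 16 :: real) ^ (p + 1)) ^ (p + 1)"
    have Q0: "Q v0 > 0" unfolding Q_def using v0 by (intro mult_pos_pos zero_less_power) auto
    have Q1: "Q (V t1) \<ge> c * Q v0"
    proof -
      have "(1 / 16) ^ (p + 1) * v0 \<le> V t1" using Vcone[of t1 t0] t1 t0(3) by (simp add: t1_def)
      then have "((1 / 16) ^ (p + 1) * v0) ^ (p + 1) * (1 - v0) ^ (m + 1) \<le> V t1 ^ (p + 1) * (1 - V t1) ^ (m + 1)"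
        using v0 Vmono[of t1 t0] t1 t0(3) V0 by (intro mult_mono power_mono) auto
      then show ?thesis unfolding Q_def c_def power_mult_distrib by (simp add: mult_ac)
    qed
    have "2 * \<kappa> * Q (V t1) + \<theta> * \<kappa> * (Q v0 - Q (V t1)) - \<kappa> / \<theta> * Q v0
        = \<kappa> * ((2 - \<theta>) * Q (V t1) - (1 / \<theta> - \<theta>) * Q v0)" by (simp add: algebra_simps)
    also have "\<dots> \<ge> \<kappa> * (c * Q v0 - (c / 2) * Q v0)"
    proof (intro mult_left_mono diff_mono)
      have "1 * (c * Q v0) \<le> (2 - \<theta>) * Q (V t1)"
        using Q1 \<theta>1 Q0 by (intro mult_mono) (auto simp: c_def)
      then show "c * Q v0 \<le> (2 - \<theta>) * Q (V t1)" by simp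
      show "(1 / \<theta> - \<theta>) * Q v0 \<le> c / 2 * Q v0"
        using \<theta>(2) Q0 by (intro mult_right_mono) (auto simp: c_def)
    qed (use \<kappa> in auto)
    finally have I2: "2 * \<kappa> * Q (V t1) + \<theta> * \<kappa> * (Q v0 - Q (V t1)) - \<kappa> / \<theta> * Q v0 \<ge> \<kappa> * (c / 2 * Q v0)" by simp
    have "F * (W - \<tau>) \<le> F * W" using F0 \<tau> by (intro mult_left_mono) auto
    also have "\<dots> = (1 - \<rho> ^ (p + 1)) ^ m * N / \<rho> ^ r * (W * A \<tau>)" by (simp add: F_def)
    also have "\<dots> \<le> (1 - \<rho> ^ (p + 1)) ^ m * N / \<rho> ^ r * (\<kappa> * (2 ^ (p + 1) / (\<theta> * \<rho>)))"
    proof (rule mult_left_mono)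
      have "\<theta> * (A \<tau> * \<tau>) \<le> \<kappa> * (S \<tau> * \<tau>)" using A\<tau> \<tau> mult_right_mono[OF A\<tau>, of \<tau>] by (simp add: mult_ac)
      also have "\<dots> \<le> \<kappa> * 2 ^ (p + 1)" using S\<tau> \<kappa> by (intro mult_left_mono) auto
      finally have "(\<theta> * \<rho>) * (W * A \<tau>) \<le> \<kappa> * 2 ^ (p + 1)" by (simp add: \<tau>_def mult_ac)
      then show "W * A \<tau> \<le> \<kappa> * (2 ^ (p + 1) / (\<theta> * \<rho>))"
        using \<theta>1 \<rho> by (simp add: le_divide_eq mult_ac)
    qed (use \<rho>d N \<rho> in auto)
    also have "\<dots> = \<kappa> * ((1 - \<rho> ^ (p + 1)) ^ m * N * (2 ^ (p + 1) / (\<theta> * \<rho> * \<rho> ^ r)))" by (simp add: mult_ac)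
    also have "\<dots> < \<kappa> * (c / 2 * Q v0)"
      using far \<kappa> by (intro mult_strict_left_mono) (auto simp: r_def N_def c_def Q_def)
    finally have I3: "F * (W - \<tau>) < \<kappa> * (c / 2 * Q v0)" .
    have "(\<integral>x. h x \<partial>lborel) \<le> (\<integral>x. A x * g (V x) \<partial>lborel)"
      using hA by (intro integral_mono hint AgV)
    then show ?thesis using I1 I2 I3 by linarith
  qed
  then show ?thesis by (simp add: g_def N_def)
qed

text \<open>\<open>r\<close> is the degree of homogeneity in lateral lengths. These grow linearly
  with depth in a cone and like the square root of depth in a paraboloid; \<eta> measures the
  deviation from the latter. Vanishing outside the interval from 0 to \<open>W\<close> is demanded
  pointwise so that all integrals may run over the real line.\<close>

definition cap_profile :: "nat \<Rightarrow> real \<Rightarrow> real \<Rightarrow> real \<Rightarrow> (real \<Rightarrow> real) \<Rightarrow> nat \<Rightarrow> bool" where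
  "cap_profile p \<eta> \<rho> W S r \<longleftrightarrow>
     integrable lborel S \<and> (\<forall>x. S x \<ge> 0) \<and> (\<forall>x\<le>0. S x = 0) \<and> (\<forall>x\<ge>W. S x = 0) \<and>
     (\<forall>s t. 0 < s \<longrightarrow> s \<le> t \<longrightarrow> S s \<ge> (s / t) ^ r * S t) \<and>
     (\<forall>s t. 0 < s \<longrightarrow> s \<le> \<rho> * W \<longrightarrow> 0 < t \<longrightarrow> t \<le> \<rho> * W \<longrightarrow> S s \<ge> (\<eta> * sqrt (s / t)) ^ r * S t)"

text \<open>The order of the quantifiers is what matters: \<eta> depends on \<open>p\<close> only,
  and \<open>m0\<close> depends on \<rho> but neither on \<open>W\<close> nor on the profiles, so
  one threshold serves every direction of a body.\<close>

lemma profile_integral_pos: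
  fixes p :: nat
  assumes p: "p \<ge> 1"
  shows "\<exists>\<eta>. 0 < \<eta> \<and> \<eta> < 1 \<and> (\<forall>\<rho>. 0 < \<rho> \<longrightarrow> \<rho> < 1 \<longrightarrow> (\<exists>m0. \<forall>m\<ge>m0. \<forall>W S A V. W > 0 \<longrightarrow>
     cap_profile p \<eta> \<rho> W S p \<longrightarrow> cap_profile p \<eta> \<rho> W A (p * (p + 2)) \<longrightarrow>
     (\<integral>x. S x \<partial>lborel) = 1 \<longrightarrow> (\<integral>x. A x \<partial>lborel) > 0 \<longrightarrow>
     (\<forall>t. V t = (\<integral>x. indicator {..t} x * S x \<partial>lborel)) \<longrightarrow>
     (\<integral>x. A x * ((1 - V x) ^ m * (real p + 1 - (real m + real p + 2) * V x)) \<partial>lborel) > 0))"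
proof -
  define c where "c = (1 / 2 :: real) * ((1 / 16) ^ (p + 1)) ^ (p + 1)"
  have c: "c > 0" by (simp add: c_def)
  have "((\<lambda>\<eta>. \<eta> ^ (2 * p\<^sup>2 + 3 * p)) \<longlongrightarrow> 1 ^ (2 * p\<^sup>2 + 3 * p)) (at_left (1::real))"
    by (intro tendsto_intros)
  then have th: "((\<lambda>\<eta>. \<eta> ^ (2 * p\<^sup>2 + 3 * p)) \<longlongrightarrow> 1) (at_left (1::real))" by simp
  have "((\<lambda>\<eta>. 1 / \<eta> ^ (2 * p\<^sup>2 + 3 * p) - \<eta> ^ (2 * p\<^sup>2 + 3 * p)) \<longlongrightarrow> 1 / 1 - 1) (at_left (1::real))"
    by (intro tendsto_intros th) auto
  then have "\<forall>\<^sub>F \<eta> in at_left (1::real). 1 / \<eta> ^ (2 * p\<^sup>2 + 3 * p) - \<eta> ^ (2 * p\<^sup>2 + 3 * p) < c"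
    using c by (intro order_tendstoD(2)) auto
  moreover have "\<forall>\<^sub>F \<eta> in at_left (1::real). 1 / 2 < \<eta> ^ (2 * p\<^sup>2 + 3 * p)"
    using th by (rule order_tendstoD(1)) simp
  moreover have "\<forall>\<^sub>F \<eta> in at_left (1::real). \<eta> \<in> {0<..<1}"
    by (rule eventually_at_leftI[of 0]) auto
  ultimately have "\<forall>\<^sub>F \<eta> in at_left (1::real). 0 < \<eta> \<and> \<eta> < 1 \<and> 1 / 2 \<le> \<eta> ^ (2 * p\<^sup>2 + 3 * p) \<and>
     1 / \<eta> ^ (2 * p\<^sup>2 + 3 * p) - \<eta> ^ (2 * p\<^sup>2 + 3 * p) \<le> c"
    by eventually_elim auto
  then obtain \<eta> :: real where \<eta>: "0 < \<eta>" "\<eta> < 1" and \<theta>: "1 / 2 \<le> \<eta> ^ (2 * p\<^sup>2 + 3 * p)"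
     "1 / \<eta> ^ (2 * p\<^sup>2 + 3 * p) - \<eta> ^ (2 * p\<^sup>2 + 3 * p) \<le> c"
    using eventually_happens[of _ "at_left (1::real)"] by (auto simp: trivial_limit_at_left_real)
  show ?thesis
  proof (rule exI[of _ \<eta>], intro conjI \<eta> allI impI)
    fix \<rho> :: real assume \<rho>: "0 < \<rho>" "\<rho> < 1"
    have x: "0 \<le> 1 - \<rho> ^ (p + 1)" "1 - \<rho> ^ (p + 1) < 1" using \<rho> by (auto simp: power_le_one simp del: power_Suc)
    have "(\<lambda>m. (real p + 1) / (real m + real p + 2)) \<longlonglongrightarrow> 0"
      by (rule real_tendsto_divide_at_top[OF tendsto_const])
         (rule filterlim_at_top_mono[OF filterlim_real_sequentially], auto)
    then have "\<forall>\<^sub>F m in sequentially. (real p + 1) / (real m + real p + 2) < \<rho> ^ (p + 1)"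
      using \<rho> by (intro order_tendstoD(2)) auto
    moreover note far_term_eventually_small[OF x c, of p "2 ^ (p + 1) / (\<eta> ^ (2 * p\<^sup>2 + 3 * p) * \<rho> * \<rho> ^ (p * (p + 2)))"]
    ultimately have "\<forall>\<^sub>F m in sequentially. \<forall>W S A V. W > 0 \<longrightarrow>
     cap_profile p \<eta> \<rho> W S p \<longrightarrow> cap_profile p \<eta> \<rho> W A (p * (p + 2)) \<longrightarrow>
     (\<integral>x. S x \<partial>lborel) = 1 \<longrightarrow> (\<integral>x. A x \<partial>lborel) > 0 \<longrightarrow>
     (\<forall>t. V t = (\<integral>x. indicator {..t} x * S x \<partial>lborel)) \<longrightarrow>
     (\<integral>x. A x * ((1 - V x) ^ m * (real p + 1 - (real m + real p + 2) * V x)) \<partial>lborel) > 0"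
    proof eventually_elim
      case (elim m)
      show ?case
      proof (intro allI impI)
        fix W and S A V :: "real \<Rightarrow> real"
        assume *: "W > 0" "cap_profile p \<eta> \<rho> W S p" "cap_profile p \<eta> \<rho> W A (p * (p + 2))"
          "(\<integral>x. S x \<partial>lborel) = 1" "(\<integral>x. A x \<partial>lborel) > 0"
          "\<forall>t. V t = (\<integral>x. indicator {..t} x * S x \<partial>lborel)"
        show "(\<integral>x. A x * ((1 - V x) ^ m * (real p + 1 - (real m + real p + 2) * V x)) \<partial>lborel) > 0"
          by (rule profile_integral_pos_aux[OF \<eta> \<theta>[unfolded c_def] p \<rho> *(1) elim(1) elim(2)[unfolded c_def]])
            (use * in \<open>auto simp: cap_profile_def\<close>)
      qed
    qed
    then show "\<exists>m0. \<forall>m\<ge>m0. \<forall>W S A V. W > 0 \<longrightarrow>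
     cap_profile p \<eta> \<rho> W S p \<longrightarrow> cap_profile p \<eta> \<rho> W A (p * (p + 2)) \<longrightarrow>
     (\<integral>x. S x \<partial>lborel) = 1 \<longrightarrow> (\<integral>x. A x \<partial>lborel) > 0 \<longrightarrow>
     (\<forall>t. V t = (\<integral>x. indicator {..t} x * S x \<partial>lborel)) \<longrightarrow>
     (\<integral>x. A x * ((1 - V x) ^ m * (real p + 1 - (real m + real p + 2) * V x)) \<partial>lborel) > 0"
      by (simp add: eventually_sequentially)
  qed
qed

section \<open>Caps of smooth convex bodies\<close>

lemma grad_of_inner: "blinfun_apply D v = grad_of D \<bullet> v" for D :: "(real^'n) \<Rightarrow>\<^sub>L real"
proof -
  have "blinfun_apply D v = blinfun_apply D (\<Sum>i\<in>UNIV. (v $ i) *\<^sub>R axis i 1)"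
    by (metis (no_types) basis_expansion scalar_mult_eq_scaleR)
  also have "\<dots> = (\<Sum>i\<in>UNIV. v $ i * blinfun_apply D (axis i 1))"
    by (simp add: blinfun.sum_right blinfun.scaleR_right)
  also have "\<dots> = grad_of D \<bullet> v" by (simp add: inner_vec_def grad_of_def mult.commute)
  finally show ?thesis .
qed

lemma hess_of_inner: "blinfun_apply (blinfun_apply H v) w = hess_of H v \<bullet> w"
  using grad_of_inner[of "blinfun_apply H v" w] by (simp add: hess_of_def grad_of_def)

lemma blinfun2_bound:
  fixes H :: "('a::real_normed_vector) \<Rightarrow>\<^sub>L ('a \<Rightarrow>\<^sub>L real)"
  shows "\<bar>blinfun_apply (blinfun_apply H v) w\<bar> \<le> norm H * norm v * norm w"
  using norm_blinfun[of "blinfun_apply H v" w] mult_right_mono[OF norm_blinfun[of H v], of "norm w"]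
  by simp

lemma second_order_lipschitz:
  fixes F' :: "('a::real_normed_vector) \<Rightarrow> ('a \<Rightarrow>\<^sub>L real)" and F'' :: "'a \<Rightarrow> ('a \<Rightarrow>\<^sub>L ('a \<Rightarrow>\<^sub>L real))"
  assumes "convex B"
    and "\<And>x. x \<in> B \<Longrightarrow> (F' has_derivative blinfun_apply (F'' x)) (at x)"
    and "\<And>x. x \<in> B \<Longrightarrow> norm (F'' x - H) \<le> e"
    and "x \<in> B" "y \<in> B"
  shows "norm (F' y - F' x - blinfun_apply H (y - x)) \<le> e * norm (y - x)"
proof -
  have "norm ((F' y - blinfun_apply H y) - (F' x - blinfun_apply H x)) \<le> e * norm (y - x)"
  proof (rule differentiable_bound[OF assms(1) _ _ assms(5,4)])
    fix z assume z: "z \<in> B"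
    show "((\<lambda>y. F' y - blinfun_apply H y) has_derivative blinfun_apply (F'' z - H)) (at z within B)"
      unfolding minus_blinfun.rep_eq
      by (intro has_derivative_diff has_derivative_at_withinI[OF assms(2)[OF z]]
          bounded_linear_imp_has_derivative blinfun.bounded_linear_right)
    show "onorm (blinfun_apply (F'' z - H)) \<le> e" using assms(3)[OF z] by (simp add: norm_blinfun.rep_eq)
  qed
  then show ?thesis by (simp add: blinfun.diff_right algebra_simps)
qed

text \<open>The remainder is measured against a bilinear form \<open>H\<close> fixed for all of
  \<open>B\<close>, not against the Hessian at \<open>x\<close>: later one form, taken at a single
  boundary point, has to serve every nearby base point.\<close>

lemma second_order_taylor:
  fixes F :: "('a::real_normed_vector) \<Rightarrow> real"
  assumes B: "convex B"
    and F: "\<And>x. x \<in> B \<Longrightarrow> (F has_derivative blinfun_apply (F' x)) (at x)"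
    and F': "\<And>x. x \<in> B \<Longrightarrow> (F' has_derivative blinfun_apply (F'' x)) (at x)"
    and e: "\<And>x. x \<in> B \<Longrightarrow> norm (F'' x - H) \<le> e"
    and x: "x \<in> B" and y: "y \<in> B"
  shows "\<bar>F y - F x - blinfun_apply (F' x) (y - x) - blinfun_apply (blinfun_apply H (y - x)) (y - x) / 2\<bar> \<le> e * (norm (y - x))\<^sup>2"
proof -
  define v where "v = y - x"
  have e0: "e \<ge> 0" using e[OF x] by (rule order_trans[OF norm_ge_zero])
  define f where "f t = F (x + t *\<^sub>R v) - t * blinfun_apply (F' x) v - t\<^sup>2 * (blinfun_apply (blinfun_apply H v) v / 2)" for t
  have inB: "x + t *\<^sub>R v \<in> B" if "t \<in> {0..1}" for t
  proof -
    have "(1 - t) *\<^sub>R x + t *\<^sub>R y \<in> B" using B x y that by (intro convexD) auto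
    then show ?thesis by (simp add: v_def algebra_simps)
  qed
  have "norm (f 1 - f 0) \<le> (e * (norm v)\<^sup>2) * norm (1 - (0::real))"
  proof (rule field_differentiable_bound[of "{0..1}"])
    fix t :: real assume t: "t \<in> {0..1}"
    have "((\<lambda>t. F (x + t *\<^sub>R v)) has_derivative (\<lambda>s. blinfun_apply (F' (x + t *\<^sub>R v)) (s *\<^sub>R v))) (at t within {0..1})"
      by (rule has_derivative_compose[where f = "\<lambda>t. x + t *\<^sub>R v" and g = F, OF _ F[OF inB[OF t]]]) (auto intro!: derivative_eq_intros)
    then have 1: "((\<lambda>t. F (x + t *\<^sub>R v)) has_field_derivative (blinfun_apply (F' (x + t *\<^sub>R v)) v)) (at t within {0..1})"
      by (simp add: has_field_derivative_def blinfun.scaleR_right mult_commute_abs)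
    show "(f has_field_derivative (blinfun_apply (F' (x + t *\<^sub>R v)) v - blinfun_apply (F' x) v - t * blinfun_apply (blinfun_apply H v) v)) (at t within {0..1})"
      unfolding f_def by (rule derivative_eq_intros 1 refl | simp)+
    have "norm (F' (x + t *\<^sub>R v) - F' x - blinfun_apply H (t *\<^sub>R v)) \<le> e * norm (t *\<^sub>R v)"
      using second_order_lipschitz[OF B F' e x inB[OF t]] by simp
    also have "\<dots> \<le> e * norm v" using t e0 by (intro mult_left_mono) (auto simp: mult_left_le_one_le)
    finally have "norm (F' (x + t *\<^sub>R v) - F' x - blinfun_apply H (t *\<^sub>R v)) * norm v \<le> e * norm v * norm v"
      by (intro mult_right_mono) auto
    then have "norm (blinfun_apply (F' (x + t *\<^sub>R v) - F' x - blinfun_apply H (t *\<^sub>R v)) v) \<le> e * norm v * norm v"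
      using norm_blinfun order_trans by blast
    then show "norm (blinfun_apply (F' (x + t *\<^sub>R v)) v - blinfun_apply (F' x) v - t * blinfun_apply (blinfun_apply H v) v) \<le> e * (norm v)\<^sup>2"
      by (simp add: blinfun.diff_left blinfun.scaleR_right blinfun.scaleR_left power2_eq_square mult.assoc)
  qed auto
  then show ?thesis by (simp add: f_def v_def algebra_simps)
qed

text \<open>The second difference of \<open>F\<close> over a small parallelogram is symmetric in the
  two sides, while differentiating it along one side or the other approximates it by the Hessian in
  one order or the other. The discrepancy is bounded by an arbitrary multiple
  \<open>e\<close>.\<close>

lemma second_derivative_symmetric:
  fixes F :: "('a::real_normed_vector) \<Rightarrow> real"
  assumes U: "open U" "p \<in> U"
    and F: "\<And>x. x \<in> U \<Longrightarrow> (F has_derivative blinfun_apply (F' x)) (at x)"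
    and F': "\<And>x. x \<in> U \<Longrightarrow> (F' has_derivative blinfun_apply (F'' x)) (at x)"
    and c: "continuous_on U F''"
  shows "blinfun_apply (blinfun_apply (F'' p) v) w = blinfun_apply (blinfun_apply (F'' p) w) v"
proof -
  define H where "H = F'' p"
  have main: "\<bar>blinfun_apply (blinfun_apply H v) w - blinfun_apply (blinfun_apply H w) v\<bar> \<le> 2 * (norm v * norm w) * e" if e: "e > 0" for e
  proof -
    have "\<forall>\<^sub>F x in at p. dist (F'' x) (F'' p) < e"
      using c U e by (metis continuous_on_eq_continuous_at isCont_def tendstoD)
    then obtain r1 where r1: "r1 > 0" "\<And>x. x \<noteq> p \<Longrightarrow> dist x p < r1 \<Longrightarrow> dist (F'' x) (F'' p) < e"
      by (auto simp: eventually_at)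
    obtain r2 where r2: "r2 > 0" "ball p r2 \<subseteq> U" using U open_contains_ball by blast
    define B where "B = ball p (min r1 r2)"
    have B: "convex B" "B \<subseteq> U" "p \<in> B" using r1 r2 by (auto simp: B_def)
    have Be: "norm (F'' x - H) \<le> e" if "x \<in> B" for x
    proof (cases "x = p")
      case False then show ?thesis using r1(2)[of x] that by (auto simp: B_def H_def dist_norm norm_minus_commute)
    qed (use e in \<open>auto simp: H_def\<close>)
    define X where "X = norm v + norm w + 1"
    define s where "s = min r1 r2 / (2 * X)"
    have n0: "X > 0" by (simp add: add_nonneg_pos X_def)
    have s: "s > 0" using r1 r2 n0 by (simp add: s_def)
    have inB: "p + a *\<^sub>R v + b *\<^sub>R w \<in> B" if "a \<in> {0..s}" "b \<in> {0..s}" for a b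
    proof -
      have "norm (a *\<^sub>R v + b *\<^sub>R w) \<le> a * norm v + b * norm w" using norm_triangle_ineq[of "a *\<^sub>R v" "b *\<^sub>R w"] that by simp
      also have "\<dots> \<le> s * norm v + s * norm w" using that by (intro add_mono mult_right_mono) auto
      also have "\<dots> < s * X" using s by (simp add: algebra_simps X_def)
      also have "\<dots> = min r1 r2 / 2" using n0 by (simp add: s_def)
      also have "\<dots> < min r1 r2" using r1(1) r2(1) by (simp add: min_def)
      finally show ?thesis by (simp add: B_def dist_norm norm_minus_commute add.assoc) (simp add: add.commute)
    qed
    have key: "\<bar>F (p + s *\<^sub>R v + s *\<^sub>R w) - F (p + s *\<^sub>R v) - F (p + s *\<^sub>R w) + F p - s\<^sup>2 * blinfun_apply (blinfun_apply H w) v\<bar> \<le> e * s\<^sup>2 * (norm v * norm w)"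
      if inB: "\<And>a b. a \<in> {0..s} \<Longrightarrow> b \<in> {0..s} \<Longrightarrow> p + a *\<^sub>R v + b *\<^sub>R w \<in> B" for v w
    proof -
      define f where "f t = F (p + t *\<^sub>R v + s *\<^sub>R w) - F (p + t *\<^sub>R v) - t * (s * blinfun_apply (blinfun_apply H w) v)" for t
      have "norm (f s - f 0) \<le> (e * s * (norm v * norm w)) * norm (s - 0)"
      proof (rule field_differentiable_bound[of "{0..s}"])
        fix t assume t: "t \<in> {0..s}"
        have b1: "p + t *\<^sub>R v + s *\<^sub>R w \<in> B" "p + t *\<^sub>R v \<in> B" using inB[OF t, of s] inB[OF t, of 0] s by auto
        have "((\<lambda>t. F (p + t *\<^sub>R v + s *\<^sub>R w)) has_derivative (\<lambda>h. blinfun_apply (F' (p + t *\<^sub>R v + s *\<^sub>R w)) (h *\<^sub>R v))) (at t within {0..s})"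
          by (rule has_derivative_compose[where f = "\<lambda>t. p + t *\<^sub>R v + s *\<^sub>R w" and g = F, OF _ F]) (use b1 B in \<open>auto intro!: derivative_eq_intros\<close>)
        moreover have "((\<lambda>t. F (p + t *\<^sub>R v)) has_derivative (\<lambda>h. blinfun_apply (F' (p + t *\<^sub>R v)) (h *\<^sub>R v))) (at t within {0..s})"
          by (rule has_derivative_compose[where f = "\<lambda>t. p + t *\<^sub>R v" and g = F, OF _ F]) (use b1 B in \<open>auto intro!: derivative_eq_intros\<close>)
        ultimately have 1: "((\<lambda>t. F (p + t *\<^sub>R v + s *\<^sub>R w)) has_field_derivative (blinfun_apply (F' (p + t *\<^sub>R v + s *\<^sub>R w)) v)) (at t within {0..s})"
          "((\<lambda>t. F (p + t *\<^sub>R v)) has_field_derivative (blinfun_apply (F' (p + t *\<^sub>R v)) v)) (at t within {0..s})"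
          by (simp_all add: has_field_derivative_def blinfun.scaleR_right mult_commute_abs)
        show "(f has_field_derivative (blinfun_apply (F' (p + t *\<^sub>R v + s *\<^sub>R w)) v - blinfun_apply (F' (p + t *\<^sub>R v)) v - s * blinfun_apply (blinfun_apply H w) v)) (at t within {0..s})"
          unfolding f_def by (rule derivative_eq_intros 1 refl | simp)+
        have "norm (F' (p + t *\<^sub>R v + s *\<^sub>R w) - F' (p + t *\<^sub>R v) - blinfun_apply H (p + t *\<^sub>R v + s *\<^sub>R w - (p + t *\<^sub>R v)))
          \<le> e * norm (p + t *\<^sub>R v + s *\<^sub>R w - (p + t *\<^sub>R v))"
          using B b1 by (intro second_order_lipschitz[OF B(1) F' Be]) auto
        then have "norm (F' (p + t *\<^sub>R v + s *\<^sub>R w) - F' (p + t *\<^sub>R v) - blinfun_apply H (s *\<^sub>R w)) * norm v \<le> e * (s * norm w) * norm v"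
          using s by (intro mult_right_mono) auto
        then have "norm (blinfun_apply (F' (p + t *\<^sub>R v + s *\<^sub>R w) - F' (p + t *\<^sub>R v) - blinfun_apply H (s *\<^sub>R w)) v) \<le> e * (s * norm w) * norm v"
          using norm_blinfun order_trans by blast
        then show "norm (blinfun_apply (F' (p + t *\<^sub>R v + s *\<^sub>R w)) v - blinfun_apply (F' (p + t *\<^sub>R v)) v - s * blinfun_apply (blinfun_apply H w) v)
          \<le> e * s * (norm v * norm w)"
          by (simp add: blinfun.diff_left blinfun.scaleR_right blinfun.scaleR_left mult_ac)
      qed (use s in auto)
      moreover have "f s - f 0 = F (p + s *\<^sub>R v + s *\<^sub>R w) - F (p + s *\<^sub>R v) - F (p + s *\<^sub>R w) + F p - s\<^sup>2 * blinfun_apply (blinfun_apply H w) v"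
        by (simp add: f_def power2_eq_square)
      ultimately show ?thesis using s by (simp add: power2_eq_square mult_ac)
    qed
    have k1: "\<bar>F (p + s *\<^sub>R v + s *\<^sub>R w) - F (p + s *\<^sub>R v) - F (p + s *\<^sub>R w) + F p - s\<^sup>2 * blinfun_apply (blinfun_apply H w) v\<bar> \<le> e * s\<^sup>2 * (norm v * norm w)"
      using inB by (rule key)
    have "\<bar>F (p + s *\<^sub>R w + s *\<^sub>R v) - F (p + s *\<^sub>R w) - F (p + s *\<^sub>R v) + F p - s\<^sup>2 * blinfun_apply (blinfun_apply H v) w\<bar> \<le> e * s\<^sup>2 * (norm w * norm v)"
    proof (rule key)
      fix a b assume "a \<in> {0..s}" "b \<in> {0..s}"
      then show "p + a *\<^sub>R w + b *\<^sub>R v \<in> B" using inB[of b a] by (simp add: add_ac)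
    qed
    then have k2: "\<bar>F (p + s *\<^sub>R v + s *\<^sub>R w) - F (p + s *\<^sub>R v) - F (p + s *\<^sub>R w) + F p - s\<^sup>2 * blinfun_apply (blinfun_apply H v) w\<bar> \<le> e * s\<^sup>2 * (norm v * norm w)"
      by (simp add: add_ac mult_ac)
    have "\<bar>s\<^sup>2 * blinfun_apply (blinfun_apply H v) w - s\<^sup>2 * blinfun_apply (blinfun_apply H w) v\<bar> \<le> 2 * (e * s\<^sup>2 * (norm v * norm w))"
      using k1 k2 by linarith
    then have "s\<^sup>2 * \<bar>blinfun_apply (blinfun_apply H v) w - blinfun_apply (blinfun_apply H w) v\<bar> \<le> s\<^sup>2 * (2 * (norm v * norm w) * e)"
      unfolding right_diff_distrib[symmetric] abs_mult by (simp add: mult_ac)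
    then show ?thesis using s by simp
  qed
  have "\<bar>blinfun_apply (blinfun_apply H v) w - blinfun_apply (blinfun_apply H w) v\<bar> \<le> 0"
  proof (rule tendsto_le[of "at_right (0::real)"])
    show "((\<lambda>e. 2 * (norm v * norm w) * e) \<longlongrightarrow> 0) (at_right 0)"
      by (auto intro!: tendsto_eq_intros)
    show "\<forall>\<^sub>F e in at_right 0. \<bar>blinfun_apply (blinfun_apply H v) w - blinfun_apply (blinfun_apply H w) v\<bar> \<le> 2 * (norm v * norm w) * e"
      using main by (auto simp: eventually_at_right_less intro!: eventually_at_rightI[of 0 1])
  qed auto
  then show ?thesis by (simp add: H_def)
qed

section \<open>Supporting hyperplanes and the Hessian on the tangent space\<close>

lemma sublevel_frontier_zero:
  fixes F :: "'a::metric_space \<Rightarrow> real"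
  assumes "closed K" "p \<in> frontier K" "open U" "p \<in> U" "continuous_on U F"
    and KU: "K \<inter> U = {x \<in> U. F x \<le> 0}"
  shows "F p = 0"
proof (rule ccontr)
  assume n: "F p \<noteq> 0"
  have "p \<in> K" using assms by (auto simp: frontier_def)
  then have "F p \<le> 0" using KU assms(4) by blast
  then have "F p < 0" using n by linarith
  moreover have "open (U \<inter> F -` {..<0})"
    using assms by (intro continuous_open_preimage) auto
  moreover have "U \<inter> F -` {..<0} \<subseteq> K" using KU by fastforce
  ultimately have "p \<in> interior K" using assms(4) by (auto simp: interior_def)
  then show False using assms(2) by (simp add: frontier_def)
qed

lemma has_derivative_decrease:
  fixes F :: "('a::real_normed_vector) \<Rightarrow> real"
  assumes F: "(F has_derivative D) (at p)" and v: "D v < 0" and U: "open U" "p \<in> U"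
  shows "\<exists>s>0. p + s *\<^sub>R v \<in> U \<and> F (p + s *\<^sub>R v) < F p"
proof -
  have "((\<lambda>t. F (p + t *\<^sub>R v)) has_derivative (\<lambda>s. D (s *\<^sub>R v))) (at 0)"
    by (rule has_derivative_compose[where f = "\<lambda>t. p + t *\<^sub>R v" and g = F, of "\<lambda>s. s *\<^sub>R v" 0 UNIV D, simplified])
      (use F in \<open>auto intro!: derivative_eq_intros\<close>)
  then have "DERIV (\<lambda>t. F (p + t *\<^sub>R v)) 0 :> D v"
    using has_derivative_linear[OF F] by (simp add: has_field_derivative_def linear_cmul mult_commute_abs)
  then obtain d where d: "d > 0" "\<And>h. 0 < h \<Longrightarrow> h < d \<Longrightarrow> F (p + (0 + h) *\<^sub>R v) < F (p + 0 *\<^sub>R v)"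
    using DERIV_neg_dec_right v by blast
  have "((\<lambda>h. p + h *\<^sub>R v) \<longlongrightarrow> p + 0 *\<^sub>R v) (at_right (0::real))" by (intro tendsto_intros)
  then have "\<forall>\<^sub>F h in at_right (0::real). p + h *\<^sub>R v \<in> U" using U by (intro topological_tendstoD) auto
  moreover have "\<forall>\<^sub>F h in at_right (0::real). 0 < h \<and> h < d"
    using d by (intro eventually_at_rightI[of 0 d]) auto
  ultimately have "\<forall>\<^sub>F h in at_right (0::real). 0 < h \<and> h < d \<and> p + h *\<^sub>R v \<in> U" by eventually_elim auto
  then obtain h where "0 < h" "h < d" "p + h *\<^sub>R v \<in> U"
    using eventually_happens[of _ "at_right (0::real)"] by (auto simp: trivial_limit_at_right_real)
  then show ?thesis using d(2)[of h] by auto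
qed

text \<open>A direction in which \<open>F\<close> decreases leads into \<open>K\<close>, so it
  cannot have a positive component along the outer normal \<open>u\<close>. This forces the gradient
  and \<open>u\<close> to be positively proportional.\<close>

lemma support_normal_gradient:
  fixes F :: "(real^'n) \<Rightarrow> real"
  assumes F: "(F has_derivative blinfun_apply D) (at p)" "F p = 0" and U: "open U" "p \<in> U"
    and KU: "K \<inter> U = {x \<in> U. F x \<le> 0}"
    and u: "norm u = 1" "\<And>y. y \<in> K \<Longrightarrow> y \<bullet> u \<le> p \<bullet> u"
    and g: "grad_of D \<noteq> 0"
  shows "grad_of D = norm (grad_of D) *\<^sub>R u"
proof -
  define g where "g = grad_of D"
  have dir: "u \<bullet> v \<le> 0" if "g \<bullet> v < 0" for v
  proof -
    have "blinfun_apply D v < 0" using that grad_of_inner[of D v] by (simp add: g_def)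
    then obtain s where s: "s > 0" "p + s *\<^sub>R v \<in> U" "F (p + s *\<^sub>R v) < F p"
      using has_derivative_decrease[OF F(1) _ U, of v] by blast
    then have "p + s *\<^sub>R v \<in> K" using KU F(2) by fastforce
    from u(2)[OF this] have "s * (v \<bullet> u) \<le> 0" by (simp add: inner_add_left)
    then show ?thesis using s by (simp add: mult_le_0_iff inner_commute)
  qed
  have gg: "g \<bullet> g > 0" using g by (simp add: g_def)
  define a where "a = (u \<bullet> g) / (g \<bullet> g)"
  \<comment> \<open>The part of \<open>u\<close> orthogonal to the gradient. Tilting it by
    \<open>- e *\<^sub>R g\<close> makes it a descent direction, and letting \<open>e\<close> tend
    to 0 gives \<open>u \<bullet> w \<le> 0\<close>, whereas \<open>u \<bullet> w\<close> is the
    squared length of \<open>w\<close>.\<close>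
  define w where "w = u - a *\<^sub>R g"
  have gw: "g \<bullet> w = 0" using gg by (simp add: w_def a_def inner_diff_right inner_commute)
  have "u \<bullet> w \<le> e * (u \<bullet> g)" if "e > 0" for e
  proof -
    have "g \<bullet> (w - e *\<^sub>R g) < 0" using that gg gw by (simp add: inner_diff_right)
    from dir[OF this] show ?thesis by (simp add: inner_diff_right)
  qed
  then have "\<forall>\<^sub>F e in at_right (0::real). u \<bullet> w \<le> e * (u \<bullet> g)" by (auto intro!: eventually_at_rightI[of 0 1])
  moreover have "((\<lambda>e. e * (u \<bullet> g)) \<longlongrightarrow> 0 * (u \<bullet> g)) (at_right (0::real))" by (intro tendsto_intros)
  ultimately have "u \<bullet> w \<le> 0 * (u \<bullet> g)"
    by (intro tendsto_lowerbound[of "\<lambda>e. e * (u \<bullet> g)" _ "at_right (0::real)"]) (auto simp: trivial_limit_at_right_real)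
  moreover have "u \<bullet> w = w \<bullet> w" using gw by (simp add: w_def inner_diff_left inner_diff_right inner_commute algebra_simps)
  ultimately have "w \<bullet> w \<le> 0" by simp
  then have "w = 0" by (metis inner_eq_zero_iff inner_ge_zero order_antisym)
  then have ua: "u = a *\<^sub>R g" by (simp add: w_def)
  have "u \<bullet> (- g) \<le> 0" using gg by (intro dir) auto
  then have "a \<ge> 0" using gg by (simp add: a_def)
  then have "1 = a * norm g" using u(1) ua by (metis abs_of_nonneg norm_scaleR)
  then have "norm g *\<^sub>R u = g" using ua by (metis mult.commute scaleR_one scaleR_scaleR)
  then show ?thesis by (simp add: g_def)
qed

text \<open>If the Hessian were negative on a tangent vector \<open>w\<close>, the body would bend
  outwards there: a curve starting in direction \<open>w\<close>, with a quadratic correction along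
  the gradient, would stay in \<open>K\<close> and yet cross the supporting hyperplane.\<close>

lemma tangent_hessian_nonneg:
  fixes F :: "(real^'n) \<Rightarrow> real"
  assumes U: "open U" "p \<in> U"
    and F: "\<And>x. x \<in> U \<Longrightarrow> (F has_derivative blinfun_apply (F' x)) (at x)"
    and F': "\<And>x. x \<in> U \<Longrightarrow> (F' has_derivative blinfun_apply (F'' x)) (at x)"
    and c: "continuous_on U F''"
    and KU: "K \<inter> U = {x \<in> U. F x \<le> 0}"
    and u: "norm u = 1" "\<And>y. y \<in> K \<Longrightarrow> y \<bullet> u \<le> p \<bullet> u"
    and F0: "F p = 0" and g: "grad_of (F' p) \<noteq> 0"
    and w: "grad_of (F' p) \<bullet> w = 0"
  shows "blinfun_apply (blinfun_apply (F'' p) w) w \<ge> 0"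
proof (rule ccontr)
  define G where "G = grad_of (F' p)"
  define H where "H a b = blinfun_apply (blinfun_apply (F'' p) a) b" for a b
  assume "\<not> ?thesis"
  then have neg: "H w w < 0" by (simp add: H_def)
  have Gu: "G = norm G *\<^sub>R u" unfolding G_def by (rule support_normal_gradient[OF F[OF U(2)] F0 U KU u g])
  have G0: "G \<bullet> G > 0" using g by (simp add: G_def)
  \<comment> \<open>\<open>k\<close> makes the first-order increase along the gradient equal to a
    quarter of \<open>- H w w * s\<^sup>2\<close>, half of what the Hessian term gains. The mixed
    terms and the Taylor remainder are kept below a sixteenth each.\<close>
  define k where "k = - H w w / (4 * (G \<bullet> G))"
  have k: "k > 0" "k * (G \<bullet> G) = - H w w / 4" using neg G0 unfolding k_def by (intro divide_pos_pos, auto)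
  define C where "C = norm w + k * norm G"
  have C: "C > 0" using k G0 by (auto simp: C_def intro!: add_nonneg_pos)
  define e where "e = - H w w / (16 * C\<^sup>2)"
  have e: "e > 0" "e * C\<^sup>2 = - H w w / 16" using neg C unfolding e_def by (intro divide_pos_pos, auto)
  have "\<forall>\<^sub>F x in at p. dist (F'' x) (F'' p) < e"
    using c U e by (metis continuous_on_eq_continuous_at isCont_def tendstoD)
  then obtain r1 where r1: "r1 > 0" "\<And>x. x \<noteq> p \<Longrightarrow> dist x p < r1 \<Longrightarrow> dist (F'' x) (F'' p) < e"
    by (auto simp: eventually_at)
  obtain r2 where r2: "r2 > 0" "ball p r2 \<subseteq> U" using U open_contains_ball by blast
  define B where "B = ball p (min r1 r2)"
  have B: "convex B" "B \<subseteq> U" "p \<in> B" "open B" using r1 r2 by (auto simp: B_def)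
  have Be: "norm (F'' x - F'' p) \<le> e" if "x \<in> B" for x
  proof (cases "x = p")
    case False then show ?thesis using r1(2)[of x] that by (auto simp: B_def dist_norm norm_minus_commute)
  qed (use e in auto)
  define h where "h s = s *\<^sub>R w + (k * s\<^sup>2) *\<^sub>R G" for s
  have "((\<lambda>s. p + h s) \<longlongrightarrow> p + (0 *\<^sub>R w + (k * 0\<^sup>2) *\<^sub>R G)) (at_right 0)"
    unfolding h_def by (intro tendsto_intros)
  then have ev1: "\<forall>\<^sub>F s in at_right 0. p + h s \<in> B" using B by (intro topological_tendstoD) auto
  have "((\<lambda>s. s * k * (H w G + H G w) / 2 + s\<^sup>2 * k\<^sup>2 * H G G / 2) \<longlongrightarrow> 0 * k * (H w G + H G w) / 2 + 0\<^sup>2 * k\<^sup>2 * H G G / 2) (at_right 0)"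
    by (intro tendsto_intros) auto
  then have ev2: "\<forall>\<^sub>F s in at_right 0. s * k * (H w G + H G w) / 2 + s\<^sup>2 * k\<^sup>2 * H G G / 2 < - H w w / 16"
    using neg by (intro order_tendstoD(2)) auto
  have ev3: "\<forall>\<^sub>F s in at_right 0. 0 < s \<and> s < (1::real)" by (rule eventually_at_rightI[of 0 1]) auto
  have "\<forall>\<^sub>F s in at_right 0. p + h s \<in> B \<and> s * k * (H w G + H G w) / 2 + s\<^sup>2 * k\<^sup>2 * H G G / 2 < - H w w / 16 \<and> 0 < s \<and> s < 1"
    using ev1 ev2 ev3 by eventually_elim auto
  then obtain s where s: "p + h s \<in> B" "s * k * (H w G + H G w) / 2 + s\<^sup>2 * k\<^sup>2 * H G G / 2 < - H w w / 16" "0 < s" "s < 1"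
    using eventually_happens[of _ "at_right (0::real)"] by (auto simp: trivial_limit_at_right_real)
  have "\<bar>F (p + h s) - F p - blinfun_apply (F' p) (p + h s - p) - blinfun_apply (blinfun_apply (F'' p) (p + h s - p)) (p + h s - p) / 2\<bar> \<le> e * (norm (p + h s - p))\<^sup>2"
    using B s by (intro second_order_taylor[OF B(1) F F' Be]) auto
  then have T: "F (p + h s) \<le> G \<bullet> h s + H (h s) (h s) / 2 + e * (norm (h s))\<^sup>2"
    using F0 by (simp add: H_def grad_of_inner G_def abs_le_iff)
  have "G \<bullet> h s = s\<^sup>2 * (k * (G \<bullet> G))" using w by (simp add: h_def inner_add_right G_def mult_ac)
  then have 1: "G \<bullet> h s = s\<^sup>2 * (- H w w / 4)" using k(2) by simp
  have 2: "H (h s) (h s) / 2 = s\<^sup>2 * (H w w / 2 + (s * k * (H w G + H G w) / 2 + s\<^sup>2 * k\<^sup>2 * H G G / 2))"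
    by (simp add: H_def h_def blinfun.add_left blinfun.add_right blinfun.scaleR_left blinfun.scaleR_right power2_eq_square algebra_simps)
  have "norm (h s) \<le> norm (s *\<^sub>R w) + norm ((k * s\<^sup>2) *\<^sub>R G)" unfolding h_def by (rule norm_triangle_ineq)
  also have "\<dots> = s * norm w + s * s * (k * norm G)" using s k by (simp add: power2_eq_square)
  also have "\<dots> \<le> s * C"
  proof -
    have "s * s * (k * norm G) \<le> s * (k * norm G)"
      using s k by (intro mult_right_mono) (auto simp: mult_left_le_one_le)
    then show ?thesis by (simp add: C_def distrib_left)
  qed
  finally have "(norm (h s))\<^sup>2 \<le> (s * C)\<^sup>2" by (intro power_mono) auto
  then have "e * (norm (h s))\<^sup>2 \<le> e * (s * C)\<^sup>2" using e by (intro mult_left_mono) auto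
  also have "\<dots> = s\<^sup>2 * (e * C\<^sup>2)" by (simp add: power_mult_distrib mult_ac)
  also have "\<dots> = s\<^sup>2 * (- H w w / 16)" using e(2) by simp
  finally have 3: "e * (norm (h s))\<^sup>2 \<le> s\<^sup>2 * (- H w w / 16)" .
  have "F (p + h s) \<le> s\<^sup>2 * (- H w w / 4 + (H w w / 2 + (s * k * (H w G + H G w) / 2 + s\<^sup>2 * k\<^sup>2 * H G G / 2)) - H w w / 16)"
    using T 1 2 3 by (simp add: algebra_simps)
  also have "\<dots> \<le> s\<^sup>2 * 0" using s neg by (intro mult_left_mono) auto
  finally have "p + h s \<in> K" using KU s(1) B by auto
  then have "h s \<bullet> u \<le> 0" using u(2) by (fastforce simp: inner_add_left)
  moreover have "h s \<bullet> u * norm G = h s \<bullet> G" by (subst (2) Gu) simp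
  moreover have "h s \<bullet> G > 0" using 1 s neg by (simp add: inner_commute mult_pos_neg)
  ultimately show False using mult_nonpos_nonneg[of "h s \<bullet> u" "norm G"] by simp
qed

text \<open>A nonnegative quadratic form that vanishes at \<open>w\<close> has \<open>w\<close> in
  its radical. The shape operator would then annihilate the tangent vector \<open>w\<close>, so its
  extension \<open>L\<close> would be singular, against the nonvanishing curvature.\<close>

lemma tangent_hessian_pos:
  fixes D :: "(real^'n) \<Rightarrow>\<^sub>L real" and D2
  assumes sym: "\<And>v w. blinfun_apply (blinfun_apply D2 v) w = blinfun_apply (blinfun_apply D2 w) v"
    and nn: "\<And>w. grad_of D \<bullet> w = 0 \<Longrightarrow> blinfun_apply (blinfun_apply D2 w) w \<ge> 0"
    and g: "grad_of D \<noteq> 0" and curv: "gauss_curvature D D2 \<noteq> 0"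
    and w: "grad_of D \<bullet> w = 0" "w \<noteq> 0"
  shows "blinfun_apply (blinfun_apply D2 w) w > 0"
proof (rule ccontr)
  define H where "H a b = blinfun_apply (blinfun_apply D2 a) b" for a b
  define u where "u = (1 / norm (grad_of D)) *\<^sub>R grad_of D"
  define P where "P w = w - (w \<bullet> u) *\<^sub>R u" for w
  define L where "L v = (1 / norm (grad_of D)) *\<^sub>R P (hess_of D2 v) + (v \<bullet> u) *\<^sub>R u" for v
  assume "\<not> ?thesis"
  then have Hww: "H w w = 0" using nn[OF w(1)] by (simp add: H_def)
  have uu: "u \<bullet> u = 1" using g by (simp add: u_def power2_norm_eq_inner[symmetric] power2_eq_square)
  have perp: "grad_of D \<bullet> z = 0 \<longleftrightarrow> z \<bullet> u = 0" for z using g by (simp add: u_def inner_commute)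
  have Hwz: "H w z = 0" if z: "z \<bullet> u = 0" for z
  proof (rule ccontr)
    assume nz: "H w z \<noteq> 0"
    have q: "2 * a * H w z + a\<^sup>2 * H z z \<ge> 0" for a
    proof -
      have "grad_of D \<bullet> z = 0" using z perp by blast
      then have "0 \<le> H (w + a *\<^sub>R z) (w + a *\<^sub>R z)" unfolding H_def
        using w(1) by (intro nn) (simp add: inner_add_right)
      also have "\<dots> = H w w + 2 * a * H w z + a\<^sup>2 * H z z"
        using sym[of w z] by (simp add: H_def blinfun.add_left blinfun.add_right blinfun.scaleR_left blinfun.scaleR_right power2_eq_square algebra_simps)
      finally show ?thesis using Hww by simp
    qed
    have Hzz: "H z z \<ge> 0" using nn z perp by (simp add: H_def)
    \<comment> \<open>Close to the minimiser of the quadratic in \<open>a\<close>; the added 1 keeps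
      the denominator positive when \<open>H z z\<close> is 0.\<close>
    define a where "a = - H w z / (1 + H z z)"
    have "2 * a * H w z + a\<^sup>2 * H z z = - (H w z)\<^sup>2 * (2 + H z z) / (1 + H z z)\<^sup>2"
      using Hzz by (simp add: a_def divide_simps power2_eq_square) (auto simp: algebra_simps)
    also have "\<dots> < 0" using nz Hzz by (simp add: divide_neg_pos mult_neg_pos)
    finally show False using q[of a] by simp
  qed
  have Pu: "P z \<bullet> u = 0" for z using uu by (simp add: P_def inner_diff_left)
  have Pi: "P z \<bullet> y = z \<bullet> y - (z \<bullet> u) * (u \<bullet> y)" for z y by (simp add: P_def inner_diff_left)
  have "P (hess_of D2 w) \<bullet> P (hess_of D2 w) = hess_of D2 w \<bullet> P (hess_of D2 w)"
    using Pu[of "hess_of D2 w"] by (simp add: Pi[of _ "P (hess_of D2 w)"] inner_commute[of u "P (hess_of D2 w)"])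
  also have "\<dots> = H w (P (hess_of D2 w))" by (simp add: H_def hess_of_inner)
  also have "\<dots> = 0" by (rule Hwz[OF Pu])
  finally have "P (hess_of D2 w) = 0" by simp
  then have Lw: "L w = 0" using w perp by (simp add: L_def)
  have hl: "hess_of D2 (x + y) = hess_of D2 x + hess_of D2 y" "hess_of D2 (c *\<^sub>R x) = c *\<^sub>R hess_of D2 x" for x y c
    by (simp_all add: hess_of_def vec_eq_iff blinfun.add_left blinfun.add_right blinfun.scaleR_left blinfun.scaleR_right)
  have linL: "linear L"
    by (rule linearI) (simp_all add: L_def P_def hl inner_add_left algebra_simps scaleR_add_left)
  have "gauss_curvature D D2 = det (matrix L)"
    by (simp only: gauss_curvature_def Let_def L_def[abs_def] P_def[abs_def] u_def)
  then have "det (matrix L) \<noteq> 0" using curv by simp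
  then have "inj L" using det_nz_iff_inj[OF linL] by simp
  then have "w = 0" using Lw linear_0[OF linL] by (metis injD)
  then show False using w by simp
qed

section \<open>Parabolic scaling of small caps\<close>

lemma abs_quadratic_expansion_bound:
  fixes X :: real
  assumes "\<bar>X - Y / 2\<bar> \<le> e" "Y = Z - 2 * a + b" "\<bar>a\<bar> \<le> A" "\<bar>b\<bar> \<le> B"
  shows "\<bar>X - Z / 2\<bar> \<le> A + B / 2 + e"
  using assms by linarith

text \<open>A point of \<open>K\<close> at depth \<open>t\<close> is displaced tangentially by some
  \<open>w\<close> with H w w / 2 at most about \<open>t * G\<close>, where \<open>G\<close> is the
  length of the gradient. Shrinking \<open>w\<close> by \<open>\<eta> * sqrt (s / t)\<close> turns
  this bound into \<eta>^2 s G, and the slack (1 - \<eta>^2) s G absorbs the Taylor errors. The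
  radii may not depend on \<open>p\<close> or \<open>u\<close>, hence the Hessian is frozen at
  \<open>p0\<close>.\<close>

lemma local_cap_scaling:
  fixes K :: "(real^'n) set" and \<eta> :: real
  assumes K: "convex K" "closed K" "interior K \<noteq> {}" and p0: "p0 \<in> frontier K" and \<eta>: "0 < \<eta>" "\<eta> < 1"
    and U: "open U" "p0 \<in> U"
    and F: "\<And>x. x \<in> U \<Longrightarrow> (F has_derivative blinfun_apply (F' x)) (at x)"
    and F': "\<And>x. x \<in> U \<Longrightarrow> (F' has_derivative blinfun_apply (F'' x)) (at x)"
    and c: "continuous_on U F''"
    and g: "\<And>x. x \<in> U \<Longrightarrow> grad_of (F' x) \<noteq> 0"
    and KU: "K \<inter> U = {x \<in> U. F x \<le> 0}"
    and curv: "gauss_curvature (F' p0) (F'' p0) > 0"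
  shows "\<exists>r>0. \<exists>\<tau>>0. \<forall>u p x s t. dist p p0 < r \<longrightarrow> norm u = 1 \<longrightarrow> p \<in> frontier K \<longrightarrow> (\<forall>y\<in>K. y \<bullet> u \<le> p \<bullet> u) \<longrightarrow>
      x \<in> K \<longrightarrow> 0 < s \<longrightarrow> s \<le> \<tau> \<longrightarrow> 0 < t \<longrightarrow> t \<le> \<tau> \<longrightarrow> x \<bullet> u = p \<bullet> u - t \<longrightarrow>
      (p - s *\<^sub>R u) + (\<eta> * sqrt (s / t)) *\<^sub>R (x - (p - t *\<^sub>R u)) \<in> K"
proof -
  define H where "H a b = blinfun_apply (blinfun_apply (F'' p0) a) b" for a b
  define g0 where "g0 = grad_of (F' p0)"
  have g0: "g0 \<noteq> 0" using g U by (simp add: g0_def)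
  have Fc: "continuous_on U F"
    using F by (intro continuous_at_imp_continuous_on) (metis differentiable_def differentiable_imp_continuous_within)
  have F'c: "continuous_on U F'"
    using F' by (intro continuous_at_imp_continuous_on) (metis differentiable_def differentiable_imp_continuous_within)
  have frontier0: "F p = 0" if "p \<in> frontier K" "p \<in> U" for p
    using sublevel_frontier_zero[OF K(2) that(1) U(1) that(2) Fc KU] .
  have p0K: "p0 \<in> K" using p0 K(2) by (auto simp: frontier_def)
  obtain a where a: "a \<noteq> 0" "\<And>y. y \<in> K \<Longrightarrow> a \<bullet> p0 \<le> a \<bullet> y"
  proof -
    have "p0 \<notin> rel_interior K" using p0 rel_interior_nonempty_interior[OF K(3)] by (simp add: frontier_def)
    from supporting_hyperplane_rel_boundary[OF K(1) p0K this] that show ?thesis by metis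
  qed
  have sym: "H v w = H w v" for v w
    unfolding H_def by (rule second_derivative_symmetric[OF U F F' c])
  have nn: "H w w \<ge> 0" if "g0 \<bullet> w = 0" for w
    unfolding H_def
  proof (rule tangent_hessian_nonneg[OF U F F' c KU _ _ frontier0[OF p0 U(2)] g[OF U(2)]])
    show "norm (- (1 / norm a) *\<^sub>R a) = 1" using a by simp
    show "y \<bullet> (- (1 / norm a) *\<^sub>R a) \<le> p0 \<bullet> (- (1 / norm a) *\<^sub>R a)" if "y \<in> K" for y
      using a(2)[OF that] a(1) by (simp add: inner_commute divide_right_mono)
  qed (use that in \<open>auto simp: g0_def\<close>)
  have pos: "H w w > 0" if "g0 \<bullet> w = 0" "w \<noteq> 0" for w
    using tangent_hessian_pos[of "F'' p0" "F' p0" w] sym nn g0 curv that by (auto simp: H_def g0_def)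
  \<comment> \<open>Positivity on unit tangent vectors becomes a uniform lower bound by
    compactness.\<close>
  obtain c0 where c0: "c0 > 0" "\<And>w. g0 \<bullet> w = 0 \<Longrightarrow> H w w \<ge> c0 * (norm w)\<^sup>2"
  proof -
    define T where "T = sphere 0 1 \<inter> {w. g0 \<bullet> w = 0}"
    have "compact T" unfolding T_def by (intro compact_Int_closed compact_sphere closed_hyperplane)
    moreover have "continuous_on T (\<lambda>w. H w w)" unfolding H_def by (intro continuous_intros)
    ultimately obtain c0 where c0: "c0 > 0" "\<And>w. w \<in> T \<Longrightarrow> H w w \<ge> c0"
    proof (cases "T = {}")
      case False
      then obtain w0 where "w0 \<in> T" "\<forall>w\<in>T. H w0 w0 \<le> H w w"
        using continuous_attains_inf[of T "\<lambda>w. H w w"] \<open>compact T\<close> \<open>continuous_on T (\<lambda>w. H w w)\<close> by auto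
      moreover from this have "H w0 w0 > 0" by (intro pos) (auto simp: T_def)
      ultimately show ?thesis using that by blast
    qed (use that[of 1] in auto)
    have "H w w \<ge> c0 * (norm w)\<^sup>2" if "g0 \<bullet> w = 0" for w
    proof (cases "w = 0")
      case False
      then have "(1 / norm w) *\<^sub>R w \<in> T" using that by (auto simp: T_def)
      from c0(2)[OF this] have "c0 \<le> H w w / (norm w)\<^sup>2"
        by (simp add: H_def blinfun.scaleR_left blinfun.scaleR_right power2_eq_square)
      then show ?thesis using False by (simp add: le_divide_eq)
    qed (simp add: H_def)
    with c0(1) show ?thesis by (rule that)
  qed
  define M where "M = norm (F'' p0) + 1"
  have M: "M > 0" by (simp add: M_def add_nonneg_pos)
  have HM: "\<bar>H v w\<bar> \<le> M * norm v * norm w" for v w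
    unfolding H_def
    by (rule order_trans[OF blinfun2_bound]) (auto simp: M_def intro!: mult_right_mono)
  \<comment> \<open>\<kappa> limits the tilt of the tangent hyperplane between \<open>p0\<close> and
    nearby boundary points, so that the lower bound \<open>c0\<close> for the Hessian drops to
    \<open>c0 / 2\<close> at worst; \<open>\<kappa>2\<close> is the inequality that ensures
    it.\<close>
  define \<kappa> where "\<kappa> = min 1 (c0 / (4 * c0 + 6 * M))"
  have \<kappa>: "0 < \<kappa>" "\<kappa> \<le> 1" using c0 M by (auto simp: \<kappa>_def)
  have \<kappa>2: "c0 * (1 - 2 * \<kappa>) - 3 * M * \<kappa> \<ge> c0 / 2"
  proof -
    have "\<kappa> * (4 * c0 + 6 * M) \<le> c0" using c0 M by (simp add: \<kappa>_def flip: le_divide_eq)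
    then show ?thesis by (simp add: algebra_simps)
  qed
  define \<gamma> where "\<gamma> = norm g0 / 2"
  have \<gamma>: "\<gamma> > 0" using g0 by (simp add: \<gamma>_def)
  define \<delta> where "\<delta> = \<kappa> * \<gamma>"
  have \<delta>: "\<delta> > 0" using \<kappa> \<gamma> by (simp add: \<delta>_def)
  have tilt: "H w w \<ge> c0 / 2 * (norm w)\<^sup>2" if "g1 \<bullet> w = 0" "norm (g1 - g0) \<le> \<delta>" for g1 w
  proof -
    define \<alpha> where "\<alpha> = (g0 \<bullet> w) / (g0 \<bullet> g0)"
    define w0 where "w0 = w - \<alpha> *\<^sub>R g0"
    have w0: "g0 \<bullet> w0 = 0" using g0 by (simp add: w0_def \<alpha>_def inner_diff_right)
    have "\<bar>g0 \<bullet> w\<bar> = \<bar>(g1 - g0) \<bullet> w\<bar>" using that by (simp add: inner_diff_left)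
    also have "\<dots> \<le> norm (g1 - g0) * norm w" by (rule Cauchy_Schwarz_ineq2)
    also have "\<dots> \<le> \<delta> * norm w" using that by (intro mult_right_mono) auto
    finally have "\<bar>g0 \<bullet> w\<bar> / norm g0 \<le> \<delta> * norm w / norm g0" by (intro divide_right_mono) auto
    moreover have "norm (\<alpha> *\<^sub>R g0) = \<bar>g0 \<bullet> w\<bar> / norm g0"
      using g0 by (simp add: \<alpha>_def power2_norm_eq_inner[symmetric] power2_eq_square)
    moreover have "\<delta> * norm w / norm g0 \<le> \<kappa> * norm w"
      using g0 \<kappa> by (simp add: \<delta>_def \<gamma>_def)
    ultimately have b: "norm (\<alpha> *\<^sub>R g0) \<le> \<kappa> * norm w" by linarith
    define b where "b = norm (\<alpha> *\<^sub>R g0)"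
    have b0: "0 \<le> b" "b \<le> \<kappa> * norm w" using b by (auto simp: b_def)
    have "g0 \<bullet> w0 = 0 \<Longrightarrow> w0 \<bullet> (\<alpha> *\<^sub>R g0) = 0" by (simp add: inner_commute)
    then have pyth: "(norm w)\<^sup>2 = (norm w0)\<^sup>2 + b\<^sup>2"
      using norm_add_Pythagorean[of w0 "\<alpha> *\<^sub>R g0"] w0 by (simp add: w0_def b_def orthogonal_def)
    then have w0w: "norm w0 \<le> norm w" by (metis le_add_same_cancel1 norm_ge_zero power2_le_imp_le zero_le_power2)
    have b2: "b\<^sup>2 \<le> \<kappa> * (norm w)\<^sup>2"
    proof -
      have "b\<^sup>2 \<le> (\<kappa> * norm w)\<^sup>2" using b0 by (intro power_mono)
      also have "\<dots> = \<kappa> * (\<kappa> * (norm w)\<^sup>2)" by (simp add: power2_eq_square)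
      also have "\<dots> \<le> 1 * (\<kappa> * (norm w)\<^sup>2)" using \<kappa> by (intro mult_right_mono) auto
      finally show ?thesis by simp
    qed
    have "H w w = H w0 w0 + 2 * H w0 (\<alpha> *\<^sub>R g0) + H (\<alpha> *\<^sub>R g0) (\<alpha> *\<^sub>R g0)"
    proof -
      have "w = w0 + \<alpha> *\<^sub>R g0" by (simp add: w0_def)
      then have "H w w = H (w0 + \<alpha> *\<^sub>R g0) (w0 + \<alpha> *\<^sub>R g0)" by simp
      also have "\<dots> = H w0 w0 + H w0 (\<alpha> *\<^sub>R g0) + H (\<alpha> *\<^sub>R g0) w0 + H (\<alpha> *\<^sub>R g0) (\<alpha> *\<^sub>R g0)"
        by (simp only: H_def blinfun.add_left blinfun.add_right)
      finally show ?thesis using sym[of w0 "\<alpha> *\<^sub>R g0"] by simp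
    qed
    moreover have "\<bar>H w0 (\<alpha> *\<^sub>R g0)\<bar> \<le> M * \<kappa> * (norm w)\<^sup>2"
    proof -
      have "\<bar>H w0 (\<alpha> *\<^sub>R g0)\<bar> \<le> M * norm w0 * b" using HM[of w0 "\<alpha> *\<^sub>R g0"] by (simp only: b_def)
      also have "\<dots> \<le> M * norm w * (\<kappa> * norm w)" using M w0w b0 by (intro mult_mono) auto
      finally show ?thesis by (simp add: power2_eq_square mult_ac)
    qed
    moreover have "\<bar>H (\<alpha> *\<^sub>R g0) (\<alpha> *\<^sub>R g0)\<bar> \<le> M * \<kappa> * (norm w)\<^sup>2"
    proof -
      have "\<bar>H (\<alpha> *\<^sub>R g0) (\<alpha> *\<^sub>R g0)\<bar> \<le> M * b * b" using HM[of "\<alpha> *\<^sub>R g0" "\<alpha> *\<^sub>R g0"] by (simp only: b_def)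
      also have "\<dots> \<le> M * (\<kappa> * (norm w)\<^sup>2)" using b2 M by (simp add: power2_eq_square mult.assoc)
      finally show ?thesis by (simp add: mult_ac)
    qed
    moreover have "H w0 w0 \<ge> c0 * (1 - 2 * \<kappa>) * (norm w)\<^sup>2"
    proof -
      have "c0 * (1 - 2 * \<kappa>) * (norm w)\<^sup>2 \<le> c0 * ((norm w)\<^sup>2 - b\<^sup>2)"
        unfolding mult.assoc
      proof (rule mult_left_mono)
        have "0 \<le> \<kappa> * (norm w)\<^sup>2" using \<kappa> by simp
        then show "(1 - 2 * \<kappa>) * (norm w)\<^sup>2 \<le> (norm w)\<^sup>2 - b\<^sup>2" using b2 by (simp add: left_diff_distrib)
      qed (use c0 in auto)
      then show ?thesis using c0(2)[OF w0] pyth by simp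
    qed
    ultimately have "H w w \<ge> (c0 * (1 - 2 * \<kappa>) - 3 * M * \<kappa>) * (norm w)\<^sup>2" by (simp add: algebra_simps)
    moreover have "(c0 * (1 - 2 * \<kappa>) - 3 * M * \<kappa>) * (norm w)\<^sup>2 \<ge> c0 / 2 * (norm w)\<^sup>2"
      using \<kappa>2 by (intro mult_right_mono) auto
    ultimately show ?thesis by linarith
  qed
  \<comment> \<open>\<open>C\<close> will bound the squared tangential displacement per unit of
    depth (\<open>near\<close>). \<open>E\<close> is a quarter of the slack when the gradient has
    its least length \<gamma>. The Hessian error \<epsilon> has to respect both the coercivity used
    for \<open>near\<close> and the final balance.\<close>
  define C where "C = 8 * (2 * norm g0 + 4 * M\<^sup>2 / c0 + M + c0) / c0"
  have C: "C > 0" using g0 M c0 by (auto simp: C_def intro!: divide_pos_pos add_pos_pos)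
  define E where "E = \<gamma> * (1 - \<eta>\<^sup>2) / 4"
  have \<eta>2: "\<eta>\<^sup>2 < 1" using \<eta> by (simp add: power_less_one_iff)
  have E: "E > 0" using \<gamma> \<eta>2 by (simp add: E_def)
  define \<epsilon> where "\<epsilon> = min (c0 / 16) (E / (C + 1))"
  have \<epsilon>: "\<epsilon> > 0" "\<epsilon> \<le> c0 / 16" "\<epsilon> * (C + 1) \<le> E"
  proof -
    show "\<epsilon> > 0" using c0 E C by (simp add: \<epsilon>_def)
    show "\<epsilon> \<le> c0 / 16" unfolding \<epsilon>_def by (rule min.cobounded1)
    have "\<epsilon> \<le> E / (C + 1)" unfolding \<epsilon>_def by (rule min.cobounded2)
    then show "\<epsilon> * (C + 1) \<le> E" using C by (simp add: le_divide_eq)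
  qed
  obtain R where R: "R > 0" "ball p0 (2 * R) \<subseteq> U"
     "\<And>x. x \<in> ball p0 (2 * R) \<Longrightarrow> norm (F'' x - F'' p0) \<le> \<epsilon>"
     "\<And>x. x \<in> ball p0 (2 * R) \<Longrightarrow> norm (grad_of (F' x) - g0) \<le> \<delta>"
  proof -
    have gc: "continuous_on U (\<lambda>x. grad_of (F' x))"
      unfolding grad_of_def by (intro continuous_on_vec_lambda continuous_intros F'c)
    have "\<forall>\<^sub>F x in at p0. dist (F'' x) (F'' p0) < \<epsilon>"
      using c U \<epsilon> by (metis continuous_on_eq_continuous_at isCont_def tendstoD)
    moreover have "\<forall>\<^sub>F x in at p0. dist (grad_of (F' x)) (grad_of (F' p0)) < \<delta>"
      using gc U \<delta> by (metis continuous_on_eq_continuous_at isCont_def tendstoD)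
    moreover have "\<forall>\<^sub>F x in at p0. x \<in> U" using U by (rule eventually_at_in_open')
    ultimately have "\<forall>\<^sub>F x in at p0. dist (F'' x) (F'' p0) < \<epsilon> \<and> dist (grad_of (F' x)) (grad_of (F' p0)) < \<delta> \<and> x \<in> U"
      by eventually_elim auto
    then obtain r where r: "r > 0" "\<And>x. x \<noteq> p0 \<Longrightarrow> dist x p0 < r \<Longrightarrow>
      dist (F'' x) (F'' p0) < \<epsilon> \<and> dist (grad_of (F' x)) (grad_of (F' p0)) < \<delta> \<and> x \<in> U"
      by (auto simp: eventually_at)
    have "x \<in> U \<and> norm (F'' x - F'' p0) \<le> \<epsilon> \<and> norm (grad_of (F' x) - g0) \<le> \<delta>" if "x \<in> ball p0 (2 * (r / 2))" for x
      using r(2)[of x] that \<epsilon> \<delta> U by (cases "x = p0") (auto simp: dist_norm norm_minus_commute g0_def)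
    then show ?thesis using r(1) by (intro that[of "r / 2"]) auto
  qed
  \<comment> \<open>Two demands on the depth \<tau>: the mixed and normal terms of the expansion
    stay below \<open>E\<close>, and every point considered stays in the ball where the expansion
    holds.\<close>
  have "((\<lambda>\<tau>. M * sqrt (C * \<tau>) + M * \<tau>) \<longlongrightarrow> M * sqrt (C * 0) + M * 0) (at_right 0)" by (intro tendsto_intros)
  then have "\<forall>\<^sub>F \<tau> in at_right 0. M * sqrt (C * \<tau>) + M * \<tau> < E" using E by (intro order_tendstoD(2)) auto
  moreover have "((\<lambda>\<tau>. (C + 1) * \<tau>) \<longlongrightarrow> (C + 1) * 0) (at_right 0)" by (intro tendsto_intros)
  then have "\<forall>\<^sub>F \<tau> in at_right 0. (C + 1) * \<tau> < (R / 2)\<^sup>2" using R by (intro order_tendstoD(2)) auto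
  moreover have "\<forall>\<^sub>F \<tau> in at_right (0::real). 0 < \<tau> \<and> \<tau> < 1" by (rule eventually_at_rightI[of 0 1]) auto
  ultimately have "\<forall>\<^sub>F \<tau> in at_right 0. M * sqrt (C * \<tau>) + M * \<tau> < E \<and> (C + 1) * \<tau> < (R / 2)\<^sup>2 \<and> 0 < \<tau> \<and> \<tau> < 1"
    by eventually_elim auto
  then obtain \<tau> where \<tau>: "M * sqrt (C * \<tau>) + M * \<tau> < E" "(C + 1) * \<tau> < (R / 2)\<^sup>2" "0 < \<tau>" "\<tau> < 1"
    using eventually_happens[of _ "at_right (0::real)"] by (auto simp: trivial_limit_at_right_real)
  have main: "(p - s *\<^sub>R u) + (\<eta> * sqrt (s / t)) *\<^sub>R (x - (p - t *\<^sub>R u)) \<in> K"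
    if p: "dist p p0 < R" "p \<in> frontier K" and u: "norm u = 1" "\<And>y. y \<in> K \<Longrightarrow> y \<bullet> u \<le> p \<bullet> u"
      and x: "x \<in> K" and s: "0 < s" "s \<le> \<tau>" and t: "0 < t" "t \<le> \<tau>" and xu: "x \<bullet> u = p \<bullet> u - t" for u p x s t
  proof -
    have uu: "u \<bullet> u = 1" using u by (simp add: power2_norm_eq_inner[symmetric])
    have pB: "p \<in> ball p0 (2 * R)" using p R by (auto simp: dist_commute)
    then have pU: "p \<in> U" using R by auto
    have pK: "p \<in> K" using p K(2) by (auto simp: frontier_def)
    define G where "G = norm (grad_of (F' p))"
    have Gu: "grad_of (F' p) = G *\<^sub>R u" unfolding G_def
      by (rule support_normal_gradient[OF F[OF pU] frontier0[OF p(2) pU] U(1) pU KU u g[OF pU]])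
    have dG: "norm (G *\<^sub>R u - g0) \<le> \<delta>" using R(4)[OF pB] Gu by simp
    have \<delta>\<gamma>: "\<delta> \<le> \<gamma>" using \<kappa> \<gamma> by (simp add: \<delta>_def mult_left_le_one_le)
    have normG: "norm (G *\<^sub>R u) = G" using u by (simp add: G_def)
    have G: "\<gamma> \<le> G" "G \<le> 2 * norm g0"
    proof -
      have "norm g0 \<le> norm (G *\<^sub>R u) + norm (G *\<^sub>R u - g0)" by (metis norm_triangle_sub norm_minus_commute)
      then show "\<gamma> \<le> G" using dG normG \<delta>\<gamma> norm_ge_zero[of g0] unfolding \<gamma>_def by linarith
      have "norm (G *\<^sub>R u) \<le> norm g0 + norm (G *\<^sub>R u - g0)" by (metis norm_triangle_sub)
      then show "G \<le> 2 * norm g0" using dG normG \<delta>\<gamma> norm_ge_zero[of g0] unfolding \<gamma>_def by linarith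
    qed
    have Hc: "H w w \<ge> c0 / 2 * (norm w)\<^sup>2" if "w \<bullet> u = 0" for w
      using tilt[OF _ dG, of w] that by (simp add: inner_commute)
    have ball_sub: "y \<in> ball p0 (2 * R)" if "norm (y - p) < R" for y
      using dist_triangle[of p0 y p] p that by (auto simp: dist_norm norm_minus_commute)
    have taylor: "\<bar>F (p + w - h *\<^sub>R u) + h * G - H w w / 2\<bar> \<le> M * h * norm w + M * h\<^sup>2 / 2 + \<epsilon> * ((norm w)\<^sup>2 + h\<^sup>2)"
      if w: "w \<bullet> u = 0" and h: "h \<ge> 0" and n: "norm (w - h *\<^sub>R u) < R" for w h
    proof -
      define v where "v = w - h *\<^sub>R u"
      have yB: "p + v \<in> ball p0 (2 * R)" using n by (intro ball_sub) (simp add: v_def)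
      have T: "\<bar>F (p + v) - F p - blinfun_apply (F' p) (p + v - p) - blinfun_apply (blinfun_apply (F'' p0) (p + v - p)) (p + v - p) / 2\<bar> \<le> \<epsilon> * (norm (p + v - p))\<^sup>2"
        using R by (intro second_order_taylor[OF convex_ball F F' _ pB yB]) auto
      have F0: "F p = 0" by (rule frontier0[OF p(2) pU])
      have F1: "blinfun_apply (F' p) v = - (h * G)"
        unfolding grad_of_inner Gu using w uu by (simp add: v_def inner_diff_right inner_commute)
      have nv: "(norm v)\<^sup>2 = (norm w)\<^sup>2 + h\<^sup>2"
        using norm_add_Pythagorean[of w "- h *\<^sub>R u"] w u by (simp add: v_def orthogonal_def)
      have eq: "F (p + w - h *\<^sub>R u) = F (p + v)" by (simp add: v_def add_diff_eq)
      have "\<bar>(F (p + v) + h * G) - H v v / 2\<bar> \<le> \<epsilon> * ((norm w)\<^sup>2 + h\<^sup>2)"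
        using T F0 F1 nv by (simp add: H_def)
      then show ?thesis unfolding eq
      proof (rule abs_quadratic_expansion_bound)
        show "H v v = H w w - 2 * (h * H w u) + h\<^sup>2 * H u u"
          using sym[of w u] by (simp add: v_def H_def blinfun.diff_left blinfun.diff_right blinfun.scaleR_left blinfun.scaleR_right power2_eq_square algebra_simps)
        show "\<bar>h * H w u\<bar> \<le> M * h * norm w"
          using HM[of w u] u h mult_left_mono[of "\<bar>H w u\<bar>" "M * norm w" h] by (simp add: abs_mult mult_ac)
        show "\<bar>h\<^sup>2 * H u u\<bar> \<le> M * h\<^sup>2"
          using HM[of u u] u mult_left_mono[of "\<bar>H u u\<bar>" "M" "h\<^sup>2"] by (simp add: abs_mult mult_ac)
      qed
    qed
    have near: "(norm w)\<^sup>2 \<le> C * h" if w: "w \<bullet> u = 0" and h: "0 < h" "h \<le> \<tau>" and n: "norm (w - h *\<^sub>R u) < R" and inK: "p + w - h *\<^sub>R u \<in> K" for w h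
    proof -
      have "p + w - h *\<^sub>R u \<in> U" using ball_sub[of "p + w - h *\<^sub>R u"] n R by (auto simp: add_diff_eq[symmetric])
      then have "F (p + w - h *\<^sub>R u) \<le> 0" using inK KU by auto
      then have "H w w / 2 \<le> h * G + M * h * norm w + M * h\<^sup>2 / 2 + \<epsilon> * ((norm w)\<^sup>2 + h\<^sup>2)"
        using taylor[OF w _ n] h by (simp add: abs_le_iff)
      \<comment> \<open>Young's inequality: the mixed term costs only \<open>c0 / 16\<close> of the
        coefficient of the squared norm, and the rest is of order \<open>h\<^sup>2\<close>. Together
        with the Hessian error this leaves \<open>c0 / 8\<close> of the original
        \<open>c0 / 4\<close>.\<close>
      moreover have "M * h * norm w \<le> c0 / 16 * (norm w)\<^sup>2 + 4 * M\<^sup>2 / c0 * h\<^sup>2"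
      proof -
        have "0 \<le> (sqrt c0 / 4 * norm w - 2 * M / sqrt c0 * h)\<^sup>2" by simp
        also have "\<dots> = c0 / 16 * (norm w)\<^sup>2 + 4 * M\<^sup>2 / c0 * h\<^sup>2 - M * h * norm w"
          using c0(1) by (simp add: power2_diff power_mult_distrib power_divide)
        finally show ?thesis by simp
      qed
      moreover have "\<epsilon> * ((norm w)\<^sup>2 + h\<^sup>2) \<le> c0 / 16 * ((norm w)\<^sup>2 + h\<^sup>2)" using \<epsilon> by (intro mult_right_mono) auto
      moreover have "h\<^sup>2 \<le> h" using h \<tau> by (simp add: power2_eq_square mult_left_le)
      then have "(4 * M\<^sup>2 / c0 + M / 2 + c0 / 16) * h\<^sup>2 \<le> (4 * M\<^sup>2 / c0 + M / 2 + c0 / 16) * h"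
        using M c0 by (intro mult_left_mono add_nonneg_nonneg) auto
      moreover have "h * G \<le> h * (2 * norm g0)" using G h by (intro mult_left_mono) auto
      moreover have "H w w / 2 \<ge> c0 / 4 * (norm w)\<^sup>2" using Hc[OF w] by simp
      moreover have "M / 2 * h \<le> M * h" "c0 / 16 * h \<le> c0 * h" using M c0 h by auto
      ultimately have "c0 / 8 * (norm w)\<^sup>2 \<le> h * (2 * norm g0 + 4 * M\<^sup>2 / c0 + M + c0)"
        by (simp add: distrib_left distrib_right mult_ac)
      then show ?thesis using c0(1) by (simp add: C_def field_simps)
    qed
    define w where "w = x - (p - t *\<^sub>R u)"
    have wu: "w \<bullet> u = 0" using xu uu by (simp add: w_def inner_diff_left)
    have xw: "p + w - t *\<^sub>R u = x" by (simp add: w_def)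
    \<comment> \<open>A point of \<open>K\<close> too far from \<open>p\<close> is excluded by
      convexity: moved towards \<open>p\<close> until its distance is \<open>R / 2\<close>, it has
      smaller depth and contradicts the bound of \<open>near\<close>.\<close>
    have xn: "norm (w - t *\<^sub>R u) < R"
    proof (rule ccontr)
      assume "\<not> ?thesis"
      then have big: "norm (x - p) \<ge> R" by (simp add: w_def)
      define \<theta> where "\<theta> = (R / 2) / norm (x - p)"
      have np: "0 < norm (x - p)" using big R(1) by linarith
      have \<theta>: "0 < \<theta>" "\<theta> < 1" using big R(1) np unfolding \<theta>_def by (auto simp only: divide_less_eq intro!: divide_pos_pos, auto)
      have n2: "norm (\<theta> *\<^sub>R w - (\<theta> * t) *\<^sub>R u) = R / 2"
      proof -
        have "\<theta> *\<^sub>R w - (\<theta> * t) *\<^sub>R u = \<theta> *\<^sub>R (x - p)" by (simp add: w_def algebra_simps)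
        moreover have "\<theta> * norm (x - p) = R / 2" using np by (simp add: \<theta>_def)
        ultimately show ?thesis using \<theta>(1) by simp
      qed
      have "(1 - \<theta>) *\<^sub>R p + \<theta> *\<^sub>R x \<in> K" using K(1) pK x \<theta> by (intro convexD) auto
      then have "p + \<theta> *\<^sub>R w - (\<theta> * t) *\<^sub>R u \<in> K" by (simp add: w_def algebra_simps)
      moreover have "\<theta> * t \<le> \<tau>" using t \<theta> mult_left_le_one_le[of t \<theta>] by linarith
      ultimately have "(norm (\<theta> *\<^sub>R w))\<^sup>2 \<le> C * (\<theta> * t)"
        using n2 R \<theta> t wu by (intro near) auto
      moreover have "(norm (\<theta> *\<^sub>R w - (\<theta> * t) *\<^sub>R u))\<^sup>2 = (norm (\<theta> *\<^sub>R w))\<^sup>2 + (\<theta> * t)\<^sup>2"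
        using norm_add_Pythagorean[of "\<theta> *\<^sub>R w" "- (\<theta> * t) *\<^sub>R u"] wu u by (simp add: orthogonal_def)
      moreover have "(\<theta> * t)\<^sup>2 \<le> \<theta> * t" using \<theta> t \<tau> \<open>\<theta> * t \<le> \<tau>\<close> mult_left_le[of "\<theta> * t" "\<theta> * t"] by (simp add: power2_eq_square)
      ultimately have "(R / 2)\<^sup>2 \<le> (C + 1) * (\<theta> * t)" unfolding n2 by (simp add: distrib_right)
      also have "\<dots> \<le> (C + 1) * \<tau>" using C \<open>\<theta> * t \<le> \<tau>\<close> by (intro mult_left_mono) auto
      finally show False using \<tau> by simp
    qed
    have wC: "(norm w)\<^sup>2 \<le> C * t" using x by (intro near[OF wu t xn]) (simp add: xw)
    define e where "e = M * sqrt (C * \<tau>) + M * \<tau> + \<epsilon> * (C + 1)"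
    have e: "2 * e \<le> G * (1 - \<eta>\<^sup>2)" "e \<ge> 0"
    proof -
      have "2 * e \<le> 4 * E" using \<tau>(1) \<epsilon>(3) by (simp add: e_def)
      also have "\<dots> = \<gamma> * (1 - \<eta>\<^sup>2)" by (simp add: E_def)
      also have "\<dots> \<le> G * (1 - \<eta>\<^sup>2)" using G \<eta>2 by (intro mult_right_mono) auto
      finally show "2 * e \<le> G * (1 - \<eta>\<^sup>2)" .
      show "e \<ge> 0" using M C \<tau> \<epsilon> by (simp add: e_def)
    qed
    have err: "\<bar>F (p + w - h *\<^sub>R u) + h * G - H w w / 2\<bar> \<le> h * e"
      if w: "w \<bullet> u = 0" and h: "0 < h" "h \<le> \<tau>" and n: "norm (w - h *\<^sub>R u) < R" and wC: "(norm w)\<^sup>2 \<le> C * h" for w h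
    proof -
      have "norm w \<le> sqrt (C * h)" using wC by (simp add: real_le_rsqrt)
      also have "\<dots> \<le> sqrt (C * \<tau>)" using h C by simp
      finally have "M * h * norm w \<le> M * h * sqrt (C * \<tau>)" using M h by (intro mult_left_mono) auto
      moreover have "h\<^sup>2 \<le> h" using h \<tau> by (simp add: power2_eq_square mult_left_le)
      then have "\<epsilon> * ((norm w)\<^sup>2 + h\<^sup>2) \<le> \<epsilon> * (C * h + h)" using wC \<epsilon> by (intro mult_left_mono) auto
      moreover have "M * h\<^sup>2 / 2 \<le> h * (M * \<tau>)"
      proof -
        have "M * h * h \<le> M * h * \<tau>" using M h by (intro mult_left_mono) auto
        moreover have "0 \<le> M * h * h" using M h by simp
        ultimately show ?thesis by (simp add: power2_eq_square mult_ac)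
      qed
      ultimately show ?thesis using taylor[OF w _ n] h by (simp add: e_def distrib_left mult_ac)
    qed
    define lam where "lam = \<eta> * sqrt (s / t)"
    have lam2: "lam\<^sup>2 = \<eta>\<^sup>2 * (s / t)" using s t by (simp add: lam_def power_mult_distrib)
    have lwu: "(lam *\<^sub>R w) \<bullet> u = 0" using wu by simp
    have lwC: "(norm (lam *\<^sub>R w))\<^sup>2 \<le> C * s"
    proof -
      have "(norm (lam *\<^sub>R w))\<^sup>2 = \<eta>\<^sup>2 * (s / t) * (norm w)\<^sup>2" using lam2 by (simp add: power_mult_distrib)
      also have "\<dots> \<le> \<eta>\<^sup>2 * (s / t) * (C * t)" using wC s t by (intro mult_left_mono) auto
      also have "\<dots> = \<eta>\<^sup>2 * (C * s)" using t by simp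
      also have "\<dots> \<le> 1 * (C * s)" using C s \<eta>2 by (intro mult_right_mono) auto
      finally show ?thesis by simp
    qed
    have lwn: "norm (lam *\<^sub>R w - s *\<^sub>R u) < R"
    proof -
      have "(norm (lam *\<^sub>R w - s *\<^sub>R u))\<^sup>2 = (norm (lam *\<^sub>R w))\<^sup>2 + s\<^sup>2"
        using norm_add_Pythagorean[of "lam *\<^sub>R w" "- s *\<^sub>R u"] lwu u by (simp add: orthogonal_def)
      also have "\<dots> \<le> C * s + s" using lwC s \<tau> by (intro add_mono) (auto simp: power2_eq_square mult_left_le)
      also have "\<dots> \<le> (C + 1) * \<tau>" using s C mult_left_mono[of s \<tau> "C + 1"] by (simp add: algebra_simps)
      also have "\<dots> < (R / 2)\<^sup>2" by (rule \<tau>)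
      finally have "norm (lam *\<^sub>R w - s *\<^sub>R u) < R / 2" by (rule power2_less_imp_less) (use R(1) in simp)
      then show ?thesis using R(1) by simp
    qed
    have "x \<in> ball p0 (2 * R)" using ball_sub[of x] xn by (simp add: w_def)
    then have "x \<in> K \<inter> U" using x R(2) by blast
    then have "F x \<le> 0" unfolding KU by simp
    then have "H w w / 2 \<le> t * G + t * e"
      using err[OF wu t xn wC, unfolded xw, THEN abs_le_D2] by simp
    then have "lam\<^sup>2 * (H w w / 2) \<le> lam\<^sup>2 * (t * G + t * e)" by (intro mult_left_mono) auto
    also have "\<dots> = s * (\<eta>\<^sup>2 * (G + e))" using t by (simp add: lam2 field_simps)
    finally have "H (lam *\<^sub>R w) (lam *\<^sub>R w) / 2 \<le> s * (\<eta>\<^sup>2 * (G + e))"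
      by (simp add: H_def blinfun.scaleR_left blinfun.scaleR_right power2_eq_square mult_ac)
    then have "F (p + lam *\<^sub>R w - s *\<^sub>R u) \<le> s * (\<eta>\<^sup>2 * (G + e) + e - G)"
      using err[OF lwu s lwn lwC, THEN abs_le_D1] by (simp add: right_diff_distrib distrib_left)
    also have "\<dots> \<le> s * 0"
    proof (rule mult_left_mono)
      have "\<eta>\<^sup>2 * e \<le> 1 * e" using e \<eta>2 by (intro mult_right_mono) auto
      then show "\<eta>\<^sup>2 * (G + e) + e - G \<le> 0" using e(1) by (simp add: algebra_simps)
    qed (use s in auto)
    finally have "F (p + lam *\<^sub>R w - s *\<^sub>R u) \<le> 0" by simp
    moreover have "p + lam *\<^sub>R w - s *\<^sub>R u \<in> U" using ball_sub[of "p + lam *\<^sub>R w - s *\<^sub>R u"] lwn R(2) by (auto simp: add_diff_eq[symmetric])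
    ultimately have "p + lam *\<^sub>R w - s *\<^sub>R u \<in> K" using KU by auto
    moreover have "(p - s *\<^sub>R u) + lam *\<^sub>R (x - (p - t *\<^sub>R u)) = p + lam *\<^sub>R w - s *\<^sub>R u"
      by (simp add: w_def algebra_simps)
    ultimately show ?thesis by (simp only: lam_def)
  qed
  show ?thesis
    by (rule exI[of _ R], rule conjI[OF R(1)], rule exI[of _ \<tau>], rule conjI[OF \<tau>(3)]) (intro allI impI main, auto)
qed

text \<open>Compactness of the boundary: the depth range is the least among those attached to a
  finite subcover. A point of \<open>K\<close> where a unit functional attains its maximum over
  \<open>K\<close> is a boundary point, so membership in \<open>K\<close> suffices as hypothesis on
  \<open>p\<close>.\<close>

theorem uniform_cap_scaling:
  fixes K :: "(real^'n) set" and \<eta> :: real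
  assumes K: "smooth_convex_body K" and \<eta>: "0 < \<eta>" "\<eta> < 1"
  shows "\<exists>\<tau>>0. \<forall>u p x s t. norm u = 1 \<longrightarrow> p \<in> K \<longrightarrow> (\<forall>y\<in>K. y \<bullet> u \<le> p \<bullet> u) \<longrightarrow>
      x \<in> K \<longrightarrow> 0 < s \<longrightarrow> s \<le> \<tau> \<longrightarrow> 0 < t \<longrightarrow> t \<le> \<tau> \<longrightarrow> x \<bullet> u = p \<bullet> u - t \<longrightarrow>
      (p - s *\<^sub>R u) + (\<eta> * sqrt (s / t)) *\<^sub>R (x - (p - t *\<^sub>R u)) \<in> K"
proof -
  have cK: "convex K" "compact K" "interior K \<noteq> {}" using K by (auto simp: smooth_convex_body_def convex_body_def)
  define P where "P r \<tau> p0 \<longleftrightarrow> (\<forall>u p x s t. dist p p0 < r \<longrightarrow> norm u = 1 \<longrightarrow> p \<in> frontier K \<longrightarrow> (\<forall>y\<in>K. y \<bullet> u \<le> p \<bullet> u) \<longrightarrow>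
      x \<in> K \<longrightarrow> 0 < s \<longrightarrow> s \<le> \<tau> \<longrightarrow> 0 < t \<longrightarrow> t \<le> \<tau> \<longrightarrow> x \<bullet> u = p \<bullet> u - t \<longrightarrow>
      (p - s *\<^sub>R u) + (\<eta> * sqrt (s / t)) *\<^sub>R (x - (p - t *\<^sub>R u)) \<in> K)" for r \<tau> p0
  have "\<forall>p0\<in>frontier K. \<exists>r \<tau>. r > 0 \<and> \<tau> > 0 \<and> P r \<tau> p0"
  proof
    fix p0 assume p0: "p0 \<in> frontier K"
    obtain U F F' F'' where *: "open U" "p0 \<in> U"
        "\<forall>x\<in>U. (F has_derivative blinfun_apply (F' x)) (at x)"
        "\<forall>x\<in>U. (F' has_derivative blinfun_apply (F'' x)) (at x)"
        "continuous_on U F''" "\<forall>x\<in>U. grad_of (F' x) \<noteq> 0"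
        "K \<inter> U = {x \<in> U. F x \<le> 0}" "gauss_curvature (F' p0) (F'' p0) > 0"
      using K[unfolded smooth_convex_body_def, THEN conjunct2, rule_format, OF p0] by (elim exE conjE) (rule that)
    have "\<exists>r>0. \<exists>\<tau>>0. P r \<tau> p0"
      unfolding P_def
    proof (rule local_cap_scaling[where U = U and F = F and F' = F' and F'' = F''])
      show "(F has_derivative blinfun_apply (F' x)) (at x)" "(F' has_derivative blinfun_apply (F'' x)) (at x)"
        "grad_of (F' x) \<noteq> 0" if "x \<in> U" for x using * that by auto
    qed (use * cK compact_imp_closed[OF cK(2)] p0 \<eta> in auto)
    then show "\<exists>r \<tau>. r > 0 \<and> \<tau> > 0 \<and> P r \<tau> p0" by metis
  qed
  then obtain r \<tau> where rt: "\<And>p0. p0 \<in> frontier K \<Longrightarrow> r p0 > (0::real) \<and> \<tau> p0 > (0::real) \<and> P (r p0) (\<tau> p0) p0" by metis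
  have "compact (frontier K)" using cK by (intro compact_frontier)
  moreover have "frontier K \<subseteq> (\<Union>p0\<in>frontier K. ball p0 (r p0))" using rt by fastforce
  ultimately obtain D where D: "D \<subseteq> frontier K" "finite D" "frontier K \<subseteq> (\<Union>p0\<in>D. ball p0 (r p0))"
    by (metis (no_types, lifting) compactE_image open_ball)
  define t0 where "t0 = Min (insert 1 (\<tau> ` D))"
  have t0: "t0 > 0" "\<And>q. q \<in> D \<Longrightarrow> t0 \<le> \<tau> q" unfolding t0_def using D rt by auto
  show ?thesis
  proof (rule exI[of _ t0], intro conjI t0 allI impI)
    fix u p x s t
    assume *: "norm u = 1" "p \<in> K" "\<forall>y\<in>K. y \<bullet> u \<le> p \<bullet> u" "x \<in> K" "0 < s" "s \<le> t0" "0 < t" "t \<le> t0" "x \<bullet> u = p \<bullet> u - t"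
    have pf: "p \<in> frontier K"
    proof -
      have "p \<notin> interior K"
      proof
        assume "p \<in> interior K"
        then obtain e where e: "e > 0" "cball p e \<subseteq> K" by (auto simp: mem_interior_cball)
        have "p + e *\<^sub>R u \<in> K" using e * by (auto simp: subset_eq dist_norm)
        then have "e * (u \<bullet> u) \<le> 0" using *(3) by (fastforce simp: inner_add_left)
        then show False using e * by (simp add: power2_norm_eq_inner[symmetric])
      qed
      then show ?thesis using * closure_subset by (auto simp: frontier_def)
    qed
    then obtain q where q: "q \<in> D" "dist p q < r q" using D(3) by (auto simp: dist_commute)
    have "P (r q) (\<tau> q) q" using q D rt by auto
    then show "(p - s *\<^sub>R u) + (\<eta> * sqrt (s / t)) *\<^sub>R (x - (p - t *\<^sub>R u)) \<in> K"
      unfolding P_def using q pf * t0(2)[OF q(1)] by (meson order_trans)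
  qed
qed

section \<open>Faces of the convex hull of finitely many points\<close>

text \<open>Coefficients are indexed by \<open>I\<close> although \<open>X\<close> may repeat
  points: in one direction the coefficient of a point goes to a single representative index, in the
  other the coefficients over each fibre are added up.\<close>

lemma affine_hull_image_finite:
  fixes X :: "'i \<Rightarrow> 'a::real_vector"
  assumes "finite I"
  shows "y \<in> affine hull (X ` I) \<longleftrightarrow> (\<exists>c. sum c I = 1 \<and> (\<Sum>i\<in>I. c i *\<^sub>R X i) = y)"
proof
  assume "y \<in> affine hull (X ` I)"
  then obtain u where u: "sum u (X ` I) = 1" "(\<Sum>v\<in>X ` I. u v *\<^sub>R v) = y"
    using affine_hull_finite[of "X ` I"] assms by auto
  obtain I' where I': "I' \<subseteq> I" "inj_on X I'" "X ` I = X ` I'" by (metis subset_image_inj subset_refl)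
  let ?c = "\<lambda>i. if i \<in> I' then u (X i) else 0"
  have "sum ?c I = sum (\<lambda>i. u (X i)) I'"
    by (rule sum.mono_neutral_cong_right) (use assms I' in auto)
  then have "sum ?c I = 1" using u(1) I' by (simp add: sum.reindex)
  moreover have "(\<Sum>i\<in>I. ?c i *\<^sub>R X i) = (\<Sum>i\<in>I'. u (X i) *\<^sub>R X i)"
    by (rule sum.mono_neutral_cong_right) (use assms I' in auto)
  then have "(\<Sum>i\<in>I. ?c i *\<^sub>R X i) = y" using u(2) I' by (simp add: sum.reindex)
  ultimately show "\<exists>c. sum c I = 1 \<and> (\<Sum>i\<in>I. c i *\<^sub>R X i) = y" by blast
next
  assume "\<exists>c. sum c I = 1 \<and> (\<Sum>i\<in>I. c i *\<^sub>R X i) = y"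
  then obtain c where c: "sum c I = 1" "(\<Sum>i\<in>I. c i *\<^sub>R X i) = y" by blast
  let ?u = "\<lambda>v. sum c {i \<in> I. X i = v}"
  have "sum ?u (X ` I) = 1" using c assms by (simp add: sum.image_gen[symmetric])
  moreover have "(\<Sum>v\<in>X ` I. ?u v *\<^sub>R v) = y"
    unfolding c(2)[symmetric] sum.image_gen[OF assms, of "\<lambda>i. c i *\<^sub>R X i" X]
    by (intro sum.cong) (auto simp: scaleR_sum_left)
  ultimately show "y \<in> affine hull (X ` I)" using affine_hull_finite[of "X ` I"] assms by auto
qed

lemma convex_hull_image_finite:
  fixes X :: "'i \<Rightarrow> 'a::real_vector"
  assumes "finite I"
  shows "y \<in> convex hull (X ` I) \<longleftrightarrow> (\<exists>c. (\<forall>i\<in>I. c i \<ge> 0) \<and> sum c I = 1 \<and> (\<Sum>i\<in>I. c i *\<^sub>R X i) = y)"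
proof
  assume "y \<in> convex hull (X ` I)"
  then obtain u where u: "\<forall>v\<in>X ` I. 0 \<le> u v" "sum u (X ` I) = 1" "(\<Sum>v\<in>X ` I. u v *\<^sub>R v) = y"
    using convex_hull_finite[of "X ` I"] assms by auto
  obtain I' where I': "I' \<subseteq> I" "inj_on X I'" "X ` I = X ` I'" by (metis subset_image_inj subset_refl)
  let ?c = "\<lambda>i. if i \<in> I' then u (X i) else 0"
  have "sum ?c I = sum (\<lambda>i. u (X i)) I'"
    by (rule sum.mono_neutral_cong_right) (use assms I' in auto)
  then have "sum ?c I = 1" using u(2) I' by (simp add: sum.reindex)
  moreover have "(\<Sum>i\<in>I. ?c i *\<^sub>R X i) = (\<Sum>i\<in>I'. u (X i) *\<^sub>R X i)"
    by (rule sum.mono_neutral_cong_right) (use assms I' in auto)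
  then have "(\<Sum>i\<in>I. ?c i *\<^sub>R X i) = y" using u(3) I' by (simp add: sum.reindex)
  moreover have "\<forall>i\<in>I. ?c i \<ge> 0" using u(1) by auto
  ultimately show "\<exists>c. (\<forall>i\<in>I. c i \<ge> 0) \<and> sum c I = 1 \<and> (\<Sum>i\<in>I. c i *\<^sub>R X i) = y"
    by (intro exI[of _ ?c] conjI)
next
  assume "\<exists>c. (\<forall>i\<in>I. c i \<ge> 0) \<and> sum c I = 1 \<and> (\<Sum>i\<in>I. c i *\<^sub>R X i) = y"
  then obtain c where c: "\<And>i. i \<in> I \<Longrightarrow> c i \<ge> 0" "sum c I = 1" "(\<Sum>i\<in>I. c i *\<^sub>R X i) = y" by blast
  have "(\<Sum>i\<in>I. c i *\<^sub>R X i) \<in> convex hull (X ` I)"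
    by (rule convex_sum[OF assms convex_convex_hull c(2,1)]) (auto intro: hull_inc)
  then show "y \<in> convex hull (X ` I)" using c(3) by simp
qed

text \<open>By continuity and compactness a zero exists exactly when the values over a countable
  dense subset come arbitrarily close to 0, and this involves only countably many measurable
  conditions.\<close>

lemma sets_ex_zero_compact:
  fixes f :: "'x \<Rightarrow> 'c::{metric_space, second_countable_topology} \<Rightarrow> real"
  assumes C: "compact C"
    and m: "\<And>c. c \<in> C \<Longrightarrow> (\<lambda>x. f x c) \<in> borel_measurable M"
    and cont: "\<And>x. x \<in> space M \<Longrightarrow> continuous_on C (f x)"
    and nn: "\<And>x c. f x c \<ge> 0"
  shows "{x \<in> space M. \<exists>c\<in>C. f x c = 0} \<in> sets M"
proof -
  obtain D where D: "countable D" "D \<subseteq> C" "C \<subseteq> closure D" using separable by blast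
  have "(\<exists>c\<in>C. f x c = 0) \<longleftrightarrow> (\<forall>k::nat. \<exists>c\<in>D. f x c < 1 / real (Suc k))" if x: "x \<in> space M" for x
  proof safe
    fix c k assume c: "c \<in> C" "f x c = 0"
    then obtain d where d: "d > 0" "\<And>y. y \<in> C \<Longrightarrow> dist y c < d \<Longrightarrow> dist (f x y) (f x c) < 1 / real (Suc k)"
      using cont[OF x] unfolding continuous_on_iff by (metis of_nat_0_less_iff zero_less_Suc zero_less_divide_1_iff)
    obtain y where "y \<in> D" "dist y c < d" using D(3) c(1) d(1) by (meson closure_approachable subsetD)
    then show "\<exists>c\<in>D. f x c < 1 / real (Suc k)" using d(2)[of y] D(2) c(2) nn[of x y] by (intro bexI[of _ y]) auto
  next
    assume *: "\<forall>k::nat. \<exists>c\<in>D. f x c < 1 / real (Suc k)"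
    then have "C \<noteq> {}" using D(2) by auto
    then obtain c where c: "c \<in> C" "\<And>y. y \<in> C \<Longrightarrow> f x c \<le> f x y"
      using continuous_attains_inf[OF C _ cont[OF x]] by blast
    have "f x c \<le> 0"
    proof (rule ccontr)
      assume "\<not> f x c \<le> 0"
      then obtain k where "1 / real (Suc k) < f x c" using reals_Archimedean[of "f x c"] by (auto simp: inverse_eq_divide)
      moreover obtain y where "y \<in> D" "f x y < 1 / real (Suc k)" using * by blast
      ultimately show False using c(2)[of y] D(2) by auto
    qed
    then show "\<exists>c\<in>C. f x c = 0" using c(1) nn[of x c] by (intro bexI[of _ c]) auto
  qed
  then have "{x \<in> space M. \<exists>c\<in>C. f x c = 0} = {x \<in> space M. \<forall>k::nat. \<exists>c\<in>D. f x c < 1 / real (Suc k)}" by auto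
  also have "\<dots> \<in> sets M"
    using D m by (intro sets.sets_Collect_countable_All sets.sets_Collect_countable_Ex') (auto intro!: borel_measurable_less)
  finally show ?thesis .
qed

text \<open>A common point of the two hulls is witnessed by coefficients; since \<open>I\<close> and
  \<open>J\<close> are disjoint, one vector \<open>c\<close> holds both families. The nonnegative
  function \<open>f\<close> adds up the violated conditions, and countably many compact boxes
  exhaust the possible witnesses.\<close>

lemma sets_affine_convex_hull_disjoint:
  fixes N I J :: "nat set"
  assumes N: "finite N" "I \<subseteq> N" "J \<subseteq> N" "I \<inter> J = {}"
  shows "{X \<in> space (PiM N (\<lambda>_. borel :: 'a::euclidean_space measure)). affine hull (X ` I) \<inter> convex hull (X ` J) = {}}
     \<in> sets (PiM N (\<lambda>_. borel))"
proof -
  let ?M = "PiM N (\<lambda>_. borel :: 'a measure)"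
  have fin: "finite I" "finite J" using N by (meson finite_subset)+
  \<comment> \<open>Coordinates outside \<open>N\<close> are fixed at 0, so the box is compact in
    the product topology on all of \<open>nat \<Rightarrow> real\<close>.\<close>
  define C where "C R = PiE UNIV (\<lambda>i::nat. if i \<in> N then {- real R..real R} else {0})" for R :: nat
  have C: "compact (C R)" for R
  proof -
    have "compactin (product_topology (\<lambda>i. euclidean) UNIV) (C R)"
      unfolding C_def compactin_PiE by (auto simp: compactin_euclidean_iff)
    then show ?thesis by (simp add: euclidean_product_topology compactin_euclidean_iff)
  qed
  define f where "f X c = \<bar>sum c I - 1\<bar> + \<bar>sum c J - 1\<bar> + (\<Sum>j\<in>J. max 0 (- c j)) +
     norm ((\<Sum>i\<in>I. c i *\<^sub>R X i) - (\<Sum>j\<in>J. c j *\<^sub>R X j))" for X :: "nat \<Rightarrow> 'a" and c :: "nat \<Rightarrow> real"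
  have key: "affine hull (X ` I) \<inter> convex hull (X ` J) \<noteq> {} \<longleftrightarrow> (\<exists>R. \<exists>c\<in>C R. f X c = 0)" for X
  proof
    assume "affine hull (X ` I) \<inter> convex hull (X ` J) \<noteq> {}"
    then obtain y where y: "y \<in> affine hull (X ` I)" "y \<in> convex hull (X ` J)" by blast
    obtain a where a: "sum a I = 1" "(\<Sum>i\<in>I. a i *\<^sub>R X i) = y" using y(1) affine_hull_image_finite[OF fin(1)] by metis
    obtain b where b: "\<forall>i\<in>J. b i \<ge> 0" "sum b J = 1" "(\<Sum>i\<in>J. b i *\<^sub>R X i) = y" using y(2) convex_hull_image_finite[OF fin(2)] by metis
    define c where "c i = (if i \<in> I then a i else if i \<in> J then b i else 0)" for i
    obtain R :: nat where R: "(\<Sum>i\<in>N. \<bar>c i\<bar>) \<le> real R" using real_arch_simple by blast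
    have b1: "- real R \<le> c i \<and> c i \<le> real R" if "i \<in> N" for i
      using member_le_sum[OF that, of "\<lambda>i. \<bar>c i\<bar>"] N(1) R by (simp add: abs_le_iff)
    have b2: "c i = 0" if "i \<notin> N" for i using that N by (auto simp: c_def)
    have "c \<in> C R" using b1 b2 by (simp add: C_def PiE_iff)
    moreover have "sum c I = sum a I" "(\<Sum>i\<in>I. c i *\<^sub>R X i) = (\<Sum>i\<in>I. a i *\<^sub>R X i)" by (auto simp: c_def intro!: sum.cong)
    moreover have "sum c J = sum b J" "(\<Sum>i\<in>J. c i *\<^sub>R X i) = (\<Sum>i\<in>J. b i *\<^sub>R X i)" "(\<Sum>j\<in>J. max 0 (- c j)) = 0"
      using N(4) b(1) by (auto simp: c_def intro!: sum.cong sum.neutral)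
    ultimately show "\<exists>R. \<exists>c\<in>C R. f X c = 0" using a b by (intro exI[of _ R] bexI[of _ c]) (auto simp: f_def)
  next
    assume "\<exists>R. \<exists>c\<in>C R. f X c = 0"
    then obtain c where "f X c = 0" by blast
    moreover have "0 \<le> (\<Sum>j\<in>J. max 0 (- c j))" by (intro sum_nonneg) auto
    ultimately have c: "sum c I = 1" "sum c J = 1" "(\<Sum>j\<in>J. max 0 (- c j)) = 0" "(\<Sum>i\<in>I. c i *\<^sub>R X i) = (\<Sum>j\<in>J. c j *\<^sub>R X j)"
      unfolding f_def by (auto simp: add_nonneg_eq_0_iff)
    have "\<forall>j\<in>J. c j \<ge> 0" using c(3) fin(2) by (subst (asm) sum_nonneg_eq_0_iff) (auto simp: max_def split: if_splits)
    then show "affine hull (X ` I) \<inter> convex hull (X ` J) \<noteq> {}"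
      using c affine_hull_image_finite[OF fin(1), of "\<Sum>j\<in>J. c j *\<^sub>R X j" X] convex_hull_image_finite[OF fin(2), of "\<Sum>j\<in>J. c j *\<^sub>R X j" X] by blast
  qed
  have "{X \<in> space ?M. \<exists>c\<in>C R. f X c = 0} \<in> sets ?M" for R
  proof (rule sets_ex_zero_compact[OF C])
    show "(\<lambda>X. f X c) \<in> borel_measurable ?M" for c
    proof -
      have "(\<lambda>X. (\<Sum>i\<in>I. c i *\<^sub>R X i) - (\<Sum>j\<in>J. c j *\<^sub>R X j)) \<in> borel_measurable ?M"
        using N by (intro borel_measurable_diff borel_measurable_sum
            borel_measurable_scaleR measurable_component_singleton borel_measurable_const) auto
      from measurable_compose[OF this borel_measurable_norm] show ?thesis
        unfolding f_def by (intro borel_measurable_add borel_measurable_const) simp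
    qed
    have cc: "continuous_on S (\<lambda>c::nat\<Rightarrow>real. c i)" for i S
      by (rule continuous_on_subset[OF continuous_on_product_coordinates subset_UNIV])
    show "continuous_on (C R) (f X)" for X
      unfolding f_def by (intro continuous_intros cc)
    show "f X c \<ge> 0" for X c unfolding f_def by (intro add_nonneg_nonneg sum_nonneg) auto
  qed
  then have "(\<Union>R. {X \<in> space ?M. \<exists>c\<in>C R. f X c = 0}) \<in> sets ?M" by blast
  then have "space ?M - (\<Union>R. {X \<in> space ?M. \<exists>c\<in>C R. f X c = 0}) \<in> sets ?M" by blast
  also have "space ?M - (\<Union>R. {X \<in> space ?M. \<exists>c\<in>C R. f X c = 0}) = {X \<in> space ?M. affine hull (X ` I) \<inter> convex hull (X ` J) = {}}"
    using key by blast
  finally show ?thesis .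
qed

lemma sets_affine_hull_member:
  fixes N I :: "nat set"
  assumes N: "finite N" "I \<subseteq> N" "j \<in> N - I"
  shows "{X \<in> space (PiM N (\<lambda>_. borel :: 'a::euclidean_space measure)). X j \<in> affine hull (X ` I)}
     \<in> sets (PiM N (\<lambda>_. borel))"
proof -
  have "{X \<in> space (PiM N (\<lambda>_. borel :: 'a measure)). affine hull (X ` I) \<inter> convex hull (X ` {j}) = {}}
     \<in> sets (PiM N (\<lambda>_. borel))" using N by (intro sets_affine_convex_hull_disjoint) auto
  from sets.compl_sets[OF this] show ?thesis
    by (rule back_subst[of "\<lambda>A. A \<in> sets _"]) auto
qed

lemma measurable_aff_dim_image:
  fixes N I :: "nat set"
  assumes N: "finite N" "I \<subseteq> N"
  shows "(\<lambda>X. aff_dim (X ` I :: 'a::euclidean_space set)) \<in> measurable (PiM N (\<lambda>_. borel)) (count_space UNIV)"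
proof -
  have "finite I" using N finite_subset by auto
  from this N(2) show ?thesis
  proof (induction I)
    case (insert j I)
    have "(\<lambda>X. if X j \<in> affine hull (X ` I) then aff_dim (X ` I) else aff_dim (X ` I :: 'a set) + 1)
        \<in> measurable (PiM N (\<lambda>_. borel)) (count_space UNIV)"
    proof (rule measurable_If)
      show m: "(\<lambda>X. aff_dim (X ` I :: 'a set)) \<in> measurable (PiM N (\<lambda>_. borel)) (count_space UNIV)"
        using insert by auto
      show "(\<lambda>X. aff_dim (X ` I :: 'a set) + 1) \<in> measurable (PiM N (\<lambda>_. borel)) (count_space UNIV)"
        using m by (rule measurable_compose) auto
      show "{X \<in> space (PiM N (\<lambda>_. borel)). X j \<in> affine hull (X ` I)} \<in> sets (PiM N (\<lambda>_. borel :: 'a measure))"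
        using insert N by (intro sets_affine_hull_member) auto
    qed
    then show ?case by (simp add: aff_dim_insert)
  qed simp
qed

text \<open>Faces are encoded by index sets: a finite \<open>N\<close> has finitely many, and each
  condition is a measurable event, which makes face counts random variables. Disjointness of the two
  hulls is the standard criterion for the hull of a subset to be a face.\<close>

definition face_idx :: "(nat \<Rightarrow> 'a::euclidean_space) \<Rightarrow> nat set \<Rightarrow> nat set \<Rightarrow> bool" where
  "face_idx X N I \<longleftrightarrow> I \<subseteq> N \<and> affine hull (X ` I) \<inter> convex hull (X ` (N - I)) = {}"

text \<open>The second part recovers the index set from the face and so gives injectivity of the
  encoding: a point with index outside \<open>I\<close> cannot even lie in the affine hull.\<close>

lemma face_idx_face:
  assumes "finite N" "face_idx X N I"
  shows "convex hull (X ` I) face_of convex hull (X ` N)" "I = {j \<in> N. X j \<in> convex hull (X ` I)}"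
proof -
  have I: "I \<subseteq> N" "affine hull (X ` I) \<inter> convex hull (X ` (N - I)) = {}" using assms by (auto simp: face_idx_def)
  have "convex hull (X ` N - X ` I) \<subseteq> convex hull (X ` (N - I))" by (intro hull_mono) auto
  then show "convex hull (X ` I) face_of convex hull (X ` N)"
    using I assms(1) by (intro face_of_convex_hulls) auto
  have "X j \<notin> convex hull (X ` I)" if "j \<in> N - I" for j
    using I(2) that hull_inc[of "X j" "X ` (N - I)" convex] convex_hull_subset_affine_hull[of "X ` I"] by auto
  then show "I = {j \<in> N. X j \<in> convex hull (X ` I)}" using I(1) by (auto intro: hull_inc)
qed

lemma convex_Diff_face:
  assumes "convex S" "F face_of S"
  shows "convex (S - F)"
  unfolding convex_contains_segment
proof (intro ballI subsetI)
  fix a b x assume ab: "a \<in> S - F" "b \<in> S - F" and x: "x \<in> closed_segment a b"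
  have "x \<in> S" using x ab assms(1) by (auto simp: convex_contains_segment)
  moreover have "x \<notin> F"
    using x ab face_ofD[OF assms(2), of x a b] by (auto simp: closed_segment_eq_open)
  ultimately show "x \<in> S - F" by simp
qed

text \<open>A face is cut out of the polytope by its affine hull, and the rest of the polytope is
  convex, so it contains the hull of the remaining points and misses that affine hull.\<close>

lemma face_face_idx:
  assumes "finite N" "F face_of convex hull (X ` N)"
  shows "face_idx X N {j \<in> N. X j \<in> F}" "F = convex hull (X ` {j \<in> N. X j \<in> F})"
proof -
  let ?I = "{j \<in> N. X j \<in> F}"
  obtain S where S: "S \<subseteq> X ` N" "F = convex hull S"
    by (rule face_of_convex_hull_subset[OF finite_imp_compact[OF finite_imageI[OF assms(1)]] assms(2)]) (rule that)
  have "S \<subseteq> X ` ?I" using S hull_subset[of S convex] by blast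
  then have "F \<subseteq> convex hull (X ` ?I)" using S by (simp add: hull_mono)
  moreover have "convex hull (X ` ?I) \<subseteq> F" using assms(2) by (intro hull_minimal) (auto simp: face_of_imp_convex)
  ultimately show eq: "F = convex hull (X ` ?I)" by blast
  have st: "F \<subseteq> convex hull (X ` N)" "convex (convex hull (X ` N) - F)" "F = affine hull F \<inter> convex hull (X ` N)"
    by (rule face_of_imp_subset[OF assms(2)] convex_Diff_face[OF convex_convex_hull assms(2)]
        face_of_imp_eq_affine_Int[OF convex_convex_hull assms(2)])+
  have "convex hull (X ` (N - ?I)) \<subseteq> convex hull (X ` N) - F"
    using st(2) by (intro hull_minimal) (auto intro: hull_inc)
  then have "affine hull F \<inter> convex hull (X ` (N - ?I)) = {}" using st(3) by auto
  moreover have "affine hull F = affine hull (X ` ?I)" by (subst eq) (simp add: affine_hull_convex_hull)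
  ultimately show "face_idx X N ?I" by (auto simp: face_idx_def)
qed

text \<open>The index set of a face collects every index whose point lies in it, so the
  correspondence is bijective even when points coincide.\<close>

lemma f_count_eq_card_face_idx:
  fixes X :: "nat \<Rightarrow> real^'n"
  assumes "finite N"
  shows "f_count i (convex hull (X ` N)) = card {I. face_idx X N I \<and> aff_dim (X ` I) = i}"
proof -
  have "bij_betw (\<lambda>I. convex hull (X ` I)) {I. face_idx X N I \<and> aff_dim (X ` I) = i}
     {F. F face_of convex hull (X ` N) \<and> aff_dim F = i}"
  proof (rule bij_betwI')
    fix I J assume "I \<in> {I. face_idx X N I \<and> aff_dim (X ` I) = i}" "J \<in> {I. face_idx X N I \<and> aff_dim (X ` I) = i}"
    then show "(convex hull (X ` I) = convex hull (X ` J)) = (I = J)"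
      using face_idx_face(2)[OF assms, of X I] face_idx_face(2)[OF assms, of X J] by auto
  next
    fix I assume "I \<in> {I. face_idx X N I \<and> aff_dim (X ` I) = i}"
    then show "convex hull (X ` I) \<in> {F. F face_of convex hull (X ` N) \<and> aff_dim F = i}"
      using face_idx_face(1)[OF assms, of X I] by (simp add: aff_dim_convex_hull)
  next
    fix F assume F: "F \<in> {F. F face_of convex hull (X ` N) \<and> aff_dim F = i}"
    then have "F face_of convex hull (X ` N)" by simp
    from face_face_idx[OF assms this]
    have "face_idx X N {j \<in> N. X j \<in> F}" "F = convex hull (X ` {j \<in> N. X j \<in> F})" .
    moreover have "aff_dim (X ` {j \<in> N. X j \<in> F}) = i"
      using F arg_cong[OF calculation(2), of aff_dim] by (simp only: aff_dim_convex_hull) simp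
    ultimately show "\<exists>I\<in>{I. face_idx X N I \<and> aff_dim (X ` I) = i}. F = convex hull (X ` I)"
      by (intro bexI[of _ "{j \<in> N. X j \<in> F}"]) simp_all
  qed
  then show ?thesis unfolding f_count_def by (rule bij_betw_same_card[symmetric])
qed

lemma sets_face_idx:
  assumes "finite N"
  shows "{X \<in> space (PiM N (\<lambda>_. borel :: 'a::euclidean_space measure)). face_idx X N I} \<in> sets (PiM N (\<lambda>_. borel))"
proof (cases "I \<subseteq> N")
  case True
  then show ?thesis unfolding face_idx_def
    using sets_affine_convex_hull_disjoint[OF assms True, of "N - I"] by (simp add: Diff_Int_distrib2)
qed (simp add: face_idx_def)

lemma borel_measurable_f_count:
  fixes N :: "nat set"
  assumes "finite N"
  shows "(\<lambda>X. real (f_count i (convex hull (X ` N) :: (real^'n) set))) \<in> borel_measurable (PiM N (\<lambda>_. borel))"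
proof -
  let ?M = "PiM N (\<lambda>_. borel :: (real^'n) measure)"
  have "(\<lambda>X. \<Sum>I\<in>Pow N. indicator ({X \<in> space ?M. face_idx X N I} \<inter> {X \<in> space ?M. aff_dim (X ` I) = i}) X :: real) \<in> borel_measurable ?M"
  proof (intro borel_measurable_sum borel_measurable_indicator sets.Int sets_face_idx assms)
    fix I assume "I \<in> Pow N"
    then have "(\<lambda>X. aff_dim (X ` I :: (real^'n) set)) \<in> measurable ?M (count_space UNIV)"
      using measurable_aff_dim_image[OF assms] by auto
    from measurable_sets[OF this, of "{i}"] show "{X \<in> space ?M. aff_dim (X ` I) = i} \<in> sets ?M"
      by (simp add: vimage_def Int_def conj_commute)
  qed
  moreover have "(\<Sum>I\<in>Pow N. indicator ({X \<in> space ?M. face_idx X N I} \<inter> {X \<in> space ?M. aff_dim (X ` I) = i}) X)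
     = real (f_count i (convex hull (X ` N)))" if "X \<in> space ?M" for X
  proof -
    have "(\<Sum>I\<in>Pow N. indicator ({X \<in> space ?M. face_idx X N I} \<inter> {X \<in> space ?M. aff_dim (X ` I) = i}) X :: real)
      = (\<Sum>I\<in>Pow N. if face_idx X N I \<and> aff_dim (X ` I) = i then 1 else 0)"
      using that by (intro sum.cong) (auto simp: indicator_def)
    also have "\<dots> = real (card {I \<in> Pow N. face_idx X N I \<and> aff_dim (X ` I) = i})"
      using assms by (simp add: sum.If_cases Int_def)
    also have "{I \<in> Pow N. face_idx X N I \<and> aff_dim (X ` I) = i} = {I. face_idx X N I \<and> aff_dim (X ` I) = i}"
      by (auto simp: face_idx_def)
    finally show ?thesis using f_count_eq_card_face_idx[OF assms, of i X] by simp
  qed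
  ultimately show ?thesis by (subst (asm) measurable_cong) auto
qed

section \<open>Points in general position\<close>

text \<open>Singletons \<open>I\<close> make the points distinct. The bound on \<open>card I\<close>
  reflects that up to \<open>DIM('a)\<close> points span an affine set of measure zero, while more
  points may span the whole space.\<close>

definition general_position :: "(nat \<Rightarrow> 'a::euclidean_space) \<Rightarrow> nat set \<Rightarrow> bool" where
  "general_position X N \<longleftrightarrow> (\<forall>I\<subseteq>N. \<forall>j\<in>N - I. card I \<le> DIM('a) \<longrightarrow> X j \<notin> affine hull (X ` I))"

lemma general_position_aff_dim:
  fixes X :: "nat \<Rightarrow> 'a::euclidean_space"
  assumes gp: "general_position X N" and N: "finite N" "I \<subseteq> N" and c: "card I \<le> DIM('a) + 1"
  shows "aff_dim (X ` I) = int (card I) - 1"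
proof -
  have "finite I" using N finite_subset by auto
  from this N(2) c show ?thesis
  proof (induction I)
    case (insert j I)
    then have "X j \<notin> affine hull (X ` I)" using gp by (auto simp: general_position_def)
    then show ?case using insert by (simp add: aff_dim_insert)
  qed simp
qed

text \<open>The case beyond the reach of \<open>general_position_aff_dim\<close> is a large
  \<open>I\<close>: it contains \<open>DIM('a) + 1\<close> points that already span the whole space,
  so its dimension exceeds \<open>k - 1\<close>.\<close>

lemma general_position_aff_dim_eq_iff:
  fixes X :: "nat \<Rightarrow> 'a::euclidean_space"
  assumes gp: "general_position X N" and N: "finite N" "I \<subseteq> N" and k: "k < DIM('a) + 1"
  shows "aff_dim (X ` I) = int k - 1 \<longleftrightarrow> card I = k"
proof (cases "card I \<le> DIM('a) + 1")
  case True
  then show ?thesis using general_position_aff_dim[OF gp N True] by auto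
next
  case False
  then obtain J where J: "J \<subseteq> I" "card J = DIM('a) + 1" by (metis nat_le_linear obtain_subset_with_card_n)
  then have "aff_dim (X ` J) = int (DIM('a))" using general_position_aff_dim[OF gp N(1), of J] N by auto
  moreover have "aff_dim (X ` J) \<le> aff_dim (X ` I)" using J by (intro aff_dim_subset) auto
  ultimately show ?thesis using k False by auto
qed

text \<open>A hyperplane strictly separates the two hulls, and a linear functional bounded below on
  an affine set is constant there. When no index is left outside \<open>I\<close>, the zero
  functional serves.\<close>

lemma face_idx_functional:
  fixes X :: "nat \<Rightarrow> 'a::euclidean_space"
  assumes N: "finite N" and f: "face_idx X N I" "I \<noteq> {}"
  obtains a b where "\<And>i. i \<in> I \<Longrightarrow> a \<bullet> X i = b" "\<And>j. j \<in> N - I \<Longrightarrow> a \<bullet> X j < b"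
proof (cases "N - I = {}")
  case True
  show ?thesis by (rule that[of 0 0]) (use True in auto)
next
  case False
  have I: "I \<subseteq> N" and d: "affine hull (X ` I) \<inter> convex hull (X ` (N - I)) = {}" using f by (auto simp: face_idx_def)
  have "compact (convex hull (X ` (N - I)))" using N by (intro finite_imp_compact_convex_hull) auto
  then obtain a b where ab: "\<forall>x\<in>convex hull (X ` (N - I)). a \<bullet> x < b" "\<forall>x\<in>affine hull (X ` I). b < a \<bullet> x"
    using separating_hyperplane_compact_closed[OF convex_convex_hull _ _ affine_imp_convex[OF affine_affine_hull] closed_affine_hull, of "X ` (N - I)" "X ` I"]
      d False by (auto simp: Int_commute)
  obtain i0 where i0: "i0 \<in> I" using f by blast
  have const: "a \<bullet> X i = a \<bullet> X i0" if "i \<in> I" for i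
  proof (rule ccontr)
    assume ne: "a \<bullet> X i \<noteq> a \<bullet> X i0"
    define t where "t = (b - a \<bullet> X i0) / (a \<bullet> X i - a \<bullet> X i0)"
    have "X i0 + t *\<^sub>R (X i - X i0) = (1 - t) *\<^sub>R X i0 + t *\<^sub>R X i" by (simp add: algebra_simps)
    also have "\<dots> \<in> affine hull (X ` I)"
      using that i0 by (intro mem_affine[OF affine_affine_hull]) (auto intro: hull_inc)
    finally have "b < a \<bullet> (X i0 + t *\<^sub>R (X i - X i0))" using ab by blast
    also have "\<dots> = a \<bullet> X i0 + t * (a \<bullet> X i - a \<bullet> X i0)" by (simp add: inner_add_right inner_diff_right)
    also have "\<dots> = b" using ne by (simp add: t_def)
    finally show False by simp
  qed
  show ?thesis
  proof (rule that[of a "a \<bullet> X i0"])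
    fix j assume "j \<in> N - I"
    then have "a \<bullet> X j < b" using ab(1) by (auto intro: hull_inc)
    moreover have "b < a \<bullet> X i0" using ab(2) i0 by (auto intro: hull_inc)
    ultimately show "a \<bullet> X j < a \<bullet> X i0" by simp
  qed (rule const)
qed

lemma functional_face_idx:
  fixes X :: "nat \<Rightarrow> 'a::euclidean_space"
  assumes "I \<subseteq> N" "\<And>i. i \<in> I \<Longrightarrow> a \<bullet> X i = b" "\<And>j. j \<in> N - I \<Longrightarrow> a \<bullet> X j < b"
  shows "face_idx X N I"
proof -
  have "affine hull (X ` I) \<subseteq> {x. a \<bullet> x = b}"
    using assms by (intro hull_minimal) (auto simp: affine_hyperplane)
  moreover have "convex hull (X ` (N - I)) \<subseteq> {x. a \<bullet> x < b}"
    using assms by (intro hull_minimal) (auto simp: convex_halfspace_lt)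
  ultimately show ?thesis using assms(1) by (auto simp: face_idx_def)
qed

text \<open>If points lay on both sides, the segment between two of them would meet the hyperplane,
  which is the affine hull of the chosen points.\<close>

lemma face_idx_iff_one_sided:
  fixes X :: "nat \<Rightarrow> 'a::euclidean_space"
  assumes I: "I \<subseteq> N" and h: "affine hull (X ` I) = {x. a \<bullet> x = b}"
  shows "face_idx X N I \<longleftrightarrow> (\<forall>j\<in>N - I. a \<bullet> X j < b) \<or> (\<forall>j\<in>N - I. a \<bullet> X j > b)"
proof
  have aI: "a \<bullet> X i = b" if "i \<in> I" for i using h that hull_inc[of "X i" "X ` I" affine] by auto
  {
    assume f: "face_idx X N I"
    show "(\<forall>j\<in>N - I. a \<bullet> X j < b) \<or> (\<forall>j\<in>N - I. a \<bullet> X j > b)"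
    proof (rule ccontr)
      assume "\<not> ?thesis"
      then obtain j k where jk: "j \<in> N - I" "a \<bullet> X j \<ge> b" "k \<in> N - I" "a \<bullet> X k \<le> b" by (auto simp: not_less)
      define p where "p = a \<bullet> X j - b"
      define q where "q = b - a \<bullet> X k"
      \<comment> \<open>If both points already lie on the hyperplane, any parameter works; the case
        distinction avoids dividing by 0.\<close>
      define t where "t = (if p + q = 0 then 0 else p / (p + q))"
      have pq: "p \<ge> 0" "q \<ge> 0" using jk by (auto simp: p_def q_def)
      have t: "0 \<le> t" "t \<le> 1" using pq by (auto simp: t_def divide_le_eq)
      have "(1 - t) *\<^sub>R X j + t *\<^sub>R X k \<in> convex hull (X ` (N - I))"
        using t jk by (intro convexD[OF convex_convex_hull]) (auto intro: hull_inc)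
      moreover have "a \<bullet> ((1 - t) *\<^sub>R X j + t *\<^sub>R X k) = b"
      proof -
        have "a \<bullet> ((1 - t) *\<^sub>R X j + t *\<^sub>R X k) = b + (p - t * (p + q))"
          by (simp add: inner_add_right p_def q_def algebra_simps)
        moreover have "t * (p + q) = p" using pq by (auto simp: t_def)
        ultimately show ?thesis by simp
      qed
      ultimately show False using f h by (auto simp: face_idx_def)
    qed
  }
  assume "(\<forall>j\<in>N - I. a \<bullet> X j < b) \<or> (\<forall>j\<in>N - I. a \<bullet> X j > b)"
  then show "face_idx X N I"
    using functional_face_idx[of I N a X b] functional_face_idx[of I N "- a" X "- b"] I aI by auto
qed

lemma general_position_facet_hyperplane:
  fixes X :: "nat \<Rightarrow> 'a::euclidean_space"
  assumes gp: "general_position X N" and N: "finite N" and I: "I \<subseteq> N" "card I = DIM('a)"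
    and a: "a \<noteq> 0" "\<And>i. i \<in> I \<Longrightarrow> a \<bullet> X i = b"
  shows "affine hull (X ` I) = {x. a \<bullet> x = b}"
proof -
  have "affine hull (X ` I) \<subseteq> {x. a \<bullet> x = b}"
    using a by (intro hull_minimal) (auto simp: affine_hyperplane)
  moreover have "aff_dim (X ` I) = int (DIM('a)) - 1" using general_position_aff_dim[OF gp N I(1)] I(2) by simp
  ultimately have "affine hull (affine hull (X ` I)) = affine hull {x. a \<bullet> x = b}"
    using a(1) by (intro aff_dim_eq_full_gen[THEN iffD1] ) (auto simp: aff_dim_hyperplane)
  then show ?thesis by (simp add: affine_hyperplane affine_hull_eq hull_same)
qed

text \<open>Rotating a supporting hyperplane about a ridge \<open>R\<close>: the slope \<open>\<rho> j\<close> of the hyperplane through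
  \<open>R\<close> and \<open>X j\<close> is injective in \<open>j\<close>, and exactly its two extreme values give facets.\<close>

lemma ridge_in_two_facets:
  fixes X :: "nat \<Rightarrow> 'a::euclidean_space"
  assumes gp: "general_position X N" and N: "finite N" "card N \<ge> DIM('a) + 1" and d: "DIM('a) \<ge> 2"
    and R: "face_idx X N R" "card R = DIM('a) - 1"
  shows "card {I. face_idx X N I \<and> card I = DIM('a) \<and> R \<subseteq> I} = 2"
proof -
  have RN: "R \<subseteq> N" using R(1) by (simp add: face_idx_def)
  have finR: "finite R" using RN N finite_subset by auto
  have Rne: "R \<noteq> {}" using R(2) d by auto
  then obtain r where r: "r \<in> R" by blast
  obtain a b where ab: "\<And>i. i \<in> R \<Longrightarrow> a \<bullet> X i = b" "\<And>j. j \<in> N - R \<Longrightarrow> a \<bullet> X j < b"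
    using face_idx_functional[OF N(1) R(1) Rne] by blast
  \<comment> \<open>\<open>h\<close> has to be orthogonal to the functional \<open>a\<close> that
    exposes the ridge and to the directions of the ridge; together these are at most
    \<open>DIM('a) - 1\<close> vectors, so a nonzero \<open>h\<close> exists.\<close>
  define T where "T = insert a ((\<lambda>i. X i - X r) ` (R - {r}))"
  have "dim T \<le> card T" by (rule dim_le_card[OF span_superset]) (use finR in \<open>auto simp: T_def\<close>)
  also have "card T \<le> Suc (card ((\<lambda>i. X i - X r) ` (R - {r})))" unfolding T_def by (rule card_insert_le_m1) auto
  also have "card ((\<lambda>i. X i - X r) ` (R - {r})) \<le> card (R - {r})" using finR by (intro card_image_le) auto
  also have "card (R - {r}) = DIM('a) - 2" using R(2) r finR by simp
  finally have "dim T < DIM('a)" using d by simp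
  then obtain h where h: "h \<noteq> 0" "\<And>y. y \<in> span T \<Longrightarrow> orthogonal h y"
    using orthogonal_to_subspace_exists by metis
  have ha: "h \<bullet> a = 0" using h(2)[of a] by (auto simp: orthogonal_def T_def intro: span_base)
  have hR: "h \<bullet> X i = h \<bullet> X r" if "i \<in> R" for i
    using h(2)[of "X i - X r"] that by (cases "i = r") (auto simp: orthogonal_def T_def inner_diff_right intro: span_base)
  \<comment> \<open>The hyperplanes of the pencil about the ridge have normals
    \<open>h + \<rho> j *\<^sub>R a\<close>. For points off the ridge the denominator is positive
    because \<open>a\<close> exposes the ridge.\<close>
  define \<rho> where "\<rho> j = (h \<bullet> X j - h \<bullet> X r) / (b - a \<bullet> X j)" for j
  define n where "n j = h + \<rho> j *\<^sub>R a" for j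
  have n0: "n j \<noteq> 0" for j
  proof
    assume "n j = 0"
    then have "h \<bullet> n j = 0" by simp
    then show False using h(1) ha by (simp add: n_def inner_add_right)
  qed
  define c where "c j = n j \<bullet> X r" for j
  have nR: "n j \<bullet> X i = c j" if "i \<in> R" for i j
    using hR[OF that] ab(1)[OF that] ab(1)[OF r] by (simp add: n_def c_def inner_add_left)
  have nk: "n j \<bullet> X k - c j = (\<rho> k - \<rho> j) * (b - a \<bullet> X k)" if "k \<in> N - R" for j k
  proof -
    have "h \<bullet> X k - h \<bullet> X r = \<rho> k * (b - a \<bullet> X k)" using ab(2)[OF that] by (simp add: \<rho>_def)
    moreover have "n j \<bullet> X k - c j = (h \<bullet> X k - h \<bullet> X r) - \<rho> j * (b - a \<bullet> X k)"
      using ab(1)[OF r] by (simp add: n_def c_def inner_add_left algebra_simps)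
    ultimately show ?thesis by (simp add: left_diff_distrib)
  qed
  have nj: "n j \<bullet> X j = c j" if "j \<in> N - R" for j using nk[OF that, of j] by simp
  have card_ins: "card (insert j R) = DIM('a)" if "j \<in> N - R" for j using that finR R(2) d by simp
  have hyp: "affine hull (X ` insert j R) = {x. n j \<bullet> x = c j}" if "j \<in> N - R" for j
    by (rule general_position_facet_hyperplane[OF gp N(1) _ card_ins[OF that] n0]) (use that RN nR nj in auto)
  have inj: "\<rho> k \<noteq> \<rho> j" if "j \<in> N - R" "k \<in> N - R" "k \<noteq> j" for j k
  proof
    assume "\<rho> k = \<rho> j"
    then have "X k \<in> affine hull (X ` insert j R)" using hyp[OF that(1)] nk[OF that(2), of j] by simp
    then show False using gp that RN card_ins[OF that(1)] unfolding general_position_def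
      by (metis Diff_iff insert_iff insert_subset order_refl)
  qed
  have face: "face_idx X N (insert j R) \<longleftrightarrow> (\<forall>k\<in>N - R. \<rho> k \<le> \<rho> j) \<or> (\<forall>k\<in>N - R. \<rho> k \<ge> \<rho> j)" if j: "j \<in> N - R" for j
  proof -
    have "(n j \<bullet> X k < c j \<longleftrightarrow> \<rho> k < \<rho> j) \<and> (n j \<bullet> X k > c j \<longleftrightarrow> \<rho> k > \<rho> j)" if "k \<in> N - R" for k
    proof -
      have "n j \<bullet> X k - c j < 0 \<longleftrightarrow> \<rho> k - \<rho> j < 0" "0 < n j \<bullet> X k - c j \<longleftrightarrow> 0 < \<rho> k - \<rho> j"
        using ab(2)[OF that] unfolding nk[OF that] by (auto simp: mult_less_0_iff zero_less_mult_iff)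
      then show ?thesis by auto
    qed
    moreover have "face_idx X N (insert j R) \<longleftrightarrow>
        (\<forall>k\<in>N - insert j R. n j \<bullet> X k < c j) \<or> (\<forall>k\<in>N - insert j R. n j \<bullet> X k > c j)"
      by (rule face_idx_iff_one_sided[OF _ hyp[OF j]]) (use j RN in auto)
    moreover have "N - insert j R = (N - R) - {j}" by auto
    moreover have "(\<forall>k\<in>N - insert j R. \<rho> k < \<rho> j) \<longleftrightarrow> (\<forall>k\<in>N - R. \<rho> k \<le> \<rho> j)"
    proof (intro iffI ballI)
      fix k assume "\<forall>k\<in>N - insert j R. \<rho> k < \<rho> j" "k \<in> N - R"
      then show "\<rho> k \<le> \<rho> j" by (cases "k = j") (auto intro: less_imp_le)
    next
      fix k assume *: "\<forall>k\<in>N - R. \<rho> k \<le> \<rho> j" "k \<in> N - insert j R"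
      then have "\<rho> k \<le> \<rho> j" "\<rho> k \<noteq> \<rho> j" using inj[OF j, of k] by auto
      then show "\<rho> k < \<rho> j" by simp
    qed
    moreover have "(\<forall>k\<in>N - insert j R. \<rho> k > \<rho> j) \<longleftrightarrow> (\<forall>k\<in>N - R. \<rho> k \<ge> \<rho> j)"
    proof (intro iffI ballI)
      fix k assume "\<forall>k\<in>N - insert j R. \<rho> k > \<rho> j" "k \<in> N - R"
      then show "\<rho> k \<ge> \<rho> j" by (cases "k = j") (auto intro: less_imp_le)
    next
      fix k assume *: "\<forall>k\<in>N - R. \<rho> k \<ge> \<rho> j" "k \<in> N - insert j R"
      then have "\<rho> k \<ge> \<rho> j" "\<rho> k \<noteq> \<rho> j" using inj[OF j, of k] by auto
      then show "\<rho> k > \<rho> j" by simp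
    qed
    moreover have "N - insert j R \<subseteq> N - R" by auto
    ultimately show ?thesis by (simp add: subset_iff)
  qed
  have fin: "finite (\<rho> ` (N - R))" using N by auto
  have "card (N - R) = card N - card R" using finR RN by (simp add: card_Diff_subset)
  then have c2: "card (N - R) \<ge> 2" using N(2) R(2) d by simp
  have "N - R \<noteq> {}"
  proof
    assume "N - R = {}"
    then have "card (N - R) = 0" by (simp only: card.empty)
    then show False using c2 by linarith
  qed
  then have ne: "\<rho> ` (N - R) \<noteq> {}" by (simp only: image_is_empty) simp
  obtain j1 where j1: "j1 \<in> N - R" "\<rho> j1 = Max (\<rho> ` (N - R))" using Max_in[OF fin ne] by auto
  obtain j2 where j2: "j2 \<in> N - R" "\<rho> j2 = Min (\<rho> ` (N - R))" using Min_in[OF fin ne] by auto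
  have max: "\<rho> k \<le> \<rho> j1" if "k \<in> N - R" for k using j1 that fin by auto
  have min: "\<rho> j2 \<le> \<rho> k" if "k \<in> N - R" for k using j2 that fin by auto
  have "j1 \<noteq> j2"
  proof
    assume "j1 = j2"
    then have "k = j1" if "k \<in> N - R" for k using max[OF that] min[OF that] inj[OF j1(1) that] by fastforce
    then have "N - R \<subseteq> {j1}" by auto
    then show False using c2 card_mono[of "{j1}" "N - R"] by simp
  qed
  have "{I. face_idx X N I \<and> card I = DIM('a) \<and> R \<subseteq> I} = {insert j1 R, insert j2 R}"
  proof (intro equalityI subsetI)
    fix I assume "I \<in> {I. face_idx X N I \<and> card I = DIM('a) \<and> R \<subseteq> I}"
    then have I: "face_idx X N I" "card I = DIM('a)" "R \<subseteq> I" by auto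
    then have IN: "I \<subseteq> N" by (simp add: face_idx_def)
    have "card (I - R) = 1" using I R(2) d finR by (simp add: card_Diff_subset)
    then obtain j where "I - R = {j}" by (rule card_1_singletonE)
    then have Ij: "I = insert j R" "j \<in> N - R" using I IN by auto
    have "j = j1 \<or> j = j2"
    proof (rule ccontr)
      assume "\<not> ?thesis"
      then have "\<rho> j < \<rho> j1" "\<rho> j2 < \<rho> j"
        using inj[OF j1(1) Ij(2)] inj[OF j2(1) Ij(2)] max[OF Ij(2)] min[OF Ij(2)] by auto
      then show False using face[OF Ij(2)] I(1) Ij(1) j1(1) j2(1) by force
    qed
    then show "I \<in> {insert j1 R, insert j2 R}" using Ij by auto
  next
    fix I assume "I \<in> {insert j1 R, insert j2 R}"
    then show "I \<in> {I. face_idx X N I \<and> card I = DIM('a) \<and> R \<subseteq> I}"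
      using face[OF j1(1)] face[OF j2(1)] max min card_ins[OF j1(1)] card_ins[OF j2(1)] by auto
  qed
  moreover have "insert j1 R \<noteq> insert j2 R" using \<open>j1 \<noteq> j2\<close> j1(1) j2(1) by blast
  ultimately show ?thesis by simp
qed

text \<open>In general position a facet is a simplex, so every choice of all but one of its vertices
  spans a face of it, and a face of a face is a face of the whole polytope.\<close>

lemma facet_ridges:
  fixes X :: "nat \<Rightarrow> 'a::euclidean_space"
  assumes gp: "general_position X N" and N: "finite N"
    and I: "face_idx X N I" "card I = DIM('a)"
  shows "card {R. face_idx X N R \<and> card R = DIM('a) - 1 \<and> R \<subseteq> I} = DIM('a)"
proof -
  have IN: "I \<subseteq> N" using I by (simp add: face_idx_def)
  have finI: "finite I" using IN N finite_subset by auto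
  have "face_idx X N R" if R: "R \<subseteq> I" "card R = DIM('a) - 1" for R
  proof -
    have "card (I - R) = 1" using I(2) R finI by (simp add: card_Diff_subset finite_subset)
    then obtain j where j: "I - R = {j}" by (rule card_1_singletonE)
    have Xj: "X j \<notin> affine hull (X ` R)"
      using gp j R IN unfolding general_position_def by (metis DiffD1 DiffD2 DiffI diff_le_self insertI1 order_trans subsetD)
    have "face_idx X I R" unfolding face_idx_def using Xj R(1) by (simp add: j)
    then have "convex hull (X ` R) face_of convex hull (X ` I)" and R2: "R = {j \<in> I. X j \<in> convex hull (X ` R)}"
      by (rule face_idx_face[OF finI])+
    then have f: "convex hull (X ` R) face_of convex hull (X ` N)"
      using face_idx_face(1)[OF N I(1)] face_of_trans by blast
    have "convex hull (X ` R) \<subseteq> convex hull (X ` I)" using R(1) by (intro hull_mono) auto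
    then have "{j \<in> N. X j \<in> convex hull (X ` R)} = R"
      using face_idx_face(2)[OF N I(1)] R2 IN by blast
    then show ?thesis using face_face_idx(1)[OF N f] by simp
  qed
  then have "{R. face_idx X N R \<and> card R = DIM('a) - 1 \<and> R \<subseteq> I} = {R. R \<subseteq> I \<and> card R = DIM('a) - 1}" by blast
  moreover have "DIM('a) choose (DIM('a) - 1) = DIM('a)"
    using binomial_symmetric[of 1 "DIM('a)"] DIM_positive[where 'a='a] by (simp add: Suc_le_eq)
  ultimately show ?thesis using n_subsets[OF finI, of "DIM('a) - 1"] I(2) by simp
qed

text \<open>Double counting of incident pairs: two facets at each ridge, \<open>DIM('a)\<close>
  ridges on each facet.\<close>

lemma ridges_facets_count:
  fixes X :: "nat \<Rightarrow> 'a::euclidean_space"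
  assumes gp: "general_position X N" and N: "finite N" "card N \<ge> DIM('a) + 1" and d: "DIM('a) \<ge> 2"
  shows "2 * card {R. face_idx X N R \<and> card R = DIM('a) - 1} = DIM('a) * card {I. face_idx X N I \<and> card I = DIM('a)}"
proof -
  let ?\<R> = "{R. face_idx X N R \<and> card R = DIM('a) - 1}"
  let ?\<F> = "{I. face_idx X N I \<and> card I = DIM('a)}"
  have "?\<R> \<subseteq> Pow N" "?\<F> \<subseteq> Pow N" by (auto simp: face_idx_def)
  then have fin: "finite ?\<R>" "finite ?\<F>" using N finite_subset finite_Pow_iff by metis+
  have "(\<Sum>R\<in>?\<R>. card {I\<in>?\<F>. R \<subseteq> I}) = (\<Sum>I\<in>?\<F>. DIM('a))"
  proof (rule sum_multicount_gen[OF fin], safe)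
    fix I assume I: "face_idx X N I" "card I = DIM('a)"
    show "card {R\<in>?\<R>. R \<subseteq> I} = DIM('a)" using facet_ridges[OF gp N(1) I] by (simp add: conj_assoc)
  qed
  moreover have "(\<Sum>R\<in>?\<R>. card {I\<in>?\<F>. R \<subseteq> I}) = (\<Sum>R\<in>?\<R>. 2)"
    using ridge_in_two_facets[OF gp N d] by (intro sum.cong) (auto simp: conj_assoc)
  ultimately show ?thesis by (simp add: mult.commute)
qed

theorem general_position_f_count:
  fixes X :: "nat \<Rightarrow> real^'n"
  assumes gp: "general_position X N" and N: "finite N" "card N \<ge> CARD('n) + 1" and d: "CARD('n) \<ge> 2"
  shows "f_count (int CARD('n) - 1) (convex hull (X ` N)) = card {I. face_idx X N I \<and> card I = CARD('n)}"
    and "2 * f_count (int CARD('n) - 2) (convex hull (X ` N)) = CARD('n) * card {I. face_idx X N I \<and> card I = CARD('n)}"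
proof -
  have 1: "face_idx X N I \<and> aff_dim (X ` I) = int CARD('n) - 1 \<longleftrightarrow> face_idx X N I \<and> card I = CARD('n)" for I
    using general_position_aff_dim_eq_iff[OF gp N(1), of I "CARD('n)"] by (auto simp: face_idx_def)
  have 2: "face_idx X N I \<and> aff_dim (X ` I) = int CARD('n) - 2 \<longleftrightarrow> face_idx X N I \<and> card I = CARD('n) - 1" for I
    using general_position_aff_dim_eq_iff[OF gp N(1), of I "CARD('n) - 1"] d by (auto simp: face_idx_def of_nat_diff)
  show "f_count (int CARD('n) - 1) (convex hull (X ` N)) = card {I. face_idx X N I \<and> card I = CARD('n)}"
    unfolding f_count_eq_card_face_idx[OF N(1)] 1 ..
  show "2 * f_count (int CARD('n) - 2) (convex hull (X ` N)) = CARD('n) * card {I. face_idx X N I \<and> card I = CARD('n)}"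
    unfolding f_count_eq_card_face_idx[OF N(1)] 2 using ridges_facets_count[OF gp N(1)] N d by simp
qed

section \<open>Changes of variables for Lebesgue measure\<close>

text \<open>Preimages of boxes are boxes with permuted sides, so the product of the side lengths is
  the same.\<close>

lemma lborel_distr_coordinate_bij:
  fixes T :: "'a::euclidean_space \<Rightarrow> 'b::euclidean_space"
  assumes T: "T \<in> borel_measurable borel" and \<sigma>: "bij_betw \<sigma> Basis Basis"
    and Tb: "\<And>x b. b \<in> Basis \<Longrightarrow> T x \<bullet> b = x \<bullet> \<sigma> b"
  shows "distr lborel borel T = lborel"
proof (rule lborel_eqI[symmetric])
  fix l u :: 'b
  assume lu: "\<And>b. b \<in> Basis \<Longrightarrow> l \<bullet> b \<le> u \<bullet> b"
  define \<tau> where "\<tau> = the_inv_into Basis \<sigma>"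
  have \<tau>: "\<tau> (\<sigma> b) = b" if "b \<in> Basis" for b
    unfolding \<tau>_def using \<sigma> that by (auto simp: bij_betw_def intro: the_inv_into_f_f)
  have \<sigma>B: "\<sigma> b \<in> Basis" if "b \<in> Basis" for b using \<sigma> that by (auto simp: bij_betw_def)
  have \<tau>B: "\<tau> c \<in> Basis" "\<sigma> (\<tau> c) = c" if "c \<in> Basis" for c
  proof -
    have "c \<in> \<sigma> ` Basis" using \<sigma> that by (simp add: bij_betw_def)
    then obtain b where "b \<in> Basis" "c = \<sigma> b" by blast
    then show "\<tau> c \<in> Basis" "\<sigma> (\<tau> c) = c" using \<tau> by auto
  qed
  define pull where "pull v = (\<Sum>c\<in>Basis. (v \<bullet> \<tau> c) *\<^sub>R c)" for v :: 'b
  have pull: "pull v \<bullet> c = v \<bullet> \<tau> c" if "c \<in> Basis" for v c using that by (simp add: pull_def)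
  have "T -` box l u = box (pull l) (pull u)"
  proof (intro set_eqI iffI)
    fix x assume x: "x \<in> T -` box l u"
    show "x \<in> box (pull l) (pull u)"
    proof (rule mem_box(1)[THEN iffD2], rule ballI)
      fix c :: 'a assume c: "c \<in> Basis"
      show "pull l \<bullet> c < x \<bullet> c \<and> x \<bullet> c < pull u \<bullet> c"
      proof -
        have "l \<bullet> \<tau> c < T x \<bullet> \<tau> c \<and> T x \<bullet> \<tau> c < u \<bullet> \<tau> c" using x \<tau>B(1)[OF c] by (simp add: mem_box)
        then show ?thesis using Tb[OF \<tau>B(1)[OF c], of x] \<tau>B(2)[OF c] c by (simp add: pull)
      qed
    qed
  next
    fix x assume x: "x \<in> box (pull l) (pull u)"
    then have "pull l \<bullet> \<sigma> b < x \<bullet> \<sigma> b \<and> x \<bullet> \<sigma> b < pull u \<bullet> \<sigma> b" if "b \<in> Basis" for b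
      using \<sigma>B[OF that] by (simp add: mem_box)
    then show "x \<in> T -` box l u" using \<tau> \<sigma>B Tb by (auto simp: mem_box pull)
  qed
  then have "emeasure (distr lborel borel T) (box l u) = emeasure lborel (box (pull l) (pull u))"
    using T by (subst emeasure_distr) auto
  also have "\<dots> = (\<Prod>c\<in>Basis. (pull u - pull l) \<bullet> c)"
    using lu \<tau>B by (intro emeasure_lborel_box) (auto simp: pull)
  also have "(\<Prod>c\<in>Basis. (pull u - pull l) \<bullet> c) = (\<Prod>c\<in>Basis. (u - l) \<bullet> \<tau> c)"
    by (intro prod.cong) (auto simp: pull inner_diff_left)
  also have "\<dots> = (\<Prod>b\<in>Basis. (u - l) \<bullet> b)"
    using prod.reindex_bij_betw[OF \<sigma>, of "\<lambda>c. (u - l) \<bullet> \<tau> c"] \<tau> by simp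
  finally show "emeasure (distr lborel borel T) (box l u) = (\<Prod>b\<in>Basis. (u - l) \<bullet> b)" .
qed simp

text \<open>A hyperplane has one dimension less than the ambient type. Its points are described in
  \<open>real^'n\<close> all the same, with slot \<open>k0\<close> free to be overwritten by a
  height or left idle; \<open>set_comp\<close> does for a vector what \<open>set_col\<close> does
  for the rows of a matrix.\<close>

definition set_col :: "'n \<Rightarrow> real^'n^'m \<Rightarrow> real^'m \<Rightarrow> real^'n^'m" where
  "set_col k0 Y z = (\<chi> i k. if k = k0 then z $ i else Y $ i $ k)"

definition set_comp :: "'n \<Rightarrow> real^'n \<Rightarrow> real \<Rightarrow> real^'n" where
  "set_comp k0 y b = (\<chi> k. if k = k0 then b else y $ k)"

lemma continuous_on_set_col [continuous_intros]:
  assumes "continuous_on S f" "continuous_on S g"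
  shows "continuous_on S (\<lambda>x. set_col k0 (f x) (g x))"
  unfolding set_col_def
proof (intro continuous_on_vec_lambda)
  show "continuous_on S (\<lambda>x. if k = k0 then g x $ i else f x $ i $ k)" for i k
    using assms by (cases "k = k0") (auto intro!: continuous_intros)
qed

lemma continuous_on_set_comp [continuous_intros]:
  assumes "continuous_on S f" "continuous_on S g"
  shows "continuous_on S (\<lambda>x. set_comp k0 (f x) (g x))"
  unfolding set_comp_def
proof (intro continuous_on_vec_lambda)
  show "continuous_on S (\<lambda>x. if k = k0 then g x else f x $ k)" for k
    using assms by (cases "k = k0") (auto intro!: continuous_intros)
qed

lemma lborel_swap_col:
  fixes k0 :: "'n::finite"
  shows "distr (lborel :: ((real^'n^'m) \<times> (real^'m)) measure) borel (\<lambda>(Y, z). (set_col k0 Y z, \<chi> i. Y $ i $ k0)) = lborel"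
proof -
  let ?B1 = "\<lambda>i k. axis i (axis k 1) :: real^'n^'m"
  let ?B2 = "\<lambda>i. axis i 1 :: real^'m"
  \<comment> \<open>On basis vectors \<sigma> exchanges column \<open>k0\<close> of the matrix with
    the extra vector and fixes the rest, so it is its own inverse there.\<close>
  define \<sigma> where "\<sigma> b = (\<Sum>i\<in>UNIV. \<Sum>k\<in>UNIV. (fst b $ i $ k) *\<^sub>R (if k = k0 then (0, ?B2 i) else (?B1 i k, 0)))
      + (\<Sum>i\<in>UNIV. (snd b $ i) *\<^sub>R (?B1 i k0, 0))" for b
  define Z where "Z i k = (if k = k0 then (0, ?B2 i) else (?B1 i k, 0))" for i k
  have z0: "(0, 0) = (0 :: (real^'n^'m) \<times> (real^'m))" by (simp add: zero_prod_def)
  have \<sigma>_alt: "\<sigma> b = (\<Sum>i\<in>UNIV. \<Sum>k\<in>UNIV. (fst b $ i $ k) *\<^sub>R Z i k) + (\<Sum>i\<in>UNIV. (snd b $ i) *\<^sub>R (?B1 i k0, 0))" for b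
    by (simp only: \<sigma>_def Z_def)
  have \<sigma>1: "\<sigma> (?B1 i k, 0) = Z i k" for i k
  proof -
    have "(?B1 i k $ i' $ k') *\<^sub>R Z i' k' = (if k' = k then if i' = i then Z i' k' else 0 else 0)" for i' k'
      by (auto simp: axis_def)
    then have "(\<Sum>i'\<in>UNIV. \<Sum>k'\<in>UNIV. (?B1 i k $ i' $ k') *\<^sub>R Z i' k') = Z i k" by simp
    then show ?thesis by (simp add: \<sigma>_alt z0)
  qed
  have \<sigma>2: "\<sigma> (0, ?B2 i) = (?B1 i k0, 0)" for i
  proof -
    have "(?B2 i $ i') *\<^sub>R (?B1 i' k0, 0 :: real^'m) = (if i' = i then (?B1 i' k0, 0) else 0)" for i'
      by (auto simp: axis_def zero_prod_def)
    then have "(\<Sum>i'\<in>UNIV. (?B2 i $ i') *\<^sub>R (?B1 i' k0, 0 :: real^'m)) = (?B1 i k0, 0)" by simp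
    then show ?thesis by (simp only: \<sigma>_alt fst_conv snd_conv zero_index scaleR_zero_left sum.neutral_const add_0_left)
  qed
  have B: "b \<in> Basis \<longleftrightarrow> (\<exists>i k. b = (?B1 i k, 0)) \<or> (\<exists>i. b = (0, ?B2 i))" for b
    by (auto simp: Basis_prod_def Basis_vec_def)
  have inv: "\<sigma> b \<in> Basis \<and> \<sigma> (\<sigma> b) = b" if "b \<in> Basis" for b
    using that unfolding B by (elim disjE exE) (auto simp: \<sigma>1 \<sigma>2 Z_def)
  have bij: "bij_betw \<sigma> Basis Basis"
    by (rule bij_betw_byWitness[where f' = \<sigma>]) (use inv in auto)
  show ?thesis
  proof (rule lborel_distr_coordinate_bij[OF _ bij])
    show "(\<lambda>(Y, z). (set_col k0 Y z, \<chi> i. Y $ i $ k0)) \<in> borel_measurable borel"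
      unfolding case_prod_beta
      by (intro borel_measurable_continuous_onI continuous_intros continuous_on_vec_lambda)
    fix x :: "(real^'n^'m) \<times> (real^'m)" and b :: "(real^'n^'m) \<times> (real^'m)"
    assume "b \<in> Basis"
    then show "(case x of (Y, z) \<Rightarrow> (set_col k0 Y z, \<chi> i. Y $ i $ k0)) \<bullet> b = x \<bullet> \<sigma> b"
      unfolding B by (elim disjE exE)
        (auto simp: \<sigma>1 \<sigma>2 Z_def case_prod_beta inner_prod_def inner_axis set_col_def)
  qed
qed

lemma lborel_swap_comp:
  fixes k0 :: "'n::finite"
  shows "distr (lborel :: ((real^'n) \<times> real) measure) borel (\<lambda>(y, b). (set_comp k0 y b, y $ k0)) = lborel"
proof -
  let ?B = "\<lambda>k. axis k 1 :: real^'n"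
  define \<sigma> where "\<sigma> b = (\<Sum>k\<in>UNIV. (fst b $ k) *\<^sub>R (if k = k0 then (0, 1 :: real) else (?B k, 0)))
      + snd b *\<^sub>R (?B k0, 0)" for b :: "(real^'n) \<times> real"
  define Z where "Z k = (if k = k0 then (0, 1 :: real) else (?B k, 0))" for k
  have z0: "(0, 0) = (0 :: (real^'n) \<times> real)" by (simp add: zero_prod_def)
  have \<sigma>_alt: "\<sigma> b = (\<Sum>k\<in>UNIV. (fst b $ k) *\<^sub>R Z k) + snd b *\<^sub>R (?B k0, 0)" for b
    by (simp only: \<sigma>_def Z_def)
  have \<sigma>1: "\<sigma> (?B k, 0) = Z k" for k
  proof -
    have "(?B k $ k') *\<^sub>R Z k' = (if k' = k then Z k' else 0)" for k' by (auto simp: axis_def)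
    then have "(\<Sum>k'\<in>UNIV. (?B k $ k') *\<^sub>R Z k') = Z k" by simp
    then show ?thesis by (simp add: \<sigma>_alt z0)
  qed
  have \<sigma>2: "\<sigma> (0, 1) = (?B k0, 0)"
    by (simp only: \<sigma>_alt fst_conv snd_conv zero_index scaleR_zero_left sum.neutral_const add_0_left scaleR_one)
  have B: "b \<in> Basis \<longleftrightarrow> (\<exists>k. b = (?B k, 0)) \<or> b = (0, 1)" for b :: "(real^'n) \<times> real"
    by (auto simp: Basis_prod_def Basis_vec_def)
  have inv: "\<sigma> b \<in> Basis \<and> \<sigma> (\<sigma> b) = b" if "b \<in> Basis" for b
    using that unfolding B by (elim disjE exE) (auto simp: \<sigma>1 \<sigma>2 Z_def)
  have bij: "bij_betw \<sigma> Basis Basis"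
    by (rule bij_betw_byWitness[where f' = \<sigma>]) (use inv in auto)
  show ?thesis
  proof (rule lborel_distr_coordinate_bij[OF _ bij])
    show "(\<lambda>(y, b). (set_comp k0 y b, y $ k0)) \<in> borel_measurable borel"
      unfolding case_prod_beta
      by (intro borel_measurable_continuous_onI continuous_intros)
    fix x b :: "(real^'n) \<times> real"
    assume "b \<in> Basis"
    then show "(case x of (y, b) \<Rightarrow> (set_comp k0 y b, y $ k0)) \<bullet> b = x \<bullet> \<sigma> b"
      unfolding B by (elim disjE exE)
        (auto simp: \<sigma>1 \<sigma>2 Z_def case_prod_beta inner_prod_def inner_axis set_comp_def)
  qed
qed

text \<open>In the next two lemmas the integrated column (coordinate) \<open>k0\<close> of \<open>Y\<close> is replaced by a fresh variable;
  the idle one is confined to the unit cube so that it contributes a factor 1.\<close>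

lemma nn_integral_split_col:
  fixes G :: "real^'n^'m \<Rightarrow> ennreal" and k0 :: "'n::finite"
  assumes [measurable]: "G \<in> borel_measurable borel"
  shows "(\<integral>\<^sup>+X. G X \<partial>lborel) = (\<integral>\<^sup>+Y. indicator {Y. \<forall>i. Y $ i $ k0 \<in> {0..1}} Y * (\<integral>\<^sup>+z. G (set_col k0 Y z) \<partial>lborel) \<partial>lborel)"
proof -
  let ?Q = "cbox 0 1 :: (real^'m) set"
  have Q1: "emeasure lborel ?Q = 1"
  proof -
    have "1 \<bullet> b = 1" if "b \<in> Basis" for b :: "real^'m" using that by (auto simp: Basis_vec_def inner_axis)
    then show ?thesis by (subst emeasure_lborel_cbox) auto
  qed
  have Qm: "z \<in> ?Q \<longleftrightarrow> (\<forall>i. z $ i \<in> {0..1})" for z by (auto simp: mem_box_cart)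
  have [measurable]: "(\<lambda>(Y::real^'n^'m, z). set_col k0 Y z) \<in> borel_measurable (borel \<Otimes>\<^sub>M borel)"
    unfolding borel_prod case_prod_beta by (intro borel_measurable_continuous_onI continuous_intros)
  have [measurable]: "(\<lambda>Y::real^'n^'m. \<chi> i. Y $ i $ k0) \<in> borel_measurable borel"
    by (intro borel_measurable_continuous_onI continuous_intros continuous_on_vec_lambda)
  have "(\<integral>\<^sup>+X. G X \<partial>lborel) = (\<integral>\<^sup>+X. \<integral>\<^sup>+z. G X * indicator ?Q z \<partial>lborel \<partial>lborel)"
    by (simp add: nn_integral_cmult Q1)
  also have "\<dots> = (\<integral>\<^sup>+p. G (fst p) * indicator ?Q (snd p) \<partial>(lborel \<Otimes>\<^sub>M lborel))"
  proof -
    have "(\<lambda>p. G (fst p) * indicator ?Q (snd p)) \<in> borel_measurable (lborel \<Otimes>\<^sub>M lborel)" by measurable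
    from lborel.nn_integral_fst[OF this] show ?thesis by simp
  qed
  also have "\<dots> = (\<integral>\<^sup>+p. G (fst p) * indicator ?Q (snd p) \<partial>(distr lborel borel (\<lambda>(Y, z). (set_col k0 Y z, \<chi> i. Y $ i $ k0))))"
    by (simp add: lborel_swap_col lborel_prod)
  also have "\<dots> = (\<integral>\<^sup>+p. G (set_col k0 (fst p) (snd p)) * indicator ?Q (\<chi> i. fst p $ i $ k0) \<partial>(lborel \<Otimes>\<^sub>M lborel))"
    unfolding lborel_prod by (subst nn_integral_distr) (auto simp: case_prod_beta borel_prod[symmetric])
  also have "\<dots> = (\<integral>\<^sup>+Y. \<integral>\<^sup>+z. G (set_col k0 Y z) * indicator ?Q (\<chi> i. Y $ i $ k0) \<partial>lborel \<partial>lborel)"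
  proof -
    have "(\<lambda>p. G (set_col k0 (fst p) (snd p)) * indicator ?Q (\<chi> i. fst p $ i $ k0)) \<in> borel_measurable (lborel \<Otimes>\<^sub>M lborel)" by measurable
    from lborel.nn_integral_fst[OF this] show ?thesis by simp
  qed
  also have "\<dots> = (\<integral>\<^sup>+Y. indicator {Y. \<forall>i. Y $ i $ k0 \<in> {0..1}} Y * (\<integral>\<^sup>+z. G (set_col k0 Y z) \<partial>lborel) \<partial>lborel)"
    by (intro nn_integral_cong) (simp add: nn_integral_multc Qm indicator_def mult.commute)
  finally show ?thesis .
qed

lemma nn_integral_split_comp:
  fixes G :: "real^'n \<Rightarrow> ennreal" and k0 :: "'n::finite"
  assumes [measurable]: "G \<in> borel_measurable borel"
  shows "(\<integral>\<^sup>+x. G x \<partial>lborel) = (\<integral>\<^sup>+y. indicator {y. y $ k0 \<in> {0..1}} y * (\<integral>\<^sup>+b. G (set_comp k0 y b) \<partial>lborel) \<partial>lborel)"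
proof -
  let ?Q = "{0..1} :: real set"
  have [measurable]: "(\<lambda>(y::real^'n, b). set_comp k0 y b) \<in> borel_measurable (borel \<Otimes>\<^sub>M borel)"
    unfolding borel_prod case_prod_beta by (intro borel_measurable_continuous_onI continuous_intros)
  have [measurable]: "(\<lambda>y::real^'n. y $ k0) \<in> borel_measurable borel"
    by (intro borel_measurable_continuous_onI continuous_intros)
  have "(\<integral>\<^sup>+x. G x \<partial>lborel) = (\<integral>\<^sup>+x. \<integral>\<^sup>+b. G x * indicator ?Q b \<partial>lborel \<partial>lborel)"
    by (simp add: nn_integral_cmult)
  also have "\<dots> = (\<integral>\<^sup>+p. G (fst p) * indicator ?Q (snd p) \<partial>(lborel \<Otimes>\<^sub>M lborel))"
  proof -
    have "(\<lambda>p. G (fst p) * indicator ?Q (snd p)) \<in> borel_measurable (lborel \<Otimes>\<^sub>M lborel)" by measurable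
    from lborel.nn_integral_fst[OF this] show ?thesis by simp
  qed
  also have "\<dots> = (\<integral>\<^sup>+p. G (fst p) * indicator ?Q (snd p) \<partial>(distr lborel borel (\<lambda>(y, b). (set_comp k0 y b, y $ k0))))"
    by (simp add: lborel_swap_comp lborel_prod)
  also have "\<dots> = (\<integral>\<^sup>+p. G (set_comp k0 (fst p) (snd p)) * indicator ?Q (fst p $ k0) \<partial>(lborel \<Otimes>\<^sub>M lborel))"
    unfolding lborel_prod by (subst nn_integral_distr) (auto simp: case_prod_beta borel_prod[symmetric])
  also have "\<dots> = (\<integral>\<^sup>+y. \<integral>\<^sup>+b. G (set_comp k0 y b) * indicator ?Q (y $ k0) \<partial>lborel \<partial>lborel)"
  proof -
    have "(\<lambda>p. G (set_comp k0 (fst p) (snd p)) * indicator ?Q (fst p $ k0)) \<in> borel_measurable (lborel \<Otimes>\<^sub>M lborel)" by measurable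
    from lborel.nn_integral_fst[OF this] show ?thesis by simp
  qed
  also have "\<dots> = (\<integral>\<^sup>+y. indicator {y. y $ k0 \<in> {0..1}} y * (\<integral>\<^sup>+b. G (set_comp k0 y b) \<partial>lborel) \<partial>lborel)"
    by (intro nn_integral_cong) (simp add: nn_integral_multc indicator_def mult.commute)
  finally show ?thesis .
qed

lemma nn_integral_diag_affine:
  fixes c :: "'a::euclidean_space \<Rightarrow> real" and f :: "'a \<Rightarrow> ennreal"
  assumes c: "\<And>j. j \<in> Basis \<Longrightarrow> c j \<noteq> 0" and f: "f \<in> borel_measurable borel"
    and T: "\<And>x b. b \<in> Basis \<Longrightarrow> T x \<bullet> b = t \<bullet> b + c b * (x \<bullet> b)"
  shows "(\<integral>\<^sup>+x. f x \<partial>lborel) = (\<integral>\<^sup>+x. ennreal (\<Prod>j\<in>Basis. \<bar>c j\<bar>) * f (T x) \<partial>lborel)"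
proof -
  have T': "T = (\<lambda>x. t + (\<Sum>j\<in>Basis. (c j * (x \<bullet> j)) *\<^sub>R j))"
  proof (rule ext, rule euclidean_eqI)
    fix x b :: 'a assume b: "b \<in> Basis"
    show "T x \<bullet> b = (t + (\<Sum>j\<in>Basis. (c j * (x \<bullet> j)) *\<^sub>R j)) \<bullet> b"
      unfolding T[OF b] inner_add_left inner_sum_left_Basis[OF b] by simp
  qed
  have Tm: "T \<in> borel_measurable borel" unfolding T'
    by (intro borel_measurable_continuous_onI continuous_intros)
  have "(\<integral>\<^sup>+x. f x \<partial>lborel) = (\<integral>\<^sup>+x. f x \<partial>density (distr lborel borel T) (\<lambda>_. ennreal (\<Prod>j\<in>Basis. \<bar>c j\<bar>)))"
    by (subst lborel_affine_euclidean[of c t, OF c]) (auto simp: T')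
  also have "\<dots> = (\<integral>\<^sup>+x. ennreal (\<Prod>j\<in>Basis. \<bar>c j\<bar>) * f (T x) \<partial>lborel)"
    using f Tm by (simp add: nn_integral_density nn_integral_distr)
  finally show ?thesis .
qed

lemma Basis_vec_real: "(Basis :: (real^'n) set) = range (\<lambda>k. axis k 1)"
  by (auto simp: Basis_vec_def)

text \<open>The formula is multiplicative in \<open>A\<close>, so elementary matrices suffice. A
  zero row is vacuous, diagonal matrices rescale and transpositions relabel the coordinates, and for
  a shear the inner integral over the single coordinate \<open>m\<close> is translation
  invariant.\<close>

lemma nn_integral_linear_change:
  fixes A :: "real^'n^'n" and f :: "real^'n \<Rightarrow> ennreal"
  assumes "det A \<noteq> 0" and "f \<in> borel_measurable borel"
  shows "(\<integral>\<^sup>+z. f z \<partial>lborel) = (\<integral>\<^sup>+a. ennreal \<bar>det A\<bar> * f (A *v a) \<partial>lborel)"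
proof -
  have meas: "(\<lambda>a. f (A *v a)) \<in> borel_measurable borel" if "f \<in> borel_measurable borel"
    for A :: "real^'n^'n" and f :: "real^'n \<Rightarrow> ennreal"
    by (rule measurable_compose[OF _ that])
      (intro borel_measurable_continuous_onI linear_continuous_on matrix_vector_mul_bounded_linear)
  define P where "P A \<longleftrightarrow> (det A \<noteq> 0 \<longrightarrow> (\<forall>f::real^'n \<Rightarrow> ennreal. f \<in> borel_measurable borel \<longrightarrow>
     (\<integral>\<^sup>+z. f z \<partial>lborel) = (\<integral>\<^sup>+a. ennreal \<bar>det A\<bar> * f (A *v a) \<partial>lborel)))" for A :: "real^'n^'n"
  have "P A"
  proof (rule induct_matrix_elementary_alt)
    fix A B :: "real^'n^'n"
    assume A: "P A" and B: "P B"
    show "P (A ** B)"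
      unfolding P_def
    proof (intro impI allI)
      fix f :: "real^'n \<Rightarrow> ennreal"
      assume d: "det (A ** B) \<noteq> 0" and f: "f \<in> borel_measurable borel"
      have "(\<integral>\<^sup>+z. f z \<partial>lborel) = (\<integral>\<^sup>+a. ennreal \<bar>det A\<bar> * f (A *v a) \<partial>lborel)"
        using A d f by (simp add: P_def det_mul)
      also have "\<dots> = (\<integral>\<^sup>+a. ennreal \<bar>det B\<bar> * (ennreal \<bar>det A\<bar> * f (A *v (B *v a))) \<partial>lborel)"
        using B d meas[OF f, of A] unfolding P_def det_mul
        by (intro B[unfolded P_def, rule_format, of "\<lambda>a. ennreal \<bar>det A\<bar> * f (A *v a)"]) (auto simp: det_mul)
      also have "\<dots> = (\<integral>\<^sup>+a. ennreal \<bar>det (A ** B)\<bar> * f ((A ** B) *v a) \<partial>lborel)"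
        by (simp add: det_mul abs_mult ennreal_mult' mult_ac matrix_vector_mul_assoc)
      finally show "(\<integral>\<^sup>+z. f z \<partial>lborel) = (\<integral>\<^sup>+a. ennreal \<bar>det (A ** B)\<bar> * f ((A ** B) *v a) \<partial>lborel)" .
    qed
  next
    fix A :: "real^'n^'n" and i assume "row i A = 0"
    then have "det A = 0" by (rule det_zero_row)
    then show "P A" by (simp add: P_def)
  next
    fix A :: "real^'n^'n" assume diag: "\<And>i j. i \<noteq> j \<Longrightarrow> A $ i $ j = 0"
    have dA: "det A = (\<Prod>i\<in>UNIV. A $ i $ i)" using diag by (rule det_diagonal)
    have Ax: "(A *v x) $ i = A $ i $ i * x $ i" for x i
    proof -
      have "(\<Sum>j\<in>UNIV. A $ i $ j * x $ j) = (\<Sum>j\<in>UNIV. if j = i then A $ i $ i * x $ i else 0)"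
        using diag by (intro sum.cong) auto
      then show ?thesis by (simp add: matrix_vector_mult_def)
    qed
    show "P A" unfolding P_def
    proof (intro impI allI)
      fix f :: "real^'n \<Rightarrow> ennreal"
      assume d: "det A \<noteq> 0" and f: "f \<in> borel_measurable borel"
      have nz: "A $ i $ i \<noteq> 0" for i using d dA by auto
      have "(\<Prod>j\<in>Basis. \<bar>(A *v j) \<bullet> j\<bar>) = \<bar>det A\<bar>"
        unfolding dA Basis_vec_real
        by (subst prod.reindex) (auto simp: inj_on_def axis_eq_axis inner_axis Ax abs_prod)
      moreover have "(\<integral>\<^sup>+x. f x \<partial>lborel) = (\<integral>\<^sup>+x. ennreal (\<Prod>j\<in>Basis. \<bar>(A *v j) \<bullet> j\<bar>) * f (A *v x) \<partial>lborel)"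
        by (rule nn_integral_diag_affine[OF _ f, where t = 0])
          (auto simp: Basis_vec_real inner_axis Ax nz)
      ultimately show "(\<integral>\<^sup>+z. f z \<partial>lborel) = (\<integral>\<^sup>+a. ennreal \<bar>det A\<bar> * f (A *v a) \<partial>lborel)" by simp
    qed
  next
    fix m n :: 'n assume "m \<noteq> n"
    let ?p = "Transposition.transpose m n"
    let ?A = "(\<chi> i j. mat 1 $ i $ ?p j) :: real^'n^'n"
    have "?p permutes UNIV" by (simp add: permutes_swap_id)
    then have "det ?A = of_int (sign ?p) * det (mat 1 :: real^'n^'n)" by (rule det_permute_columns)
    then have d: "\<bar>det ?A\<bar> = 1" by (simp add: sign_def)
    have Ax: "(?A *v x) $ i = x $ ?p i" for x i
    proof -
      have "(\<Sum>j\<in>UNIV. mat 1 $ i $ ?p j * x $ j) = (\<Sum>j\<in>UNIV. if j = ?p i then x $ j else 0)"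
        by (intro sum.cong) (auto simp: mat_def Transposition.transpose_def)
      then show ?thesis by (simp add: matrix_vector_mult_def)
    qed
    have "distr lborel borel (\<lambda>x. ?A *v x) = lborel"
    proof (rule lborel_distr_coordinate_bij)
      let ?\<sigma> = "\<lambda>b::real^'n. \<chi> i. b $ ?p i"
      have ax: "?\<sigma> (axis i 1) = axis (?p i) 1" for i
        by (auto simp: axis_def vec_eq_iff Transposition.transpose_def)
      have in_B: "?\<sigma> b \<in> Basis" if "b \<in> Basis" for b using that by (auto simp: Basis_vec_real ax)
      have "?\<sigma> (?\<sigma> b) = b" for b by (simp add: vec_eq_iff)
      then show "bij_betw ?\<sigma> Basis Basis"
        using in_B by (intro bij_betw_byWitness[where f' = ?\<sigma>]) auto
      show "(?A *v x) \<bullet> b = x \<bullet> ?\<sigma> b" if "b \<in> Basis" for x b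
        using that by (auto simp: Basis_vec_real ax inner_axis Ax)
    qed (intro borel_measurable_continuous_onI linear_continuous_on matrix_vector_mul_bounded_linear)
    moreover have "(\<integral>\<^sup>+z. f z \<partial>distr lborel borel (\<lambda>x. ?A *v x)) = (\<integral>\<^sup>+a. f (?A *v a) \<partial>lborel)"
      if "f \<in> borel_measurable borel" for f :: "real^'n \<Rightarrow> ennreal"
      using that by (intro nn_integral_distr) (auto intro!: borel_measurable_continuous_onI linear_continuous_on matrix_vector_mul_bounded_linear)
    ultimately show "P ?A" unfolding P_def d by simp
  next
    fix m n :: 'n assume mn: "m \<noteq> n"
    let ?A = "(\<chi> i j. of_bool (i = m \<and> j = n \<or> i = j)) :: real^'n^'n"
    have "?A = (\<chi> k. if k = m then row m (mat 1) + 1 *s row n (mat 1) else row k (mat 1))"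
      using mn by (auto simp: vec_eq_iff row_def mat_def)
    then have d: "det ?A = 1" using det_row_operation[OF mn, of "mat 1" 1] by simp
    have Ax: "?A *v set_comp m y b = set_comp m y (y $ n + b)" for y b
    proof -
      have "(\<Sum>j\<in>UNIV. of_bool (i = m \<and> j = n \<or> i = j) * x $ j) = x $ i + (if i = m then x $ n else 0)" for x :: "real^'n" and i
      proof -
        have "(\<Sum>j\<in>UNIV. of_bool (i = m \<and> j = n \<or> i = j) * x $ j)
          = (\<Sum>j\<in>UNIV. (if j = i then x $ j else 0) + (if j = n then if i = m then x $ j else 0 else 0))"
          using mn by (intro sum.cong) auto
        then show ?thesis by (simp add: sum.distrib)
      qed
      then have "(?A *v x) $ i = x $ i + (if i = m then x $ n else 0)" for x i
        by (simp only: matrix_vector_mult_def vec_lambda_beta)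
      then show ?thesis using mn by (simp only: vec_eq_iff) (simp add: set_comp_def)
    qed
    show "P ?A" unfolding P_def d
    proof (intro impI allI)
      fix f :: "real^'n \<Rightarrow> ennreal"
      assume f: "f \<in> borel_measurable borel"
      have "(\<integral>\<^sup>+b. f (set_comp m y b) \<partial>lborel) = (\<integral>\<^sup>+b. f (?A *v set_comp m y b) \<partial>lborel)" for y
      proof -
        have "(\<lambda>b. f (set_comp m y b)) \<in> borel_measurable borel"
          by (rule measurable_compose[OF _ f]) (intro borel_measurable_continuous_onI continuous_intros)
        from nn_integral_real_affine[OF this, of 1 "y $ n"] show ?thesis unfolding Ax by simp
      qed
      then show "(\<integral>\<^sup>+z. f z \<partial>lborel) = (\<integral>\<^sup>+a. ennreal \<bar>1\<bar> * f (?A *v a) \<partial>lborel)"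
        unfolding nn_integral_split_comp[OF f, of m] nn_integral_split_comp[OF meas[OF f], of ?A m]
          abs_one ennreal_1 mult_1_left by (simp only:)
    qed
  qed
  then show ?thesis using assms by (simp add: P_def)
qed

text \<open>The bridge between independent points and Lebesgue measure on matrices: row
  \<open>i\<close> is the point with label \<open>e i\<close>. Both measures give a box the product
  of its side lengths.\<close>

lemma lborel_matrix_eq_distr_PiM:
  fixes e :: "'m::finite \<Rightarrow> 'i"
  assumes e: "bij_betw e UNIV I" and I: "finite I"
  shows "(lborel :: (real^'n^'m) measure) = distr (PiM I (\<lambda>_. lborel)) borel (\<lambda>x. \<chi> i. x (e i))"
proof (rule lborel_eqI)
  interpret product_sigma_finite "\<lambda>_::'i. lborel :: (real^'n) measure" ..
  have eI: "e i \<in> I" for i using e by (auto simp: bij_betw_def)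
  have inje: "inj e" using e by (auto simp: bij_betw_def)
  have m: "(\<lambda>x. \<chi> i. x (e i)) \<in> borel_measurable (PiM I (\<lambda>_. lborel :: (real^'n) measure))"
  proof (rule borel_measurable_euclidean_space[THEN iffD2], rule ballI)
    fix b :: "real^'n^'m" assume "b \<in> Basis"
    then obtain i k where b: "b = axis i (axis k 1)" by (auto simp: Basis_vec_def)
    have "(\<lambda>a::real^'n. a $ k) \<in> borel_measurable borel"
      by (intro borel_measurable_continuous_onI continuous_intros)
    then have "(\<lambda>x. x (e i) $ k) \<in> borel_measurable (PiM I (\<lambda>_. lborel :: (real^'n) measure))"
      by (intro measurable_compose[OF measurable_component_singleton[OF eI]]) simp
    then show "(\<lambda>x. (\<chi> i. x (e i)) \<bullet> b) \<in> borel_measurable (PiM I (\<lambda>_. lborel :: (real^'n) measure))"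
      by (simp add: b inner_axis)
  qed
  fix l u :: "real^'n^'m"
  assume lu: "\<And>b. b \<in> Basis \<Longrightarrow> l \<bullet> b \<le> u \<bullet> b"
  have lu': "l $ i $ k \<le> u $ i $ k" for i k
    using lu[of "axis i (axis k 1)"] by (auto simp: Basis_vec_def inner_axis)
  let ?A = "\<lambda>j. box (l $ inv e j) (u $ inv e j)"
  have "(\<lambda>x. \<chi> i. x (e i)) -` box l u \<inter> space (PiM I (\<lambda>_. lborel)) = PiE I ?A"
  proof -
    have bx: "Z \<in> box l u \<longleftrightarrow> (\<forall>i. Z $ i \<in> box (l $ i) (u $ i))" for Z :: "real^'n^'m"
      by (auto simp: mem_box Basis_vec_def inner_axis)
    have "I = range e" using e by (auto simp: bij_betw_def)
    then show ?thesis using inv_f_f[OF inje] by (auto simp: space_PiM bx PiE_iff)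
  qed
  then have "emeasure (distr (PiM I (\<lambda>_. lborel)) borel (\<lambda>x. \<chi> i. x (e i))) (box l u) = emeasure (PiM I (\<lambda>_. lborel)) (PiE I ?A)"
    using m by (subst emeasure_distr) auto
  also have "\<dots> = (\<Prod>j\<in>I. emeasure lborel (?A j))" using I by (subst emeasure_PiM) auto
  also have "\<dots> = (\<Prod>i\<in>UNIV. emeasure lborel (box (l $ i) (u $ i)))"
    using prod.reindex_bij_betw[OF e, of "\<lambda>j. emeasure lborel (?A j)"] inv_f_f[OF inje] by simp
  also have "\<dots> = (\<Prod>i\<in>UNIV. ennreal (\<Prod>k\<in>UNIV. u $ i $ k - l $ i $ k))"
  proof (rule prod.cong[OF refl])
    fix i
    have "emeasure lborel (box (l $ i) (u $ i)) = ennreal (\<Prod>b\<in>Basis. (u $ i - l $ i) \<bullet> b)"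
      using lu' by (intro emeasure_lborel_box) (auto simp: Basis_vec_def inner_axis)
    also have "(\<Prod>b\<in>Basis. (u $ i - l $ i) \<bullet> b) = (\<Prod>k\<in>UNIV. u $ i $ k - l $ i $ k)"
    proof -
      have B: "(Basis :: (real^'n) set) = range (\<lambda>k. axis k 1)" by (auto simp: Basis_vec_def)
      show ?thesis unfolding B by (subst prod.reindex) (auto simp: inj_on_def axis_eq_axis inner_axis)
    qed
    finally show "emeasure lborel (box (l $ i) (u $ i)) = ennreal (\<Prod>k\<in>UNIV. u $ i $ k - l $ i $ k)" .
  qed
  also have "\<dots> = ennreal (\<Prod>i\<in>UNIV. \<Prod>k\<in>UNIV. u $ i $ k - l $ i $ k)"
    using lu' by (intro prod_ennreal prod_nonneg) auto
  also have "(\<Prod>i\<in>UNIV. \<Prod>k\<in>UNIV. u $ i $ k - l $ i $ k) = (\<Prod>b\<in>Basis. (u - l) \<bullet> b)"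
  proof -
    have B: "(Basis :: (real^'n^'m) set) = (\<lambda>(i, k). axis i (axis k 1)) ` UNIV" by (auto simp: Basis_vec_def)
    have "inj (\<lambda>(i, k). axis i (axis k 1) :: real^'n^'m)" by (auto simp: inj_on_def axis_eq_axis)
    then have "(\<Prod>b\<in>Basis. (u - l) \<bullet> b) = (\<Prod>(i, k)\<in>UNIV. u $ i $ k - l $ i $ k)"
      unfolding B by (subst prod.reindex) (auto intro!: prod.cong simp: inner_axis)
    then show ?thesis by (simp add: prod.cartesian_product)
  qed
  finally show "emeasure (distr (PiM I (\<lambda>_. lborel)) borel (\<lambda>x. \<chi> i. x (e i))) (box l u) = (\<Prod>b\<in>Basis. (u - l) \<bullet> b)" .
qed simp

section \<open>Hyperplanes through the given points\<close>

text \<open>The rows are homogeneous coordinates of the rows of \<open>Y\<close> projected along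
  axis \<open>k0\<close>. Up to sign the determinant is (d - 1)! times the volume of the projected
  simplex.\<close>

definition hom_mat :: "'n \<Rightarrow> real^'n^'n \<Rightarrow> real^'n^'n" where
  "hom_mat k0 Y = set_col k0 Y 1"

text \<open>The non-vertical hyperplane with parameter \<open>a\<close> consists of the points \<open>x\<close> whose \<open>k0\<close>-coordinate is the
  affine function of the other coordinates with slopes \<open>a $ k\<close> and intercept \<open>a $ k0\<close>.\<close>

definition graph_height :: "'n::finite \<Rightarrow> real^'n \<Rightarrow> real^'n \<Rightarrow> real" where
  "graph_height k0 a y = a \<bullet> set_comp k0 y 1"

definition graph_pt :: "'n::finite \<Rightarrow> real^'n \<Rightarrow> real^'n \<Rightarrow> real^'n" where
  "graph_pt k0 a y = set_comp k0 y (graph_height k0 a y)"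

definition graph_mat :: "'n::finite \<Rightarrow> real^'n \<Rightarrow> real^'n^'n \<Rightarrow> real^'n^'n" where
  "graph_mat k0 a Y = (\<chi> i. graph_pt k0 a (Y $ i))"

text \<open>Column \<open>k0\<close> carries no information in the hyperplane parametrisation;
  confining it to a unit cube keeps its contribution to an integral equal to 1.\<close>

definition unit_col :: "'n \<Rightarrow> (real^'n^'n) set" where
  "unit_col k0 = {Y. \<forall>i. Y $ i $ k0 \<in> {0..1}}"

lemma graph_height_eq: "graph_height k0 a y = (\<Sum>k\<in>-{k0}. a $ k * y $ k) + a $ k0"
proof -
  have "graph_height k0 a y = (\<Sum>k\<in>UNIV. a $ k * (if k = k0 then 1 else y $ k))"
    by (simp add: graph_height_def inner_vec_def set_comp_def)
  also have "\<dots> = a $ k0 + (\<Sum>k\<in>UNIV - {k0}. a $ k * (if k = k0 then 1 else y $ k))"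
    by (subst sum.remove[of UNIV k0]) auto
  also have "(\<Sum>k\<in>UNIV - {k0}. a $ k * (if k = k0 then 1 else y $ k)) = (\<Sum>k\<in>-{k0}. a $ k * y $ k)"
    by (intro sum.cong) auto
  finally show ?thesis by simp
qed

lemma graph_pt_nth: "graph_pt k0 a y $ k = (if k = k0 then graph_height k0 a y else y $ k)"
  by (simp add: graph_pt_def set_comp_def)

lemma graph_height_graph_pt [simp]: "graph_height k0 a (graph_pt k0 a y) = graph_height k0 a y"
  by (simp add: graph_height_eq graph_pt_nth)

text \<open>The heights of the points depend linearly on the hyperplane parameter, with matrix
  \<open>hom_mat k0 Y\<close>. This makes the passage from heights to hyperplanes a linear change of
  variables.\<close>

lemma graph_mat_eq_set_col: "graph_mat k0 a Y = set_col k0 Y (hom_mat k0 Y *v a)"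
proof -
  have "graph_height k0 a (Y $ i) = (hom_mat k0 Y *v a) $ i" for i
    by (simp add: graph_height_def matrix_vector_mult_def inner_vec_def set_comp_def hom_mat_def set_col_def mult.commute cong: if_cong)
  then show ?thesis by (simp add: vec_eq_iff graph_mat_def graph_pt_nth set_col_def)
qed

lemma hom_mat_graph_mat [simp]: "hom_mat k0 (graph_mat k0 a Y) = hom_mat k0 Y"
  by (simp add: hom_mat_def graph_mat_def vec_eq_iff set_col_def graph_pt_nth)

lemma continuous_on_hom_mat [continuous_intros]:
  "continuous_on S f \<Longrightarrow> continuous_on S (\<lambda>x. hom_mat k0 (f x))"
  unfolding hom_mat_def by (intro continuous_intros)

lemma continuous_on_graph_height [continuous_intros]:
  "continuous_on S f \<Longrightarrow> continuous_on S g \<Longrightarrow> continuous_on S (\<lambda>x. graph_height k0 (f x) (g x))"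
  unfolding graph_height_def by (intro continuous_intros)

lemma continuous_on_graph_pt [continuous_intros]:
  "continuous_on S f \<Longrightarrow> continuous_on S g \<Longrightarrow> continuous_on S (\<lambda>x. graph_pt k0 (f x) (g x))"
  unfolding graph_pt_def by (intro continuous_intros)

lemma continuous_on_graph_mat [continuous_intros]:
  "continuous_on S f \<Longrightarrow> continuous_on S g \<Longrightarrow> continuous_on S (\<lambda>x. graph_mat k0 (f x) (g x))"
  unfolding graph_mat_def by (intro continuous_intros continuous_on_vec_lambda)

lemma continuous_on_det' [continuous_intros]:
  fixes f :: "'a::topological_space \<Rightarrow> real^'n^'n"
  shows "continuous_on S f \<Longrightarrow> continuous_on S (\<lambda>x. det (f x))"
  unfolding det_def by (intro continuous_intros)

text \<open>Projected along axis \<open>k0\<close>, the standard basis becomes the origin together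
  with the other basis vectors, a nondegenerate simplex. It serves as the one point off the zero set
  from which lines are drawn.\<close>

lemma det_hom_mat_1: "det (hom_mat k0 (mat 1 :: real^'n^'n)) \<noteq> 0"
proof -
  let ?A = "hom_mat k0 (mat 1) :: real^'n^'n"
  have A: "(?A *v x) $ i = (if i = k0 then x $ k0 else x $ i + x $ k0)" for x i
  proof -
    have "(\<Sum>j\<in>UNIV. ?A $ i $ j * x $ j) = (\<Sum>j\<in>UNIV. (if j = k0 then x $ j else 0) + (if j = i then if i = k0 then 0 else x $ j else 0))"
      by (intro sum.cong) (auto simp: hom_mat_def set_col_def mat_def)
    then show ?thesis by (simp add: matrix_vector_mult_def sum.distrib)
  qed
  have "inj ((*v) ?A)"
  proof (rule linear_injective_0[THEN iffD2, OF matrix_vector_mul_linear], intro allI impI)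
    fix x assume "?A *v x = 0"
    then have "(if i = k0 then x $ k0 else x $ i + x $ k0) = 0" for i using A[of x i] by simp
    then have "x $ i = 0" for i by (metis add.right_neutral)
    then show "x = 0" by (simp add: vec_eq_iff)
  qed
  then show ?thesis using det_nz_iff_inj[OF matrix_vector_mul_linear, of ?A] by simp
qed

text \<open>On every line through \<open>mat 1\<close> the determinant is a nonzero polynomial; by Fubini some dilate of the
  zero set, hence the zero set itself, is null.\<close>

lemma AE_det_hom_mat:
  fixes k0 :: "'n::finite"
  shows "AE Y in lborel. det (hom_mat k0 Y) \<noteq> 0"
proof -
  define N where "N = {Y. det (hom_mat k0 Y) = 0}"
  have "closed N" unfolding N_def by (intro closed_Collect_eq continuous_intros)
  then have [measurable]: "N \<in> sets borel" by simp
  define T where "T t Y = (1 - t) *\<^sub>R Y + t *\<^sub>R mat 1" for t :: real and Y :: "real^'n^'n"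
  have [measurable]: "(\<lambda>(t, Y). T t Y) \<in> borel_measurable (borel \<Otimes>\<^sub>M borel)"
    unfolding borel_prod T_def case_prod_beta by (intro borel_measurable_continuous_onI continuous_intros)
  have fin: "finite {t. T t Y \<in> N}" for Y
  proof -
    define P where "P = (\<Sum>\<pi> | \<pi> permutes (UNIV :: 'n set). of_int (sign \<pi>) *
       (\<Prod>i\<in>UNIV. if \<pi> i = k0 then [:1:] else [: Y $ i $ \<pi> i, mat 1 $ i $ \<pi> i - Y $ i $ \<pi> i :]))"
    have P: "poly P t = det (hom_mat k0 (T t Y))" for t
      unfolding P_def det_def poly_sum poly_mult poly_prod of_int_poly
      by (intro sum.cong prod.cong arg_cong2[of _ _ _ _ "(*)"] refl)
        (auto simp: hom_mat_def set_col_def T_def algebra_simps)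
    have "poly P 1 \<noteq> 0" unfolding P by (simp add: T_def det_hom_mat_1)
    then have "finite {t. poly P t = 0}" by (intro poly_roots_finite) auto
    then show ?thesis unfolding P N_def by simp
  qed
  \<comment> \<open>Restricting \<open>t\<close> to the interval from 0 to 1/2 keeps the factor
    \<open>1 - t\<close> nonzero in the rescaling that brings the null set back to
    \<open>N\<close>.\<close>
  have "(\<integral>\<^sup>+t. \<integral>\<^sup>+Y. indicator {0<..<1/2} t * indicator N (T t Y) \<partial>lborel \<partial>lborel)
     = (\<integral>\<^sup>+Y. \<integral>\<^sup>+t. indicator {0<..<1/2} t * indicator N (T t Y) \<partial>lborel \<partial>lborel)"
    by (rule lborel_pair.Fubini') measurable
  also have "\<dots> = (\<integral>\<^sup>+Y. 0 \<partial>(lborel :: (real^'n^'n) measure))"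
  proof (rule nn_integral_cong)
    fix Y
    have "{t. T t Y \<in> N} \<in> null_sets lborel" using fin by (intro finite_imp_null_set_lborel)
    then have "AE t in lborel. t \<notin> {t. T t Y \<in> N}" by (rule AE_not_in)
    then have "(\<integral>\<^sup>+t. indicator {0<..<1/2} t * indicator N (T t Y) \<partial>lborel) = (\<integral>\<^sup>+t. 0 \<partial>(lborel :: real measure))"
      by (intro nn_integral_cong_AE) (auto elim!: eventually_mono)
    then show "(\<integral>\<^sup>+t. indicator {0<..<1/2} t * indicator N (T t Y) \<partial>lborel) = 0" by simp
  qed
  finally have "(\<integral>\<^sup>+t. \<integral>\<^sup>+Y. indicator {0<..<1/2} t * indicator N (T t Y) \<partial>lborel \<partial>lborel) = 0" by simp
  then have "AE t in lborel. (\<integral>\<^sup>+Y. indicator {0<..<1/2} t * indicator N (T t Y) \<partial>lborel) = 0"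
    by (subst (asm) nn_integral_0_iff_AE) measurable
  moreover have "\<not> (AE t in lborel. t \<notin> {0<..<1/2::real})"
    by (subst AE_iff_measurable[of "{0<..<1/2}"]) auto
  ultimately obtain t :: real where t: "t \<in> {0<..<1/2}" "(\<integral>\<^sup>+Y. indicator {0<..<1/2} t * indicator N (T t Y) \<partial>lborel) = 0"
    by (metis (mono_tags, lifting) eventually_mono)
  have "(\<integral>\<^sup>+Y. indicator N Y \<partial>lborel) = (\<integral>\<^sup>+Y. ennreal (\<Prod>j\<in>(Basis :: (real^'n^'n) set). \<bar>1 - t\<bar>) * indicator N (T t Y) \<partial>lborel)"
    by (rule nn_integral_diag_affine[where t = "t *\<^sub>R mat 1"]) (use t(1) in \<open>auto simp: T_def inner_add_left\<close>)
  also have "\<dots> = ennreal (\<Prod>j\<in>(Basis :: (real^'n^'n) set). \<bar>1 - t\<bar>) * (\<integral>\<^sup>+Y. indicator N (T t Y) \<partial>lborel)"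
    by (intro nn_integral_cmult) measurable
  also have "\<dots> = 0" using t by simp
  finally have "emeasure lborel N = 0" by simp
  then have "N \<in> null_sets lborel" by auto
  then have "AE Y in lborel. Y \<notin> N" by (rule AE_not_in)
  then show ?thesis by (simp add: N_def)
qed

text \<open>An affine form of the Blaschke--Petkantschin formula: \<open>d\<close> points are parametrised by the hyperplane \<open>a\<close> through them
  and by their projections along the \<open>k0\<close> axis.\<close>

lemma nn_integral_hyperplane_param:
  fixes G :: "real^'n^'n \<Rightarrow> ennreal"
  assumes [measurable]: "G \<in> borel_measurable borel"
  shows "(\<integral>\<^sup>+X. G X \<partial>lborel) =
    (\<integral>\<^sup>+a. \<integral>\<^sup>+Y. indicator (unit_col k0) Y * (ennreal \<bar>det (hom_mat k0 Y)\<bar> * G (graph_mat k0 a Y)) \<partial>lborel \<partial>lborel)"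
proof -
  have "closed (unit_col k0)" unfolding unit_col_def atLeastAtMost_iff
    by (intro closed_Collect_all closed_Collect_conj closed_Collect_le continuous_intros)
  then have [measurable]: "unit_col k0 \<in> sets borel" by simp
  have [measurable]: "(\<lambda>(a, Y). graph_mat k0 a Y) \<in> borel_measurable (borel \<Otimes>\<^sub>M borel)"
    unfolding borel_prod case_prod_beta by (intro borel_measurable_continuous_onI continuous_intros)
  have [measurable]: "(\<lambda>Y. det (hom_mat k0 Y)) \<in> borel_measurable borel"
    by (intro borel_measurable_continuous_onI continuous_intros)
  have sm: "(\<lambda>z. G (set_col k0 Y z)) \<in> borel_measurable borel" for Y
    by (rule measurable_compose[OF _ assms]) (intro borel_measurable_continuous_onI continuous_intros)
  have "(\<integral>\<^sup>+X. G X \<partial>lborel) = (\<integral>\<^sup>+Y. indicator (unit_col k0) Y * (\<integral>\<^sup>+z. G (set_col k0 Y z) \<partial>lborel) \<partial>lborel)"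
    unfolding unit_col_def by (rule nn_integral_split_col) measurable
  also have "\<dots> = (\<integral>\<^sup>+Y. \<integral>\<^sup>+a. indicator (unit_col k0) Y * (ennreal \<bar>det (hom_mat k0 Y)\<bar> * G (graph_mat k0 a Y)) \<partial>lborel \<partial>lborel)"
  proof (rule nn_integral_cong_AE)
    show "AE Y in lborel. indicator (unit_col k0) Y * (\<integral>\<^sup>+z. G (set_col k0 Y z) \<partial>lborel) =
       (\<integral>\<^sup>+a. indicator (unit_col k0) Y * (ennreal \<bar>det (hom_mat k0 Y)\<bar> * G (graph_mat k0 a Y)) \<partial>lborel)"
      using AE_det_hom_mat[of k0]
    proof eventually_elim
      case (elim Y)
      show ?case
        unfolding nn_integral_linear_change[OF elim sm] graph_mat_eq_set_col[symmetric]
        by (intro nn_integral_cmult[symmetric]) measurable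
    qed
  qed
  also have "\<dots> = (\<integral>\<^sup>+a. \<integral>\<^sup>+Y. indicator (unit_col k0) Y * (ennreal \<bar>det (hom_mat k0 Y)\<bar> * G (graph_mat k0 a Y)) \<partial>lborel \<partial>lborel)"
    by (rule lborel_pair.Fubini') measurable
  finally show ?thesis .
qed

text \<open>The (d - 1)-volume of the section projected along axis \<open>k0\<close>. It differs
  from the volume of the section itself by a factor depending on the slope only, hence constant on
  parallel sections. The \<open>k0\<close> coordinate of \<open>y\<close> is idle.\<close>

definition section_vol :: "'n::finite \<Rightarrow> (real^'n) set \<Rightarrow> real^'n \<Rightarrow> ennreal" where
  "section_vol k0 K a = (\<integral>\<^sup>+y. indicator {y. y $ k0 \<in> {0..1}} y * indicator K (graph_pt k0 a y) \<partial>lborel)"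

text \<open>Up to the factor (d - 1)!, the integral of simplex volumes over \<open>d\<close> points
  of the projected section: the weight that the integral formula gives to the hyperplane
  \<open>a\<close>.\<close>

definition section_det :: "'n::finite \<Rightarrow> (real^'n) set \<Rightarrow> real^'n \<Rightarrow> ennreal" where
  "section_det k0 K a = (\<integral>\<^sup>+Y. indicator (unit_col k0) Y * (ennreal \<bar>det (hom_mat k0 Y)\<bar> *
     (\<Prod>i\<in>UNIV. indicator K (graph_mat k0 a Y $ i))) \<partial>lborel)"

text \<open>A homothety with ratio \<open>l\<close> carries one section into a parallel one. In
  projection it scales volume by l^(d - 1); in the determinant integral each of the \<open>d\<close>
  points contributes this factor and the determinant contributes it once more, whence the exponent
  (d - 1)(d + 1).\<close>

lemma section_scaling:
  fixes K :: "(real^'n) set" and a a' c c' :: "real^'n"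
  assumes K: "closed K" and l: "l > 0"
    and slope: "\<And>k. k \<noteq> k0 \<Longrightarrow> a' $ k = a $ k"
    and c: "c $ k0 = graph_height k0 a c" "c' $ k0 = graph_height k0 a' c'"
    and sub: "\<And>x. x \<in> K \<Longrightarrow> x $ k0 = graph_height k0 a x \<Longrightarrow> c' + l *\<^sub>R (x - c) \<in> K"
  shows "section_vol k0 K a' \<ge> ennreal (l ^ (CARD('n) - 1)) * section_vol k0 K a"
    and "section_det k0 K a' \<ge> ennreal (l ^ ((CARD('n) - 1) * (CARD('n) + 1))) * section_det k0 K a"
proof -
  have [measurable]: "K \<in> sets borel" using K by simp
  have "closed (unit_col k0)" unfolding unit_col_def atLeastAtMost_iff
    by (intro closed_Collect_all closed_Collect_conj closed_Collect_le continuous_intros)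
  then have [measurable]: "unit_col k0 \<in> sets borel" by simp
  have [measurable]: "(\<lambda>y. graph_pt k0 a y) \<in> borel_measurable borel" "(\<lambda>Y. graph_mat k0 a Y $ i) \<in> borel_measurable borel" for a i
    by (intro borel_measurable_continuous_onI continuous_intros)+
  have [measurable]: "(\<lambda>Y. det (hom_mat k0 Y)) \<in> borel_measurable borel" "(\<lambda>y::real^'n. y $ k0) \<in> borel_measurable borel"
    by (intro borel_measurable_continuous_onI continuous_intros)+
  \<comment> \<open>The homothety as seen in the projection; the idle coordinate is left alone so
    that its unit interval is preserved.\<close>
  define \<tau> where "\<tau> y = (\<chi> k. if k = k0 then y $ k else c' $ k + l * (y $ k - c $ k))" for y :: "real^'n"
  have gp: "graph_pt k0 a' (\<tau> y) = c' + l *\<^sub>R (graph_pt k0 a y - c)" for y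
  proof (rule vec_eq_iff[THEN iffD2], rule allI)
    fix k
    show "graph_pt k0 a' (\<tau> y) $ k = (c' + l *\<^sub>R (graph_pt k0 a y - c)) $ k"
    proof (cases "k = k0")
      case True
      have "graph_height k0 a' (\<tau> y) = (\<Sum>k\<in>-{k0}. a $ k * (c' $ k + l * (y $ k - c $ k))) + a' $ k0"
        unfolding graph_height_eq by (auto simp: \<tau>_def slope intro!: sum.cong)
      also have "\<dots> = ((\<Sum>k\<in>-{k0}. a $ k * c' $ k) + a' $ k0) + l * ((\<Sum>k\<in>-{k0}. a $ k * y $ k) - (\<Sum>k\<in>-{k0}. a $ k * c $ k))"
        by (simp add: sum.distrib sum_subtractf sum_distrib_left algebra_simps)
      also have "(\<Sum>k\<in>-{k0}. a $ k * c' $ k) + a' $ k0 = c' $ k0"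
        unfolding c(2) graph_height_eq by (auto simp: slope intro!: sum.cong)
      also have "(\<Sum>k\<in>-{k0}. a $ k * y $ k) - (\<Sum>k\<in>-{k0}. a $ k * c $ k) = graph_height k0 a y - c $ k0"
        unfolding c(1) graph_height_eq by simp
      finally show ?thesis using True by (simp add: graph_pt_nth)
    qed (simp add: graph_pt_nth \<tau>_def)
  qed
  have inK: "indicator K (graph_pt k0 a y) \<le> (indicator K (graph_pt k0 a' (\<tau> y)) :: ennreal)" for y
    unfolding gp using sub[of "graph_pt k0 a y"] by (auto simp: indicator_def graph_pt_nth[of _ _ _ k0])
  have \<tau>0: "\<tau> y $ k0 = y $ k0" for y by (simp add: \<tau>_def)
  define cc where "cc k = (if k = k0 then 1 else l)" for k
  define tt where "tt = (\<chi> k. if k = k0 then 0 else c' $ k - l * c $ k)"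
  have \<tau>k: "\<tau> y $ k = tt $ k + cc k * y $ k" for y k by (simp add: \<tau>_def cc_def tt_def algebra_simps)
  have ccp: "(\<Prod>k\<in>UNIV. \<bar>cc k\<bar>) = l ^ (CARD('n) - 1)"
  proof -
    have "(\<Prod>k\<in>UNIV. \<bar>cc k\<bar>) = \<bar>cc k0\<bar> * (\<Prod>k\<in>UNIV - {k0}. \<bar>cc k\<bar>)" by (rule prod.remove) auto
    also have "(\<Prod>k\<in>UNIV - {k0}. \<bar>cc k\<bar>) = (\<Prod>k\<in>UNIV - {k0}. l)" using l by (intro prod.cong) (auto simp: cc_def)
    finally show ?thesis by (simp add: cc_def card_Diff_singleton)
  qed
  have cc0: "cc k \<noteq> 0" for k using l by (simp add: cc_def)
  show "section_vol k0 K a' \<ge> ennreal (l ^ (CARD('n) - 1)) * section_vol k0 K a"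
  proof -
    have "section_vol k0 K a' = (\<integral>\<^sup>+y. ennreal (\<Prod>b\<in>(Basis :: (real^'n) set). \<bar>cc (THE k. b = axis k 1)\<bar>) *
        (indicator {y. y $ k0 \<in> {0..1}} (\<tau> y) * indicator K (graph_pt k0 a' (\<tau> y))) \<partial>lborel)"
      unfolding section_vol_def
      by (rule nn_integral_diag_affine[where t = tt and T = \<tau> and c = "\<lambda>b. cc (THE k. b = axis k 1)"
            and f = "\<lambda>y. indicator {y. y $ k0 \<in> {0..1}} y * indicator K (graph_pt k0 a' y)"])
        (auto simp: cc0 Basis_vec_real inner_axis \<tau>k axis_eq_axis)
    also have "(\<Prod>b\<in>(Basis :: (real^'n) set). \<bar>cc (THE k. b = axis k 1)\<bar>) = l ^ (CARD('n) - 1)"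
      unfolding Basis_vec_real by (subst prod.reindex) (auto simp: inj_on_def axis_eq_axis ccp)
    also have "(\<integral>\<^sup>+y. ennreal (l ^ (CARD('n) - 1)) * (indicator {y. y $ k0 \<in> {0..1}} (\<tau> y) * indicator K (graph_pt k0 a' (\<tau> y))) \<partial>lborel)
       \<ge> (\<integral>\<^sup>+y. ennreal (l ^ (CARD('n) - 1)) * (indicator {y. y $ k0 \<in> {0..1}} y * indicator K (graph_pt k0 a y)) \<partial>lborel)"
      using inK by (intro nn_integral_mono mult_left_mono mult_mono) (auto simp: \<tau>0 indicator_def)
    finally show ?thesis unfolding section_vol_def by (subst (asm) nn_integral_cmult) measurable
  qed
  define T where "T Y = (\<chi> i. \<tau> (Y $ i))" for Y :: "real^'n^'n"
  have Tu: "T Y \<in> unit_col k0 \<longleftrightarrow> Y \<in> unit_col k0" for Y by (simp add: unit_col_def T_def \<tau>0)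
  have inK2: "(\<Prod>i\<in>UNIV. indicator K (graph_mat k0 a Y $ i)) \<le> (\<Prod>i\<in>UNIV. indicator K (graph_mat k0 a' (T Y) $ i) :: ennreal)" for Y
    by (intro prod_mono_ennreal) (simp add: graph_mat_def T_def inK)
  have detT: "\<bar>det (hom_mat k0 (T Y))\<bar> = l ^ (CARD('n) - 1) * \<bar>det (hom_mat k0 Y)\<bar>" for Y
  proof -
    \<comment> \<open>The column of ones turns the translation into a row operation:
      \<open>M\<close> is the diagonal matrix \<open>D\<close> of the scaling with \<open>tt\<close>
      added to row \<open>k0\<close>, and \<open>tt\<close> lies in the span of the other rows
      because its \<open>k0\<close> component is 0.\<close>
    define D where "D = ((\<chi> j k. if j = k then cc j else 0) :: real^'n^'n)"
    define M where "M = (\<chi> j. if j = k0 then row k0 D + tt else row j D)"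
    have dD: "det D = (\<Prod>k\<in>UNIV. cc k)" unfolding D_def by (subst det_diagonal) auto
    have "tt \<in> vec.span {row j D |j. j \<noteq> k0}"
    proof -
      have rD: "row j D = cc j *s axis j 1" for j by (auto simp: row_def D_def vec_eq_iff axis_def)
      have "tt = (\<Sum>j\<in>UNIV - {k0}. (tt $ j / cc j) *s row j D)"
      proof (rule vec_eq_iff[THEN iffD2], rule allI)
        fix k
        have "(\<Sum>j\<in>UNIV - {k0}. (tt $ j / cc j) *s row j D) $ k = (\<Sum>j\<in>UNIV - {k0}. if j = k then tt $ j else 0)"
          unfolding sum_component rD by (intro sum.cong) (auto simp: axis_def cc0)
        also have "\<dots> = tt $ k" by (auto simp: tt_def)
        finally show "tt $ k = (\<Sum>j\<in>UNIV - {k0}. (tt $ j / cc j) *s row j D) $ k" by simp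
      qed
      also have "\<dots> \<in> vec.span {row j D |j. j \<noteq> k0}"
        by (intro vec.span_sum vec.span_scale vec.span_base) auto
      finally show ?thesis .
    qed
    then have "det M = det D" unfolding M_def by (rule det_row_span)
    then have "\<bar>det M\<bar> = l ^ (CARD('n) - 1)" using ccp dD by (simp add: abs_prod)
    moreover have "hom_mat k0 (T Y) = hom_mat k0 Y ** M"
    proof -
      have "(\<Sum>j\<in>UNIV. hom_mat k0 Y $ i $ j * M $ j $ k) = hom_mat k0 (T Y) $ i $ k" for i k
      proof -
        have "(\<Sum>j\<in>UNIV. hom_mat k0 Y $ i $ j * M $ j $ k)
          = (\<Sum>j\<in>UNIV. (if j = k then hom_mat k0 Y $ i $ k * cc k else 0) + (if j = k0 then tt $ k else 0))"
          by (intro sum.cong) (auto simp: M_def row_def D_def hom_mat_def set_col_def)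
        also have "\<dots> = hom_mat k0 Y $ i $ k * cc k + tt $ k" by (simp add: sum.distrib)
        also have "\<dots> = hom_mat k0 (T Y) $ i $ k"
          by (auto simp: hom_mat_def set_col_def T_def \<tau>k) (auto simp: cc_def tt_def)
        finally show ?thesis .
      qed
      then show ?thesis by (simp add: vec_eq_iff matrix_matrix_mult_def)
    qed
    ultimately show ?thesis by (simp add: det_mul abs_mult)
  qed
  show "section_det k0 K a' \<ge> ennreal (l ^ ((CARD('n) - 1) * (CARD('n) + 1))) * section_det k0 K a"
  proof -
    let ?c = "\<lambda>b::real^'n^'n. cc (THE k. \<exists>i. b = axis i (axis k 1))"
    have B: "(Basis :: (real^'n^'n) set) = (\<lambda>(i, k). axis i (axis k 1)) ` UNIV" by (auto simp: Basis_vec_def)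
    have injB: "inj (\<lambda>(i, k). axis i (axis k 1) :: real^'n^'n)" by (auto simp: inj_on_def axis_eq_axis)
    have cB: "?c (axis i (axis k 1)) = cc k" for i k by (simp add: axis_eq_axis)
    have "section_det k0 K a' = (\<integral>\<^sup>+Y. ennreal (\<Prod>b\<in>(Basis :: (real^'n^'n) set). \<bar>?c b\<bar>) *
        (indicator (unit_col k0) (T Y) * (ennreal \<bar>det (hom_mat k0 (T Y))\<bar> * (\<Prod>i\<in>UNIV. indicator K (graph_mat k0 a' (T Y) $ i)))) \<partial>lborel)"
      unfolding section_det_def
      by (rule nn_integral_diag_affine[where t = "\<chi> i. tt" and T = T and c = ?c
            and f = "\<lambda>Y. indicator (unit_col k0) Y * (ennreal \<bar>det (hom_mat k0 Y)\<bar> * (\<Prod>i\<in>UNIV. indicator K (graph_mat k0 a' Y $ i)))"])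
        (auto simp: B cB cc0 inner_axis T_def \<tau>k)
    also have "(\<Prod>b\<in>(Basis :: (real^'n^'n) set). \<bar>?c b\<bar>) = (l ^ (CARD('n) - 1)) ^ CARD('n)"
    proof -
      have "(\<Prod>b\<in>(Basis :: (real^'n^'n) set). \<bar>?c b\<bar>) = (\<Prod>(i::'n, k)\<in>UNIV. \<bar>cc k\<bar>)"
        unfolding B by (subst prod.reindex[OF injB]) (auto intro!: prod.cong simp: cB)
      also have "\<dots> = (\<Prod>i\<in>(UNIV :: 'n set). \<Prod>k\<in>UNIV. \<bar>cc k\<bar>)"
        using prod.cartesian_product[of "\<lambda>(i::'n) k. \<bar>cc k\<bar>" UNIV UNIV] by simp
      finally show ?thesis by (simp add: ccp)
    qed
    also have "(\<integral>\<^sup>+Y. ennreal ((l ^ (CARD('n) - 1)) ^ CARD('n)) *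
        (indicator (unit_col k0) (T Y) * (ennreal \<bar>det (hom_mat k0 (T Y))\<bar> * (\<Prod>i\<in>UNIV. indicator K (graph_mat k0 a' (T Y) $ i)))) \<partial>lborel)
      \<ge> (\<integral>\<^sup>+Y. ennreal (l ^ ((CARD('n) - 1) * (CARD('n) + 1))) *
        (indicator (unit_col k0) Y * (ennreal \<bar>det (hom_mat k0 Y)\<bar> * (\<Prod>i\<in>UNIV. indicator K (graph_mat k0 a Y $ i)))) \<partial>lborel)"
    proof (rule nn_integral_mono)
      fix Y
      have e: "ennreal (l ^ ((CARD('n) - 1) * (CARD('n) + 1))) = ennreal ((l ^ (CARD('n) - 1)) ^ CARD('n)) * ennreal (l ^ (CARD('n) - 1))"
        unfolding distrib_left mult_1_right power_add power_mult using l by (intro ennreal_mult') simp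
      have "ennreal (l ^ ((CARD('n) - 1) * (CARD('n) + 1))) *
        (indicator (unit_col k0) Y * (ennreal \<bar>det (hom_mat k0 Y)\<bar> * (\<Prod>i\<in>UNIV. indicator K (graph_mat k0 a Y $ i))))
        = ennreal ((l ^ (CARD('n) - 1)) ^ CARD('n)) *
        (indicator (unit_col k0) (T Y) * (ennreal \<bar>det (hom_mat k0 (T Y))\<bar> * (\<Prod>i\<in>UNIV. indicator K (graph_mat k0 a Y $ i))))"
        unfolding e detT using l by (simp add: Tu indicator_def ennreal_mult' mult_ac)
      also have "\<dots> \<le> ennreal ((l ^ (CARD('n) - 1)) ^ CARD('n)) *
        (indicator (unit_col k0) (T Y) * (ennreal \<bar>det (hom_mat k0 (T Y))\<bar> * (\<Prod>i\<in>UNIV. indicator K (graph_mat k0 a' (T Y) $ i))))"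
        using inK2 by (intro mult_left_mono) auto
      finally show "ennreal (l ^ ((CARD('n) - 1) * (CARD('n) + 1))) *
        (indicator (unit_col k0) Y * (ennreal \<bar>det (hom_mat k0 Y)\<bar> * (\<Prod>i\<in>UNIV. indicator K (graph_mat k0 a Y $ i))))
        \<le> ennreal ((l ^ (CARD('n) - 1)) ^ CARD('n)) *
        (indicator (unit_col k0) (T Y) * (ennreal \<bar>det (hom_mat k0 (T Y))\<bar> * (\<Prod>i\<in>UNIV. indicator K (graph_mat k0 a' (T Y) $ i))))" .
    qed
    finally show ?thesis unfolding section_det_def by (subst (asm) nn_integral_cmult) measurable
  qed
qed

section \<open>Parallel sections\<close>

definition graph_normal :: "'n::finite \<Rightarrow> real^'n \<Rightarrow> real^'n" where
  "graph_normal k0 a = (\<chi> k. if k = k0 then 1 else - a $ k)"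

lemma graph_normal_inner: "graph_normal k0 a \<bullet> x = x $ k0 - (\<Sum>k\<in>-{k0}. a $ k * x $ k)"
proof -
  have "graph_normal k0 a \<bullet> x = (\<Sum>k\<in>UNIV. graph_normal k0 a $ k * x $ k)" by (simp add: inner_vec_def)
  also have "\<dots> = graph_normal k0 a $ k0 * x $ k0 + (\<Sum>k\<in>UNIV - {k0}. graph_normal k0 a $ k * x $ k)"
    by (rule sum.remove) auto
  also have "(\<Sum>k\<in>UNIV - {k0}. graph_normal k0 a $ k * x $ k) = (\<Sum>k\<in>-{k0}. - (a $ k * x $ k))"
    by (intro sum.cong) (auto simp: graph_normal_def)
  finally show ?thesis by (simp add: graph_normal_def sum_negf)
qed

lemma graph_height_level: "x $ k0 - graph_height k0 a x = graph_normal k0 a \<bullet> x - a $ k0"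
  by (simp add: graph_height_eq graph_normal_inner)

lemma graph_normal_set_comp [simp]: "graph_normal k0 (set_comp k0 a b) = graph_normal k0 a"
  by (simp add: graph_normal_def set_comp_def vec_eq_iff)

lemma graph_normal_nonzero: "graph_normal k0 a \<noteq> 0"
  by (auto simp: graph_normal_def vec_eq_iff)

lemma set_comp_nth_same [simp]: "set_comp k0 a b $ k0 = b"
  by (simp add: set_comp_def)

lemma on_level_iff: "x $ k0 = graph_height k0 (set_comp k0 a b) x \<longleftrightarrow> graph_normal k0 a \<bullet> x = b"
  using graph_height_level[of x k0 "set_comp k0 a b"] by auto

text \<open>Fubini along axis \<open>k0\<close>. Because the normal has \<open>k0\<close> component
  1, moving along that axis changes the level \<open>b\<close> at unit rate, so no Jacobian
  appears.\<close>

lemma nn_integral_section_vol: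
  fixes K :: "(real^'n) set"
  assumes K: "closed K" and [measurable]: "E \<in> sets borel"
  shows "(\<integral>\<^sup>+b. indicator E b * section_vol k0 K (set_comp k0 a b) \<partial>lborel) = emeasure lborel (K \<inter> {x. graph_normal k0 a \<bullet> x \<in> E})"
proof -
  have [measurable]: "K \<in> sets borel" using K by simp
  have [measurable]: "(\<lambda>x. graph_normal k0 a \<bullet> x) \<in> borel_measurable borel" "(\<lambda>y::real^'n. y $ k0) \<in> borel_measurable borel"
    by (intro borel_measurable_continuous_onI continuous_intros)+
  have [measurable]: "(\<lambda>(b, y). graph_pt k0 (set_comp k0 a b) y) \<in> borel_measurable (borel \<Otimes>\<^sub>M borel)"
    unfolding borel_prod case_prod_beta by (intro borel_measurable_continuous_onI continuous_intros)
  let ?Q = "{y::real^'n. y $ k0 \<in> {0..1}}"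
  have "emeasure lborel (K \<inter> {x. graph_normal k0 a \<bullet> x \<in> E}) = (\<integral>\<^sup>+x. indicator K x * indicator E (graph_normal k0 a \<bullet> x) \<partial>lborel)"
  proof -
    have "(\<lambda>x. indicator K x * indicator E (graph_normal k0 a \<bullet> x)) = (indicator (K \<inter> {x. graph_normal k0 a \<bullet> x \<in> E}) :: _ \<Rightarrow> ennreal)"
      by (auto simp: indicator_def fun_eq_iff)
    then show ?thesis by simp
  qed
  also have "\<dots> = (\<integral>\<^sup>+y. indicator ?Q y * (\<integral>\<^sup>+z. indicator K (set_comp k0 y z) * indicator E (graph_normal k0 a \<bullet> set_comp k0 y z) \<partial>lborel) \<partial>lborel)"
    by (rule nn_integral_split_comp) measurable
  also have "\<dots> = (\<integral>\<^sup>+y. \<integral>\<^sup>+b. indicator ?Q y * (indicator K (graph_pt k0 (set_comp k0 a b) y) * indicator E b) \<partial>lborel \<partial>lborel)"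
  proof (rule nn_integral_cong)
    fix y :: "real^'n"
    define s where "s = (\<Sum>k\<in>-{k0}. a $ k * y $ k)"
    have g: "graph_pt k0 (set_comp k0 a b) y = set_comp k0 y (s + b)" for b
    proof -
      have "(\<Sum>k\<in>-{k0}. set_comp k0 a b $ k * y $ k) = s" unfolding s_def by (intro sum.cong) (auto simp: set_comp_def)
      then show ?thesis by (simp add: graph_pt_def graph_height_eq)
    qed
    have n: "graph_normal k0 a \<bullet> set_comp k0 y z = z - s" for z
    proof -
      have "(\<Sum>k\<in>-{k0}. a $ k * set_comp k0 y z $ k) = s" unfolding s_def by (intro sum.cong) (auto simp: set_comp_def)
      then show ?thesis by (simp add: graph_normal_inner)
    qed
    have [measurable]: "(\<lambda>z. set_comp k0 y z) \<in> borel_measurable borel"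
      by (intro borel_measurable_continuous_onI continuous_intros)
    have "(\<integral>\<^sup>+z. indicator K (set_comp k0 y z) * indicator E (z - s) \<partial>lborel) = (\<integral>\<^sup>+b. indicator K (set_comp k0 y (s + b)) * indicator E b \<partial>lborel)"
      using nn_integral_real_affine[of "\<lambda>z. indicator K (set_comp k0 y z) * indicator E (z - s)" 1 s] by simp
    then show "indicator ?Q y * (\<integral>\<^sup>+z. indicator K (set_comp k0 y z) * indicator E (graph_normal k0 a \<bullet> set_comp k0 y z) \<partial>lborel)
       = (\<integral>\<^sup>+b. indicator ?Q y * (indicator K (graph_pt k0 (set_comp k0 a b) y) * indicator E b) \<partial>lborel)"
      unfolding n g by (subst nn_integral_cmult) auto
  qed
  also have "\<dots> = (\<integral>\<^sup>+b. \<integral>\<^sup>+y. indicator ?Q y * (indicator K (graph_pt k0 (set_comp k0 a b) y) * indicator E b) \<partial>lborel \<partial>lborel)"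
    by (rule lborel_pair.Fubini') measurable
  also have "\<dots> = (\<integral>\<^sup>+b. indicator E b * section_vol k0 K (set_comp k0 a b) \<partial>lborel)"
    unfolding section_vol_def
    by (intro nn_integral_cong, subst nn_integral_cmult[symmetric]) (auto simp: mult_ac)
  finally show ?thesis by simp
qed

lemma norm_le_DIM_mult:
  fixes x :: "'a::euclidean_space"
  assumes "\<And>b. b \<in> Basis \<Longrightarrow> \<bar>x \<bullet> b\<bar> \<le> B"
  shows "norm x \<le> real DIM('a) * B"
  using norm_le_l1[of x] sum_bounded_above[of Basis "\<lambda>b. \<bar>x \<bullet> b\<bar>" B] assms by simp

text \<open>The domain of integration is bounded: the idle coordinates are confined to the unit
  interval, and the others are coordinates of points of \<open>K\<close>.\<close>

lemma section_finite:
  fixes K :: "(real^'n) set"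
  assumes K: "compact K"
  shows "section_vol k0 K a < \<infinity>" "section_det k0 K a < \<infinity>"
proof -
  obtain B where B: "B \<ge> 1" "\<And>x. x \<in> K \<Longrightarrow> norm x \<le> B"
  proof -
    obtain B where "\<forall>x\<in>K. norm x \<le> B" using compact_imp_bounded[OF K] by (auto simp: bounded_iff)
    then show ?thesis using that[of "max B 1"] by fastforce
  qed
  have bnd: "\<bar>y $ k\<bar> \<le> B" if "y $ k0 \<in> {0..1}" "graph_pt k0 a y \<in> K" for y k
  proof (cases "k = k0")
    case True then show ?thesis using that B(1) by auto
  next
    case False
    then have "\<bar>y $ k\<bar> = \<bar>graph_pt k0 a y $ k\<bar>" by (simp add: graph_pt_nth)
    also have "\<dots> \<le> norm (graph_pt k0 a y)" by (rule component_le_norm_cart)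
    finally show ?thesis using B(2)[OF that(2)] by simp
  qed
  have "section_vol k0 K a \<le> (\<integral>\<^sup>+y. indicator (cball 0 (real DIM(real^'n) * B) :: (real^'n) set) y \<partial>lborel)"
    unfolding section_vol_def
  proof (intro nn_integral_mono)
    fix y
    show "indicator {y. y $ k0 \<in> {0..1}} y * indicator K (graph_pt k0 a y) \<le> (indicator (cball 0 (real DIM(real^'n) * B)) y :: ennreal)"
    proof (cases "y $ k0 \<in> {0..1} \<and> graph_pt k0 a y \<in> K")
      case True
      then have "norm y \<le> real DIM(real^'n) * B"
        by (intro norm_le_DIM_mult) (auto simp only: Basis_vec_real inner_axis inner_real_def mult_1_right intro: bnd)
      then show ?thesis by (simp add: indicator_def)
    qed (auto simp: indicator_def)
  qed
  also have "\<dots> < \<infinity>" using emeasure_bounded_finite[OF bounded_cball] by simp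
  finally show "section_vol k0 K a < \<infinity>" .
  let ?C = "cball 0 (real DIM(real^'n^'n) * B) :: (real^'n^'n) set"
  have "compact ((\<lambda>Y. det (hom_mat k0 Y)) ` ?C)"
    by (intro compact_continuous_image continuous_intros compact_cball)
  then have "bounded ((\<lambda>Y. det (hom_mat k0 Y)) ` ?C)" by (rule compact_imp_bounded)
  then obtain M where "\<forall>x\<in>(\<lambda>Y. det (hom_mat k0 Y)) ` ?C. norm x \<le> M" unfolding bounded_iff by blast
  then have M: "\<bar>det (hom_mat k0 Y)\<bar> \<le> M" if "Y \<in> ?C" for Y using that by simp
  have "section_det k0 K a \<le> (\<integral>\<^sup>+Y. ennreal M * indicator ?C Y \<partial>lborel)"
    unfolding section_det_def
  proof (intro nn_integral_mono)
    fix Y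
    show "indicator (unit_col k0) Y * (ennreal \<bar>det (hom_mat k0 Y)\<bar> * (\<Prod>i\<in>UNIV. indicator K (graph_mat k0 a Y $ i))) \<le> ennreal M * indicator ?C Y"
    proof (cases "Y \<in> unit_col k0 \<and> (\<forall>i. graph_mat k0 a Y $ i \<in> K)")
      case True
      then have "\<bar>Y $ i $ k\<bar> \<le> B" for i k using bnd[of "Y $ i" k] by (auto simp: unit_col_def graph_mat_def)
      then have "norm Y \<le> real DIM(real^'n^'n) * B"
        by (intro norm_le_DIM_mult) (auto simp: Basis_vec_def inner_axis)
      then have "Y \<in> ?C" by simp
      then show ?thesis using True M[of Y] by (auto intro: ennreal_leI)
    next
      case False
      then have "indicator (unit_col k0) Y * (ennreal \<bar>det (hom_mat k0 Y)\<bar> * (\<Prod>i\<in>UNIV. indicator K (graph_mat k0 a Y $ i))) = 0"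
        by (auto simp: indicator_def)
      then show ?thesis by (rule ord_eq_le_trans) simp
    qed
  qed
  also have "\<dots> = ennreal M * emeasure lborel ?C" by (subst nn_integral_cmult) (auto intro!: borel_measurable_indicator)
  also have "\<dots> < \<infinity>" using emeasure_bounded_finite[OF bounded_cball, of "0 :: real^'n^'n" "real DIM(real^'n^'n) * B"]
    by (simp add: ennreal_mult_less_top)
  finally show "section_det k0 K a < \<infinity>" .
qed

lemma enn2real_scale_le:
  assumes "ennreal c * X \<le> Y" "Y < \<infinity>" "c \<ge> 0"
  shows "c * enn2real X \<le> enn2real Y"
  using enn2real_mono[OF assms(1)] assms(2,3) by (simp add: enn2real_mult)

lemma measurable_section_vol:
  fixes K :: "(real^'n) set"
  assumes K: "closed K"
  shows "(\<lambda>b. section_vol k0 K (set_comp k0 a b)) \<in> borel_measurable borel"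
proof -
  have [measurable]: "K \<in> sets borel" using K by simp
  have [measurable]: "(\<lambda>y::real^'n. y $ k0) \<in> borel_measurable borel"
    by (intro borel_measurable_continuous_onI continuous_intros)
  have [measurable]: "(\<lambda>(b, y). graph_pt k0 (set_comp k0 a b) y) \<in> borel_measurable (borel \<Otimes>\<^sub>M borel)"
    unfolding borel_prod case_prod_beta by (intro borel_measurable_continuous_onI continuous_intros)
  show ?thesis unfolding section_vol_def by measurable
qed

lemma measure_compact_pos:
  fixes K :: "'a::euclidean_space set"
  assumes "compact K" "interior K \<noteq> {}"
  shows "measure lborel K > 0"
proof -
  have "\<not> negligible K" using assms(2) negligible_subset[OF _ interior_subset] open_not_negligible[OF open_interior] by blast
  moreover have "K \<in> lmeasurable" using assms(1) by (rule lmeasurable_compact)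
  moreover have "K \<in> sets borel" using assms(1) by (simp add: compact_imp_closed)
  ultimately show ?thesis by (simp add: negligible_iff_measure0 zero_less_measure_iff)
qed

text \<open>For one slope \<open>a\<close> and one side \<sigma>, the sections parametrised by their
  depth below the supporting hyperplane form profiles to which \<open>profile_integral_pos\<close>
  applies. The homothety about the support point gives the global comparison,
  \<open>uniform_cap_scaling\<close> the one at small depth. \<open>m0\<close> is uniform because
  \<eta> depends on the dimension and \<rho> on \<open>K\<close> alone.\<close>

lemma directional_positivity:
  fixes K :: "(real^'n) set"
  assumes K: "smooth_convex_body K" and d: "CARD('n) \<ge> 2"
  shows "\<exists>m0. \<forall>m\<ge>m0. \<forall>a::real^'n. \<forall>\<sigma>\<in>{1, -1 :: real}. \<forall>A P.
    A = (\<lambda>b. enn2real (section_det k0 K (set_comp k0 a b))) \<longrightarrow>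
    P = (\<lambda>b. measure lborel (K \<inter> {x. \<sigma> * (graph_normal k0 a \<bullet> x) < \<sigma> * b}) / measure lborel K) \<longrightarrow>
    integrable lborel A \<longrightarrow> 0 < (\<integral>b. A b \<partial>lborel) \<longrightarrow>
    0 < (\<integral>b. A b * ((1 - P b) ^ m * (real CARD('n) - (real m + real CARD('n) + 1) * P b)) \<partial>lborel)"
proof -
  define p where "p = CARD('n) - 1"
  have p: "p \<ge> 1" "CARD('n) = p + 1" using d by (auto simp: p_def)
  have cK: "compact K" "convex K" "interior K \<noteq> {}" using K by (auto simp: smooth_convex_body_def convex_body_def)
  have clK: "closed K" using cK by (simp add: compact_imp_closed)
  have Km[measurable]: "K \<in> sets borel" using clK by simp
  have Kpos: "measure lborel K > 0" using cK by (intro measure_compact_pos)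
  have Kfin: "emeasure lborel K < \<infinity>" using cK(1) by (intro emeasure_bounded_finite compact_imp_bounded)
  obtain \<eta> where \<eta>: "0 < \<eta>" "\<eta> < 1" and prof: "\<And>\<rho>. 0 < \<rho> \<Longrightarrow> \<rho> < 1 \<Longrightarrow> (\<exists>m0. \<forall>m\<ge>m0. \<forall>W S A V. W > 0 \<longrightarrow>
     cap_profile p \<eta> \<rho> W S p \<longrightarrow> cap_profile p \<eta> \<rho> W A (p * (p + 2)) \<longrightarrow>
     (\<integral>x. S x \<partial>lborel) = 1 \<longrightarrow> (\<integral>x. A x \<partial>lborel) > 0 \<longrightarrow>
     (\<forall>t. V t = (\<integral>x. indicator {..t} x * S x \<partial>lborel)) \<longrightarrow>
     (\<integral>x. A x * ((1 - V x) ^ m * (real p + 1 - (real m + real p + 2) * V x)) \<partial>lborel) > 0)"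
    using profile_integral_pos[OF p(1)] by blast
  obtain \<tau> where \<tau>: "\<tau> > 0" and scal: "\<And>u p x s t. norm u = 1 \<Longrightarrow> p \<in> K \<Longrightarrow> (\<And>y. y \<in> K \<Longrightarrow> y \<bullet> u \<le> p \<bullet> u) \<Longrightarrow>
      x \<in> K \<Longrightarrow> 0 < s \<Longrightarrow> s \<le> \<tau> \<Longrightarrow> 0 < t \<Longrightarrow> t \<le> \<tau> \<Longrightarrow> x \<bullet> u = p \<bullet> u - t \<Longrightarrow>
      (p - s *\<^sub>R u) + (\<eta> * sqrt (s / t)) *\<^sub>R (x - (p - t *\<^sub>R u)) \<in> K"
    using uniform_cap_scaling[OF K \<eta>] by blast
  obtain B where B: "B > 0" "\<And>x. x \<in> K \<Longrightarrow> norm x \<le> B"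
    using compact_imp_bounded[OF cK(1)] by (auto simp: bounded_pos)
  \<comment> \<open>Depth is measured with a normal whose length \<open>N\<close> depends on the
    slope, while \<tau> is a Euclidean depth. As the width \<open>W\<close> is at most
    \<open>N * (2 * B)\<close>, the fraction \<rho> of it has Euclidean depth at most \<tau>
    whatever the slope.\<close>
  define \<rho> where "\<rho> = min (1 / 2) (\<tau> / (2 * B))"
  have \<rho>: "0 < \<rho>" "\<rho> < 1" "\<rho> * (2 * B) \<le> \<tau>"
  proof -
    show "0 < \<rho>" "\<rho> < 1" using \<tau> B by (auto simp: \<rho>_def)
    have "\<rho> \<le> \<tau> / (2 * B)" unfolding \<rho>_def by (rule min.cobounded2)
    then show "\<rho> * (2 * B) \<le> \<tau>" using B by (simp add: le_divide_eq)
  qed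
  obtain m0 where m0: "\<And>m W S A V. m \<ge> m0 \<Longrightarrow> W > 0 \<Longrightarrow>
     cap_profile p \<eta> \<rho> W S p \<Longrightarrow> cap_profile p \<eta> \<rho> W A (p * (p + 2)) \<Longrightarrow>
     (\<integral>x. S x \<partial>lborel) = 1 \<Longrightarrow> (\<integral>x. A x \<partial>lborel) > 0 \<Longrightarrow>
     (\<And>t. V t = (\<integral>x. indicator {..t} x * S x \<partial>lborel)) \<Longrightarrow>
     (\<integral>x. A x * ((1 - V x) ^ m * (real p + 1 - (real m + real p + 2) * V x)) \<partial>lborel) > 0"
    using prof[OF \<rho>(1,2)] by blast
  have "0 < (\<integral>b. A b * ((1 - P b) ^ m * (real CARD('n) - (real m + real CARD('n) + 1) * P b)) \<partial>lborel)"
    if m: "m \<ge> m0" and \<sigma>: "\<sigma> \<in> {1, -1 :: real}"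
      and A: "A = (\<lambda>b. enn2real (section_det k0 K (set_comp k0 a b)))"
      and P: "P = (\<lambda>b. measure lborel (K \<inter> {x. \<sigma> * (graph_normal k0 a \<bullet> x) < \<sigma> * b}) / measure lborel K)"
      and Ai: "integrable lborel A" "0 < (\<integral>b. A b \<partial>lborel)" for m a \<sigma> A P
  proof -
    define n where "n = graph_normal k0 a"
    \<comment> \<open>The outward direction of the cap: \<open>P\<close> measures the side where
      \<open>\<nu>\<close> is large, and level \<open>b0 + \<sigma> * t\<close> lies at depth
      \<open>t\<close> below the support point \<open>pp\<close>.\<close>
    define \<nu> where "\<nu> = (- \<sigma>) *\<^sub>R n"
    have \<sigma>2: "\<sigma> * \<sigma> = 1" "\<bar>\<sigma>\<bar> = 1" "\<sigma> \<noteq> 0" using \<sigma> by auto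
    have \<nu>0: "\<nu> \<noteq> 0" using graph_normal_nonzero[of k0 a] \<sigma>2 by (simp add: \<nu>_def n_def)
    define N where "N = norm \<nu>"
    have N: "N > 0" using \<nu>0 by (simp add: N_def)
    have n\<nu>: "n \<bullet> x = - \<sigma> * (\<nu> \<bullet> x)" for x using \<sigma>2 by (simp add: \<nu>_def mult.assoc[symmetric])
    have Kne: "K \<noteq> {}" using cK(3) by auto
    have \<nu>c: "continuous_on K (\<lambda>x. \<nu> \<bullet> x)" by (intro continuous_intros)
    obtain pp where pp: "pp \<in> K" "\<And>y. y \<in> K \<Longrightarrow> \<nu> \<bullet> y \<le> \<nu> \<bullet> pp"
      using continuous_attains_sup[OF cK(1) Kne \<nu>c] by blast
    obtain qq where qq: "qq \<in> K" "\<And>y. y \<in> K \<Longrightarrow> \<nu> \<bullet> qq \<le> \<nu> \<bullet> y"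
      using continuous_attains_inf[OF cK(1) Kne \<nu>c] by blast
    define W where "W = \<nu> \<bullet> pp - \<nu> \<bullet> qq"
    have W: "W > 0"
    proof (rule ccontr)
      assume "\<not> W > 0"
      then have "K \<subseteq> {x. \<nu> \<bullet> x = \<nu> \<bullet> pp}" using pp qq by (fastforce simp: W_def)
      then have "interior K \<subseteq> interior {x. \<nu> \<bullet> x = \<nu> \<bullet> pp}" by (rule interior_mono)
      then show False using interior_hyperplane[OF \<nu>0] cK(3) by auto
    qed
    have WB: "W \<le> N * (2 * B)"
    proof -
      have "W = \<nu> \<bullet> (pp - qq)" by (simp add: W_def inner_diff_right)
      also have "\<dots> \<le> norm \<nu> * norm (pp - qq)" by (rule norm_cauchy_schwarz)
      also have "\<dots> \<le> norm \<nu> * (norm pp + norm qq)" by (intro mult_left_mono norm_triangle_ineq4) auto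
      also have "\<dots> \<le> N * (2 * B)" unfolding N_def using B(2)[OF pp(1)] B(2)[OF qq(1)] by (intro mult_left_mono) auto
      finally show ?thesis .
    qed
    define u where "u = (1 / N) *\<^sub>R \<nu>"
    have u: "norm u = 1" using N by (simp add: u_def N_def)
    have xu: "x \<bullet> u = (\<nu> \<bullet> x) / N" for x by (simp add: u_def inner_commute)
    have \<nu>u: "\<nu> \<bullet> u = N" using N by (simp add: u_def N_def power2_norm_eq_inner[symmetric] power2_eq_square)
    define b0 where "b0 = n \<bullet> pp"
    define lev where "lev t = set_comp k0 a (b0 + \<sigma> * t)" for t
    have on_lev: "x $ k0 = graph_height k0 (lev t) x \<longleftrightarrow> \<nu> \<bullet> x = \<nu> \<bullet> pp - t" for x t
    proof -
      have "n \<bullet> x = b0 + \<sigma> * t \<longleftrightarrow> \<sigma> * (\<nu> \<bullet> x) = \<sigma> * (\<nu> \<bullet> pp - t)"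
        unfolding b0_def n\<nu> by (auto simp: algebra_simps)
      then show ?thesis unfolding lev_def on_level_iff n_def[symmetric] using \<sigma>2 by simp
    qed
    \<comment> \<open>The point where the inner normal from the support point meets level
      \<open>t\<close>; it serves as reference point of the section. Division by \<open>N\<close>
      converts \<open>t\<close> to Euclidean depth.\<close>
    define c where "c t = pp - (t / N) *\<^sub>R u" for t
    have c: "c t $ k0 = graph_height k0 (lev t) (c t)" for t
      unfolding on_lev c_def using N \<nu>u by (simp add: inner_diff_right)
    have slope: "lev s $ k = lev t $ k" if "k \<noteq> k0" for s t k using that by (simp add: lev_def set_comp_def)
    define S0 where "S0 t = enn2real (section_vol k0 K (lev t))" for t
    define A0 where "A0 t = enn2real (section_det k0 K (lev t))" for t
    have scale: "l ^ p * S0 t \<le> S0 s \<and> l ^ (p * (p + 2)) * A0 t \<le> A0 s"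
      if l: "l > 0" and sub: "\<And>x. x \<in> K \<Longrightarrow> \<nu> \<bullet> x = \<nu> \<bullet> pp - t \<Longrightarrow> c s + l *\<^sub>R (x - c t) \<in> K" for l s t
    proof -
      have "ennreal (l ^ (CARD('n) - 1)) * section_vol k0 K (lev t) \<le> section_vol k0 K (lev s)"
        "ennreal (l ^ ((CARD('n) - 1) * (CARD('n) + 1))) * section_det k0 K (lev t) \<le> section_det k0 K (lev s)"
        by (rule section_scaling[OF clK l slope c c]; use sub on_lev in blast)+
      then show ?thesis unfolding S0_def A0_def using l
        by (auto intro!: enn2real_scale_le section_finite cK simp: p(2) add.commute)
    qed
    have cone: "(s / t) ^ p * S0 t \<le> S0 s \<and> (s / t) ^ (p * (p + 2)) * A0 t \<le> A0 s" if st: "0 < s" "s \<le> t" for s t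
    proof (rule scale)
      show "s / t > 0" using st by simp
      fix x assume x: "x \<in> K"
      have "c s + (s / t) *\<^sub>R (x - c t) = (1 - s / t) *\<^sub>R pp + (s / t) *\<^sub>R x"
        using st by (simp add: c_def algebra_simps)
      also have "\<dots> \<in> K" using cK(2) pp(1) x st by (intro convexD) auto
      finally show "c s + (s / t) *\<^sub>R (x - c t) \<in> K" .
    qed
    have near: "(\<eta> * sqrt (s / t)) ^ p * S0 t \<le> S0 s \<and> (\<eta> * sqrt (s / t)) ^ (p * (p + 2)) * A0 t \<le> A0 s"
      if st: "0 < s" "s \<le> \<rho> * W" "0 < t" "t \<le> \<rho> * W" for s t
    proof (rule scale)
      show "\<eta> * sqrt (s / t) > 0" using st \<eta> by simp
      have small: "r / N \<le> \<tau>" if "r \<le> \<rho> * W" for r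
      proof -
        have "\<rho> * W \<le> \<rho> * (N * (2 * B))" using WB \<rho> by (intro mult_left_mono) auto
        also have "\<dots> = N * (\<rho> * (2 * B))" by simp
        also have "\<dots> \<le> N * \<tau>" using \<rho>(3) N by (intro mult_left_mono) auto
        finally show ?thesis using that N by (simp add: divide_le_eq mult.commute)
      qed
      fix x assume x: "x \<in> K" "\<nu> \<bullet> x = \<nu> \<bullet> pp - t"
      have "(pp - (s / N) *\<^sub>R u) + (\<eta> * sqrt ((s / N) / (t / N))) *\<^sub>R (x - (pp - (t / N) *\<^sub>R u)) \<in> K"
        using st N x pp small by (intro scal u) (auto simp: xu divide_right_mono diff_divide_distrib)
      then show "c s + (\<eta> * sqrt (s / t)) *\<^sub>R (x - c t) \<in> K" using N by (simp add: c_def)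
    qed
    have empty: "section_vol k0 K (lev t) = 0 \<and> section_det k0 K (lev t) = 0" if t: "t < 0 \<or> t > W" for t
    proof -
      have no: "graph_pt k0 (lev t) y \<notin> K" for y
      proof
        assume g: "graph_pt k0 (lev t) y \<in> K"
        have "graph_pt k0 (lev t) y $ k0 = graph_height k0 (lev t) (graph_pt k0 (lev t) y)" by (simp add: graph_pt_nth)
        then have "\<nu> \<bullet> graph_pt k0 (lev t) y = \<nu> \<bullet> pp - t" by (simp only: on_lev)
        then show False using pp(2)[OF g] qq(2)[OF g] t by (simp add: W_def)
      qed
      then show ?thesis by (simp add: section_vol_def section_det_def graph_mat_def zero_power)
    qed
    \<comment> \<open>Cutting off the levels 0 and \<open>W\<close> alters a null set only and
      provides the pointwise vanishing demanded by \<open>cap_profile\<close>.\<close>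
    define ins where "ins t = (indicator {0<..<W} t :: real)" for t :: real
    define S where "S t = ins t * S0 t / measure lborel K" for t
    define A1 where "A1 t = ins t * A0 t" for t
    have S0nn: "S0 t \<ge> 0" "A0 t \<ge> 0" for t by (auto simp: S0_def A0_def)
    have AE0: "AE t in lborel. t \<noteq> 0 \<and> t \<noteq> W" using AE_lborel_singleton[of 0] AE_lborel_singleton[of W] by eventually_elim auto
    have AES: "AE t in lborel. S t = S0 t / measure lborel K"
      using AE0
    proof eventually_elim
      case (elim t)
      then show ?case using empty[of t] by (cases "0 < t \<and> t < W") (auto simp: S_def ins_def S0_def)
    qed
    have AEA: "AE t in lborel. A1 t = A0 t"
      using AE0
    proof eventually_elim
      case (elim t)
      then show ?case using empty[of t] by (cases "0 < t \<and> t < W") (auto simp: A1_def ins_def A0_def)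
    qed
    have S0m[measurable]: "S0 \<in> borel_measurable borel"
      unfolding S0_def lev_def using measurable_section_vol[OF clK, of k0 a]
      by (intro borel_measurable_enn2real measurable_compose[of "\<lambda>t. b0 + \<sigma> * t" borel borel "\<lambda>b. section_vol k0 K (set_comp k0 a b)"]) auto
    have S0int: "integrable lborel (\<lambda>t. indicator E (b0 + \<sigma> * t) * S0 t)"
      "(\<integral>t. indicator E (b0 + \<sigma> * t) * S0 t \<partial>lborel) = measure lborel (K \<inter> {x. n \<bullet> x \<in> E})"
      if E[measurable]: "E \<in> sets borel" for E
    proof -
      have [measurable]: "(\<lambda>b. section_vol k0 K (set_comp k0 a b)) \<in> borel_measurable borel" by (rule measurable_section_vol[OF clK])
      have "(\<integral>\<^sup>+t. ennreal (indicator E (b0 + \<sigma> * t) * S0 t) \<partial>lborel) = (\<integral>\<^sup>+t. indicator E (b0 + \<sigma> * t) * section_vol k0 K (set_comp k0 a (b0 + \<sigma> * t)) \<partial>lborel)"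
        using section_finite(1)[OF cK(1)] by (intro nn_integral_cong) (simp add: S0_def lev_def ennreal_mult'' ennreal_indicator)
      also have "\<dots> = (\<integral>\<^sup>+b. indicator E b * section_vol k0 K (set_comp k0 a b) \<partial>lborel)"
        using nn_integral_real_affine[of "\<lambda>b. indicator E b * section_vol k0 K (set_comp k0 a b)" \<sigma> b0] \<sigma>2 by simp
      also have "\<dots> = emeasure lborel (K \<inter> {x. n \<bullet> x \<in> E})" unfolding n_def by (rule nn_integral_section_vol[OF clK E])
      also have "\<dots> = ennreal (measure lborel (K \<inter> {x. n \<bullet> x \<in> E}))"
        using Kfin emeasure_mono[of "K \<inter> {x. n \<bullet> x \<in> E}" K lborel] by (intro emeasure_eq_ennreal_measure) (auto simp: top_unique less_top)
      finally have nn: "(\<integral>\<^sup>+t. ennreal (indicator E (b0 + \<sigma> * t) * S0 t) \<partial>lborel) = ennreal (measure lborel (K \<inter> {x. n \<bullet> x \<in> E}))" .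
      have "has_bochner_integral lborel (\<lambda>t. indicator E (b0 + \<sigma> * t) * S0 t) (measure lborel (K \<inter> {x. n \<bullet> x \<in> E}))"
        using nn S0nn by (intro has_bochner_integral_nn_integral) (auto intro!: AE_I2)
      then show "integrable lborel (\<lambda>t. indicator E (b0 + \<sigma> * t) * S0 t)"
        "(\<integral>t. indicator E (b0 + \<sigma> * t) * S0 t \<partial>lborel) = measure lborel (K \<inter> {x. n \<bullet> x \<in> E})"
        by (auto simp: has_bochner_integral_iff)
    qed
    have [measurable]: "ins \<in> borel_measurable borel" unfolding ins_def by measurable
    have Sm[measurable]: "S \<in> borel_measurable borel" unfolding S_def by measurable
    have A0i: "integrable lborel A0" "(\<integral>t. A0 t \<partial>lborel) = (\<integral>b. A b \<partial>lborel)"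
    proof -
      have e: "A0 t = A (b0 + \<sigma> * t)" for t by (simp add: A0_def A lev_def)
      show "integrable lborel A0" unfolding e[abs_def] using lborel_integrable_real_affine[OF Ai(1) \<sigma>2(3), of b0] .
      show "(\<integral>t. A0 t \<partial>lborel) = (\<integral>b. A b \<partial>lborel)"
        unfolding e using lborel_integral_real_affine[OF \<sigma>2(3), of A b0] \<sigma>2 by simp
    qed
    have [measurable]: "A0 \<in> borel_measurable borel" using A0i(1) by (auto dest: borel_measurable_integrable)
    have A1m[measurable]: "A1 \<in> borel_measurable borel" unfolding A1_def by measurable
    have "integrable lborel A1" using A0i(1) AEA by (subst integrable_cong_AE[of A1 lborel A0]) auto
    moreover have "(\<integral>t. A1 t \<partial>lborel) > 0" using A0i(2) Ai(2) AEA integral_cong_AE[of A1 lborel A0] by auto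
    moreover have "integrable lborel S"
      using S0int(1)[of UNIV] AES by (subst integrable_cong_AE[of S lborel "\<lambda>t. S0 t / measure lborel K"]) auto
    moreover have "(\<integral>t. S t \<partial>lborel) = 1"
      using S0int(2)[of UNIV] AES Kpos integral_cong_AE[of S lborel "\<lambda>t. S0 t / measure lborel K"] by auto
    moreover have "cap_profile p \<eta> \<rho> W S p"
    proof -
      have "(s / t) ^ p * S t \<le> S s" if st: "0 < s" "s \<le> t" for s t
      proof (cases "t < W")
        case True
        then have "(s / t) ^ p * S0 t / measure lborel K \<le> S0 s / measure lborel K"
          using cone[OF st] Kpos by (intro divide_right_mono) auto
        then show ?thesis using True st by (simp add: S_def ins_def)
      qed (use st S0nn in \<open>simp add: S_def ins_def\<close>)
      moreover have "(\<eta> * sqrt (s / t)) ^ p * S t \<le> S s" if st: "0 < s" "s \<le> \<rho> * W" "0 < t" "t \<le> \<rho> * W" for s t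
      proof -
        have "\<rho> * W < W" using W \<rho> by simp
        moreover have "(\<eta> * sqrt (s / t)) ^ p * S0 t / measure lborel K \<le> S0 s / measure lborel K"
          using near[OF st] Kpos by (intro divide_right_mono) auto
        ultimately show ?thesis using st by (simp add: S_def ins_def)
      qed
      ultimately show ?thesis unfolding cap_profile_def using \<open>integrable lborel S\<close> S0nn
        by (auto simp: S_def ins_def)
    qed
    moreover have "cap_profile p \<eta> \<rho> W A1 (p * (p + 2))"
    proof -
      have "(s / t) ^ (p * (p + 2)) * A1 t \<le> A1 s" if st: "0 < s" "s \<le> t" for s t
      proof (cases "t < W")
        case True
        then show ?thesis using cone[OF st] st by (simp add: A1_def ins_def)
      qed (use st S0nn in \<open>simp add: A1_def ins_def\<close>)
      moreover have "(\<eta> * sqrt (s / t)) ^ (p * (p + 2)) * A1 t \<le> A1 s" if st: "0 < s" "s \<le> \<rho> * W" "0 < t" "t \<le> \<rho> * W" for s t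
      proof -
        have "\<rho> * W < W" using W \<rho> by simp
        then show ?thesis using near[OF st] st by (simp add: A1_def ins_def)
      qed
      ultimately show ?thesis unfolding cap_profile_def using \<open>integrable lborel A1\<close> S0nn
        by (auto simp: A1_def ins_def)
    qed
    moreover have VP: "P (b0 + \<sigma> * t) = (\<integral>x. indicator {..t} x * S x \<partial>lborel)" for t
    proof -
      \<comment> \<open>\<open>P\<close> uses a strict inequality and the distribution function a
        closed ray; they differ on the single level \<open>t\<close>.\<close>
      have "(\<integral>x. indicator {..t} x * S x \<partial>lborel) = (\<integral>x. (indicator {b. \<sigma> * b < \<sigma> * (b0 + \<sigma> * t)} (b0 + \<sigma> * x) * S0 x) / measure lborel K \<partial>lborel)"
      proof (rule integral_cong_AE)
        show "AE x in lborel. indicator {..t} x * S x = (indicator {b. \<sigma> * b < \<sigma> * (b0 + \<sigma> * t)} (b0 + \<sigma> * x) * S0 x) / measure lborel K"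
          using AES AE_lborel_singleton[of t]
        proof eventually_elim
          case (elim x)
          have "\<sigma> * (b0 + \<sigma> * x) < \<sigma> * (b0 + \<sigma> * t) \<longleftrightarrow> x < t" using \<sigma>2 by (simp add: distrib_left mult.assoc[symmetric])
          then show ?case using elim by (auto simp: indicator_def)
        qed
      qed measurable
      also have "\<dots> = measure lborel (K \<inter> {x. n \<bullet> x \<in> {b. \<sigma> * b < \<sigma> * (b0 + \<sigma> * t)}}) / measure lborel K"
        using S0int(2)[of "{b. \<sigma> * b < \<sigma> * (b0 + \<sigma> * t)}"] by simp
      finally show ?thesis by (simp add: P n_def)
    qed
    ultimately have pos: "(\<integral>x. A1 x * ((1 - P (b0 + \<sigma> * x)) ^ m * (real p + 1 - (real m + real p + 2) * P (b0 + \<sigma> * x))) \<partial>lborel) > 0"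
      using m0[of m W S A1 "\<lambda>t. P (b0 + \<sigma> * t)"] m W by blast
    have Pm: "(\<lambda>t. P (b0 + \<sigma> * t)) \<in> borel_measurable borel"
    proof -
      have "integrable lborel S" by fact
      then have "continuous_on UNIV (\<lambda>t. P (b0 + \<sigma> * t))" using VP by (rule continuous_cdf)
      then show ?thesis by (rule borel_measurable_continuous_onI)
    qed
    have "(\<integral>b. A b * ((1 - P b) ^ m * (real p + 1 - (real m + real p + 2) * P b)) \<partial>lborel)
      = (\<integral>x. A (b0 + \<sigma> * x) * ((1 - P (b0 + \<sigma> * x)) ^ m * (real p + 1 - (real m + real p + 2) * P (b0 + \<sigma> * x))) \<partial>lborel)"
      using lborel_integral_real_affine[OF \<sigma>2(3), of "\<lambda>b. A b * ((1 - P b) ^ m * (real p + 1 - (real m + real p + 2) * P b))" b0] \<sigma>2 by simp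
    also have "\<dots> = (\<integral>x. A1 x * ((1 - P (b0 + \<sigma> * x)) ^ m * (real p + 1 - (real m + real p + 2) * P (b0 + \<sigma> * x))) \<partial>lborel)"
    proof (rule integral_cong_AE)
      have e: "(\<lambda>x. A (b0 + \<sigma> * x)) = A0" by (simp add: A0_def[abs_def] A lev_def)
      show "AE x in lborel. A (b0 + \<sigma> * x) * ((1 - P (b0 + \<sigma> * x)) ^ m * (real p + 1 - (real m + real p + 2) * P (b0 + \<sigma> * x)))
        = A1 x * ((1 - P (b0 + \<sigma> * x)) ^ m * (real p + 1 - (real m + real p + 2) * P (b0 + \<sigma> * x)))"
        using AEA by eventually_elim (simp add: fun_cong[OF e, symmetric])
      show "(\<lambda>x. A (b0 + \<sigma> * x) * ((1 - P (b0 + \<sigma> * x)) ^ m * (real p + 1 - (real m + real p + 2) * P (b0 + \<sigma> * x)))) \<in> borel_measurable lborel"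
        using Pm \<open>A0 \<in> borel_measurable borel\<close>[folded e] by simp
      show "(\<lambda>x. A1 x * ((1 - P (b0 + \<sigma> * x)) ^ m * (real p + 1 - (real m + real p + 2) * P (b0 + \<sigma> * x)))) \<in> borel_measurable lborel"
        using Pm A1m by simp
    qed
    finally show ?thesis using pos p(2) by (simp add: add_ac)
  qed
  then show ?thesis by blast
qed

section \<open>Random polytopes\<close>

lemma null_affine_hull:
  fixes S :: "'a::euclidean_space set"
  assumes "finite S" "card S \<le> DIM('a)"
  shows "affine hull S \<in> null_sets lborel"
proof -
  have "aff_dim (affine hull S) < int DIM('a)"
    using aff_dim_le_card[OF assms(1)] assms(2) by simp
  then have "interior (affine hull S) = {}" using aff_dim_nonempty_interior[of "affine hull S"] by force
  then have "negligible (affine hull S)"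
    using negligible_convex_interior[of "affine hull S"] by (simp add: affine_imp_convex)
  moreover have "affine hull S \<in> sets borel" by (simp add: closed_affine_hull)
  ultimately show ?thesis by (simp add: negligible_iff_null_sets null_sets_completion_iff)
qed

text \<open>The parameter of the hyperplane through the rows of \<open>Z\<close>, written out by
  Cramer's rule so that it is visibly measurable. Where the determinant vanishes, all components are
  0 by the convention for division.\<close>

definition sol :: "'n::finite \<Rightarrow> real^'n^'n \<Rightarrow> real^'n" where
  "sol k0 Z = (\<chi> k. det (\<chi> i j. if j = k then Z $ i $ k0 else hom_mat k0 Z $ i $ j) / det (hom_mat k0 Z))"

lemma sol_eq_iff:
  assumes "det (hom_mat k0 Z) \<noteq> 0"
  shows "hom_mat k0 Z *v a = (\<chi> i. Z $ i $ k0) \<longleftrightarrow> a = sol k0 Z"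
  using cramer[OF assms, of a "\<chi> i. Z $ i $ k0"] by (simp only: sol_def vec_lambda_beta)

lemma sol_graph_mat:
  assumes "det (hom_mat k0 Y) \<noteq> 0"
  shows "sol k0 (graph_mat k0 a Y) = a"
proof -
  have "hom_mat k0 (graph_mat k0 a Y) *v a = (\<chi> i. graph_mat k0 a Y $ i $ k0)"
    by (simp add: vec_eq_iff) (simp add: graph_mat_eq_set_col set_col_def)
  then show ?thesis using sol_eq_iff[of k0 "graph_mat k0 a Y" a] assms by simp
qed

lemma sol_hyperplane:
  assumes "det (hom_mat k0 Z) \<noteq> 0"
  shows "graph_normal k0 (sol k0 Z) \<bullet> (Z $ i) = sol k0 Z $ k0"
proof -
  have "hom_mat k0 Z *v sol k0 Z = (\<chi> i. Z $ i $ k0)" using sol_eq_iff[OF assms] by blast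
  then have "(hom_mat k0 Z *v sol k0 Z) $ i = Z $ i $ k0" by simp
  moreover have "(hom_mat k0 Z *v sol k0 Z) $ i = graph_height k0 (sol k0 Z) (Z $ i)"
    by (simp add: graph_height_def matrix_vector_mult_def inner_vec_def set_comp_def hom_mat_def set_col_def mult.commute cong: if_cong)
  ultimately show ?thesis using graph_height_level[of "Z $ i" k0 "sol k0 Z"] by simp
qed

lemma borel_measurable_sol [measurable]: "sol k0 \<in> borel_measurable borel"
proof (rule borel_measurable_euclidean_space[THEN iffD2], rule ballI)
  fix b :: "real^'a" assume "b \<in> Basis"
  then obtain k where b: "b = axis k 1" by (auto simp: Basis_vec_real)
  have c1: "continuous_on UNIV (\<lambda>Z::real^'a^'a. det (\<chi> i j. if j = k then Z $ i $ k0 else hom_mat k0 Z $ i $ j))"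
  proof (intro continuous_on_det' continuous_on_vec_lambda)
    show "continuous_on UNIV (\<lambda>Z::real^'a^'a. if j = k then Z $ i $ k0 else hom_mat k0 Z $ i $ j)" for i j
      by (cases "j = k") (auto intro!: continuous_intros)
  qed
  have c2: "continuous_on UNIV (\<lambda>Z::real^'a^'a. det (hom_mat k0 Z))" by (intro continuous_intros)
  show "(\<lambda>Z. sol k0 Z \<bullet> b) \<in> borel_measurable borel"
    unfolding b inner_axis sol_def
    using borel_measurable_divide[OF borel_measurable_continuous_onI[OF c1] borel_measurable_continuous_onI[OF c2]] by simp
qed

section \<open>Independent uniform points in a compact set of positive volume\<close>

locale positive_compact =
  fixes K :: "(real^'n) set" and k0 :: 'n
  assumes compact_K: "compact K" and K_pos: "measure lborel K > 0"
begin

abbreviation \<mu> :: "(real^'n) measure" where "\<mu> \<equiv> uniform_measure lborel K"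

definition vol :: real where "vol = measure lborel K"

definition cap :: "real \<Rightarrow> real^'n \<Rightarrow> real" where
  "cap \<sigma> a = measure lborel (K \<inter> {x. \<sigma> * (graph_normal k0 a \<bullet> x) < \<sigma> * a $ k0}) / vol"

definition pts :: "('n \<Rightarrow> nat) \<Rightarrow> (nat \<Rightarrow> real^'n) \<Rightarrow> real^'n^'n" where
  "pts e X = (\<chi> i. X (e i))"

lemma K_borel [measurable]: "K \<in> sets borel"
  using compact_K by (simp add: compact_imp_closed)

lemma vol_pos: "vol > 0" using K_pos by (simp add: vol_def)

lemma emeasure_K: "emeasure lborel K = ennreal vol"
  unfolding vol_def using emeasure_bounded_finite[OF compact_imp_bounded[OF compact_K]]
  by (intro emeasure_eq_ennreal_measure) (simp add: less_top)

lemma emeasure_K_sub: "emeasure lborel (K \<inter> B) = ennreal (measure lborel (K \<inter> B))" if "B \<in> sets borel"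
  using emeasure_mono[of "K \<inter> B" K lborel] emeasure_K that
  by (intro emeasure_eq_ennreal_measure) (auto simp: top_unique)

lemma prob_space_\<mu>: "prob_space \<mu>"
  using emeasure_K vol_pos by (intro prob_space_uniform_measure) auto

sublocale prod: product_prob_space "\<lambda>_::nat. \<mu>" UNIV
  by (intro product_prob_spaceI prob_space_\<mu>)

lemma sets_PiM_\<mu>: "sets (PiM N (\<lambda>_. \<mu>)) = sets (PiM N (\<lambda>_. borel))"
  by (intro sets_PiM_cong) auto

lemma measurable_PiM_\<mu>: "f \<in> measurable (PiM N (\<lambda>_. borel)) M \<Longrightarrow> f \<in> measurable (PiM N (\<lambda>_. \<mu>)) M"
  using measurable_cong_sets[OF sets_PiM_\<mu>[of N] refl, of M] by blast

lemma space_PiM_\<mu>: "space (PiM N (\<lambda>_. \<mu>)) = space (PiM N (\<lambda>_. borel))"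
  by (simp add: space_PiM)

lemma null_\<mu>: "B \<in> null_sets lborel \<Longrightarrow> emeasure \<mu> B = 0"
  using null_set_Int1[of B lborel K]
  by (subst emeasure_uniform_measure) (auto simp: null_setsD1 null_setsD2)

lemma PiM_uniform_eq_density:
  assumes "finite I"
  shows "PiM I (\<lambda>_::'z. \<mu>) = density (PiM I (\<lambda>_. lborel)) (\<lambda>x. \<Prod>j\<in>I. indicator K (x j) / emeasure lborel K)"
proof -
  interpret U: product_sigma_finite "\<lambda>_::'z. \<mu>"
    using prob_space_\<mu> by (intro product_sigma_finite.intro prob_space_imp_sigma_finite)
  show ?thesis
  proof (rule U.PiM_eqI[symmetric])
    interpret L: product_sigma_finite "\<lambda>_::'z. lborel :: (real^'n) measure" ..
    have m: "(\<lambda>x. \<Prod>j\<in>I. indicator K (x j) / emeasure lborel K) \<in> borel_measurable (PiM I (\<lambda>_. lborel))"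
      by measurable
    show "sets (density (PiM I (\<lambda>_. lborel)) (\<lambda>x. \<Prod>j\<in>I. indicator K (x j) / emeasure lborel K)) = PiM I (\<lambda>_. \<mu>)"
      by (auto intro!: sets_PiM_cong)
    fix A :: "'z \<Rightarrow> (real^'n) set" assume A: "\<And>i. i \<in> I \<Longrightarrow> A i \<in> sets \<mu>"
    have PA: "PiE I A \<in> sets (PiM I (\<lambda>_. lborel))" using A assms by (intro sets_PiM_I_finite) auto
    have "emeasure (density (PiM I (\<lambda>_. lborel)) (\<lambda>x. \<Prod>j\<in>I. indicator K (x j) / emeasure lborel K)) (PiE I A)
       = (\<integral>\<^sup>+x. (\<Prod>j\<in>I. indicator K (x j) / emeasure lborel K) * indicator (PiE I A) x \<partial>PiM I (\<lambda>_. lborel))"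
      using m PA by (rule emeasure_density)
    also have "\<dots> = (\<integral>\<^sup>+x. (\<Prod>j\<in>I. indicator K (x j) / emeasure lborel K * indicator (A j) (x j)) \<partial>PiM I (\<lambda>_. lborel))"
    proof (rule nn_integral_cong)
      fix x assume "x \<in> space (PiM I (\<lambda>_. lborel :: (real^'n) measure))"
      then have "indicator (PiE I A) x = (\<Prod>j\<in>I. indicator (A j) (x j) :: ennreal)"
        using assms by (auto simp: space_PiM PiE_iff indicator_def prod_zero_iff)
      then show "(\<Prod>j\<in>I. indicator K (x j) / emeasure lborel K) * indicator (PiE I A) x
         = (\<Prod>j\<in>I. indicator K (x j) / emeasure lborel K * indicator (A j) (x j))" by (simp add: prod.distrib)
    qed
    also have "\<dots> = (\<Prod>j\<in>I. \<integral>\<^sup>+y. indicator K y / emeasure lborel K * indicator (A j) y \<partial>lborel)"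
      using A assms by (intro L.product_nn_integral_prod) auto
    also have "\<dots> = (\<Prod>j\<in>I. emeasure \<mu> (A j))"
      using A by (intro prod.cong refl) (auto simp: uniform_measure_def emeasure_density)
    finally show "emeasure (density (PiM I (\<lambda>_. lborel)) (\<lambda>x. \<Prod>j\<in>I. indicator K (x j) / emeasure lborel K)) (PiE I A) = (\<Prod>j\<in>I. emeasure \<mu> (A j))" .
  qed fact
qed

lemma pts_measurable:
  assumes "range e \<subseteq> I"
  shows "pts e \<in> borel_measurable (PiM I (\<lambda>_. borel))"
proof (rule borel_measurable_euclidean_space[THEN iffD2], rule ballI)
  fix b :: "real^'n^'n" assume "b \<in> Basis"
  then obtain i k where b: "b = axis i (axis k 1)" by (auto simp: Basis_vec_def)
  have "(\<lambda>a::real^'n. a $ k) \<in> borel_measurable borel"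
    by (intro borel_measurable_continuous_onI continuous_intros)
  moreover have "e i \<in> I" using assms by auto
  ultimately have "(\<lambda>x. x (e i) $ k) \<in> borel_measurable (PiM I (\<lambda>_. borel :: (real^'n) measure))"
    by (intro measurable_compose[OF measurable_component_singleton]) auto
  then show "(\<lambda>x. pts e x \<bullet> b) \<in> borel_measurable (PiM I (\<lambda>_. borel :: (real^'n) measure))"
    by (simp add: b inner_axis pts_def)
qed

definition dens :: "real^'n^'n \<Rightarrow> ennreal" where
  "dens Z = (\<Prod>i\<in>UNIV. indicator K (Z $ i)) / ennreal (vol ^ CARD('n))"

lemma borel_measurable_dens [measurable]: "dens \<in> borel_measurable borel"
proof -
  have [measurable]: "(\<lambda>Z::real^'n^'n. Z $ i) \<in> borel_measurable borel" for i
    by (intro borel_measurable_continuous_onI continuous_intros)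
  show ?thesis unfolding dens_def by measurable
qed

lemma nn_integral_pts:
  assumes e: "bij_betw e UNIV I" and [measurable]: "f \<in> borel_measurable borel"
  shows "(\<integral>\<^sup>+x. f (pts e x) \<partial>PiM I (\<lambda>_. \<mu>)) = (\<integral>\<^sup>+Z. dens Z * f Z \<partial>lborel)"
proof -
  have I: "finite I" using bij_betw_finite[OF e] by simp
  have eI: "range e \<subseteq> I" "I = range e" and inj: "inj e" using e by (auto simp: bij_betw_def)
  have pm: "pts e \<in> borel_measurable (PiM I (\<lambda>_. lborel))"
    using pts_measurable[OF eI(1)] measurable_cong_sets[OF sets_PiM_cong[of I I "\<lambda>_. lborel" "\<lambda>_. borel"] refl] by auto
  have d: "(\<Prod>j\<in>I. indicator K (x j) / emeasure lborel K) = dens (pts e x)" for x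
  proof -
    have "(\<Prod>j\<in>I. indicator K (x j) / emeasure lborel K) = (\<Prod>i\<in>UNIV. indicator K (x (e i)) / emeasure lborel K)"
      unfolding eI(2) by (simp add: prod.reindex[OF inj])
    also have "\<dots> = (\<Prod>i\<in>UNIV. indicator K (x (e i))) / ennreal (vol ^ CARD('n))"
      using vol_pos by (simp add: emeasure_K divide_ennreal_def prod.distrib inverse_ennreal ennreal_power power_inverse)
    finally show ?thesis by (simp add: dens_def pts_def)
  qed
  have "(\<integral>\<^sup>+x. f (pts e x) \<partial>PiM I (\<lambda>_. \<mu>)) = (\<integral>\<^sup>+x. dens (pts e x) * f (pts e x) \<partial>PiM I (\<lambda>_. lborel))"
    unfolding PiM_uniform_eq_density[OF I] d
    using pm by (intro nn_integral_density measurable_compose[OF pm]) auto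
  also have "\<dots> = (\<integral>\<^sup>+Z. dens Z * f Z \<partial>distr (PiM I (\<lambda>_. lborel)) borel (pts e))"
    using pm by (intro nn_integral_distr[symmetric]) auto
  also have "distr (PiM I (\<lambda>_. lborel)) borel (pts e) = lborel"
    unfolding pts_def by (rule lborel_matrix_eq_distr_PiM[OF e I, symmetric])
  finally show ?thesis .
qed

text \<open>With the other points fixed, point \<open>j\<close> would have to fall into the affine
  hull of at most \<open>d\<close> points, a null set. Fubini over point \<open>j\<close> alone
  settles one pair of \<open>I\<close> and \<open>j\<close>, and there are finitely many
  pairs.\<close>

lemma AE_general_position:
  fixes N :: "nat set"
  assumes N: "finite N"
  shows "AE X in PiM N (\<lambda>_. \<mu>). general_position X N"
proof -
  have one: "AE X in PiM N (\<lambda>_. \<mu>). X j \<notin> affine hull (X ` I)"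
    if I: "I \<subseteq> N" "j \<in> N - I" "card I \<le> CARD('n)" for I j
  proof -
    let ?A = "{X \<in> space (PiM N (\<lambda>_. \<mu>)). X j \<in> affine hull (X ` I)}"
    have A: "?A \<in> sets (PiM N (\<lambda>_. \<mu>))"
      unfolding sets_PiM_\<mu> space_PiM_\<mu> using sets_affine_hull_member[OF N I(1,2)] .
    have finI: "finite I" using I(1) N finite_subset by auto
    have Nj: "N = insert j (N - {j})" using I by auto
    have "emeasure (PiM N (\<lambda>_. \<mu>)) ?A = (\<integral>\<^sup>+X. indicator ?A X \<partial>PiM (insert j (N - {j})) (\<lambda>_. \<mu>))"
      using A Nj by simp
    also have "\<dots> = (\<integral>\<^sup>+x. \<integral>\<^sup>+y. indicator ?A (x(j := y)) \<partial>\<mu> \<partial>PiM (N - {j}) (\<lambda>_. \<mu>))"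
    proof (rule prod.product_nn_integral_insert)
      show "indicator ?A \<in> borel_measurable (PiM (insert j (N - {j})) (\<lambda>_. \<mu>))"
        unfolding Nj[symmetric] using A by (rule borel_measurable_indicator)
    qed (use N in auto)
    also have "\<dots> = (\<integral>\<^sup>+x. 0 \<partial>PiM (N - {j}) (\<lambda>_. \<mu>))"
    proof (rule nn_integral_cong)
      fix x assume x: "x \<in> space (PiM (N - {j}) (\<lambda>_. \<mu>))"
      have "card (x ` I) \<le> CARD('n)" using card_image_le[OF finI, of x] I(3) by simp
      then have null: "affine hull (x ` I) \<in> null_sets lborel" using finI by (intro null_affine_hull) auto
      have "indicator ?A (x(j := y)) \<le> (indicator (affine hull (x ` I)) y :: ennreal)" for y
      proof -
        have "(x(j := y)) ` I = x ` I" using I(2) by (auto simp: image_def)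
        then show ?thesis by (auto simp: indicator_def)
      qed
      then have "(\<integral>\<^sup>+y. indicator ?A (x(j := y)) \<partial>\<mu>) \<le> (\<integral>\<^sup>+y. indicator (affine hull (x ` I)) y \<partial>\<mu>)" by (intro nn_integral_mono)
      also have "\<dots> = 0" using null_\<mu>[OF null] null by (subst nn_integral_indicator) auto
      finally show "(\<integral>\<^sup>+y. indicator ?A (x(j := y)) \<partial>\<mu>) = 0" by simp
    qed
    finally have "?A \<in> null_sets (PiM N (\<lambda>_. \<mu>))" using A by auto
    then show ?thesis by (rule AE_I') auto
  qed
  have "AE X in PiM N (\<lambda>_. \<mu>). \<forall>I\<in>Pow N. \<forall>j\<in>N - I. card I \<le> CARD('n) \<longrightarrow> X j \<notin> affine hull (X ` I)"
    using N one by (intro AE_finite_allI) (auto intro!: AE_impI)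
  then show ?thesis by eventually_elim (auto simp: general_position_def)
qed

lemma cap_measurable [measurable]: "cap \<sigma> \<in> borel_measurable borel"
proof -
  have [measurable]: "(\<lambda>(a, x). graph_normal k0 a \<bullet> x) \<in> borel_measurable (borel \<Otimes>\<^sub>M borel)"
  proof -
    have "continuous_on UNIV (\<lambda>p::(real^'n)\<times>(real^'n). graph_normal k0 (fst p) \<bullet> snd p)"
      unfolding graph_normal_inner by (intro continuous_intros)
    then show ?thesis unfolding borel_prod case_prod_beta by (rule borel_measurable_continuous_onI)
  qed
  have [measurable]: "(\<lambda>a::real^'n. a $ k0) \<in> borel_measurable borel"
    by (intro borel_measurable_continuous_onI continuous_intros)
  have "(\<lambda>a. enn2real (\<integral>\<^sup>+x. indicator K x * indicator {p. \<sigma> * (graph_normal k0 (fst p) \<bullet> snd p) < \<sigma> * fst p $ k0} (a, x) \<partial>lborel) / vol) \<in> borel_measurable borel"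
    by measurable
  moreover have "enn2real (\<integral>\<^sup>+x. indicator K x * indicator {p. \<sigma> * (graph_normal k0 (fst p) \<bullet> snd p) < \<sigma> * fst p $ k0} (a, x) \<partial>lborel) / vol = cap \<sigma> a" for a
  proof -
    have "(\<integral>\<^sup>+x. indicator K x * indicator {p. \<sigma> * (graph_normal k0 (fst p) \<bullet> snd p) < \<sigma> * fst p $ k0} (a, x) \<partial>lborel)
      = (\<integral>\<^sup>+x. indicator (K \<inter> {x. \<sigma> * (graph_normal k0 a \<bullet> x) < \<sigma> * a $ k0}) x \<partial>lborel)"
      by (intro nn_integral_cong) (auto simp: indicator_def)
    also have "\<dots> = emeasure lborel (K \<inter> {x. \<sigma> * (graph_normal k0 a \<bullet> x) < \<sigma> * a $ k0})"
      by (subst nn_integral_indicator) auto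
    finally show ?thesis by (simp add: cap_def measure_def)
  qed
  ultimately show ?thesis by simp
qed

lemma halfspace_borel [measurable]: "{x. \<sigma> * (graph_normal k0 a \<bullet> x) < \<sigma> * b} \<in> sets borel"
  by (intro borel_open open_Collect_less continuous_intros)

lemma emeasure_cap: "emeasure \<mu> {x. \<sigma> * (graph_normal k0 a \<bullet> x) < \<sigma> * a $ k0} = ennreal (cap \<sigma> a)"
  using vol_pos by (simp add: emeasure_K emeasure_K_sub cap_def divide_ennreal)

lemma cap_bounds: "0 \<le> cap \<sigma> a" "cap \<sigma> a \<le> 1"
proof -
  show "0 \<le> cap \<sigma> a" using vol_pos by (simp add: cap_def)
  have "ennreal (cap \<sigma> a) \<le> 1"
    unfolding emeasure_cap[symmetric] using prob_space.emeasure_le_1[OF prob_space_\<mu>] .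
  then show "cap \<sigma> a \<le> 1" by simp
qed

lemma cap_complement: "cap (-1) a = 1 - cap 1 a"
proof -
  let ?n = "graph_normal k0 a"
  have "{x. ?n \<bullet> x = a $ k0} \<in> null_sets lborel"
  proof -
    have "negligible {x. ?n \<bullet> x = a $ k0}" by (intro negligible_hyperplane) (simp add: graph_normal_nonzero)
    moreover have "{x. ?n \<bullet> x = a $ k0} \<in> sets borel" by (simp add: closed_hyperplane)
    ultimately show ?thesis by (simp add: negligible_iff_null_sets null_sets_completion_iff)
  qed
  then have z: "emeasure \<mu> {x. ?n \<bullet> x = a $ k0} = 0" by (rule null_\<mu>)
  have s: "{x. ?n \<bullet> x = a $ k0} \<in> sets \<mu>" by (simp add: closed_hyperplane)
  have sp: "{x. 1 * (?n \<bullet> x) < 1 * a $ k0} \<in> sets \<mu>" "{x. -1 * (?n \<bullet> x) < -1 * a $ k0} \<in> sets \<mu>"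
    using halfspace_borel[of 1 a "a $ k0"] halfspace_borel[of "-1" a "a $ k0"] by simp_all
  note Un = finite_measure.finite_measure_Union[OF prob_space.finite_measure[OF prob_space_\<mu>]]
  have "({x. 1 * (?n \<bullet> x) < 1 * a $ k0} \<union> {x. -1 * (?n \<bullet> x) < -1 * a $ k0}) \<union> {x. ?n \<bullet> x = a $ k0} = space \<mu>" by auto
  then have "1 = measure \<mu> (({x. 1 * (?n \<bullet> x) < 1 * a $ k0} \<union> {x. -1 * (?n \<bullet> x) < -1 * a $ k0}) \<union> {x. ?n \<bullet> x = a $ k0})"
    using prob_space.prob_space[OF prob_space_\<mu>] by (simp only:)
  also have "\<dots> = measure \<mu> ({x. 1 * (?n \<bullet> x) < 1 * a $ k0} \<union> {x. -1 * (?n \<bullet> x) < -1 * a $ k0}) + measure \<mu> {x. ?n \<bullet> x = a $ k0}"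
    by (rule Un[OF sets.Un[OF sp] s]) auto
  also have "measure \<mu> ({x. 1 * (?n \<bullet> x) < 1 * a $ k0} \<union> {x. -1 * (?n \<bullet> x) < -1 * a $ k0}) = measure \<mu> {x. 1 * (?n \<bullet> x) < 1 * a $ k0} + measure \<mu> {x. -1 * (?n \<bullet> x) < -1 * a $ k0}"
    by (rule Un[OF sp]) auto
  also have "measure \<mu> {x. ?n \<bullet> x = a $ k0} = 0" unfolding measure_def z by simp
  also have "measure \<mu> {x. 1 * (?n \<bullet> x) < 1 * a $ k0} = cap 1 a" unfolding measure_def emeasure_cap using cap_bounds by simp
  also have "measure \<mu> {x. -1 * (?n \<bullet> x) < -1 * a $ k0} = cap (-1) a" unfolding measure_def emeasure_cap using cap_bounds by simp
  finally show ?thesis by simp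
qed

end

context positive_compact
begin

text \<open>Given the points with indices in \<open>I\<close>, the remaining ones are independent
  and identically distributed, so their product integrates to a power.\<close>

lemma nn_integral_pts_fold:
  fixes N I :: "nat set"
  assumes N: "finite N" "I \<subseteq> N" and e: "bij_betw e UNIV I"
    and F[measurable]: "F \<in> borel_measurable borel" and G[measurable]: "(\<lambda>(Z, y). G Z y) \<in> borel_measurable (borel \<Otimes>\<^sub>M borel)"
  shows "(\<integral>\<^sup>+X. F (pts e X) * (\<Prod>j\<in>N - I. G (pts e X) (X j)) \<partial>PiM N (\<lambda>_. \<mu>))
    = (\<integral>\<^sup>+Z. dens Z * (F Z * (\<integral>\<^sup>+y. G Z y \<partial>\<mu>) ^ card (N - I)) \<partial>lborel)"
proof -
  have finI: "finite I" using N finite_subset by auto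
  have NI: "N = I \<union> (N - I)" using N by auto
  have eI: "range e \<subseteq> I" using e by (auto simp: bij_betw_def)
  have pm: "pts e \<in> borel_measurable (PiM N (\<lambda>_. \<mu>))"
    using eI N by (intro measurable_PiM_\<mu> pts_measurable) auto
  have m: "(\<lambda>X. F (pts e X) * (\<Prod>j\<in>N - I. G (pts e X) (X j))) \<in> borel_measurable (PiM N (\<lambda>_. \<mu>))"
  proof (intro borel_measurable_times_ennreal borel_measurable_prod_ennreal)
    show "(\<lambda>X. F (pts e X)) \<in> borel_measurable (PiM N (\<lambda>_. \<mu>))" by (rule measurable_compose[OF pm F])
    fix j assume "j \<in> N - I"
    then have "(\<lambda>X. X j) \<in> measurable (PiM N (\<lambda>_. \<mu>)) borel"
      by (intro measurable_PiM_\<mu> measurable_component_singleton) auto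
    then show "(\<lambda>X. G (pts e X) (X j)) \<in> borel_measurable (PiM N (\<lambda>_. \<mu>))"
      using measurable_compose[OF measurable_Pair[OF pm] G] by simp
  qed
  have pts_merge: "pts e (merge I (N - I) (x, y)) = pts e x" for x y
    using eI by (auto simp: pts_def vec_eq_iff merge_def)
  have Gm: "(\<lambda>y. G Z y) \<in> borel_measurable \<mu>" for Z by measurable
  have "(\<integral>\<^sup>+X. F (pts e X) * (\<Prod>j\<in>N - I. G (pts e X) (X j)) \<partial>PiM (I \<union> (N - I)) (\<lambda>_. \<mu>))
    = (\<integral>\<^sup>+x. \<integral>\<^sup>+y. F (pts e x) * (\<Prod>j\<in>N - I. G (pts e x) (merge I (N - I) (x, y) j)) \<partial>PiM (N - I) (\<lambda>_. \<mu>) \<partial>PiM I (\<lambda>_. \<mu>))"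
    using N finI m NI by (subst prod.product_nn_integral_fold) (auto simp: pts_merge)
  also have "\<dots> = (\<integral>\<^sup>+x. F (pts e x) * (\<integral>\<^sup>+y. G (pts e x) y \<partial>\<mu>) ^ card (N - I) \<partial>PiM I (\<lambda>_. \<mu>))"
  proof (rule nn_integral_cong)
    fix x
    have "(\<integral>\<^sup>+y. F (pts e x) * (\<Prod>j\<in>N - I. G (pts e x) (merge I (N - I) (x, y) j)) \<partial>PiM (N - I) (\<lambda>_. \<mu>))
      = (\<integral>\<^sup>+y. F (pts e x) * (\<Prod>j\<in>N - I. G (pts e x) (y j)) \<partial>PiM (N - I) (\<lambda>_. \<mu>))"
      by (intro nn_integral_cong arg_cong2[of _ _ _ _ "(*)"] prod.cong) (auto simp: merge_def)
    also have "\<dots> = F (pts e x) * (\<integral>\<^sup>+y. (\<Prod>j\<in>N - I. G (pts e x) (y j)) \<partial>PiM (N - I) (\<lambda>_. \<mu>))"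
    proof (rule nn_integral_cmult, rule borel_measurable_prod_ennreal)
      fix j assume "j \<in> N - I"
      then have "(\<lambda>y. y j) \<in> measurable (PiM (N - I) (\<lambda>_. \<mu>)) \<mu>" by (rule measurable_component_singleton)
      from measurable_compose[OF this Gm] show "(\<lambda>y. G (pts e x) (y j)) \<in> borel_measurable (PiM (N - I) (\<lambda>_. \<mu>))" .
    qed
    also have "(\<integral>\<^sup>+y. (\<Prod>j\<in>N - I. G (pts e x) (y j)) \<partial>PiM (N - I) (\<lambda>_. \<mu>)) = (\<Prod>j\<in>N - I. \<integral>\<^sup>+y. G (pts e x) y \<partial>\<mu>)"
      using N Gm by (intro prod.product_nn_integral_prod) auto
    finally show "(\<integral>\<^sup>+y. F (pts e x) * (\<Prod>j\<in>N - I. G (pts e x) (merge I (N - I) (x, y) j)) \<partial>PiM (N - I) (\<lambda>_. \<mu>))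
      = F (pts e x) * (\<integral>\<^sup>+y. G (pts e x) y \<partial>\<mu>) ^ card (N - I)" by simp
  qed
  also have "\<dots> = (\<integral>\<^sup>+Z. dens Z * (F Z * (\<integral>\<^sup>+y. G Z y \<partial>\<mu>) ^ card (N - I)) \<partial>lborel)"
  proof (rule nn_integral_pts[OF e])
    have "(\<lambda>Z. \<integral>\<^sup>+y. G Z y \<partial>\<mu>) \<in> borel_measurable borel"
      by (rule sigma_finite_measure.borel_measurable_nn_integral[OF prob_space_imp_sigma_finite[OF prob_space_\<mu>]]) measurable
    then show "(\<lambda>Z. F Z * (\<integral>\<^sup>+y. G Z y \<partial>\<mu>) ^ card (N - I)) \<in> borel_measurable borel" by measurable
  qed
  finally show ?thesis using NI by simp
qed

lemma AE_det_pts: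
  assumes N: "finite N" "I \<subseteq> N" and e: "bij_betw e UNIV I"
  shows "AE X in PiM N (\<lambda>_. \<mu>). det (hom_mat k0 (pts e X)) \<noteq> 0"
proof -
  define D where "D = {Z::real^'n^'n. det (hom_mat k0 Z) = 0}"
  have "closed D" unfolding D_def by (intro closed_Collect_eq continuous_intros)
  then have D[measurable]: "D \<in> sets borel" by simp
  have eN: "range e \<subseteq> N" using e N by (auto simp: bij_betw_def)
  have pm: "pts e \<in> borel_measurable (PiM N (\<lambda>_. \<mu>))"
    using eN by (intro measurable_PiM_\<mu> pts_measurable)
  have "(\<integral>\<^sup>+X. indicator D (pts e X) * (\<Prod>j\<in>N - I. 1) \<partial>PiM N (\<lambda>_. \<mu>))
    = (\<integral>\<^sup>+Z. dens Z * (indicator D Z * (\<integral>\<^sup>+y. 1 \<partial>\<mu>) ^ card (N - I)) \<partial>lborel)"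
    by (rule nn_integral_pts_fold[OF N e]) measurable
  also have "\<dots> = (\<integral>\<^sup>+Z. 0 \<partial>(lborel :: (real^'n^'n) measure))"
    by (rule nn_integral_cong_AE) (use AE_det_hom_mat[of k0] in \<open>auto simp: D_def elim!: eventually_mono\<close>)
  finally have "(\<integral>\<^sup>+X. indicator D (pts e X) \<partial>PiM N (\<lambda>_. \<mu>)) = 0" by simp
  moreover have "(\<lambda>X. indicator D (pts e X) :: ennreal) \<in> borel_measurable (PiM N (\<lambda>_. \<mu>))"
    by (rule measurable_compose[OF pm]) measurable
  ultimately have "AE X in PiM N (\<lambda>_. \<mu>). indicator D (pts e X) = (0 :: ennreal)"
    by (subst (asm) nn_integral_0_iff_AE)
  then show ?thesis by eventually_elim (auto simp: D_def indicator_def split: if_splits)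
qed

text \<open>Almost surely the points of \<open>I\<close> span a hyperplane, and \<open>I\<close>
  gives a facet exactly when all other points lie on one side of it. As at least one point remains,
  the two sides are exclusive events and their probabilities add.\<close>

lemma facet_probability:
  assumes N: "finite N" "I \<subseteq> N" "card I = CARD('n)" "N - I \<noteq> {}"
  shows "(\<integral>\<^sup>+X. indicator {X. face_idx X N I} X \<partial>PiM N (\<lambda>_. \<mu>))
    = (\<integral>\<^sup>+Z. dens Z * ennreal (cap 1 (sol k0 Z) ^ card (N - I) + cap (-1) (sol k0 Z) ^ card (N - I)) \<partial>lborel)"
proof -
  have finI: "finite I" using N finite_subset by auto
  obtain e where e: "bij_betw e (UNIV :: 'n set) I"
    using finite_same_card_bij[of "UNIV :: 'n set" I] finI N by auto
  have Ie: "I = range e" using e by (auto simp: bij_betw_def)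
  define H where "H \<sigma> = {p::(real^'n)\<times>(real^'n). \<sigma> * (graph_normal k0 (fst p) \<bullet> snd p) < \<sigma> * fst p $ k0}" for \<sigma>
  have "open (H \<sigma>)" for \<sigma>
    unfolding H_def graph_normal_inner by (intro open_Collect_less continuous_intros)
  then have H[measurable]: "H \<sigma> \<in> sets (borel \<Otimes>\<^sub>M borel)" for \<sigma> unfolding borel_prod by simp
  define f where "f \<sigma> X = (\<Prod>j\<in>N - I. indicator (H \<sigma>) (sol k0 (pts e X), X j) :: ennreal)" for \<sigma> X
  have Gm: "(\<lambda>(Z, y). indicator (H \<sigma>) (sol k0 Z, y) :: ennreal) \<in> borel_measurable (borel \<Otimes>\<^sub>M borel)" for \<sigma> by measurable
  have fm: "f \<sigma> \<in> borel_measurable (PiM N (\<lambda>_. \<mu>))" for \<sigma>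
    unfolding f_def
  proof (rule borel_measurable_prod_ennreal)
    fix j assume "j \<in> N - I"
    then have 1: "(\<lambda>X. X j) \<in> measurable (PiM N (\<lambda>_. \<mu>)) borel"
      by (intro measurable_PiM_\<mu> measurable_component_singleton) auto
    have "pts e \<in> borel_measurable (PiM N (\<lambda>_. \<mu>))"
      using Ie N by (intro measurable_PiM_\<mu> pts_measurable) auto
    from measurable_compose[OF measurable_Pair[OF this 1] Gm]
    show "(\<lambda>X. indicator (H \<sigma>) (sol k0 (pts e X), X j) :: ennreal) \<in> borel_measurable (PiM N (\<lambda>_. \<mu>))" by simp
  qed
  have int: "(\<integral>\<^sup>+X. f \<sigma> X \<partial>PiM N (\<lambda>_. \<mu>)) = (\<integral>\<^sup>+Z. dens Z * ennreal (cap \<sigma> (sol k0 Z) ^ card (N - I)) \<partial>lborel)" for \<sigma>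
  proof -
    have "(\<integral>\<^sup>+X. f \<sigma> X \<partial>PiM N (\<lambda>_. \<mu>)) = (\<integral>\<^sup>+X. 1 * (\<Prod>j\<in>N - I. indicator (H \<sigma>) (sol k0 (pts e X), X j)) \<partial>PiM N (\<lambda>_. \<mu>))"
      by (simp add: f_def)
    also have "\<dots> = (\<integral>\<^sup>+Z. dens Z * (1 * (\<integral>\<^sup>+y. indicator (H \<sigma>) (sol k0 Z, y) \<partial>\<mu>) ^ card (N - I)) \<partial>lborel)"
      by (rule nn_integral_pts_fold[OF N(1,2) e _ Gm]) measurable
    also have "\<dots> = (\<integral>\<^sup>+Z. dens Z * ennreal (cap \<sigma> (sol k0 Z) ^ card (N - I)) \<partial>lborel)"
    proof -
      have "(\<integral>\<^sup>+y. indicator (H \<sigma>) (sol k0 Z, y) \<partial>\<mu>) = ennreal (cap \<sigma> (sol k0 Z))" for Z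
      proof -
        have "(\<integral>\<^sup>+y. indicator (H \<sigma>) (sol k0 Z, y) \<partial>\<mu>) = (\<integral>\<^sup>+y. indicator {x. \<sigma> * (graph_normal k0 (sol k0 Z) \<bullet> x) < \<sigma> * sol k0 Z $ k0} y \<partial>\<mu>)"
          by (intro nn_integral_cong) (auto simp: H_def indicator_def)
        also have "\<dots> = emeasure \<mu> {x. \<sigma> * (graph_normal k0 (sol k0 Z) \<bullet> x) < \<sigma> * sol k0 Z $ k0}"
          by (rule nn_integral_indicator) (use halfspace_borel in simp)
        finally show ?thesis by (simp only: emeasure_cap)
      qed
      then show ?thesis using cap_bounds by (simp add: ennreal_power)
    qed
    finally show ?thesis .
  qed
  have "AE X in PiM N (\<lambda>_. \<mu>). indicator {X. face_idx X N I} X = f 1 X + f (-1) X"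
    using AE_general_position[OF N(1)] AE_det_pts[OF N(1,2) e]
  proof eventually_elim
    case (elim X)
    let ?a = "sol k0 (pts e X)" and ?n = "graph_normal k0 (sol k0 (pts e X))"
    have on: "?n \<bullet> X i = ?a $ k0" if i: "i \<in> I" for i
    proof -
      obtain i' where "i = e i'" using i Ie by blast
      then show ?thesis using sol_hyperplane[OF elim(2), of i'] by (simp add: pts_def)
    qed
    have "affine hull (X ` I) = {x. ?n \<bullet> x = ?a $ k0}"
      by (rule general_position_facet_hyperplane[OF elim(1) N(1,2) _ graph_normal_nonzero on]) (use N in auto)
    then have F: "face_idx X N I \<longleftrightarrow> (\<forall>j\<in>N - I. ?n \<bullet> X j < ?a $ k0) \<or> (\<forall>j\<in>N - I. ?n \<bullet> X j > ?a $ k0)"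
      by (rule face_idx_iff_one_sided[OF N(2)])
    have fi: "f \<sigma> X = (if \<forall>j\<in>N - I. \<sigma> * (?n \<bullet> X j) < \<sigma> * ?a $ k0 then 1 else 0)" for \<sigma>
      unfolding f_def using N(1) by (auto simp: H_def indicator_def prod_zero_iff)
    obtain j where "j \<in> N - I" using N(4) by blast
    then have "\<not> ((\<forall>j\<in>N - I. ?n \<bullet> X j < ?a $ k0) \<and> (\<forall>j\<in>N - I. ?n \<bullet> X j > ?a $ k0))" by force
    then show ?case unfolding fi using F by (auto simp: indicator_def)
  qed
  then have "(\<integral>\<^sup>+X. indicator {X. face_idx X N I} X \<partial>PiM N (\<lambda>_. \<mu>)) = (\<integral>\<^sup>+X. f 1 X + f (-1) X \<partial>PiM N (\<lambda>_. \<mu>))"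
    by (rule nn_integral_cong_AE)
  also have "\<dots> = (\<integral>\<^sup>+X. f 1 X \<partial>PiM N (\<lambda>_. \<mu>)) + (\<integral>\<^sup>+X. f (-1) X \<partial>PiM N (\<lambda>_. \<mu>))"
    by (rule nn_integral_add[OF fm fm])
  also have "\<dots> = (\<integral>\<^sup>+Z. dens Z * ennreal (cap 1 (sol k0 Z) ^ card (N - I)) + dens Z * ennreal (cap (-1) (sol k0 Z) ^ card (N - I)) \<partial>lborel)"
    unfolding int by (intro nn_integral_add[symmetric]) measurable
  also have "\<dots> = (\<integral>\<^sup>+Z. dens Z * ennreal (cap 1 (sol k0 Z) ^ card (N - I) + cap (-1) (sol k0 Z) ^ card (N - I)) \<partial>lborel)"
    using cap_bounds by (intro nn_integral_cong) (simp add: ennreal_plus distrib_left)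
  finally show ?thesis .
qed

text \<open>The density of the parameter of the hyperplane through \<open>d\<close> independent
  points, as \<open>nn_integral_dens_sol\<close> shows.\<close>

definition hweight :: "real^'n \<Rightarrow> real" where
  "hweight a = enn2real (section_det k0 K a) / vol ^ CARD('n)"

lemma measurable_section_det [measurable]: "section_det k0 K \<in> borel_measurable borel"
proof -
  have "closed (unit_col k0)" unfolding unit_col_def atLeastAtMost_iff
    by (intro closed_Collect_all closed_Collect_conj closed_Collect_le continuous_intros)
  then have [measurable]: "unit_col k0 \<in> sets borel" by simp
  have [measurable]: "(\<lambda>(a, Y). graph_mat k0 a Y $ i) \<in> borel_measurable (borel \<Otimes>\<^sub>M borel)" for i
    unfolding borel_prod case_prod_beta by (intro borel_measurable_continuous_onI continuous_intros)
  have [measurable]: "(\<lambda>Y::real^'n^'n. det (hom_mat k0 Y)) \<in> borel_measurable borel"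
    by (intro borel_measurable_continuous_onI continuous_intros)
  show ?thesis unfolding section_det_def by measurable
qed

lemma hweight_measurable [measurable]: "hweight \<in> borel_measurable borel"
  unfolding hweight_def by measurable

lemma hweight_nonneg: "hweight a \<ge> 0" using vol_pos by (simp add: hweight_def)

text \<open>The hyperplane parametrisation applied to a function of the spanned hyperplane:
  \<open>sol\<close> recovers \<open>a\<close> except where the determinant vanishes, and there the
  integrand is 0 because it contains the determinant as a factor.\<close>

lemma nn_integral_dens_sol:
  assumes [measurable]: "h \<in> borel_measurable borel" and h0: "\<And>a. h a \<ge> 0"
  shows "(\<integral>\<^sup>+Z. dens Z * ennreal (h (sol k0 Z)) \<partial>lborel) = (\<integral>\<^sup>+a. ennreal (hweight a * h a) \<partial>lborel)"
proof -
  have "(\<integral>\<^sup>+Z. dens Z * ennreal (h (sol k0 Z)) \<partial>lborel) = (\<integral>\<^sup>+a. \<integral>\<^sup>+Y. indicator (unit_col k0) Y *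
     (ennreal \<bar>det (hom_mat k0 Y)\<bar> * (dens (graph_mat k0 a Y) * ennreal (h (sol k0 (graph_mat k0 a Y))))) \<partial>lborel \<partial>lborel)"
    by (rule nn_integral_hyperplane_param) measurable
  also have "\<dots> = (\<integral>\<^sup>+a. ennreal (hweight a * h a) \<partial>lborel)"
  proof (rule nn_integral_cong)
    fix a
    have "closed (unit_col k0)" unfolding unit_col_def atLeastAtMost_iff
      by (intro closed_Collect_all closed_Collect_conj closed_Collect_le continuous_intros)
    then have [measurable]: "unit_col k0 \<in> sets borel" by simp
    have [measurable]: "(\<lambda>Y::real^'n^'n. graph_mat k0 a Y $ i) \<in> borel_measurable borel" for i
      by (intro borel_measurable_continuous_onI continuous_intros)
    have [measurable]: "(\<lambda>Y::real^'n^'n. det (hom_mat k0 Y)) \<in> borel_measurable borel"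
      by (intro borel_measurable_continuous_onI continuous_intros)
    have "(\<integral>\<^sup>+Y. indicator (unit_col k0) Y * (ennreal \<bar>det (hom_mat k0 Y)\<bar> * (dens (graph_mat k0 a Y) * ennreal (h (sol k0 (graph_mat k0 a Y))))) \<partial>lborel)
      = (\<integral>\<^sup>+Y. (ennreal (h a) / ennreal (vol ^ CARD('n))) * (indicator (unit_col k0) Y * (ennreal \<bar>det (hom_mat k0 Y)\<bar> * (\<Prod>i\<in>UNIV. indicator K (graph_mat k0 a Y $ i)))) \<partial>lborel)"
    proof (rule nn_integral_cong)
      fix Y
      show "indicator (unit_col k0) Y * (ennreal \<bar>det (hom_mat k0 Y)\<bar> * (dens (graph_mat k0 a Y) * ennreal (h (sol k0 (graph_mat k0 a Y)))))
        = (ennreal (h a) / ennreal (vol ^ CARD('n))) * (indicator (unit_col k0) Y * (ennreal \<bar>det (hom_mat k0 Y)\<bar> * (\<Prod>i\<in>UNIV. indicator K (graph_mat k0 a Y $ i))))"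
      proof (cases "det (hom_mat k0 Y) = 0")
        case False
        then show ?thesis by (simp add: sol_graph_mat dens_def divide_ennreal_def mult_ac)
      qed simp
    qed
    also have "\<dots> = (ennreal (h a) / ennreal (vol ^ CARD('n))) * section_det k0 K a"
      unfolding section_det_def by (rule nn_integral_cmult) measurable
    also have "\<dots> = (ennreal (h a) / ennreal (vol ^ CARD('n))) * ennreal (enn2real (section_det k0 K a))"
      using section_finite(2)[OF compact_K] by simp
    also have "\<dots> = ennreal (hweight a * h a)"
      using vol_pos h0[of a] by (simp add: hweight_def divide_ennreal ennreal_mult'[symmetric] mult.commute)
    finally show "(\<integral>\<^sup>+Y. indicator (unit_col k0) Y * (ennreal \<bar>det (hom_mat k0 Y)\<bar> * (dens (graph_mat k0 a Y) * ennreal (h (sol k0 (graph_mat k0 a Y))))) \<partial>lborel)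
      = ennreal (hweight a * h a)" .
  qed
  finally show ?thesis .
qed

text \<open>For the constant function 1 the transfer from points to hyperplanes computes the total
  mass of a probability measure.\<close>

lemma hweight_integral: "has_bochner_integral lborel hweight 1"
proof -
  obtain e :: "'n \<Rightarrow> nat" where e: "bij_betw e UNIV {..<CARD('n)}"
    using finite_same_card_bij[of "UNIV :: 'n set" "{..<CARD('n)}"] by auto
  have "(\<integral>\<^sup>+a. ennreal (hweight a) \<partial>lborel) = (\<integral>\<^sup>+Z. dens Z * 1 \<partial>lborel)"
    using nn_integral_dens_sol[of "\<lambda>_. 1"] by simp
  also have "\<dots> = (\<integral>\<^sup>+x. 1 \<partial>PiM {..<CARD('n)} (\<lambda>_. \<mu>))"
    using nn_integral_pts[OF e, of "\<lambda>_. 1"] by simp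
  also have "\<dots> = 1"
  proof -
    have "prob_space (PiM {..<CARD('n)} (\<lambda>_. \<mu>))" by (intro prob_space_PiM prob_space_\<mu>)
    from prob_space.emeasure_space_1[OF this] show ?thesis by simp
  qed
  finally show ?thesis using hweight_nonneg by (intro has_bochner_integral_nn_integral) auto
qed

text \<open>Linearity of expectation over the index sets of size \<open>d\<close>, which all have
  the same facet probability. The bound on \<open>n\<close> guarantees a point outside every
  candidate facet. Ridges follow from the almost sure incidence count.\<close>

lemma expected_facets:
  assumes n: "n \<ge> CARD('n) + 1" and d: "CARD('n) \<ge> 2"
  shows "expected_faces K n (int CARD('n) - 1) =
     real (n choose CARD('n)) * (\<integral>a. hweight a * (cap 1 a ^ (n - CARD('n)) + cap (-1) a ^ (n - CARD('n))) \<partial>lborel)"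
    and "2 * expected_faces K n (int CARD('n) - 2) = real CARD('n) * expected_faces K n (int CARD('n) - 1)"
proof -
  let ?N = "{..<n}" and ?M = "PiM {..<n} (\<lambda>_. \<mu>)"
  have fm: "(\<lambda>X. real (f_count i (convex hull (X ` ?N) :: (real^'n) set))) \<in> borel_measurable ?M" for i
    by (intro measurable_PiM_\<mu> borel_measurable_f_count) auto
  have gp: "AE X in ?M. general_position X ?N" by (rule AE_general_position) auto
  define h where "h a = cap 1 a ^ (n - CARD('n)) + cap (-1) a ^ (n - CARD('n))" for a
  have [measurable]: "h \<in> borel_measurable borel" unfolding h_def by measurable
  have h0: "h a \<ge> 0" for a using cap_bounds by (simp add: h_def)
  let ?\<I> = "{I. I \<subseteq> ?N \<and> card I = CARD('n)}"
  have fin: "finite ?\<I>" by simp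
  have im: "(\<lambda>X. indicator {X. face_idx X ?N I} X :: ennreal) \<in> borel_measurable ?M" for I
  proof -
    have "{X \<in> space ?M. face_idx X ?N I} \<in> sets ?M"
      unfolding sets_PiM_\<mu> space_PiM_\<mu> by (rule sets_face_idx) simp
    then have "(\<lambda>X. indicator {X \<in> space ?M. face_idx X ?N I} X :: ennreal) \<in> borel_measurable ?M" by (rule borel_measurable_indicator)
    then show ?thesis by (rule measurable_cong[THEN iffD1, rotated]) (auto simp: indicator_def)
  qed
  have "(\<integral>\<^sup>+X. ennreal (real (f_count (int CARD('n) - 1) (convex hull (X ` ?N)))) \<partial>?M) = (\<integral>\<^sup>+X. (\<Sum>I\<in>?\<I>. indicator {X. face_idx X ?N I} X) \<partial>?M)"
  proof (rule nn_integral_cong_AE)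
    show "AE X in ?M. ennreal (real (f_count (int CARD('n) - 1) (convex hull (X ` ?N)))) = (\<Sum>I\<in>?\<I>. indicator {X. face_idx X ?N I} X)"
      using gp
    proof eventually_elim
      case (elim X)
      have "f_count (int CARD('n) - 1) (convex hull (X ` ?N)) = card {I. face_idx X ?N I \<and> card I = CARD('n)}"
        using general_position_f_count(1)[OF elim] n d by simp
      also have "{I. face_idx X ?N I \<and> card I = CARD('n)} = {I \<in> ?\<I>. face_idx X ?N I}" by (auto simp: face_idx_def)
      finally have "f_count (int CARD('n) - 1) (convex hull (X ` ?N)) = card {I \<in> ?\<I>. face_idx X ?N I}" .
      moreover have "(\<Sum>I\<in>?\<I>. indicator {X. face_idx X ?N I} X :: ennreal) = of_nat (card {I \<in> ?\<I>. face_idx X ?N I})"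
        using fin by (simp add: indicator_def sum.If_cases Int_def)
      ultimately show ?case by (simp add: ennreal_of_nat_eq_real_of_nat)
    qed
  qed
  also have "\<dots> = (\<Sum>I\<in>?\<I>. \<integral>\<^sup>+X. indicator {X. face_idx X ?N I} X \<partial>?M)" by (intro nn_integral_sum im)
  also have "\<dots> = (\<Sum>I\<in>?\<I>. \<integral>\<^sup>+Z. dens Z * ennreal (h (sol k0 Z)) \<partial>lborel)"
  proof (rule sum.cong[OF refl])
    fix I assume "I \<in> ?\<I>"
    then have I: "I \<subseteq> ?N" "card I = CARD('n)" by auto
    have c: "card (?N - I) = n - CARD('n)" using I finite_subset[OF I(1)] by (simp add: card_Diff_subset)
    then have "?N - I \<noteq> {}" using n by (metis card.empty diff_is_0_eq not_less_eq_eq Suc_eq_plus1)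
    then show "(\<integral>\<^sup>+X. indicator {X. face_idx X ?N I} X \<partial>?M) = (\<integral>\<^sup>+Z. dens Z * ennreal (h (sol k0 Z)) \<partial>lborel)"
      unfolding h_def c[symmetric] using I by (intro facet_probability) auto
  qed
  also have "\<dots> = of_nat (n choose CARD('n)) * (\<integral>\<^sup>+a. ennreal (hweight a * h a) \<partial>lborel)"
    using n_subsets[of ?N "CARD('n)"] nn_integral_dens_sol[of h] h0 by simp
  finally have nn: "(\<integral>\<^sup>+X. ennreal (real (f_count (int CARD('n) - 1) (convex hull (X ` ?N)))) \<partial>?M)
     = of_nat (n choose CARD('n)) * (\<integral>\<^sup>+a. ennreal (hweight a * h a) \<partial>lborel)" .
  have "expected_faces K n (int CARD('n) - 1) = enn2real (\<integral>\<^sup>+X. ennreal (real (f_count (int CARD('n) - 1) (convex hull (X ` ?N)))) \<partial>?M)"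
    unfolding expected_faces_def by (rule integral_eq_nn_integral[OF fm]) simp
  also have "\<dots> = real (n choose CARD('n)) * enn2real (\<integral>\<^sup>+a. ennreal (hweight a * h a) \<partial>lborel)"
    unfolding nn by (simp add: enn2real_mult)
  also have "enn2real (\<integral>\<^sup>+a. ennreal (hweight a * h a) \<partial>lborel) = (\<integral>a. hweight a * h a \<partial>lborel)"
    using hweight_nonneg h0 by (intro integral_eq_nn_integral[symmetric]) auto
  finally show "expected_faces K n (int CARD('n) - 1) =
     real (n choose CARD('n)) * (\<integral>a. hweight a * (cap 1 a ^ (n - CARD('n)) + cap (-1) a ^ (n - CARD('n))) \<partial>lborel)"
    by (simp add: h_def)
  have "(\<integral>X. 2 * real (f_count (int CARD('n) - 2) (convex hull (X ` ?N))) \<partial>?M)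
     = (\<integral>X. real CARD('n) * real (f_count (int CARD('n) - 1) (convex hull (X ` ?N))) \<partial>?M)"
  proof (rule integral_cong_AE)
    show "AE X in ?M. 2 * real (f_count (int CARD('n) - 2) (convex hull (X ` ?N))) = real CARD('n) * real (f_count (int CARD('n) - 1) (convex hull (X ` ?N)))"
      using gp
    proof eventually_elim
      case (elim X)
      have "2 * f_count (int CARD('n) - 2) (convex hull (X ` ?N)) = CARD('n) * f_count (int CARD('n) - 1) (convex hull (X ` ?N))"
        using general_position_f_count[OF elim] n d by simp
      then show ?case by (metis of_nat_mult of_nat_numeral)
    qed
  qed (use fm in measurable)
  then show "2 * expected_faces K n (int CARD('n) - 2) = real CARD('n) * expected_faces K n (int CARD('n) - 1)"
    by (simp add: expected_faces_def)
qed

end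

section \<open>Monotonicity\<close>

text \<open>The splitting of one coordinate for functions of either sign. Integrability has to be
  carried along, and for the inner functions it is known only at almost every slope.\<close>

lemma integral_split_comp:
  fixes f :: "real^'n \<Rightarrow> real" and k0 :: "'n::finite"
  assumes f: "integrable lborel f"
  defines "Q \<equiv> {a::real^'n. a $ k0 \<in> {0..1}}"
  shows "AE a in lborel. a \<in> Q \<longrightarrow> integrable lborel (\<lambda>b. f (set_comp k0 a b))"
    and "integrable lborel (\<lambda>a. indicator Q a * (\<integral>b. f (set_comp k0 a b) \<partial>lborel))"
    and "(\<integral>a. f a \<partial>lborel) = (\<integral>a. indicator Q a * (\<integral>b. f (set_comp k0 a b) \<partial>lborel) \<partial>lborel)"
proof -
  have [measurable]: "f \<in> borel_measurable borel" using f by (auto dest: borel_measurable_integrable)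
  define g where "g p = f (fst p) * indicator {0..1::real} (snd p)" for p
  define T where "T = (\<lambda>(a, b). (set_comp k0 a b, a $ k0))"
  have T[measurable]: "T \<in> borel_measurable borel"
    unfolding T_def case_prod_beta by (intro borel_measurable_continuous_onI continuous_intros)
  have gm: "g \<in> borel_measurable (lborel \<Otimes>\<^sub>M lborel)" unfolding g_def by measurable
  have gi: "integrable (lborel \<Otimes>\<^sub>M lborel) g"
  proof (rule lborel_pair.Fubini_integrable[OF gm])
    show "integrable lborel (\<lambda>x. \<integral>y. norm (g (x, y)) \<partial>lborel)" using f by (simp add: g_def abs_mult)
    show "AE x in lborel. integrable lborel (\<lambda>y. g (x, y))" by (simp add: g_def integrable_indicator_iff)
  qed
  have gint: "(\<integral>p. g p \<partial>(lborel \<Otimes>\<^sub>M lborel)) = (\<integral>a. f a \<partial>lborel)"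
    unfolding lborel_pair.integral_fst'[OF gi, symmetric] by (simp add: g_def)
  have dist: "distr lborel borel T = lborel" unfolding T_def by (rule lborel_swap_comp)
  have gb: "g \<in> borel_measurable borel" using gm by (simp add: lborel_prod)
  have "integrable (distr lborel borel T) g" unfolding dist using gi by (simp add: lborel_prod)
  then have gTi: "integrable (lborel \<Otimes>\<^sub>M lborel) (\<lambda>p. g (T p))"
    unfolding lborel_prod using gb by (subst (asm) integrable_distr_eq) auto
  have "(\<integral>p. g (T p) \<partial>(lborel \<Otimes>\<^sub>M lborel)) = (\<integral>p. g (T p) \<partial>lborel)" by (simp only: lborel_prod)
  also have "\<dots> = (\<integral>p. g p \<partial>distr lborel borel T)" using gb by (intro integral_distr[symmetric]) auto
  also have "\<dots> = (\<integral>p. g p \<partial>(lborel \<Otimes>\<^sub>M lborel))" by (simp only: dist lborel_prod)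
  also note gint
  finally have gTint: "(\<integral>p. g (T p) \<partial>(lborel \<Otimes>\<^sub>M lborel)) = (\<integral>a. f a \<partial>lborel)" .
  have gT: "g (T (a, b)) = indicator Q a * f (set_comp k0 a b)" for a b
    by (simp add: g_def T_def Q_def indicator_def)
  have "AE a in lborel. integrable lborel (\<lambda>b. g (T (a, b)))" by (rule lborel_pair.AE_integrable_fst'[OF gTi])
  then show "AE a in lborel. a \<in> Q \<longrightarrow> integrable lborel (\<lambda>b. f (set_comp k0 a b))"
    unfolding gT by eventually_elim auto
  show "integrable lborel (\<lambda>a. indicator Q a * (\<integral>b. f (set_comp k0 a b) \<partial>lborel))"
    using lborel_pair.integrable_fst'[OF gTi] unfolding gT by simp
  show "(\<integral>a. f a \<partial>lborel) = (\<integral>a. indicator Q a * (\<integral>b. f (set_comp k0 a b) \<partial>lborel) \<partial>lborel)"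
    using lborel_pair.integral_fst'[OF gTi] unfolding gT gTint by simp
qed

context positive_compact
begin

lemma integrable_hweight_bounded:
  assumes [measurable]: "h \<in> borel_measurable borel" and h: "\<And>a. \<bar>h a\<bar> \<le> C"
  shows "integrable lborel (\<lambda>a. hweight a * h a)"
proof (rule Bochner_Integration.integrable_bound)
  show "integrable lborel (\<lambda>a. C * hweight a)" using hweight_integral by (simp add: has_bochner_integral_iff)
  show "AE a in lborel. norm (hweight a * h a) \<le> norm (C * hweight a)"
  proof (rule AE_I2)
    fix a
    have "\<bar>h a\<bar> * hweight a \<le> C * hweight a" using h hweight_nonneg by (intro mult_right_mono)
    then show "norm (hweight a * h a) \<le> norm (C * hweight a)"
      using hweight_nonneg[of a] order_trans[OF abs_ge_zero h] by (simp add: abs_mult mult.commute)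
  qed
qed measurable

text \<open>Along each slope the inner integral \<open>F\<close> is positive unless the slope
  carries no weight. The total is strictly positive since the weight \<open>H\<close> per slope has
  integral 1 and so cannot vanish almost everywhere.\<close>

lemma hweight_cap_integral_pos:
  fixes m :: nat and \<sigma> :: real
  defines "g \<equiv> \<lambda>v. (1 - v) ^ m * (real CARD('n) - (real m + real CARD('n) + 1) * v)"
  assumes pos: "\<And>a A P. A = (\<lambda>b. enn2real (section_det k0 K (set_comp k0 a b))) \<Longrightarrow>
    P = (\<lambda>b. measure lborel (K \<inter> {x. \<sigma> * (graph_normal k0 a \<bullet> x) < \<sigma> * b}) / measure lborel K) \<Longrightarrow>
    integrable lborel A \<Longrightarrow> 0 < (\<integral>b. A b \<partial>lborel) \<Longrightarrow> 0 < (\<integral>b. A b * g (P b) \<partial>lborel)"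
  shows "integrable lborel (\<lambda>a. hweight a * g (cap \<sigma> a))" "0 < (\<integral>a. hweight a * g (cap \<sigma> a) \<partial>lborel)"
proof -
  define N where "N = real m + real CARD('n) + 1"
  have gc: "continuous_on UNIV g" unfolding g_def by (intro continuous_intros)
  have [measurable]: "g \<in> borel_measurable borel" using gc by (rule borel_measurable_continuous_onI)
  have gb: "\<bar>g v\<bar> \<le> N" if "0 \<le> v" "v \<le> 1" for v
  proof -
    have "N \<ge> 0" "real CARD('n) \<le> N" by (auto simp: N_def)
    moreover from this have "0 \<le> N * v" "N * v \<le> N" using that by (auto simp: mult_left_le)
    ultimately have "\<bar>real CARD('n) - N * v\<bar> \<le> N" by linarith
    moreover have "\<bar>(1 - v) ^ m\<bar> \<le> 1" using that by (simp add: power_le_one)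
    ultimately have "\<bar>(1 - v) ^ m\<bar> * \<bar>real CARD('n) - N * v\<bar> \<le> 1 * N" by (intro mult_mono) auto
    then show ?thesis by (simp add: g_def N_def abs_mult)
  qed
  let ?f = "\<lambda>a. hweight a * g (cap \<sigma> a)"
  show fi: "integrable lborel ?f" using gb cap_bounds by (intro integrable_hweight_bounded[where C = N]) auto
  have hi: "integrable lborel hweight" "(\<integral>a. hweight a \<partial>lborel) = 1" using hweight_integral by (auto simp: has_bochner_integral_iff)
  define Q where "Q = {a::real^'n. a $ k0 \<in> {0..1}}"
  define H where "H a = indicator Q a * (\<integral>b. hweight (set_comp k0 a b) \<partial>lborel)" for a
  define F where "F a = indicator Q a * (\<integral>b. ?f (set_comp k0 a b) \<partial>lborel)" for a
  have H1: "(\<integral>a. H a \<partial>lborel) = 1" unfolding H_def Q_def using integral_split_comp(3)[OF hi(1), of k0] hi(2) by simp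
  have F1: "integrable lborel F" "(\<integral>a. F a \<partial>lborel) = (\<integral>a. ?f a \<partial>lborel)"
    unfolding F_def Q_def using integral_split_comp(2,3)[OF fi, of k0] by simp_all
  have FH: "AE a in lborel. F a \<ge> 0 \<and> (F a = 0 \<longrightarrow> H a = 0)"
    using integral_split_comp(1)[OF hi(1), of k0]
  proof eventually_elim
    case (elim a)
    show ?case
    proof (cases "a \<in> Q")
      case True
      then have hai: "integrable lborel (\<lambda>b. hweight (set_comp k0 a b))" using elim by (simp add: Q_def)
      define A where "A = (\<lambda>b. enn2real (section_det k0 K (set_comp k0 a b)))"
      define P where "P = (\<lambda>b. measure lborel (K \<inter> {x. \<sigma> * (graph_normal k0 a \<bullet> x) < \<sigma> * b}) / measure lborel K)"
      have hA: "hweight (set_comp k0 a b) = A b / vol ^ CARD('n)" for b by (simp add: hweight_def A_def)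
      have cP: "cap \<sigma> (set_comp k0 a b) = P b" for b by (simp add: cap_def P_def vol_def)
      have volp: "vol ^ CARD('n) > 0" using vol_pos by simp
      have "integrable lborel (\<lambda>b. hweight (set_comp k0 a b) * vol ^ CARD('n))" using hai by simp
      then have Ai: "integrable lborel A" unfolding hA using vol_pos by simp
      have Ha: "H a = (\<integral>b. A b \<partial>lborel) / vol ^ CARD('n)" using True by (simp add: H_def hA)
      have Fa: "F a = (\<integral>b. A b * g (P b) \<partial>lborel) / vol ^ CARD('n)" using True by (simp add: F_def hA cP)
      have Ann: "A b \<ge> 0" for b by (simp add: A_def)
      show ?thesis
      proof (cases "0 < (\<integral>b. A b \<partial>lborel)")
        case True
        then show ?thesis using pos[OF A_def P_def Ai True] vol_pos Fa by simp
      next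
        case False
        moreover have "0 \<le> (\<integral>b. A b \<partial>lborel)" using Ann by (intro integral_nonneg_AE) auto
        ultimately have z: "(\<integral>b. A b \<partial>lborel) = 0" by simp
        then have "AE b in lborel. A b = 0" using integral_nonneg_eq_0_iff_AE[OF Ai] Ann by simp
        then have "AE b in lborel. A b * g (P b) = 0" by eventually_elim simp
        then have "(\<integral>b. A b * g (P b) \<partial>lborel) = 0" by (rule integral_eq_zero_AE)
        then show ?thesis using z Ha Fa by simp
      qed
    qed (simp add: F_def H_def)
  qed
  have "(\<integral>a. F a \<partial>lborel) \<ge> 0" using FH by (intro integral_nonneg_AE) (auto elim: eventually_mono)
  moreover have "(\<integral>a. F a \<partial>lborel) \<noteq> 0"
  proof
    assume "(\<integral>a. F a \<partial>lborel) = 0"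
    moreover have "AE a in lborel. 0 \<le> F a" using FH by eventually_elim simp
    ultimately have "AE a in lborel. F a = 0" using integral_nonneg_eq_0_iff_AE[OF F1(1)] by simp
    with FH have "AE a in lborel. H a = 0" by eventually_elim simp
    then have "(\<integral>a. H a \<partial>lborel) = 0" by (rule integral_eq_zero_AE)
    then show False using H1 by simp
  qed
  ultimately show "0 < (\<integral>a. ?f a \<partial>lborel)" unfolding F1(2)[symmetric] by simp
qed

end

theorem theorem2:
  fixes K :: "(real^'n) set"
  assumes "CARD('n) \<ge> 2"
    and "smooth_convex_body K"
  shows "\<exists>nK::nat. \<forall>n\<ge>nK. \<forall>i \<in> {int CARD('n) - 2, int CARD('n) - 1}.
           expected_faces K (Suc n) i > expected_faces K n i"
proof -
  have cK: "compact K" "interior K \<noteq> {}" using assms(2) by (auto simp: smooth_convex_body_def convex_body_def)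
  define k0 :: 'n where "k0 = undefined"
  interpret positive_compact K k0
    using cK measure_compact_pos by unfold_locales auto
  let ?d = "CARD('n)"
  let ?g = "\<lambda>m v. (1 - v) ^ m * (real ?d - (real m + real ?d + 1) * v)"
  obtain m0 where m0: "\<And>m a \<sigma> A P. m \<ge> m0 \<Longrightarrow> \<sigma> \<in> {1, -1 :: real} \<Longrightarrow>
    A = (\<lambda>b. enn2real (section_det k0 K (set_comp k0 a b))) \<Longrightarrow>
    P = (\<lambda>b. measure lborel (K \<inter> {x. \<sigma> * (graph_normal k0 a \<bullet> x) < \<sigma> * b}) / measure lborel K) \<Longrightarrow>
    integrable lborel A \<Longrightarrow> 0 < (\<integral>b. A b \<partial>lborel) \<Longrightarrow> 0 < (\<integral>b. A b * ?g m (P b) \<partial>lborel)"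
    using directional_positivity[OF assms(2,1), of k0] by blast
  \<comment> \<open>The summand \<open>?d + 1\<close> ensures that \<open>m = n - d\<close> is at
    least \<open>m0\<close> and that a point remains outside every facet.\<close>
  have incr: "expected_faces K (Suc n) (int ?d - 1) > expected_faces K n (int ?d - 1)" if n: "n \<ge> m0 + ?d + 1" for n
  proof -
    define m where "m = n - ?d"
    have m: "m \<ge> m0" "n = m + ?d" "Suc n - ?d = Suc m" using n by (auto simp: m_def)
    have gi: "integrable lborel (\<lambda>a. hweight a * ?g m (cap \<sigma> a))" "0 < (\<integral>a. hweight a * ?g m (cap \<sigma> a) \<partial>lborel)"
      if "\<sigma> \<in> {1, -1}" for \<sigma>
      using hweight_cap_integral_pos[of \<sigma> m] m0[OF m(1) that] by blast+
    have pw: "integrable lborel (\<lambda>a. hweight a * (cap 1 a ^ k + cap (-1) a ^ k))" for k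
    proof (rule integrable_hweight_bounded)
      fix a
      have "0 \<le> cap 1 a ^ k" "cap 1 a ^ k \<le> 1" "0 \<le> cap (-1) a ^ k" "cap (-1) a ^ k \<le> 1"
        using cap_bounds[of 1 a] cap_bounds[of "-1" a] by (auto intro: power_le_one)
      then show "\<bar>cap 1 a ^ k + cap (-1) a ^ k\<bar> \<le> 2" by simp
    qed measurable
    define I where "I k = (\<integral>a. hweight a * (cap 1 a ^ k + cap (-1) a ^ k) \<partial>lborel)" for k
    have "0 < (\<integral>a. hweight a * ?g m (cap 1 a) \<partial>lborel) + (\<integral>a. hweight a * ?g m (cap (-1) a) \<partial>lborel)"
      using gi(2)[of 1] gi(2)[of "-1"] by simp
    also have "\<dots> = (\<integral>a. hweight a * ?g m (cap 1 a) + hweight a * ?g m (cap (-1) a) \<partial>lborel)"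
      using gi(1)[of 1] gi(1)[of "-1"] by (intro Bochner_Integration.integral_add[symmetric]) auto
    \<comment> \<open>With n = m + d the linear factor d - (n + 1) q equals (n + 1)(1 - q) - (m +
      1), so each side of the hyperplane yields the power of its complementary fraction at the
      exponents m + 1 and m.\<close>
    also have "\<dots> = (\<integral>a. (real n + 1) * (hweight a * (cap 1 a ^ Suc m + cap (-1) a ^ Suc m)) - (real m + 1) * (hweight a * (cap 1 a ^ m + cap (-1) a ^ m)) \<partial>lborel)"
    proof (rule Bochner_Integration.integral_cong[OF refl])
      fix a
      define q where "q = cap 1 a"
      have q: "cap (-1) a = 1 - q" by (simp add: q_def cap_complement)
      have "?g m q = (1 - q) ^ m * ((real n + 1) * (1 - q) - (real m + 1))"
        by (simp add: m(2) algebra_simps)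
      moreover have "?g m (1 - q) = q ^ m * ((real n + 1) * q - (real m + 1))"
        by (simp add: m(2) algebra_simps)
      ultimately show "hweight a * ?g m (cap 1 a) + hweight a * ?g m (cap (-1) a)
        = (real n + 1) * (hweight a * (cap 1 a ^ Suc m + cap (-1) a ^ Suc m)) - (real m + 1) * (hweight a * (cap 1 a ^ m + cap (-1) a ^ m))"
        unfolding q q_def[symmetric] by (simp only:) (simp add: algebra_simps)
    qed
    also have "\<dots> = (real n + 1) * I (Suc m) - (real m + 1) * I m"
      unfolding I_def using pw[of m] pw[of "Suc m"] by (subst Bochner_Integration.integral_diff) auto
    finally have J: "(real m + 1) * I m < (real n + 1) * I (Suc m)" by simp
    \<comment> \<open>The ratio (n + 1)/(m + 1) of consecutive binomial coefficients is exactly the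
      ratio of the weights in \<open>J\<close>.\<close>
    have bin: "(real m + 1) * real (Suc n choose ?d) = (real n + 1) * real (n choose ?d)"
    proof -
      have "Suc m * (Suc n choose ?d) = Suc n * (n choose ?d)"
        using binomial_absorb_comp[of "Suc n" ?d] m(3) by simp
      then have "real (Suc m * (Suc n choose ?d)) = real (Suc n * (n choose ?d))" by simp
      then show ?thesis by (simp only: of_nat_mult of_nat_Suc add.commute)
    qed
    have E1: "expected_faces K n (int ?d - 1) = real (n choose ?d) * I m"
      using expected_facets(1)[OF _ assms(1), of n] n by (simp add: I_def m_def)
    have E2: "expected_faces K (Suc n) (int ?d - 1) = real (Suc n choose ?d) * I (Suc m)"
      using expected_facets(1)[OF _ assms(1), of "Suc n"] n m(3) by (simp add: I_def del: binomial_Suc_Suc)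
    have "(real m + 1) * expected_faces K n (int ?d - 1) = real (n choose ?d) * ((real m + 1) * I m)"
      by (simp add: E1)
    also have "\<dots> < real (n choose ?d) * ((real n + 1) * I (Suc m))"
      using J m(2) by (intro mult_strict_left_mono) (auto simp: zero_less_binomial)
    also have "\<dots> = (real m + 1) * expected_faces K (Suc n) (int ?d - 1)"
      unfolding E2 mult.assoc[symmetric] bin by (simp add: mult_ac)
    finally show ?thesis by (simp add: mult_less_cancel_left_pos)
  qed
  show ?thesis
  proof (intro exI[of _ "m0 + ?d + 1"] allI impI ballI)
    fix n i assume n: "m0 + ?d + 1 \<le> n" and i: "i \<in> {int ?d - 2, int ?d - 1}"
    have ridge: "2 * expected_faces K n (int ?d - 2) = real ?d * expected_faces K n (int ?d - 1)"
      "2 * expected_faces K (Suc n) (int ?d - 2) = real ?d * expected_faces K (Suc n) (int ?d - 1)"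
      using expected_facets(2)[OF _ assms(1)] n by auto
    have "real ?d * expected_faces K n (int ?d - 1) < real ?d * expected_faces K (Suc n) (int ?d - 1)"
      using incr[OF n] assms(1) by (intro mult_strict_left_mono) auto
    then have "expected_faces K n (int ?d - 2) < expected_faces K (Suc n) (int ?d - 2)" using ridge by linarith
    then show "expected_faces K n i < expected_faces K (Suc n) i" using i incr[OF n] by blast
  qed
qed

end
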